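(* There exist universal constants $\kappa,\xi>0$ and a deterministic polynomial-time algorithm with the following property. Let $G$ be an instance of $\mathrm{DkSExp}(n,k,d,\delta,d',\lambda)$ (defined in the context) with planted set $S$, such that \[\nu := 2\sqrt{3\left(6\delta+\xi\sqrt{\frac{\delta n}{dk}}+\frac{\lambda}{d}+\frac{d'k}{(n-k)d}\right)}\] satisfies $\nu\in(0,1)$, and $\frac{\delta d}{k}\in\left[\kappa\frac{\log n}{n},1\right)$. Then, given $G$, with high probability (over the random choices in Step 1 of the instance), the algorithm outputs a vertex set $\mathcal Q$ with $|\mathcal Q|=k$ and \[\rho(\mathcal Q)\ge (1-\nu)\frac{kd}{2}.\] The algorithm also computes a vertex set $T$ such that (a) $|T|\le k\left(1+\frac{\nu}{5}\right)$ and (b) $\rho(T\cap S)\ge\left(1-\frac{\nu}{2}\right)\frac{kd}{2}$.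
   Context: All graphs are weighted undirected graphs $G=(V,E,w)$ with $V=[n]$ and non-negative weights; a non-edge is treated as an edge of weight $0$. For $V'\subseteq V$, $\rho(V'):=\frac12\sum_{i,j\in V'}w(\{i,j\})$ (the total weight of edges inside $V'$). A graph $H$ is a $(d',\lambda)$-expander if it is $d'$-regular (every vertex has weighted degree $d'$) and every eigenvalue of its weighted adjacency matrix other than the largest one has absolute value at most $\lambda$. An instance of $\mathrm{DkSExp}(n,k,d,\delta,d',\lambda)$ (with $k<n$, $d>0$, $0<\delta<1$) is generated as follows: (1) $V$ is partitioned into $S$ and $V\setminus S$ with $|S|=k$; each pair in $S\times(V\setminus S)$ independently becomes an edge of weight $1$ with probability $p:=\delta d/k$. (2) Edges of arbitrary non-negative weights are added between arbitrary pairs of vertices in $S$ so that the graph induced on $S$ has average weighted degree $d$. (3) Edges of arbitrary non-negative weights are added between arbitrary pairs of vertices in $V\setminus S$ so that the graph induced on $V\setminus S$ is a $(d',\lambda)$-expander. (4) (Monotone adversary) Any of the edges added in steps (1) and (3) may be arbitrarily deleted. (5) The resulting graph is output; the algorithm sees only the graph (and $k$), not $S$. *)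

theory Defs
  imports
    "HOL-Probability.Product_PMF"
    "HOL-Library.Log_Nat"
    "Jordan_Normal_Form.Char_Poly"
begin

section \<open>Weighted graphs and expanders\<close>

text \<open>
  The vertex set [n] is rendered as \<open>{..<n}\<close>. An edge weight function is a symmetric
  function of two vertices; non-edges (and pairs outside the vertex set) have weight 0, and
  there are no loops.
\<close>

definition wgraph :: "nat set \<Rightarrow> (nat \<Rightarrow> nat \<Rightarrow> real) \<Rightarrow> bool" where
  "wgraph V w \<longleftrightarrow>
     (\<forall>i j. 0 \<le> w i j \<and> w i j = w j i) \<and>
     (\<forall>i. w i i = 0) \<and>
     (\<forall>i j. w i j \<noteq> 0 \<longrightarrow> i \<in> V \<and> j \<in> V)"

definition \<rho> :: "(nat \<Rightarrow> nat \<Rightarrow> real) \<Rightarrow> nat set \<Rightarrow> real" where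
  "\<rho> w U = 1/2 * (\<Sum>i\<in>U. \<Sum>j\<in>U. w i j)"

definition wdegree :: "nat set \<Rightarrow> (nat \<Rightarrow> nat \<Rightarrow> real) \<Rightarrow> nat \<Rightarrow> real" where
  "wdegree V w i = (\<Sum>j\<in>V. w i j)"

definition avg_degree :: "nat set \<Rightarrow> (nat \<Rightarrow> nat \<Rightarrow> real) \<Rightarrow> real" where
  "avg_degree V w = (\<Sum>i\<in>V. wdegree V w i) / real (card V)"

definition adj_mat :: "nat set \<Rightarrow> (nat \<Rightarrow> nat \<Rightarrow> real) \<Rightarrow> real mat" where
  "adj_mat V w = mat (card V) (card V)
     (\<lambda>(i, j). w (sorted_list_of_set V ! i) (sorted_list_of_set V ! j))"

text \<open>
  The eigenvalues with multiplicity. The matrix is real symmetric, so its characteristic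
  polynomial splits over the reals and this multiset has \<open>card V\<close> elements.
\<close>

definition adj_spectrum :: "nat set \<Rightarrow> (nat \<Rightarrow> nat \<Rightarrow> real) \<Rightarrow> real multiset" where
  "adj_spectrum V w = proots (char_poly (adj_mat V w))"

text \<open>
  Only one copy of the largest eigenvalue is exempt from the bound: if it is a multiple
  eigenvalue, it must itself be bounded by \<open>lam\<close>.
\<close>

definition expander :: "nat set \<Rightarrow> (nat \<Rightarrow> nat \<Rightarrow> real) \<Rightarrow> real \<Rightarrow> real \<Rightarrow> bool" where
  "expander V w d' lam \<longleftrightarrow>
     wgraph V w \<and>
     (\<forall>i\<in>V. wdegree V w i = d') \<and>
     (\<forall>x \<in># adj_spectrum V w - {# Max (set_mset (adj_spectrum V w)) #}. \<bar>x\<bar> \<le> lam)"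

section \<open>The planted model\<close>

text \<open>
  The random choices of step 1: \<open>R (i, j)\<close> says whether the pair \<open>(i, j)\<close> in
  \<open>S \<times> (V - S)\<close> becomes an edge (of weight 1).
\<close>

definition cross_pmf :: "nat \<Rightarrow> nat set \<Rightarrow> real \<Rightarrow> (nat \<times> nat \<Rightarrow> bool) pmf" where
  "cross_pmf n S p = Pi_pmf (S \<times> ({..<n} - S)) False (\<lambda>_. bernoulli_pmf p)"

definition cross_weight :: "(nat \<times> nat \<Rightarrow> bool) \<Rightarrow> nat \<Rightarrow> nat \<Rightarrow> real" where
  "cross_weight R i j = (if R (i, j) \<or> R (j, i) then 1 else 0)"

text \<open>
  \<open>DkSExp_output n S d d' lam R w\<close>: the graph \<open>w\<close> is a possible output of steps 2 to 5
  when the random choices of step 1 turned out to be \<open>R\<close>. Here \<open>B\<close> is the graph added on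
  \<open>S\<close>, \<open>H\<close> the expander added on the complement of \<open>S\<close>, and \<open>D\<close> is what the monotone
  adversary leaves of the edges of steps 1 and 3.
\<close>

definition DkSExp_output ::
  "nat \<Rightarrow> nat set \<Rightarrow> real \<Rightarrow> real \<Rightarrow> real \<Rightarrow> (nat \<times> nat \<Rightarrow> bool) \<Rightarrow> (nat \<Rightarrow> nat \<Rightarrow> real) \<Rightarrow> bool"
where
  "DkSExp_output n S d d' lam R w \<longleftrightarrow>
     (\<exists>B H D.
        wgraph S B \<and> avg_degree S B = d \<and>
        expander ({..<n} - S) H d' lam \<and>
        wgraph {..<n} D \<and>
        (\<forall>i j. D i j = cross_weight R i j + H i j \<or> D i j = 0) \<and>
        w = (\<lambda>i j. B i j + D i j))"

definition \<nu> :: "real \<Rightarrow> nat \<Rightarrow> nat \<Rightarrow> real \<Rightarrow> real \<Rightarrow> real \<Rightarrow> real \<Rightarrow> real" where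
  "\<nu> \<xi> n k d \<delta> d' lam =
     2 * sqrt (3 * (6 * \<delta> + \<xi> * sqrt (\<delta> * real n / (d * real k)) + lam / d
                    + d' * real k / ((real n - real k) * d)))"

section \<open>Polynomial-time algorithms\<close>

text \<open>
  Deterministic random access machines with logarithmic cost, as structured programs. The
  memory is an infinite array of natural numbers. Every access to a cell is charged the
  bit lengths of the address and of the content.
\<close>

datatype binop = Plus | Minus | Times | Quot

fun binop_val :: "binop \<Rightarrow> nat \<Rightarrow> nat \<Rightarrow> nat" where
  "binop_val Plus a b = a + b"
| "binop_val Minus a b = a - b"
| "binop_val Times a b = a * b"
| "binop_val Quot a b = a div b"

datatype prog =
    Skip
  | SetConst nat nat
  | SetOp nat binop nat nat
  | Load nat nat
  | Store nat nat
  | Seq prog prog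
  | IfNonzero nat prog prog
  | WhileNonzero nat prog

type_synonym memory = "nat \<Rightarrow> nat"

definition bits :: "nat \<Rightarrow> nat" where
  "bits a = floorlog 2 a"

definition access_cost :: "memory \<Rightarrow> nat \<Rightarrow> nat" where
  "access_cost M a = bits a + bits (M a)"

text \<open>
  \<open>runs P M t M'\<close>: started with memory \<open>M\<close>, the program \<open>P\<close> halts with memory \<open>M'\<close> after
  time \<open>t\<close>.
\<close>

inductive runs :: "prog \<Rightarrow> memory \<Rightarrow> nat \<Rightarrow> memory \<Rightarrow> bool" where
  Skip: "runs Skip M 1 M"
| SetConst: "M' = M(r := c) \<Longrightarrow>
    runs (SetConst r c) M (1 + access_cost M' r) M'"
| SetOp: "M' = M(r := binop_val f (M a) (M b)) \<Longrightarrow>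
    runs (SetOp r f a b) M (1 + access_cost M a + access_cost M b + access_cost M' r) M'"
| Load: "M' = M(r := M (M a)) \<Longrightarrow>
    runs (Load r a) M (1 + access_cost M a + access_cost M (M a) + access_cost M' r) M'"
| Store: "M' = M(M a := M b) \<Longrightarrow>
    runs (Store a b) M (1 + access_cost M a + access_cost M b + access_cost M' (M a)) M'"
| Seq: "runs P M s M' \<Longrightarrow> runs Q M' t M'' \<Longrightarrow> runs (Seq P Q) M (s + t) M''"
| IfTrue: "M a \<noteq> 0 \<Longrightarrow> runs P M t M' \<Longrightarrow>
    runs (IfNonzero a P Q) M (1 + access_cost M a + t) M'"
| IfFalse: "M a = 0 \<Longrightarrow> runs Q M t M' \<Longrightarrow>
    runs (IfNonzero a P Q) M (1 + access_cost M a + t) M'"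
| WhileFalse: "M a = 0 \<Longrightarrow>
    runs (WhileNonzero a P) M (1 + access_cost M a) M"
| WhileTrue: "M a \<noteq> 0 \<Longrightarrow> runs P M s M' \<Longrightarrow> runs (WhileNonzero a P) M' t M'' \<Longrightarrow>
    runs (WhileNonzero a P) M (1 + access_cost M a + s + t) M''"

inductive_cases runs_elims:
  "runs Skip M t M'"
  "runs (SetConst r c) M t M'"
  "runs (SetOp r f a b) M t M'"
  "runs (Load r a) M t M'"
  "runs (Store a b) M t M'"
  "runs (Seq P Q) M t M'"
  "runs (IfNonzero a P Q) M t M'"
  "runs (WhileNonzero a P) M t M'"

lemma runs_deterministic:
  "runs P M t M' \<Longrightarrow> runs P M s M'' \<Longrightarrow> s = t \<and> M'' = M'"
proof (induction arbitrary: s M'' rule: runs.induct)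
  case (Seq P M s1 M1 Q t1 M2)
  from Seq.prems obtain s2 N t2
    where "s = s2 + t2" "runs P M s2 N" "runs Q N t2 M''" by (rule runs_elims(6))
  then show ?case using Seq.IH by metis
next
  case (IfTrue M a P t1 M1 Q)
  from IfTrue.prems show ?case
    by (rule runs_elims(7)) (use IfTrue.hyps(1) in \<open>auto dest: IfTrue.IH\<close>)
next
  case (IfFalse M a Q t1 M1 P)
  from IfFalse.prems show ?case
    by (rule runs_elims(7)) (use IfFalse.hyps(1) in \<open>auto dest: IfFalse.IH\<close>)
next
  case (WhileFalse M a P)
  from WhileFalse.prems show ?case
    by (rule runs_elims(8)) (use WhileFalse.hyps in auto)
next
  case (WhileTrue M a P s1 M1 t1 M2)
  from WhileTrue.prems show ?case
    by (rule runs_elims(8)) (use WhileTrue.hyps(1) in \<open>auto dest!: WhileTrue.IH(1) dest: WhileTrue.IH(2)\<close>)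
qed (erule runs_elims; simp)+

text \<open>
  The input consists of \<open>n\<close>, \<open>k\<close> and the \<open>n \<times> n\<close> matrix of rational weights, row by row,
  each entry as numerator and denominator in lowest terms.
\<close>

definition input_length :: "nat \<Rightarrow> nat" where
  "input_length n = 2 + 2 * (n * n)"

definition input_memory :: "nat \<Rightarrow> nat \<Rightarrow> (nat \<Rightarrow> nat \<Rightarrow> rat) \<Rightarrow> memory" where
  "input_memory n k w a =
     (if a = 0 then n
      else if a = 1 then k
      else if a < input_length n then
        (let m = (a - 2) div 2; q = quotient_of (w (m div n) (m mod n))
         in nat (if even a then fst q else snd q))
      else 0)"

definition input_size :: "nat \<Rightarrow> nat \<Rightarrow> (nat \<Rightarrow> nat \<Rightarrow> rat) \<Rightarrow> nat" where
  "input_size n k w = (\<Sum>a<input_length n. 1 + bits (input_memory n k w a))"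

text \<open>
  The output is a pair of vertex sets, given by their indicator vectors in the cells
  \<open>0, \<dots>, n - 1\<close> and \<open>n, \<dots>, 2 n - 1\<close> of the final memory.
\<close>

definition output_sets :: "nat \<Rightarrow> memory \<Rightarrow> nat set \<times> nat set" where
  "output_sets n M = ({i. i < n \<and> M i \<noteq> 0}, {i. i < n \<and> M (n + i) \<noteq> 0})"

abbreviation real_weights :: "(nat \<Rightarrow> nat \<Rightarrow> rat) \<Rightarrow> nat \<Rightarrow> nat \<Rightarrow> real" where
  "real_weights w \<equiv> (\<lambda>i j. real_of_rat (w i j))"

text \<open>
  A single program computes \<open>alg\<close> on all rationally weighted graphs on \<open>{..<n}\<close>, for all
  \<open>n\<close> and \<open>k\<close>, in time polynomial in the bit length of the input.
\<close>

definition polynomial_time ::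
  "(nat \<Rightarrow> nat \<Rightarrow> (nat \<Rightarrow> nat \<Rightarrow> rat) \<Rightarrow> nat set \<times> nat set) \<Rightarrow> bool" where
  "polynomial_time alg \<longleftrightarrow>
     (\<exists>P C e. \<forall>n k w. wgraph {..<n} (real_weights w) \<longrightarrow>
        (\<exists>t M. runs P (input_memory n k w) t M \<and>
               t \<le> C * input_size n k w ^ e \<and>
               output_sets n M = alg n k w))"

end

theory Submission
  imports Defs "Jordan_Normal_Form.Schur_Decomposition"
    "HOL-Computational_Algebra.Fundamental_Theorem_Algebra"
begin

unbundle no vec_syntax and no inner_syntax

text \<open>
  The algorithm is a rounded semidefinite relaxation. The relaxation asks for a positive
  semidefinite matrix \<open>x\<close> with entries in \<open>[0, 1]\<close>, \<open>x i j \<le> x i i\<close>, trace at most \<open>k\<close> and entry sum at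
  most \<open>k\<^sup>2\<close>, of value at least \<open>k d\<close>; the indicator matrix of the planted set is feasible. It is
  solved approximately, in integer arithmetic with scale \<open>N = n ^ 18\<close>, by repeated projection: each
  violated constraint moves the current matrix strictly closer to the (unknown) indicator matrix, and
  a violation of semidefiniteness is detected through a high power of \<open>n N I - X\<close>. All possible
  target values are tried.

  For a near-optimal \<open>x\<close>, the layers of its diagonal together with the low discrepancy of
  the random bipartite graph bound the value on the cross edges, and the spectrum of the expander bounds the
  value outside \<open>S\<close>. Hence almost all the weight inside \<open>S\<close> lies between vertices with \<open>x i i \<ge> 2/3\<close>.
  There are at most \<open>3 k / 2\<close> of these; keeping the \<open>k\<close> of largest degree discards vertices of no larger average
  degree than the wrongly chosen ones, whose degrees are small by the same two bounds. If the total
  weight is enormous, a plain choice by degree suffices.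
\<close>

section \<open>A structured language compiled to the machine\<close>

text \<open>The scaled indicator matrix of \<open>S\<close> is unknown but satisfies every
  constraint, so a step along the normal of a violated constraint lowers the squared distance to it.
  This distance is an integer, at first at most \<open>n * n * N * N\<close>, which bounds the
  number of steps. The choices \<open>N = n ^ 18\<close>, step length \<open>n ^ 10\<close> and
  power \<open>2 * (n * N)\<close> meet two demands: a step must outweigh the rounding of its
  \<open>n * n\<close> entries, and the power must expose every eigenvalue of \<open>X\<close> below
  \<open>- 4 * n ^ 10\<close>.

  The relaxation is accurate only relative to the total weight, which the weights inside
  \<open>S\<close> can make huge; but then all losses are tiny compared with \<open>d\<close>,
  whence the separate case.

  Every estimate for edges not inside \<open>S\<close> is an upper bound, so the deletions of the
  adversary do no harm. As \<open>S\<close> and \<open>d\<close> are unknown, candidates are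
  compared by total weight; a set of size \<open>k\<close> has little weight outside its part in
  \<open>S\<close>, so the heaviest candidate is good. The losses are linear in \<sigma> and fit
  under the square root in \<nu> because \<nu> < 1. Both output sets are the same set of size
  \<open>k\<close>.\<close>

datatype aexp = Num nat | Var nat | Op binop aexp aexp | Get nat aexp aexp | Inp aexp

datatype com = Asg nat aexp | Put nat aexp aexp aexp | Out aexp aexp
  | Sq com com (infixr \<open>;;\<close> 60) | Cond aexp com com | Loop nat aexp com

record state =
  vr :: "nat \<Rightarrow> nat"
  ar :: "nat \<Rightarrow> nat \<Rightarrow> nat \<Rightarrow> nat"
  io :: "nat \<Rightarrow> nat"

definition setv :: "nat \<Rightarrow> nat \<Rightarrow> state \<Rightarrow> state" where
  "setv x v s = s\<lparr>vr := (vr s)(x := v)\<rparr>"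

definition seta :: "nat \<Rightarrow> nat \<Rightarrow> nat \<Rightarrow> nat \<Rightarrow> state \<Rightarrow> state" where
  "seta a i j v s = s\<lparr>ar := (\<lambda>a' i' j'. if a' = a \<and> i' = i \<and> j' = j then v else ar s a' i' j')\<rparr>"

definition seto :: "nat \<Rightarrow> nat \<Rightarrow> state \<Rightarrow> state" where
  "seto i v s = s\<lparr>io := (io s)(i := v)\<rparr>"

lemma set_simps [simp]:
  "vr (setv x v s) = (vr s)(x := v)" "ar (setv x v s) = ar s" "io (setv x v s) = io s"
  "vr (seta a i j v s) = vr s" "io (seta a i j v s) = io s"
  "ar (seta a i j v s) = (\<lambda>a' i' j'. if a' = a \<and> i' = i \<and> j' = j then v else ar s a' i' j')"
  "vr (seto i v s) = vr s" "ar (seto i v s) = ar s" "io (seto i v s) = (io s)(i := v)"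
  by (simp_all add: setv_def seta_def seto_def)

lemma setv_same [simp]: "setv x v (setv x w s) = setv x v s"
  by (simp add: setv_def)

lemma setv_id: "vr s x = v \<Longrightarrow> setv x v s = s"
  by (auto simp: setv_def)

fun eval :: "aexp \<Rightarrow> state \<Rightarrow> nat" where
  "eval (Num c) s = c"
| "eval (Var x) s = vr s x"
| "eval (Op f a b) s = binop_val f (eval a s) (eval b s)"
| "eval (Get a i j) s = ar s a (eval i s) (eval j s)"
| "eval (Inp i) s = io s (eval i s)"

fun dloop :: "(nat \<Rightarrow> 's \<Rightarrow> 's) \<Rightarrow> nat \<Rightarrow> 's \<Rightarrow> 's" where
  "dloop f 0 s = s"
| "dloop f (Suc m) s = dloop f m (f m s)"

fun dall :: "(nat \<Rightarrow> 's \<Rightarrow> bool) \<Rightarrow> (nat \<Rightarrow> 's \<Rightarrow> 's) \<Rightarrow> nat \<Rightarrow> 's \<Rightarrow> bool" where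
  "dall g f 0 s = True"
| "dall g f (Suc m) s = (g m s \<and> dall g f m (f m s))"

text \<open>Loops count downwards; the loop variable runs through \<open>m - 1, \<dots>, 0\<close>.\<close>

primrec sem :: "com \<Rightarrow> state \<Rightarrow> state" where
  "sem (Asg x e) s = setv x (eval e s) s"
| "sem (Put a i j e) s = seta a (eval i s) (eval j s) (eval e s) s"
| "sem (Out i e) s = seto (eval i s) (eval e s) s"
| "sem (c1 ;; c2) s = sem c2 (sem c1 s)"
| "sem (Cond e c1 c2) s = (if eval e s \<noteq> 0 then sem c1 s else sem c2 s)"
| "sem (Loop x e c) s = setv x 0 (dloop (\<lambda>i s. sem c (setv x i s)) (eval e s) s)"

text \<open>
  Variables occupy the cells below \<open>40\<close>, with \<open>n\<close> in cell 0 and the end \<open>b\<close> of the input in cell 2;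
  cells \<open>40, \<dots>, 59\<close> hold intermediate results. Seven two-dimensional arrays with rows of length \<open>n\<close>
  are interleaved behind the input.
\<close>

fun eok :: "aexp \<Rightarrow> state \<Rightarrow> bool" where
  "eok (Num c) s = True"
| "eok (Var x) s = True"
| "eok (Op f a b) s = (eok a s \<and> eok b s)"
| "eok (Get a i j) s = (eok i s \<and> eok j s \<and> eval j s < vr s 0)"
| "eok (Inp i) s = (eok i s \<and> 60 \<le> eval i s \<and> eval i s < vr s 2)"

text \<open>\<open>Q\<close> bounds every stored value and \<open>K\<close> every number of loop
  rounds. Intermediate values of an expression carry no condition: they stay below a fixed power of
  \<open>Q + 1\<close>.\<close>

primrec ok :: "nat \<Rightarrow> nat \<Rightarrow> com \<Rightarrow> state \<Rightarrow> bool" where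
  "ok Q K (Asg x e) s = (eok e s \<and> eval e s \<le> Q)"
| "ok Q K (Put a i j e) s = (eok i s \<and> eok j s \<and> eok e s \<and> eval j s < vr s 0 \<and> eval e s \<le> Q)"
| "ok Q K (Out i e) s = (eok i s \<and> eok e s \<and> 60 \<le> eval i s \<and> eval i s < vr s 2 \<and> eval e s \<le> Q)"
| "ok Q K (c1 ;; c2) s = (ok Q K c1 s \<and> ok Q K c2 (sem c1 s))"
| "ok Q K (Cond e c1 c2) s = (eok e s \<and> (if eval e s \<noteq> 0 then ok Q K c1 s else ok Q K c2 s))"
| "ok Q K (Loop x e c) s = (eok e s \<and> eval e s \<le> K \<and> eval e s \<le> Q \<and>
     dall (\<lambda>i s. ok Q K c (setv x i s)) (\<lambda>i s. sem c (setv x i s)) (eval e s) s)"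

text \<open>One measure for two purposes: a value is at most \<open>(Q + 1) ^ esize e\<close>, and
  the compiled code takes at most \<open>2 * esize e\<close> instructions. The 8 at
  \<open>Get\<close> pays for the address computation and the load.\<close>

fun esize :: "aexp \<Rightarrow> nat" where
  "esize (Num c) = 1"
| "esize (Var x) = 1"
| "esize (Op f a b) = esize a + esize b + 1"
| "esize (Get a i j) = esize i + esize j + 8"
| "esize (Inp i) = esize i + 1"

fun wfe :: "aexp \<Rightarrow> bool" where
  "wfe (Num c) = (c \<le> 100)"
| "wfe (Var x) = (x < 40)"
| "wfe (Op f a b) = (wfe a \<and> wfe b)"
| "wfe (Get a i j) = (wfe i \<and> wfe j \<and> 1 \<le> a \<and> a \<le> 7)"
| "wfe (Inp i) = wfe i"

text \<open>The number of cells above the target that evaluation may use: a left operand waits in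
  cell \<open>t\<close> while the right one is evaluated from \<open>Suc t\<close> on.\<close>

fun height :: "aexp \<Rightarrow> nat" where
  "height (Num c) = 0"
| "height (Var x) = 1"
| "height (Op f a b) = max (height a) (Suc (height b))"
| "height (Get a i j) = max (height i) (Suc (height j))"
| "height (Inp i) = height i"

text \<open>Evaluation begins in cell 40 or 41, so height 17 keeps all intermediate results within
  cells 40 to 58; size 80 keeps values and addresses within the word length of
  \<open>machine\<close>.\<close>

definition wfx :: "aexp \<Rightarrow> bool" where
  "wfx e \<longleftrightarrow> wfe e \<and> height e \<le> 17 \<and> esize e \<le> 80"

primrec writes :: "com \<Rightarrow> nat set" where
  "writes (Asg x e) = {x}"
| "writes (Put a i j e) = {}"
| "writes (Out i e) = {}"
| "writes (c1 ;; c2) = writes c1 \<union> writes c2"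
| "writes (Cond e c1 c2) = writes c1 \<union> writes c2"
| "writes (Loop x e c) = insert x (writes c)"

text \<open>Cells 0 to 2 hold \<open>n\<close>, \<open>k\<close> and the end of the input and must
  never change. A loop variable may not be assigned in the body because the compiled loop uses that
  same cell as its counter.\<close>

primrec wfc :: "com \<Rightarrow> bool" where
  "wfc (Asg x e) = (3 \<le> x \<and> x < 40 \<and> wfx e)"
| "wfc (Put a i j e) = (1 \<le> a \<and> a \<le> 7 \<and> wfx i \<and> wfx j \<and> wfx e)"
| "wfc (Out i e) = (wfx i \<and> wfx e)"
| "wfc (c1 ;; c2) = (wfc c1 \<and> wfc c2)"
| "wfc (Cond e c1 c2) = (wfx e \<and> wfc c1 \<and> wfc c2)"
| "wfc (Loop x e c) = (3 \<le> x \<and> x < 40 \<and> wfx e \<and> x \<notin> writes c \<and> wfc c)"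

text \<open>Expects the row in \<open>t\<close> and the column in \<open>Suc t\<close>. Rows have
  length \<open>n\<close> but their number is unlimited, so an array may have more than
  \<open>n\<close> rows; the factor 8 leaves room for the residues 1 to 7 that tell the arrays
  apart.\<close>

definition address :: "nat \<Rightarrow> nat \<Rightarrow> prog" where
  "address t a = Seq (SetOp t Times t 0) (Seq (SetOp t Plus t (Suc t)) (Seq (SetConst (Suc t) 8)
     (Seq (SetOp t Times t (Suc t)) (Seq (SetOp t Plus t 2) (Seq (SetConst (Suc t) a)
     (SetOp t Plus t (Suc t)))))))"

fun cexp :: "nat \<Rightarrow> aexp \<Rightarrow> prog" where
  "cexp t (Num c) = SetConst t c"
| "cexp t (Var x) = Seq (SetConst (Suc t) 0) (SetOp t Plus x (Suc t))"
| "cexp t (Op f a b) = Seq (cexp t a) (Seq (cexp (Suc t) b) (SetOp t f t (Suc t)))"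
| "cexp t (Get a i j) = Seq (cexp t i) (Seq (cexp (Suc t) j) (Seq (address t a) (Load t t)))"
| "cexp t (Inp i) = Seq (cexp t i) (Load t t)"

text \<open>The counter is decremented before the body runs, which therefore sees
  \<open>m - 1\<close> down to 0. Adding a zero cell serves as a move instruction.\<close>

primrec ccom :: "com \<Rightarrow> prog" where
  "ccom (Asg x e) = Seq (cexp 40 e) (Seq (SetConst 41 0) (SetOp x Plus 40 41))"
| "ccom (Put a i j e) = Seq (cexp 40 i) (Seq (cexp 41 j) (Seq (address 40 a) (Seq (cexp 41 e) (Store 40 41))))"
| "ccom (Out i e) = Seq (cexp 40 i) (Seq (cexp 41 e) (Store 40 41))"
| "ccom (c1 ;; c2) = Seq (ccom c1) (ccom c2)"
| "ccom (Cond e c1 c2) = Seq (cexp 40 e) (IfNonzero 40 (ccom c1) (ccom c2))"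
| "ccom (Loop x e c) = Seq (cexp 40 e) (Seq (SetConst 41 0) (Seq (SetOp x Plus 40 41)
     (WhileNonzero x (Seq (SetConst 40 1) (Seq (SetOp x Minus x 40) (ccom c))))))"

primrec csteps :: "nat \<Rightarrow> com \<Rightarrow> nat" where
  "csteps K (Asg x e) = esize e * 2 + 2"
| "csteps K (Put a i j e) = esize i * 2 + esize j * 2 + esize e * 2 + 8"
| "csteps K (Out i e) = esize i * 2 + esize e * 2 + 1"
| "csteps K (c1 ;; c2) = csteps K c1 + csteps K c2"
| "csteps K (Cond e c1 c2) = esize e * 2 + 1 + csteps K c1 + csteps K c2"
| "csteps K (Loop x e c) = esize e * 2 + 3 + K * (csteps K c + 3)"

text \<open>The nesting depth of the loops is fixed by the program, so bounding each loop by
  \<open>K\<close> rounds gives a polynomial in \<open>K\<close> whose degree depends on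
  \<open>c\<close> alone.\<close>

lemma csteps_poly: "\<exists>C e. \<forall>K. csteps K c \<le> C * (K + 1) ^ e"
proof (induction c)
  case (Asg x e)
  show ?case by (rule exI[of _ "csteps 0 (Asg x e)"], rule exI[of _ 0]) simp
next
  case (Put a i j e)
  show ?case by (rule exI[of _ "csteps 0 (Put a i j e)"], rule exI[of _ 0]) simp
next
  case (Out i e)
  show ?case by (rule exI[of _ "csteps 0 (Out i e)"], rule exI[of _ 0]) simp
next
  case (Sq c1 c2)
  then obtain C e C' e' where *: "\<And>K. csteps K c1 \<le> C * (K + 1) ^ e" "\<And>K. csteps K c2 \<le> C' * (K + 1) ^ e'" by metis
  have "csteps K (c1 ;; c2) \<le> (C + C') * (K + 1) ^ (e + e')" for K
  proof -
    have "C * (K + 1) ^ e \<le> C * (K + 1) ^ (e + e')" "C' * (K + 1) ^ e' \<le> C' * (K + 1) ^ (e + e')"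
      by (auto intro!: mult_left_mono power_increasing)
    then show ?thesis using *(1)[of K] *(2)[of K] by (simp only: csteps.simps add_mult_distrib)
  qed
  then show ?case by blast
next
  case (Cond b c1 c2)
  then obtain C e C' e' where *: "\<And>K. csteps K c1 \<le> C * (K + 1) ^ e" "\<And>K. csteps K c2 \<le> C' * (K + 1) ^ e'" by metis
  let ?z = "esize b * 2 + 1"
  have "csteps K (Cond b c1 c2) \<le> (?z + C + C') * (K + 1) ^ (e + e')" for K
  proof -
    have "C * (K + 1) ^ e \<le> C * (K + 1) ^ (e + e')" "C' * (K + 1) ^ e' \<le> C' * (K + 1) ^ (e + e')"
      "?z * 1 \<le> ?z * (K + 1) ^ (e + e')"
      by (intro mult_left_mono power_increasing; simp)+
    then show ?thesis using *(1)[of K] *(2)[of K] by (simp only: csteps.simps add_mult_distrib)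
  qed
  then show ?case by blast
next
  case (Loop x b c)
  then obtain C e where *: "\<And>K. csteps K c \<le> C * (K + 1) ^ e" by metis
  let ?z = "esize b * 2 + 3"
  have "csteps K (Loop x b c) \<le> (?z + C + 3) * (K + 1) ^ (Suc e)" for K
  proof -
    have "?z * 1 \<le> ?z * (K + 1) ^ (Suc e)" by (intro mult_left_mono one_le_power) auto
    moreover have "K * (csteps K c + 3) \<le> (K + 1) * ((C + 3) * (K + 1) ^ e)"
    proof (rule mult_mono)
      have "3 * 1 \<le> 3 * (K + 1) ^ e" by (intro mult_left_mono one_le_power) auto
      then show "csteps K c + 3 \<le> (C + 3) * (K + 1) ^ e" using *[of K] by (simp only: add_mult_distrib)
    qed auto
    ultimately show ?thesis by (simp add: algebra_simps)
  qed
  then show ?case by blast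
qed

section \<open>Cost of single instructions\<close>

definition runs_le :: "prog \<Rightarrow> memory \<Rightarrow> nat \<Rightarrow> memory \<Rightarrow> bool" where
  "runs_le P M t M' \<longleftrightarrow> (\<exists>t'\<le>t. runs P M t' M')"

lemma runs_le_Seq: "runs_le P M s M' \<Longrightarrow> runs_le Q M' t M'' \<Longrightarrow> runs_le (Seq P Q) M (s + t) M''"
  unfolding runs_le_def by (meson add_mono runs.Seq)

lemma runs_le_mono: "runs_le P M s M' \<Longrightarrow> s \<le> t \<Longrightarrow> runs_le P M t M'"
  unfolding runs_le_def by (meson order_trans)

lemma exec_exI: "runs_le P M t M' \<Longrightarrow> R M' \<Longrightarrow> \<exists>M'. runs_le P M t M' \<and> R M'"
  by blast

lemma bits_le: "a < 2 ^ L \<Longrightarrow> bits a \<le> L"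
  unfolding bits_def by (rule floorlog_leI) auto

lemma access_cost_le: "a < 2 ^ L \<Longrightarrow> M a < 2 ^ L \<Longrightarrow> access_cost M a \<le> 2 * L"
  unfolding access_cost_def using bits_le[of a L] bits_le[of "M a" L] by simp

text \<open>An instruction makes at most three accesses; with addresses and contents of at most
  \<open>L\<close> bits each access costs at most \<open>2 * L\<close>.\<close>

definition utime :: "nat \<Rightarrow> nat" where
  "utime L = 1 + 6 * L"

lemma run_SetConst:
  assumes "r < 2 ^ L" "c < 2 ^ L"
  shows "runs_le (SetConst r c) M (utime L) (M(r := c))"
  unfolding runs_le_def
proof (intro exI conjI)
  show "runs (SetConst r c) M (1 + access_cost (M(r := c)) r) (M(r := c))" by (rule runs.SetConst) simp
  show "1 + access_cost (M(r := c)) r \<le> utime L"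
    using access_cost_le[of r L "M(r := c)"] assms by (simp add: utime_def)
qed

lemma run_SetOp:
  assumes "r < 2 ^ L" "a < 2 ^ L" "b < 2 ^ L" "M a < 2 ^ L" "M b < 2 ^ L" "binop_val f (M a) (M b) < 2 ^ L"
  shows "runs_le (SetOp r f a b) M (utime L) (M(r := binop_val f (M a) (M b)))"
  unfolding runs_le_def
proof (intro exI conjI)
  let ?M = "M(r := binop_val f (M a) (M b))"
  show "runs (SetOp r f a b) M (1 + access_cost M a + access_cost M b + access_cost ?M r) ?M"
    by (rule runs.SetOp) simp
  show "1 + access_cost M a + access_cost M b + access_cost ?M r \<le> utime L"
    using access_cost_le[of r L "?M"] access_cost_le[of a L M] access_cost_le[of b L M] assms by (simp add: utime_def)
qed

lemma run_Load:
  assumes "r < 2 ^ L" "a < 2 ^ L" "M a < 2 ^ L" "M (M a) < 2 ^ L"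
  shows "runs_le (Load r a) M (utime L) (M(r := M (M a)))"
  unfolding runs_le_def
proof (intro exI conjI)
  let ?M = "M(r := M (M a))"
  show "runs (Load r a) M (1 + access_cost M a + access_cost M (M a) + access_cost ?M r) ?M"
    by (rule runs.Load) simp
  show "1 + access_cost M a + access_cost M (M a) + access_cost ?M r \<le> utime L"
    using access_cost_le[of r L "?M"] access_cost_le[of a L M] access_cost_le[of "M a" L M] assms by (simp add: utime_def)
qed

lemma run_Store:
  assumes "a < 2 ^ L" "b < 2 ^ L" "M a < 2 ^ L" "M b < 2 ^ L"
  shows "runs_le (Store a b) M (utime L) (M(M a := M b))"
  unfolding runs_le_def
proof (intro exI conjI)
  let ?M = "M(M a := M b)"
  show "runs (Store a b) M (1 + access_cost M a + access_cost M b + access_cost ?M (M a)) ?M"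
    by (rule runs.Store) simp
  show "1 + access_cost M a + access_cost M b + access_cost ?M (M a) \<le> utime L"
    using access_cost_le[of "M a" L "?M"] access_cost_le[of a L M] access_cost_le[of b L M] assms by (simp add: utime_def)
qed

lemma run_If:
  assumes "a < 2 ^ L" "M a < 2 ^ L" "runs_le (if M a \<noteq> 0 then P else Q) M t M'"
  shows "runs_le (IfNonzero a P Q) M (utime L + t) M'"
proof -
  obtain t' where t': "t' \<le> t" "runs (if M a \<noteq> 0 then P else Q) M t' M'"
    using assms(3) by (auto simp: runs_le_def)
  have "runs (IfNonzero a P Q) M (1 + access_cost M a + t') M'"
    using t'(2) runs.IfTrue[of M a P t' M' Q] runs.IfFalse[of M a Q t' M' P] by (cases "M a = 0") simp_all
  then show ?thesis unfolding runs_le_def utime_def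
    using access_cost_le[of a L M] assms t'(1) by (intro exI[of _ "1 + access_cost M a + t'"]) simp
qed

lemma run_WhileFalse:
  assumes "a < 2 ^ L" "M a = 0"
  shows "runs_le (WhileNonzero a P) M (utime L) M"
  unfolding runs_le_def utime_def using runs.WhileFalse[of M a P] access_cost_le[of a L M] assms
  by (intro exI[of _ "1 + access_cost M a"]) simp

lemma run_WhileTrue:
  assumes "a < 2 ^ L" "M a < 2 ^ L" "M a \<noteq> 0" "runs_le P M s M'" "runs_le (WhileNonzero a P) M' t M''"
  shows "runs_le (WhileNonzero a P) M (utime L + s + t) M''"
proof -
  obtain s' t' where st: "s' \<le> s" "runs P M s' M'" "t' \<le> t" "runs (WhileNonzero a P) M' t' M''"
    using assms(4,5) by (auto simp: runs_le_def)
  show ?thesis unfolding runs_le_def utime_def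
    using runs.WhileTrue[OF assms(3) st(2,4)] access_cost_le[of a L M] assms st
    by (intro exI[of _ "1 + access_cost M a + s' + t'"]) simp
qed

section \<open>Simulation of the structured language\<close>

definition bounded :: "nat \<Rightarrow> state \<Rightarrow> bool" where
  "bounded Q s \<longleftrightarrow> (\<forall>x<40. vr s x \<le> Q) \<and> (\<forall>a i j. ar s a i j \<le> Q) \<and> (\<forall>i. io s i \<le> Q)"

text \<open>Cells 40 to 59 are left out, which makes them free for intermediate results. Input cells
  below 60 are left out as well: they have become registers.\<close>

definition represents :: "state \<Rightarrow> memory \<Rightarrow> bool" where
  "represents s M \<longleftrightarrow> (\<forall>x<40. M x = vr s x) \<and> (\<forall>i. 60 \<le> i \<longrightarrow> i < vr s 2 \<longrightarrow> M i = io s i) \<and>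
     (\<forall>a i j. 1 \<le> a \<longrightarrow> a \<le> 7 \<longrightarrow> j < vr s 0 \<longrightarrow> M (vr s 2 + 8 * (i * vr s 0 + j) + a) = ar s a i j)"

text \<open>The extra factor \<open>Q + 1\<close> per operation absorbs both sums and products, as
  \<open>x + y \<le> x * y * 2\<close> for positive \<open>x\<close> and \<open>y\<close>;
  differences and quotients do not exceed their first argument.\<close>

lemma eval_bound:
  assumes "bounded Q s" "100 \<le> Q" "wfe e"
  shows "eval e s \<le> (Q + 1) ^ esize e"
  using assms(3)
proof (induction e)
  case (Op f a b)
  let ?x = "(Q + 1) ^ esize a" and ?y = "(Q + 1) ^ esize b"
  have 1: "1 \<le> ?x" "1 \<le> ?y" by auto
  have le: "?x \<le> ?x * ?y * (Q + 1)"
  proof -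
    have "1 \<le> ?y * (Q + 1)" using 1 mult_le_mono[OF 1(2), of 1 "Q + 1"] by (simp del: mult_Suc_right)
    then have "?x * 1 \<le> ?x * (?y * (Q + 1))" by (rule mult_le_mono2)
    then show ?thesis by (simp only: mult.assoc mult_1_right)
  qed
  have "eval a s \<le> ?x" "eval b s \<le> ?y" using Op by auto
  moreover have "?x + ?y \<le> ?x * ?y * (Q + 1)"
  proof -
    have "?x + ?y \<le> ?x * ?y + ?x * ?y" using 1 by (intro add_mono) auto
    also have "\<dots> = ?x * ?y * 2" by simp
    also have "\<dots> \<le> ?x * ?y * (Q + 1)" using assms(2) by (intro mult_left_mono) auto
    finally show ?thesis .
  qed
  moreover have "eval a s * eval b s \<le> ?x * ?y * (Q + 1)"
    using mult_le_mono[OF calculation(1,2)] by (simp add: trans_le_add1)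
  moreover have "eval a s - eval b s \<le> ?x" "eval a s div eval b s \<le> ?x"
    using calculation(1) by (auto intro: order_trans[OF div_le_dividend])
  ultimately show ?case using le by (cases f) (auto simp: power_add mult_ac)
next
  case (Get a i j)
  have "ar s a (eval i s) (eval j s) \<le> Q" using assms(1) by (simp add: bounded_def)
  also have "\<dots> \<le> (Q + 1) ^ 1" by simp
  also have "\<dots> \<le> (Q + 1) ^ esize (Get a i j)" by (intro power_increasing) auto
  finally show ?case by simp
next
  case (Inp i)
  have "io s (eval i s) \<le> Q" using assms(1) by (simp add: bounded_def)
  also have "\<dots> \<le> (Q + 1) ^ 1" by simp
  also have "\<dots> \<le> (Q + 1) ^ esize (Inp i)" by (intro power_increasing) auto
  finally show ?case by simp
qed (use assms in \<open>auto simp: bounded_def le_SucI\<close>)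

lemma sem_unwritten: "x \<notin> writes c \<Longrightarrow> vr (sem c s) x = vr s x"
proof (induction c arbitrary: s)
  case (Loop y e c)
  have "vr (dloop (\<lambda>i s. sem c (setv y i s)) m s) x = vr s x" for m s
    using Loop by (induction m arbitrary: s) auto
  then show ?case using Loop by auto
qed auto

lemma wfc_writes: "wfc c \<Longrightarrow> x \<in> writes c \<Longrightarrow> 3 \<le> x"
  by (induction c) auto

lemma wfc_keeps:
  assumes "wfc c" "x < 3"
  shows "vr (sem c s) x = vr s x"
  using assms wfc_writes[of c x] by (intro sem_unwritten) auto

text \<open>\<open>2 ^ L\<close> exceeds every number that occurs: values of expressions, which
  reach \<open>(Q + 1) ^ 80\<close>, and array addresses formed from two of them; the exponent 170
  leaves ample room.\<close>

locale machine =
  fixes n b Q K L :: nat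
  assumes b60: "60 \<le> b" and n0: "0 < n" and nQ: "n \<le> Q" and bQ: "b \<le> Q" and Q100: "100 \<le> Q" and L: "(Q + 1) ^ 170 < 2 ^ L"
begin

abbreviation "unit_time \<equiv> utime L"

lemma small: "v \<le> (Q + 1) ^ 170 \<Longrightarrow> v < 2 ^ L" using L by simp

lemma Qp:
  assumes "m \<le> 170"
  shows "(Q + 1) ^ m < 2 ^ L"
  by (rule small) (rule power_increasing[OF assms], simp)

lemma Q_small: "v \<le> Q \<Longrightarrow> v < 2 ^ L"
proof -
  assume "v \<le> Q"
  then have "v < (Q + 1) ^ 1" by simp
  then show ?thesis using Qp[of 1] by simp
qed

lemma c_small: "v \<le> (100::nat) \<Longrightarrow> v < 2 ^ L" using Q100 Q_small by simp

lemma eval_small: "bounded Q s \<Longrightarrow> wfe e \<Longrightarrow> esize e \<le> 170 \<Longrightarrow> eval e s < 2 ^ L"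
  using eval_bound[of Q s e] Q100 Qp[of "esize e"] by simp

lemma address_bound:
  assumes "bounded Q s" "wfe i" "wfe j" "esize i \<le> 80" "esize j \<le> 80" "a \<le> 7"
  shows "vr s 2 + 8 * (eval i s * vr s 0 + eval j s) + a < 2 ^ L"
proof -
  let ?i = "(Q + 1) ^ 80"
  have i: "eval i s \<le> ?i" "eval j s \<le> ?i"
    using eval_bound[OF assms(1) Q100] assms
    by (meson le_add2 order_trans power_increasing)+
  have v: "vr s 2 \<le> Q" "vr s 0 \<le> Q" using assms(1) by (auto simp: bounded_def)
  have q: "Q \<le> ?i" using power_increasing[of 1 80 "Q + 1"] by simp
  have "vr s 2 + 8 * (eval i s * vr s 0 + eval j s) + a \<le> ?i + 8 * (?i * Q + ?i) + 7"
    using i v q assms(6) by (intro add_mono mult_mono) auto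
  also have "\<dots> \<le> 100 * (?i * (Q + 1))"
  proof -
    have "p + 8 * (p * Q + p) + 7 \<le> 100 * (p * (Q + 1))" if "1 \<le> p" for p :: nat
      using that by (simp add: algebra_simps)
    then show ?thesis using q Q100 by simp
  qed
  also have "\<dots> \<le> (Q + 1) * (?i * (Q + 1))" using Q100 by (intro mult_right_mono) auto
  also have "\<dots> = (Q + 1) ^ 82" using power_add[of "Q + 1" 80 2] by (simp only: power2_eq_square mult_ac) (simp add: mult_ac)
  finally show ?thesis using Qp[of 82] by simp
qed

lemma run_address:
  assumes M: "M t = x" "M (Suc t) = y" "M 0 = n" "M 2 = b" and t: "40 \<le> t" "Suc t < 60"
    and small: "b + 8 * (x * n + y) + a < 2 ^ L" and a: "a \<le> 7"
  shows "\<exists>M'. runs_le (address t a) M (7 * unit_time) M' \<and> M' t = b + 8 * (x * n + y) + a \<and>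
     (\<forall>c. c \<noteq> t \<longrightarrow> c \<noteq> Suc t \<longrightarrow> M' c = M c)"
proof -
  have n1: "1 \<le> n" using n0 by simp
  have xy: "x * n < 2 ^ L" "y < 2 ^ L" "x * n + y < 2 ^ L" "(x * n + y) * 8 < 2 ^ L" "b < 2 ^ L"
    "(x * n + y) * 8 + b < 2 ^ L" "(x * n + y) * 8 + b + a < 2 ^ L"
    using small by auto
  have x: "x < 2 ^ L" using xy(1) n1 by (metis le_less_trans mult.right_neutral mult_le_mono2)
  have cs: "t < 2 ^ L" "Suc t < 2 ^ L" "0 < (2::nat) ^ L" "2 < (2::nat) ^ L" "8 < (2::nat) ^ L" "a < 2 ^ L"
    using t a by (auto intro: c_small)
  have ns: "n < 2 ^ L" using nQ by (rule Q_small)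
    let ?M1 = "M(t := x * n)" let ?M2 = "?M1(t := x * n + y)" let ?M3 = "?M2(Suc t := 8)"
    let ?M4 = "?M3(t := (x * n + y) * 8)" let ?M5 = "?M4(t := (x * n + y) * 8 + b)"
    let ?M6 = "?M5(Suc t := a)" let ?M7 = "?M6(t := (x * n + y) * 8 + b + a)"
    have 1: "runs_le (SetOp t Times t 0) M unit_time ?M1"
      using run_SetOp[of t L t 0 M Times] M cs x xy ns t by simp
    have 2: "runs_le (SetOp t Plus t (Suc t)) ?M1 unit_time ?M2"
      using run_SetOp[of t L t "Suc t" ?M1 Plus] M cs x xy ns t by simp
    have 3: "runs_le (SetConst (Suc t) 8) ?M2 unit_time ?M3"
      using run_SetConst[of "Suc t" L 8 ?M2] cs by simp
    have 4: "runs_le (SetOp t Times t (Suc t)) ?M3 unit_time ?M4"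
      using run_SetOp[of t L t "Suc t" ?M3 Times] M cs x xy ns t by simp
    have 5: "runs_le (SetOp t Plus t 2) ?M4 unit_time ?M5"
      using run_SetOp[of t L t 2 ?M4 Plus] M cs x xy ns t by simp
    have 6: "runs_le (SetConst (Suc t) a) ?M5 unit_time ?M6"
      using run_SetConst[of "Suc t" L a ?M5] cs by simp
    have 7: "runs_le (SetOp t Plus t (Suc t)) ?M6 unit_time ?M7"
      using run_SetOp[of t L t "Suc t" ?M6 Plus] M cs x xy ns t by simp
    have "runs_le (address t a) M (unit_time + (unit_time + (unit_time + (unit_time + (unit_time + (unit_time + unit_time)))))) ?M7"
      unfolding address_def by (intro runs_le_Seq[OF 1] runs_le_Seq[OF 2] runs_le_Seq[OF 3] runs_le_Seq[OF 4] runs_le_Seq[OF 5] runs_le_Seq[OF 6] 7)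
    then have "runs_le (address t a) M (7 * unit_time) ?M7" by (rule runs_le_mono) simp
    then show ?thesis by (intro exec_exI[of _ _ _ ?M7]) (assumption, auto)
qed

lemma represents_cong:
  assumes "represents s M" "vr s 2 = b" "\<And>c. c < 40 \<or> 60 \<le> c \<Longrightarrow> M' c = M c"
  shows "represents s M'"
  using assms b60 unfolding represents_def by auto

text \<open>Cells below \<open>t\<close> survive, so a left operand waiting in a lower cell is safe;
  cells from 60 on survive, so the represented state is untouched.\<close>

lemma run_cexp:
  assumes s: "vr s 0 = n" "vr s 2 = b" "bounded Q s"
  shows "represents s M \<Longrightarrow> wfe e \<Longrightarrow> eok e s \<Longrightarrow> esize e \<le> 80 \<Longrightarrow> 40 \<le> t \<Longrightarrow> t + height e < 59 \<Longrightarrow>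
    \<exists>M'. runs_le (cexp t e) M (2 * esize e * unit_time) M' \<and> M' t = eval e s \<and>
      (\<forall>c. c < t \<or> 60 \<le> c \<longrightarrow> M' c = M c)"
proof (induction e arbitrary: M t)
  case (Num c)
  have "runs_le (SetConst t c) M unit_time (M(t := c))"
    using Num by (intro run_SetConst) (auto intro: c_small)
  then have "runs_le (SetConst t c) M (2 * esize (Num c) * unit_time) (M(t := c))"
    by (rule runs_le_mono) simp
  then show ?case using Num by (intro exec_exI[of _ _ _ "M(t := c)"]) (simp_all only: cexp.simps, auto)
next
  case (Var x)
  let ?M1 = "M(Suc t := 0)" let ?M2 = "?M1(t := M x)"
  have x: "M x = vr s x" "x < 40" "M x \<le> Q" using Var s by (auto simp: represents_def bounded_def)
  have 1: "runs_le (SetConst (Suc t) 0) M unit_time ?M1"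
    using Var by (intro run_SetConst) (auto intro: c_small)
  have "runs_le (SetOp t Plus x (Suc t)) ?M1 unit_time (?M1(t := binop_val Plus (?M1 x) (?M1 (Suc t))))"
    using Var x by (intro run_SetOp) (auto intro: c_small Q_small)
  then have 2: "runs_le (SetOp t Plus x (Suc t)) ?M1 unit_time ?M2" using x Var.prems by simp
  have "runs_le (cexp t (Var x)) M (2 * esize (Var x) * unit_time) ?M2"
    by (rule runs_le_mono[of _ _ "unit_time + unit_time"]) (auto intro: runs_le_Seq[OF 1 2])
  then show ?case using x Var.prems by (intro exec_exI[of _ _ _ ?M2]) (assumption, auto)
next
  case (Op f a e)
  have pa: "wfe a" "eok a s" "esize a \<le> 80" "t + height a < 59" and
    pe: "wfe e" "eok e s" "esize e \<le> 80" "40 \<le> Suc t" "Suc t + height e < 59"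
    using Op.prems by auto
  obtain M1 where M1: "runs_le (cexp t a) M (2 * esize a * unit_time) M1" "M1 t = eval a s"
    "\<And>c. c < t \<or> 60 \<le> c \<Longrightarrow> M1 c = M c"
    using Op.IH(1)[OF Op.prems(1) pa(1-3) Op.prems(5) pa(4)] by blast
  have r1: "represents s M1" using Op.prems s M1 by (intro represents_cong[OF Op.prems(1)]) auto
  obtain M2 where M2: "runs_le (cexp (Suc t) e) M1 (2 * esize e * unit_time) M2" "M2 (Suc t) = eval e s"
    "\<And>c. c < Suc t \<or> 60 \<le> c \<Longrightarrow> M2 c = M1 c"
    using Op.IH(2)[OF r1 pe] by blast
  let ?M3 = "M2(t := eval (Op f a e) s)"
  have "runs_le (SetOp t f t (Suc t)) M2 unit_time (M2(t := binop_val f (M2 t) (M2 (Suc t))))"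
    using Op.prems s pa pe M1 M2 eval_small[of s a] eval_small[of s e] eval_small[of s "Op f a e"]
    by (intro run_SetOp) (auto intro: c_small)
  then have 3: "runs_le (SetOp t f t (Suc t)) M2 unit_time ?M3" using M1 M2 by simp
  have "runs_le (cexp t (Op f a e)) M (2 * esize a * unit_time + (2 * esize e * unit_time + unit_time)) ?M3"
    unfolding cexp.simps by (intro runs_le_Seq[OF M1(1)] runs_le_Seq[OF M2(1)] 3)
  then have "runs_le (cexp t (Op f a e)) M (2 * esize (Op f a e) * unit_time) ?M3"
    by (rule runs_le_mono) (simp add: algebra_simps)
  then show ?case using M1 M2 Op.prems by (intro exec_exI[of _ _ _ ?M3]) (assumption, auto)
next
  case (Get a i j)
  have pa: "wfe i" "eok i s" "esize i \<le> 80" "t + height i < 59" and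
    pe: "wfe j" "eok j s" "esize j \<le> 80" "40 \<le> Suc t" "Suc t + height j < 59"
    using Get.prems by auto
  obtain M1 where M1: "runs_le (cexp t i) M (2 * esize i * unit_time) M1" "M1 t = eval i s"
    "\<And>c. c < t \<or> 60 \<le> c \<Longrightarrow> M1 c = M c"
    using Get.IH(1)[OF Get.prems(1) pa(1-3) Get.prems(5) pa(4)] by blast
  have r1: "represents s M1" using Get.prems s M1 by (intro represents_cong[OF Get.prems(1)]) auto
  obtain M2 where M2: "runs_le (cexp (Suc t) j) M1 (2 * esize j * unit_time) M2" "M2 (Suc t) = eval j s"
    "\<And>c. c < Suc t \<or> 60 \<le> c \<Longrightarrow> M2 c = M1 c"
    using Get.IH(2)[OF r1 pe] by blast
  have r2: "represents s M2" using Get.prems s M2 by (intro represents_cong[OF r1]) auto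
  let ?ad = "b + 8 * (eval i s * n + eval j s) + a"
  have ad: "?ad < 2 ^ L" using address_bound[of s i j a] Get.prems s by auto
  obtain M3 where M3: "runs_le (address t a) M2 (7 * unit_time) M3" "M3 t = ?ad"
     "\<And>c. c \<noteq> t \<Longrightarrow> c \<noteq> Suc t \<Longrightarrow> M3 c = M2 c"
    using run_address[of M2 t "eval i s" "eval j s" a] M1 M2 r2 s Get.prems ad pe
    by (auto simp: represents_def)
  have r3: "represents s M3" using Get.prems s M3 by (intro represents_cong[OF r2]) auto
  have v: "M3 ?ad = eval (Get a i j) s" using r3 Get.prems s by (auto simp: represents_def)
  let ?M4 = "M3(t := eval (Get a i j) s)"
  have "eval (Get a i j) s < 2 ^ L" using s by (auto simp: bounded_def intro: Q_small)
  then have "runs_le (Load t t) M3 unit_time (M3(t := M3 (M3 t)))"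
    using Get.prems M3(2) v ad by (intro run_Load) (auto intro: c_small)
  then have 4: "runs_le (Load t t) M3 unit_time ?M4" using M3(2) v by simp
  have "runs_le (cexp t (Get a i j)) M (2 * esize i * unit_time + (2 * esize j * unit_time + (7 * unit_time + unit_time))) ?M4"
    unfolding cexp.simps by (intro runs_le_Seq[OF M1(1)] runs_le_Seq[OF M2(1)] runs_le_Seq[OF M3(1)] 4)
  then have "runs_le (cexp t (Get a i j)) M (2 * esize (Get a i j) * unit_time) ?M4"
    by (rule runs_le_mono) (simp add: algebra_simps)
  then show ?case using M1 M2 M3 Get.prems by (intro exec_exI[of _ _ _ ?M4]) (assumption, auto)
next
  case (Inp i)
  have pa: "wfe i" "eok i s" "esize i \<le> 80" "t + height i < 59" using Inp.prems by auto
  obtain M1 where M1: "runs_le (cexp t i) M (2 * esize i * unit_time) M1" "M1 t = eval i s"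
    "\<And>c. c < t \<or> 60 \<le> c \<Longrightarrow> M1 c = M c"
    using Inp.IH(1)[OF Inp.prems(1) pa(1-3) Inp.prems(5) pa(4)] by blast
  have r1: "represents s M1" using Inp.prems s M1 by (intro represents_cong[OF Inp.prems(1)]) auto
  have v: "M1 (eval i s) = eval (Inp i) s" using r1 Inp.prems s by (auto simp: represents_def)
  let ?M4 = "M1(t := eval (Inp i) s)"
  have "eval (Inp i) s < 2 ^ L" using s by (auto simp: bounded_def intro: Q_small)
  then have "runs_le (Load t t) M1 unit_time (M1(t := M1 (M1 t)))"
    using Inp.prems M1(2) v eval_small[of s i] pa s by (intro run_Load) (auto intro: c_small)
  then have 4: "runs_le (Load t t) M1 unit_time ?M4" using M1(2) v by simp
  have "runs_le (cexp t (Inp i)) M (2 * esize i * unit_time + unit_time) ?M4"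
    unfolding cexp.simps by (intro runs_le_Seq[OF M1(1)] 4)
  then have "runs_le (cexp t (Inp i)) M (2 * esize (Inp i) * unit_time) ?M4"
    by (rule runs_le_mono) (simp add: algebra_simps)
  then show ?case using M1 Inp.prems by (intro exec_exI[of _ _ _ ?M4]) (assumption, auto)
qed

lemma run_cexp':
  assumes "represents s M" "vr s 0 = n" "vr s 2 = b" "bounded Q s" "wfx e" "eok e s" "t = 40 \<or> t = 41"
  shows "\<exists>M'. runs_le (cexp t e) M (2 * esize e * unit_time) M' \<and> M' t = eval e s \<and>
    (\<forall>c. c < t \<or> 60 \<le> c \<longrightarrow> M' c = M c) \<and> represents s M' \<and> eval e s < 2 ^ L"
proof -
  obtain M' where M': "runs_le (cexp t e) M (2 * esize e * unit_time) M'" "M' t = eval e s"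
      "\<forall>c. c < t \<or> 60 \<le> c \<longrightarrow> M' c = M c"
    using run_cexp[OF assms(2-4) assms(1), of e t] assms(5-7) unfolding wfx_def by fastforce
  moreover have "represents s M'" using assms M' by (intro represents_cong[OF assms(1)]) auto
  moreover have "eval e s < 2 ^ L" using assms eval_small[of s e] by (auto simp: wfx_def)
  ultimately show ?thesis by (intro exI[of _ M'] conjI)
qed

text \<open>Reduction modulo 8 recovers the array, and division by \<open>n\<close> then separates
  row from column.\<close>

lemma address_inj:
  assumes "1 \<le> a" "a \<le> 7" "1 \<le> a'" "a' \<le> (7::nat)" "j < n" "j' < n"
    "b + 8 * (i * n + j) + a = b + 8 * (i' * n + j') + a'"
  shows "a = a' \<and> i = i' \<and> j = j'"
proof -
  have e: "8 * (i * n + j) + a = 8 * (i' * n + j') + a'" using assms by simp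
  have "a = (8 * (i * n + j) + a) mod 8" "a' = (8 * (i' * n + j') + a') mod 8"
    using assms by (simp_all only: mod_mult_self4 mod_less)
  then have a: "a = a'" using e by simp
  then have e: "i * n + j = i' * n + j'" using e by simp
  have "i = (i * n + j) div n" "i' = (i' * n + j') div n" using assms by auto
  then have "i = i'" using e by simp
  then show ?thesis using a e by simp
qed

lemma represents_setv:
  assumes "represents s M" "3 \<le> x" "x < 40" "vr s 2 = b"
  shows "represents (setv x v s) (M(x := v))"
  using assms b60 unfolding represents_def by auto

lemma represents_seta:
  assumes "represents s M" "1 \<le> a" "a \<le> 7" "j < n" "vr s 2 = b" "vr s 0 = n"
  shows "represents (seta a i j v s) (M(b + 8 * (i * n + j) + a := v))"
proof -
  have R: "M (b + 8 * (i' * n + j') + a') = ar s a' i' j'" if "1 \<le> a'" "a' \<le> 7" "j' < n" for a' i' j'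
    using assms(1) that unfolding represents_def assms(5,6) by blast
  have inj: "a' = a \<and> i' = i \<and> j' = j"
    if "1 \<le> a'" "a' \<le> 7" "j' < n" "b + 8 * (i' * n + j') + a' = b + 8 * (i * n + j) + a" for a' i' j'
    by (rule address_inj[OF that(1,2) assms(2,3) that(3) assms(4) that(4)])
  have "(M(b + 8 * (i * n + j) + a := v)) (b + 8 * (i' * n + j') + a') = ar (seta a i j v s) a' i' j'"
    if "1 \<le> a'" "a' \<le> 7" "j' < n" for a' i' j'
    using R[OF that, of i'] inj[OF that, of i'] by (cases "a' = a \<and> i' = i \<and> j' = j") auto
  moreover have "(M(b + 8 * (i * n + j) + a := v)) x = M x" if "x \<le> b" for x
    using that assms(2) by simp
  ultimately show ?thesis using assms(1) b60 unfolding represents_def set_simps(4,5) assms(5,6)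
    by (intro conjI allI impI) (simp_all add: less_imp_le)
qed

lemma represents_seto:
  assumes "represents s M" "60 \<le> i" "i < b" "vr s 2 = b"
  shows "represents (seto i v s) (M(i := v))"
  using assms b60 unfolding represents_def by auto

lemma bounded_setv: "bounded Q s \<Longrightarrow> v \<le> Q \<Longrightarrow> bounded Q (setv x v s)"
  and bounded_seta: "bounded Q s \<Longrightarrow> v \<le> Q \<Longrightarrow> bounded Q (seta a i j v s)"
  and bounded_seto: "bounded Q s \<Longrightarrow> v \<le> Q \<Longrightarrow> bounded Q (seto i v s)"
  unfolding bounded_def by auto

lemma exec_ccomI: "runs_le P M t M' \<Longrightarrow> represents s M' \<Longrightarrow> bounded Q s \<Longrightarrow>
    \<exists>M'. runs_le P M t M' \<and> represents s M' \<and> bounded Q s"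
  by blast

lemma run_ccom:
  assumes "represents s M" "vr s 0 = n" "vr s 2 = b" "bounded Q s" "wfc c" "ok Q K c s"
  shows "\<exists>M'. runs_le (ccom c) M (csteps K c * unit_time) M' \<and> represents (sem c s) M' \<and> bounded Q (sem c s)"
  using assms
proof (induction c arbitrary: s M)
  case (Asg x e)
  have "wfx e" "eok e s" using Asg.prems(5,6) by simp_all
  from run_cexp'[OF Asg.prems(1-4) this disjI1[OF refl]]
  obtain M1 where M1: "runs_le (cexp 40 e) M (2 * esize e * unit_time) M1" "M1 40 = eval e s"
    "represents s M1" "eval e s < 2 ^ L"
    by (elim exE conjE) (rule that; assumption)
  let ?M2 = "M1(41 := 0)" let ?M3 = "?M2(x := eval e s)"
  have 2: "runs_le (SetConst 41 0) M1 unit_time ?M2" by (intro run_SetConst) (auto intro: c_small)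
  have "runs_le (SetOp x Plus 40 41) ?M2 unit_time (?M2(x := binop_val Plus (?M2 40) (?M2 41)))"
    using M1 Asg.prems by (intro run_SetOp) (auto intro: c_small)
  then have 3: "runs_le (SetOp x Plus 40 41) ?M2 unit_time ?M3" using M1 by simp
  have "runs_le (ccom (Asg x e)) M (2 * esize e * unit_time + (unit_time + unit_time)) ?M3"
    unfolding ccom.simps by (intro runs_le_Seq[OF M1(1)] runs_le_Seq[OF 2] 3)
  then have r1: "runs_le (ccom (Asg x e)) M (csteps K (Asg x e) * unit_time) ?M3"
    by (rule runs_le_mono) (simp add: algebra_simps)
  have "represents s ?M2" using Asg.prems by (intro represents_cong[OF M1(3)]) auto
  then have r2: "represents (sem (Asg x e) s) ?M3"
    unfolding sem.simps using Asg.prems by (intro represents_setv) simp_all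
  have r3: "bounded Q (sem (Asg x e) s)" unfolding sem.simps using Asg.prems by (intro bounded_setv) simp_all
  show ?case by (rule exec_ccomI[OF r1 r2 r3])
next
  case (Put a i j e)
  have "wfx i" "eok i s" using Put.prems(5,6) by simp_all
  from run_cexp'[OF Put.prems(1-4) this disjI1[OF refl]]
  obtain M1 where M1: "runs_le (cexp 40 i) M (2 * esize i * unit_time) M1" "M1 40 = eval i s"
    "represents s M1" "eval i s < 2 ^ L"
    by (elim exE conjE) (rule that; assumption)
  have "wfx j" "eok j s" using Put.prems(5,6) by simp_all
  from run_cexp'[OF M1(3) Put.prems(2-4) this disjI2[OF refl]]
  obtain M2 where M2: "runs_le (cexp 41 j) M1 (2 * esize j * unit_time) M2" "M2 41 = eval j s"
    "\<forall>c. c < 41 \<or> 60 \<le> c \<longrightarrow> M2 c = M1 c" "represents s M2" "eval j s < 2 ^ L"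
    by (elim exE conjE) (rule that; assumption)
  let ?ad = "b + 8 * (eval i s * n + eval j s) + a"
  have ad: "?ad < 2 ^ L" using address_bound[of s i j a] Put.prems by (auto simp: wfx_def)
  obtain M3 where M3: "runs_le (address 40 a) M2 (7 * unit_time) M3" "M3 40 = ?ad"
     "\<And>c. c \<noteq> 40 \<Longrightarrow> c \<noteq> 41 \<Longrightarrow> M3 c = M2 c"
    using run_address[of M2 40 "eval i s" "eval j s" a] M1 M2 Put.prems ad
    by (auto simp: represents_def)
  have r3: "represents s M3" using Put.prems M3 by (intro represents_cong[OF M2(4)]) auto
  have "wfx e" "eok e s" using Put.prems(5,6) by simp_all
  from run_cexp'[OF r3 Put.prems(2-4) this disjI2[OF refl]]
  obtain M4 where M4: "runs_le (cexp 41 e) M3 (2 * esize e * unit_time) M4" "M4 41 = eval e s"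
    "\<forall>c. c < 41 \<or> 60 \<le> c \<longrightarrow> M4 c = M3 c" "represents s M4" "eval e s < 2 ^ L"
    by (elim exE conjE) (rule that; assumption)
  let ?M5 = "M4(?ad := eval e s)"
  have "runs_le (Store 40 41) M4 unit_time (M4(M4 40 := M4 41))"
    using M3 M4 ad by (intro run_Store) (auto intro: c_small)
  then have 5: "runs_le (Store 40 41) M4 unit_time ?M5" using M3 M4 by simp
  have "runs_le (ccom (Put a i j e)) M (2 * esize i * unit_time + (2 * esize j * unit_time +
      (7 * unit_time + (2 * esize e * unit_time + unit_time)))) ?M5"
    unfolding ccom.simps by (intro runs_le_Seq[OF M1(1)] runs_le_Seq[OF M2(1)] runs_le_Seq[OF M3(1)] runs_le_Seq[OF M4(1)] 5)
  then have r1: "runs_le (ccom (Put a i j e)) M (csteps K (Put a i j e) * unit_time) ?M5"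
    by (rule runs_le_mono) (simp add: algebra_simps)
  have r2: "represents (sem (Put a i j e) s) ?M5"
    unfolding sem.simps using Put.prems M4(4) by (intro represents_seta) simp_all
  have r3: "bounded Q (sem (Put a i j e) s)" unfolding sem.simps using Put.prems by (intro bounded_seta) simp_all
  show ?case by (rule exec_ccomI[OF r1 r2 r3])
next
  case (Out i e)
  have "wfx i" "eok i s" using Out.prems(5,6) by simp_all
  from run_cexp'[OF Out.prems(1-4) this disjI1[OF refl]]
  obtain M1 where M1: "runs_le (cexp 40 i) M (2 * esize i * unit_time) M1" "M1 40 = eval i s"
    "represents s M1" "eval i s < 2 ^ L"
    by (elim exE conjE) (rule that; assumption)
  have "wfx e" "eok e s" using Out.prems(5,6) by simp_all
  from run_cexp'[OF M1(3) Out.prems(2-4) this disjI2[OF refl]]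
  obtain M2 where M2: "runs_le (cexp 41 e) M1 (2 * esize e * unit_time) M2" "M2 41 = eval e s"
    "\<forall>c. c < 41 \<or> 60 \<le> c \<longrightarrow> M2 c = M1 c" "represents s M2" "eval e s < 2 ^ L"
    by (elim exE conjE) (rule that; assumption)
  let ?M3 = "M2(eval i s := eval e s)"
  have "runs_le (Store 40 41) M2 unit_time (M2(M2 40 := M2 41))"
    using M1 M2 by (intro run_Store) (auto intro: c_small)
  then have 3: "runs_le (Store 40 41) M2 unit_time ?M3" using M1 M2 by simp
  have "runs_le (ccom (Out i e)) M (2 * esize i * unit_time + (2 * esize e * unit_time + unit_time)) ?M3"
    unfolding ccom.simps by (intro runs_le_Seq[OF M1(1)] runs_le_Seq[OF M2(1)] 3)
  then have r1: "runs_le (ccom (Out i e)) M (csteps K (Out i e) * unit_time) ?M3"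
    by (rule runs_le_mono) (simp add: algebra_simps)
  have r2: "represents (sem (Out i e) s) ?M3"
    unfolding sem.simps using Out.prems M2(4) by (intro represents_seto) simp_all
  have r3: "bounded Q (sem (Out i e) s)" unfolding sem.simps using Out.prems by (intro bounded_seto) simp_all
  show ?case by (rule exec_ccomI[OF r1 r2 r3])
next
  case (Sq c1 c2)
  obtain M1 where M1: "runs_le (ccom c1) M (csteps K c1 * unit_time) M1" "represents (sem c1 s) M1" "bounded Q (sem c1 s)"
    using Sq.IH(1)[OF Sq.prems(1-4)] Sq.prems(5,6) by auto
  have "vr (sem c1 s) 0 = n" "vr (sem c1 s) 2 = b"
    using Sq.prems by (simp_all add: wfc_keeps)
  then obtain M2 where M2: "runs_le (ccom c2) M1 (csteps K c2 * unit_time) M2"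
      "represents (sem c2 (sem c1 s)) M2" "bounded Q (sem c2 (sem c1 s))"
    using Sq.IH(2)[OF M1(2) _ _ M1(3)] Sq.prems(5,6) by auto
  show ?case using runs_le_Seq[OF M1(1) M2(1)] M2 by (intro exI[of _ M2]) (auto simp: algebra_simps)
next
  case (Cond e c1 c2)
  have "wfx e" "eok e s" using Cond.prems(5,6) by simp_all
  from run_cexp'[OF Cond.prems(1-4) this disjI1[OF refl]]
  obtain M1 where M1: "runs_le (cexp 40 e) M (2 * esize e * unit_time) M1" "M1 40 = eval e s"
    "represents s M1" "eval e s < 2 ^ L"
    by (elim exE conjE) (rule that; assumption)
  let ?c = "if eval e s \<noteq> 0 then c1 else c2"
  obtain M2 where M2: "runs_le (ccom ?c) M1 (csteps K ?c * unit_time) M2"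
     "represents (sem ?c s) M2" "bounded Q (sem ?c s)"
    using Cond.IH(1)[OF M1(3) Cond.prems(2-4)] Cond.IH(2)[OF M1(3) Cond.prems(2-4)] Cond.prems(5,6)
    by (cases "eval e s = 0") auto
  have "runs_le (IfNonzero 40 (ccom c1) (ccom c2)) M1 (unit_time + csteps K ?c * unit_time) M2"
    using M1 M2(1) by (intro run_If) (auto intro: c_small split: if_splits)
  from runs_le_Seq[OF M1(1) this]
  have "runs_le (ccom (Cond e c1 c2)) M (csteps K (Cond e c1 c2) * unit_time) M2"
    unfolding ccom.simps by (rule runs_le_mono) (auto simp: algebra_simps)
  then show ?case using M2 by (intro exI[of _ M2]) (auto split: if_splits)
next
  case (Loop x e c)
  have x: "3 \<le> x" "x < 40" "wfx e" "x \<notin> writes c" "wfc c" using Loop.prems by auto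
  let ?f = "\<lambda>i s. sem c (setv x i s)" and ?g = "\<lambda>i s. ok Q K c (setv x i s)"
  let ?B = "Seq (SetConst 40 1) (Seq (SetOp x Minus x 40) (ccom c))"
  have "wfx e" "eok e s" using Loop.prems(5,6) by simp_all
  from run_cexp'[OF Loop.prems(1-4) this disjI1[OF refl]]
  obtain M1 where M1: "runs_le (cexp 40 e) M (2 * esize e * unit_time) M1" "M1 40 = eval e s"
    "represents s M1" "eval e s < 2 ^ L"
    by (elim exE conjE) (rule that; assumption)
  let ?M2 = "M1(41 := 0)" let ?M3 = "?M2(x := eval e s)"
  have 2: "runs_le (SetConst 41 0) M1 unit_time ?M2" by (intro run_SetConst) (auto intro: c_small)
  have "runs_le (SetOp x Plus 40 41) ?M2 unit_time (?M2(x := binop_val Plus (?M2 40) (?M2 41)))"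
    using M1 x by (intro run_SetOp) (auto intro: c_small)
  then have 3: "runs_le (SetOp x Plus 40 41) ?M2 unit_time ?M3" using M1 by simp
  have "represents s ?M2" using Loop.prems by (intro represents_cong[OF M1(3)]) auto
  then have r3: "represents (setv x (eval e s) s) ?M3" using x Loop.prems by (intro represents_setv) auto
  \<comment> \<open>With \<open>m\<close> rounds left the memory represents the state whose variable
    \<open>x\<close> is \<open>m\<close>; the loop counter is thus part of the represented state and
    no separate cell has to be tracked.\<close>
  have w: "\<exists>M'. runs_le (WhileNonzero x ?B) M (m * ((csteps K c + 3) * unit_time) + unit_time) M' \<and>
      represents (setv x 0 (dloop ?f m s)) M' \<and> bounded Q (dloop ?f m s)"
    if "represents (setv x m s) M" "vr s 0 = n" "vr s 2 = b" "bounded Q s" "m \<le> Q" "dall ?g ?f m s" for m s M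
    using that
  proof (induction m arbitrary: s M)
    case 0
    then have "M x = 0" using x by (auto simp: represents_def)
    have "x < 2 ^ L" using x by (intro c_small) simp
    then have "runs_le (WhileNonzero x ?B) M unit_time M" using \<open>M x = 0\<close> by (rule run_WhileFalse)
    then show ?case using 0 by (intro exI[of _ M]) simp
  next
    case (Suc m)
    have Mx: "M x = Suc m" using x Suc.prems by (auto simp: represents_def)
    let ?Ma = "M(40 := 1)" let ?Mb = "?Ma(x := m)"
    have a: "runs_le (SetConst 40 1) M unit_time ?Ma" by (intro run_SetConst) (auto intro: c_small)
    have sm: "Suc m < 2 ^ L" using Suc.prems Q_small by simp
    have "runs_le (SetOp x Minus x 40) ?Ma unit_time (?Ma(x := binop_val Minus (?Ma x) (?Ma 40)))"
      using Mx x sm by (intro run_SetOp) (auto intro: c_small)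
    then have b: "runs_le (SetOp x Minus x 40) ?Ma unit_time ?Mb" using Mx x by simp
    have "represents (setv x (Suc m) s) ?Ma" using Suc.prems x by (intro represents_cong[OF Suc.prems(1)]) auto
    then have "represents (setv x m (setv x (Suc m) s)) ?Mb" using x Suc.prems by (intro represents_setv) auto
    then have rb: "represents (setv x m s) ?Mb" by simp
    have bb: "bounded Q (setv x m s)" using Suc.prems by (intro bounded_setv) auto
    have "x \<noteq> 0" "x \<noteq> 2" using x by auto
    then have nb: "vr (setv x m s) 0 = n" "vr (setv x m s) 2 = b" using Suc.prems by auto
    have "ok Q K c (setv x m s)" using Suc.prems by simp
    from Loop.IH[OF rb nb bb x(5) this]
    obtain Mc where Mc: "runs_le (ccom c) ?Mb (csteps K c * unit_time) Mc" "represents (?f m s) Mc" "bounded Q (?f m s)"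
      by (elim exE conjE) (rule that; assumption)
    \<comment> \<open>The body leaves \<open>x\<close> alone, so after it the counter still holds
      \<open>m\<close> and the induction hypothesis applies.\<close>
    have idv: "setv x m (?f m s) = ?f m s" using sem_unwritten[OF x(4), of "setv x m s"] by (intro setv_id) simp
    have nb': "vr (?f m s) 0 = n" "vr (?f m s) 2 = b"
      using nb wfc_keeps[OF x(5), of 0 "setv x m s"] wfc_keeps[OF x(5), of 2 "setv x m s"] by simp_all
    have "represents (setv x m (?f m s)) Mc" unfolding idv by (rule Mc(2))
    moreover have "m \<le> Q" "dall ?g ?f m (?f m s)" using Suc.prems by simp_all
    ultimately have "\<exists>M'. runs_le (WhileNonzero x ?B) Mc (m * ((csteps K c + 3) * unit_time) + unit_time) M' \<and>
      represents (setv x 0 (dloop ?f m (?f m s))) M' \<and> bounded Q (dloop ?f m (?f m s))"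
      using nb' Mc(3) by (intro Suc.IH)
    then obtain M' where M': "runs_le (WhileNonzero x ?B) Mc (m * ((csteps K c + 3) * unit_time) + unit_time) M'"
      "represents (setv x 0 (dloop ?f m (?f m s))) M'" "bounded Q (dloop ?f m (?f m s))"
      by (elim exE conjE) (rule that; assumption)
    have B: "runs_le ?B M (unit_time + (unit_time + csteps K c * unit_time)) Mc"
      by (intro runs_le_Seq[OF a] runs_le_Seq[OF b] Mc)
    have "runs_le (WhileNonzero x ?B) M (unit_time + (unit_time + (unit_time + csteps K c * unit_time)) +
        (m * ((csteps K c + 3) * unit_time) + unit_time)) M'"
      using Mx sm x by (intro run_WhileTrue[OF _ _ _ B M'(1)]) (auto intro: c_small)
    then have "runs_le (WhileNonzero x ?B) M (Suc m * ((csteps K c + 3) * unit_time) + unit_time) M'"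
      by (rule runs_le_mono) (simp add: algebra_simps)
    then show ?case using M'(2,3) by (intro exec_ccomI[of _ _ _ M', simplified conj_assoc] exI[of _ M'] conjI) simp_all
  qed
  have "eval e s \<le> Q" "dall ?g ?f (eval e s) s" using Loop.prems(6) by simp_all
  from w[OF r3 Loop.prems(2-4) this]
  obtain M' where M': "runs_le (WhileNonzero x ?B) ?M3 (eval e s * ((csteps K c + 3) * unit_time) + unit_time) M'"
      "represents (setv x 0 (dloop ?f (eval e s) s)) M'" "bounded Q (dloop ?f (eval e s) s)"
    by (elim exE conjE) (rule that; assumption)
  have "runs_le (ccom (Loop x e c)) M (2 * esize e * unit_time + (unit_time + (unit_time +
     (eval e s * ((csteps K c + 3) * unit_time) + unit_time)))) M'"
    unfolding ccom.simps by (intro runs_le_Seq[OF M1(1)] runs_le_Seq[OF 2] runs_le_Seq[OF 3] M'(1))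
  moreover have "eval e s * ((csteps K c + 3) * unit_time) \<le> K * ((csteps K c + 3) * unit_time)"
    using Loop.prems by (intro mult_right_mono) auto
  ultimately have "runs_le (ccom (Loop x e c)) M (csteps K (Loop x e c) * unit_time) M'"
    by (elim runs_le_mono) (simp add: algebra_simps)
  then show ?case using M' by (intro exI[of _ M']) (auto intro: bounded_setv)
qed

end

section \<open>Start-up, output and the whole machine program\<close>

definition copy_out :: "nat \<Rightarrow> prog" where
  "copy_out r = Seq (SetConst r (8 * r)) (Seq (SetOp r Plus r 0) (Load r r))"

fun copy_outs :: "nat list \<Rightarrow> prog" where
  "copy_outs [] = Skip"
| "copy_outs (r # rs) = Seq (copy_out r) (copy_outs rs)"

text \<open>Cell 0 serves as the base address and is overwritten last.\<close>

definition finish :: prog where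
  "finish = Seq (SetConst 1 5) (Seq (SetOp 0 Plus 2 1) (Seq (copy_outs [1..<60]) (Load 0 0)))"

definition start :: prog where
  "start = Seq (SetOp 3 Times 0 0) (Seq (SetOp 3 Plus 3 3) (Seq (SetConst 2 2) (SetOp 2 Plus 2 3)))"

text \<open>
  The cells of row 0 of the weight matrix are free to be used as registers, because the matrix is
  symmetric with zero diagonal; there are enough of them once \<open>n > 1000\<close>.
\<close>

definition wrap :: "com \<Rightarrow> prog" where
  "wrap c = Seq (SetConst 2 1000) (Seq (SetOp 2 Minus 0 2)
     (IfNonzero 2 (Seq start (Seq (ccom c) finish)) Skip))"

text \<open>Variables start with the raw input cells, so the program must set a variable before it
  relies on it; variable 3 holds a residue of computing the input length. Arrays start as 0 because
  the memory behind the input is 0.\<close>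

definition initial :: "nat \<Rightarrow> nat \<Rightarrow> (nat \<Rightarrow> nat \<Rightarrow> rat) \<Rightarrow> state" where
  "initial n k w = \<lparr>vr = (input_memory n k w)(2 := input_length n, 3 := 2 * (n * n)),
     ar = (\<lambda>_ _ _. 0), io = input_memory n k w\<rparr>"

lemma less_power_bits: "x < 2 ^ bits x"
proof (cases "x = 0")
  case False
  then show ?thesis using floorlog_bounds[of x 2] by (simp add: bits_def)
qed simp

lemma input_memory_bound: "input_memory n k w a < 2 ^ input_size n k w"
proof (cases "a < input_length n")
  case True
  have "1 + bits (input_memory n k w a) \<le> input_size n k w"
    unfolding input_size_def using True by (intro member_le_sum) auto
  then have "bits (input_memory n k w a) \<le> input_size n k w" by simp
  then have "(2::nat) ^ bits (input_memory n k w a) \<le> 2 ^ input_size n k w" by (intro power_increasing) auto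
  then show ?thesis using less_power_bits[of "input_memory n k w a"] by linarith
next
  case False
  then have "input_memory n k w a = 0" by (auto simp: input_memory_def input_length_def)
  then show ?thesis by simp
qed

lemma input_length_le_size: "input_length n \<le> input_size n k w"
proof -
  have "(\<Sum>a<input_length n. 1) \<le> input_size n k w" unfolding input_size_def by (intro sum_mono) auto
  then show ?thesis by simp
qed

context machine
begin

lemma run_copy_out:
  assumes "M 0 = B" "1 \<le> r" "r < 60" "60 \<le> B" "B + 8 * r < 2 ^ L" "M (B + 8 * r) < 2 ^ L"
  shows "runs_le (copy_out r) M (3 * unit_time) (M(r := M (B + 8 * r)))"
proof -
  have s: "8 * r < 2 ^ L" "B < 2 ^ L" "r < 2 ^ L" "0 < (2::nat) ^ L" using assms c_small[of r] by auto
  have 1: "runs_le (SetConst r (8 * r)) M unit_time (M(r := 8 * r))" using s by (intro run_SetConst) auto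
  have 2: "runs_le (SetOp r Plus r 0) (M(r := 8 * r)) unit_time (M(r := 8 * r, r := 8 * r + B))"
    using run_SetOp[of r L r 0 "M(r := 8 * r)" Plus] s assms by (simp add: add.commute)
  have "runs_le (Load r r) (M(r := 8 * r, r := 8 * r + B)) unit_time ((M(r := 8 * r, r := 8 * r + B))(r := M (B + 8 * r)))"
    using run_Load[of r L r "M(r := 8 * r, r := 8 * r + B)"] s assms by (simp add: add.commute)
  then have 3: "runs_le (Load r r) (M(r := 8 * r, r := 8 * r + B)) unit_time (M(r := M (B + 8 * r)))" by simp
  have "runs_le (copy_out r) M (unit_time + (unit_time + unit_time)) (M(r := M (B + 8 * r)))"
    unfolding copy_out_def by (intro runs_le_Seq[OF 1] runs_le_Seq[OF 2] 3)
  then show ?thesis by (rule runs_le_mono) simp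
qed

lemma run_copy_outs:
  assumes "M 0 = B" "set rs \<subseteq> {1..<60}" "60 \<le> B" "\<And>r. r < 60 \<Longrightarrow> B + 8 * r < 2 ^ L \<and> M (B + 8 * r) < 2 ^ L"
  shows "runs_le (copy_outs rs) M (3 * length rs * unit_time + 1) (\<lambda>c. if c \<in> set rs then M (B + 8 * c) else M c)"
  using assms
proof (induction rs arbitrary: M)
  case Nil
  have "runs_le Skip M 1 M" unfolding runs_le_def using runs.Skip by blast
  then show ?case by simp
next
  case (Cons r rs)
  let ?M = "M(r := M (B + 8 * r))"
  have 1: "runs_le (copy_out r) M (3 * unit_time) ?M" using Cons.prems by (intro run_copy_out) auto
  have 2: "runs_le (copy_outs rs) ?M (3 * length rs * unit_time + 1) (\<lambda>c. if c \<in> set rs then ?M (B + 8 * c) else ?M c)"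
    using Cons.prems by (intro Cons.IH) auto
  have eq: "(\<lambda>c. if c \<in> set rs then ?M (B + 8 * c) else ?M c) = (\<lambda>c. if c \<in> set (r # rs) then M (B + 8 * c) else M c)"
    using Cons.prems by (intro ext) auto
  from runs_le_Seq[OF 1 2] show ?case unfolding eq by (simp add: algebra_simps) 
qed

text \<open>The output cells below 60 have served as registers, so their values wait in row 0 of
  array 5. Each copy uses no scratch cell besides its own target, and the source lies behind the
  input, out of reach of the earlier copies.\<close>

lemma run_finish:
  assumes r: "represents s M" and s: "vr s 0 = n" "vr s 2 = b" "bounded Q s" and n60: "60 \<le> n"
  shows "\<exists>M'. runs_le finish M (200 * unit_time) M' \<and> (\<forall>i<60. M' i = ar s 5 0 i) \<and> (\<forall>i. 60 \<le> i \<longrightarrow> i < b \<longrightarrow> M' i = io s i)"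
proof -
  have M2: "M 2 = b" using r s by (auto simp: represents_def)
  let ?M1 = "M(1 := 5)" let ?M2 = "?M1(0 := b + 5)"
  have bs: "b < 2 ^ L" using bQ by (rule Q_small)
  have "Q + 1000 \<le> (Q + 1) ^ 3"
  proof -
    have "Q + 1000 \<le> (Q + 1) * 101" using Q100 by simp
    also have "\<dots> \<le> (Q + 1) * ((Q + 1) * (Q + 1))" using Q100 by (intro mult_left_mono) (auto intro: order_trans[of 101 "Q + 1"])
    finally show ?thesis by (simp add: numeral_eq_Suc)
  qed
  then have big: "b + 1000 < 2 ^ L" using bQ Qp[of 3] by simp
  have 1: "runs_le (SetConst 1 5) M unit_time ?M1" by (intro run_SetConst) (auto intro: c_small)
  have 2: "runs_le (SetOp 0 Plus 2 1) ?M1 unit_time ?M2"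
    using run_SetOp[of 0 L 2 1 ?M1 Plus] M2 big by (simp add: c_small)
  have arr: "M (b + 5 + 8 * j) = ar s 5 0 j" if "j < 60" for j
  proof -
    have "\<forall>a i j. 1 \<le> a \<longrightarrow> a \<le> 7 \<longrightarrow> j < n \<longrightarrow> M (b + 8 * (i * n + j) + a) = ar s a i j"
      using r unfolding represents_def s(1,2) by blast
    from this[rule_format, of 5 j 0] show ?thesis using that n60 by (simp add: add_ac)
  qed
  have arr2: "?M2 (b + 5 + 8 * j) = ar s 5 0 j" if "j < 60" for j
    using arr[OF that] b60 by simp
  have arrs: "ar s 5 0 j < 2 ^ L" for j using s by (auto simp: bounded_def intro: Q_small)
  let ?M3 = "\<lambda>c. if c \<in> set [1..<60] then ?M2 (b + 5 + 8 * c) else ?M2 c"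
  have 3: "runs_le (copy_outs [1..<60]) ?M2 (3 * length [1..<60] * unit_time + 1) ?M3"
    using b60 big arr2 arrs by (intro run_copy_outs) auto
  have "runs_le (Load 0 0) ?M3 unit_time (?M3(0 := ?M3 (?M3 0)))"
    using b60 big arr2[of 0] arrs[of 0] by (intro run_Load) auto
  then have 4: "runs_le (Load 0 0) ?M3 unit_time (?M3(0 := ar s 5 0 0))"
    using b60 arr2[of 0] by simp
  let ?M4 = "?M3(0 := ar s 5 0 0)"
  have "runs_le finish M (unit_time + (unit_time + ((3 * length [1..<60] * unit_time + 1) + unit_time))) ?M4"
    unfolding finish_def by (intro runs_le_Seq[OF 1] runs_le_Seq[OF 2] runs_le_Seq[OF 3] 4)
  then have R: "runs_le finish M (200 * unit_time) ?M4"
    by (rule runs_le_mono) (auto simp: utime_def)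
  have "\<forall>i<60. ?M4 i = ar s 5 0 i" using arr2 by auto
  moreover have "\<forall>i. 60 \<le> i \<longrightarrow> i < b \<longrightarrow> ?M4 i = io s i" using r s by (auto simp: represents_def)
  ultimately show ?thesis using R by blast
qed

end

lemma represents_initial:
  assumes "1000 < n"
  shows "represents (initial n k w) ((input_memory n k w)(2 := input_length n, 3 := 2 * (n * n)))"
  unfolding represents_def
proof (intro conjI allI impI)
  fix a i j :: nat assume "1 \<le> a" "a \<le> 7"
  have b: "vr (initial n k w) 2 = input_length n" by (simp add: initial_def)
  define c where "c = vr (initial n k w) 2 + 8 * (i * vr (initial n k w) 0 + j) + a"
  have "input_length n < c" using b \<open>1 \<le> a\<close> by (simp add: c_def)
  moreover have "3 < input_length n"
  proof -
    have "1000 * 1000 < n * n" using assms by (intro mult_strict_mono) auto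
    then show ?thesis by (simp add: input_length_def)
  qed
  ultimately have "((input_memory n k w)(2 := input_length n, 3 := 2 * (n * n))) c = 0"
    by (auto simp: input_memory_def)
  then show "((input_memory n k w)(2 := input_length n, 3 := 2 * (n * n)))
        (vr (initial n k w) 2 + 8 * (i * vr (initial n k w) 0 + j) + a) = ar (initial n k w) a i j"
    unfolding c_def by (simp add: initial_def)
qed (auto simp: initial_def)

lemma bounded_initial:
  assumes "2 ^ input_size n k w \<le> Q"
  shows "bounded Q (initial n k w)"
proof -
  have "input_length n < 2 ^ input_size n k w" using input_length_le_size[of n k w]
    by (meson less_exp less_le_trans le_less_trans)
  then have "input_length n \<le> Q" "2 * (n * n) \<le> Q" using assms by (auto simp: input_length_def)
  moreover have "input_memory n k w a \<le> Q" for a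
    using input_memory_bound[of n k w a] assms by simp
  ultimately show ?thesis by (auto simp: bounded_def initial_def)
qed

text \<open>Stored numbers may have \<open>z ^ 21\<close> bits and loops \<open>z ^ 38\<close>
  rounds, \<open>z\<close> being the input size: the largest numbers stem from a matrix power with
  exponent \<open>2 * n ^ 19\<close>, and the longest loop has \<open>n ^ 38 + 1\<close>
  rounds.\<close>

lemma run_wrap:
  assumes wf: "wfc c" and L: "((2 ^ (z ^ 21)) + 1) ^ 170 < (2::nat) ^ L" and z: "z = input_size n k w"
    and ok: "1000 < n \<Longrightarrow> ok (2 ^ (z ^ 21)) (z ^ 38) c (initial n k w)"
    and out: "1000 < n \<Longrightarrow> (\<forall>i<n. (60 \<le> i \<longrightarrow> io (sem c (initial n k w)) i = ar (sem c (initial n k w)) 5 0 i) \<and>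
        io (sem c (initial n k w)) (n + i) = ar (sem c (initial n k w)) 5 0 i)"
  shows "\<exists>M'. runs_le (wrap c) (input_memory n k w) ((csteps (z ^ 38) c + 300) * utime L) M' \<and>
    (1000 < n \<longrightarrow> output_sets n M' =
       ({i. i < n \<and> ar (sem c (initial n k w)) 5 0 i \<noteq> 0}, {i. i < n \<and> ar (sem c (initial n k w)) 5 0 i \<noteq> 0}))"
proof -
  let ?M0 = "input_memory n k w" and ?Q = "2 ^ (z ^ 21) :: nat"
  let ?M1 = "?M0(2 := 1000)" let ?M2 = "?M1(2 := n - 1000)"
  have z2: "2 \<le> z" using input_length_le_size[of n k w] z by (simp add: input_length_def)
  then have zz: "z \<le> z ^ 21" by (intro self_le_power) auto
  then have "(2::nat) ^ z \<le> ?Q" by (intro power_increasing) auto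
  then have cell: "?M0 a \<le> ?Q" for a using input_memory_bound[of n k w a] unfolding z by linarith
  have m0: "?M0 0 = n" by (simp add: input_memory_def)
  have QL: "v < 2 ^ L" if "v \<le> ?Q" for v
  proof -
    have "?Q + 1 \<le> (?Q + 1) ^ 170" by (intro self_le_power) auto
    then show ?thesis using that L by linarith
  qed
  have q2: "(2::nat) ^ 21 \<le> ?Q" using power_mono[OF z2, of 21] self_le_power[of 2 21] by (intro power_increasing) (auto intro: order_trans[of 21 "2 ^ 21"])
  have c1000: "v < 2 ^ L" if "v \<le> 1000" for v :: nat using that q2 by (intro QL) simp
  have 1: "runs_le (SetConst 2 1000) ?M0 (utime L) ?M1" by (intro run_SetConst) (auto intro: c1000)
  have 2: "runs_le (SetOp 2 Minus 0 2) ?M1 (utime L) ?M2"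
    using run_SetOp[of 2 L 0 2 ?M1 Minus] m0 c1000 QL[OF cell[of 0]] by simp
  show ?thesis
  proof (cases "1000 < n")
    \<comment> \<open>For small \<open>n\<close> the program stops at once; only its running time is
      claimed.\<close>
    case False
    have "runs_le Skip ?M2 1 ?M2" unfolding runs_le_def using runs.Skip by blast
    then have "runs_le (IfNonzero 2 (Seq start (Seq (ccom c) finish)) Skip) ?M2 (utime L + 1) ?M2"
      using False by (intro run_If) (auto intro: c1000)
    from runs_le_Seq[OF 1 runs_le_Seq[OF 2 this]]
    have "runs_le (wrap c) ?M0 (utime L + (utime L + (utime L + 1))) ?M2" unfolding wrap_def .
    moreover have "utime L + (utime L + (utime L + 1)) \<le> (csteps (z ^ 38) c + 300) * utime L"
      by (simp add: utime_def algebra_simps)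
    ultimately show ?thesis using False runs_le_mono by blast
  next
    case True
    let ?s = "initial n k w" and ?b = "input_length n"
    have bz: "?b \<le> ?Q" using input_length_le_size[of n k w] z zz less_exp[of z] \<open>(2::nat) ^ z \<le> ?Q\<close> by linarith
    interpret machine n ?b ?Q "z ^ 38" L
    proof
      have "1000 * 1000 < n * n" using True by (intro mult_strict_mono) auto
      then show "60 \<le> ?b" by (simp add: input_length_def)
      show "0 < n" using True by simp
      show "n \<le> ?Q" using cell[of 0] m0 by simp
      show "?b \<le> ?Q" by (rule bz)
      show "100 \<le> ?Q" using q2 by simp
      show "(?Q + 1) ^ 170 < 2 ^ L" by (rule L)
    qed
    let ?M3 = "?M2(3 := n * n)" let ?M4 = "?M3(3 := n * n + n * n)" let ?M5 = "?M4(2 := 2)" let ?M6 = "?M5(2 := 2 + (n * n + n * n))"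
    have nn: "n * n < 2 ^ L" "n * n + n * n < 2 ^ L" "2 + (n * n + n * n) < 2 ^ L" "n < 2 ^ L"
      using bz QL[OF cell[of 0]] by (auto simp: input_length_def m0 intro!: QL)
    have 3: "runs_le (SetOp 3 Times 0 0) ?M2 (utime L) ?M3"
      using run_SetOp[of 3 L 0 0 ?M2 Times] m0 nn c1000 by simp
    have 4: "runs_le (SetOp 3 Plus 3 3) ?M3 (utime L) ?M4"
      using run_SetOp[of 3 L 3 3 ?M3 Plus] m0 nn c1000 by simp
    have 5: "runs_le (SetConst 2 2) ?M4 (utime L) ?M5" by (intro run_SetConst) (auto intro: c1000)
    have 6: "runs_le (SetOp 2 Plus 2 3) ?M5 (utime L) ?M6"
      using run_SetOp[of 2 L 2 3 ?M5 Plus] m0 nn c1000 by simp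
    have M6: "?M6 = ?M0(2 := ?b, 3 := 2 * (n * n))" by (auto simp: input_length_def fun_eq_iff)
    have st: "runs_le start ?M2 (utime L + (utime L + (utime L + utime L))) ?M6"
      unfolding start_def by (intro runs_le_Seq[OF 3] runs_le_Seq[OF 4] runs_le_Seq[OF 5] 6)
    have r: "represents ?s ?M6" unfolding M6 by (rule represents_initial[OF True])
    have vs: "vr ?s 0 = n" "vr ?s 2 = ?b" by (auto simp: initial_def m0)
    have bd: "bounded ?Q ?s" using \<open>(2::nat) ^ z \<le> ?Q\<close> z by (intro bounded_initial) simp
    obtain M7 where M7: "runs_le (ccom c) ?M6 (csteps (z ^ 38) c * utime L) M7" "represents (sem c ?s) M7" "bounded ?Q (sem c ?s)"
      using run_ccom[OF r vs bd wf ok[OF True]] by blast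
    have vs': "vr (sem c ?s) 0 = n" "vr (sem c ?s) 2 = ?b"
      using vs by (simp_all add: wfc_keeps[OF wf])
    obtain M8 where M8: "runs_le finish M7 (200 * utime L) M8" "\<forall>i<60. M8 i = ar (sem c ?s) 5 0 i"
      "\<forall>i. 60 \<le> i \<longrightarrow> i < ?b \<longrightarrow> M8 i = io (sem c ?s) i"
      using run_finish[OF M7(2) vs' M7(3)] True by auto
    have body: "runs_le (Seq start (Seq (ccom c) finish)) ?M2
        ((utime L + (utime L + (utime L + utime L))) + (csteps (z ^ 38) c * utime L + 200 * utime L)) M8"
      by (intro runs_le_Seq[OF st] runs_le_Seq[OF M7(1)] M8(1))
    have eq: "(if ?M2 2 \<noteq> 0 then Seq start (Seq (ccom c) finish) else Skip) = Seq start (Seq (ccom c) finish)"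
      using True by simp
    have "runs_le (IfNonzero 2 (Seq start (Seq (ccom c) finish)) Skip) ?M2
      (utime L + ((utime L + (utime L + (utime L + utime L))) + (csteps (z ^ 38) c * utime L + 200 * utime L))) M8"
    proof (rule run_If)
      show "2 < (2::nat) ^ L" "?M2 2 < 2 ^ L" using c1000[of 2] nn by simp_all
    qed (subst eq, rule body)
    from runs_le_Seq[OF 1 runs_le_Seq[OF 2 this]]
    have R: "runs_le (wrap c) ?M0 ((csteps (z ^ 38) c + 300) * utime L) M8" unfolding wrap_def
      by (rule runs_le_mono) (simp add: algebra_simps)
    have o1: "M8 i = ar (sem c ?s) 5 0 i" if "i < n" for i
    proof (cases "i < 60")
      case False
      have "n \<le> n * n" by simp
      then have "i < ?b" using that unfolding input_length_def by linarith
      then show ?thesis using False M8(3) out[OF True] that by auto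
    qed (use M8 in auto)
    have o2: "M8 (n + i) = ar (sem c ?s) 5 0 i" if "i < n" for i
    proof -
      have "n \<le> n * n" by simp
      then have "n + i < ?b" using that unfolding input_length_def by linarith
      then show ?thesis using True M8(3) out[OF True] that by auto
    qed
    show ?thesis using R o1 o2 unfolding output_sets_def by (intro exI[of _ M8]) auto
  qed
qed

text \<open>\<open>alg\<close> is read off the final memory of the program; determinism of the
  machine makes it the output of every run.\<close>

lemma polynomial_time_wrap:
  assumes wf: "wfc c"
    and ok: "\<And>n k w. 1000 < n \<Longrightarrow> wgraph {..<n} (real_weights w) \<Longrightarrow>
        ok (2 ^ (input_size n k w ^ 21)) (input_size n k w ^ 38) c (initial n k w)"
    and out: "\<And>n k w. 1000 < n \<Longrightarrow> wgraph {..<n} (real_weights w) \<Longrightarrow>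
        (\<forall>i<n. (60 \<le> i \<longrightarrow> io (sem c (initial n k w)) i = ar (sem c (initial n k w)) 5 0 i) \<and>
        io (sem c (initial n k w)) (n + i) = ar (sem c (initial n k w)) 5 0 i)"
  shows "\<exists>alg. polynomial_time alg \<and> (\<forall>n k w. 1000 < n \<longrightarrow> wgraph {..<n} (real_weights w) \<longrightarrow>
     alg n k w = ({i. i < n \<and> ar (sem c (initial n k w)) 5 0 i \<noteq> 0}, {i. i < n \<and> ar (sem c (initial n k w)) 5 0 i \<noteq> 0}))"
proof -
  define alg where "alg n k w = output_sets n (SOME M. \<exists>t. runs (wrap c) (input_memory n k w) t M)" for n k w
  obtain C e where Ce: "\<And>K. csteps K c \<le> C * (K + 1) ^ e" using csteps_poly by metis
  \<comment> \<open>340 doubles the exponent 170 of \<open>machine\<close>, to make up for the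
    \<open>+ 1\<close> in \<open>(2 ^ (z ^ 21) + 1) ^ 170\<close>.\<close>
  let ?L = "\<lambda>z::nat. 340 * z ^ 21 + 1"
  have run: "\<exists>M'. runs_le (wrap c) (input_memory n k w) ((csteps (input_size n k w ^ 38) c + 300) * utime (?L (input_size n k w))) M' \<and>
      (1000 < n \<longrightarrow> output_sets n M' =
       ({i. i < n \<and> ar (sem c (initial n k w)) 5 0 i \<noteq> 0}, {i. i < n \<and> ar (sem c (initial n k w)) 5 0 i \<noteq> 0}))"
    if "wgraph {..<n} (real_weights w)" for n k w
  proof (rule run_wrap[OF wf _ refl])
    let ?z = "input_size n k w"
    have "2 \<le> ?z" using input_length_le_size[of n k w] by (simp add: input_length_def)
    then have z1: "1 \<le> ?z ^ 21" by (intro one_le_power) simp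
    have "((2::nat) ^ (?z ^ 21) + 1) ^ 170 \<le> (2 ^ (?z ^ 21 + 1)) ^ 170" by (intro power_mono) auto
    also have "\<dots> = 2 ^ (170 * ?z ^ 21 + 170)" by (simp only: power_mult[symmetric]) (simp add: algebra_simps)
    also have "\<dots> \<le> 2 ^ (340 * ?z ^ 21)" using z1 by (intro power_increasing) auto
    also have "\<dots> < 2 ^ ?L ?z" by (intro power_strict_increasing) auto
    finally show "((2::nat) ^ (?z ^ 21) + 1) ^ 170 < 2 ^ ?L ?z" .
  qed (use ok out that in auto)
  have det: "alg n k w = output_sets n M" if R: "runs_le (wrap c) (input_memory n k w) t M" for n k w t M
  proof -
    obtain t' where t': "runs (wrap c) (input_memory n k w) t' M" using R unfolding runs_le_def by blast
    then have "(SOME M. \<exists>t. runs (wrap c) (input_memory n k w) t M) = M"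
      by (intro some_equality) (use runs_deterministic in blast)+
    then show ?thesis by (simp add: alg_def)
  qed
  have "polynomial_time alg"
    unfolding polynomial_time_def
  \<comment> \<open>The number of steps has degree \<open>e\<close> in \<open>z ^ 38 + 1\<close>,
    which is at most \<open>z ^ 39\<close>; the summand 21 accounts for the cost of one
    instruction.\<close>
  proof (rule exI[of _ "wrap c"], rule exI[of _ "(C + 300) * 3000"], rule exI[of _ "39 * e + 21"], intro allI impI)
    fix n k :: nat and w :: "nat \<Rightarrow> nat \<Rightarrow> rat"
    assume wg: "wgraph {..<n} (real_weights w)"
    let ?z = "input_size n k w"
    obtain M' where M': "runs_le (wrap c) (input_memory n k w) ((csteps (?z ^ 38) c + 300) * utime (?L ?z)) M'"
      using run[OF wg] by blast
    then obtain t where t: "runs (wrap c) (input_memory n k w) t M'" "t \<le> (csteps (?z ^ 38) c + 300) * utime (?L ?z)"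
      unfolding runs_le_def by blast
    have z2: "2 \<le> ?z" using input_length_le_size[of n k w] by (simp add: input_length_def)
    have "?z ^ 38 + 1 \<le> ?z ^ 39"
    proof -
      have "?z ^ 38 + 1 \<le> ?z ^ 38 * 2" using z2 one_le_power[of ?z 38] by simp
      also have "\<dots> \<le> ?z ^ 38 * ?z" using z2 by (intro mult_left_mono) auto
      also have "\<dots> = ?z ^ 39" using power_add[of ?z 38 1] by simp
      finally show ?thesis .
    qed
    then have "(?z ^ 38 + 1) ^ e \<le> (?z ^ 39) ^ e" by (intro power_mono) auto
    then have "csteps (?z ^ 38) c \<le> C * ?z ^ (39 * e)"
      using Ce[of "?z ^ 38"] by (metis mult_le_mono2 order_trans power_mult)
    moreover have "300 * 1 \<le> 300 * ?z ^ (39 * e)" using z2 by (intro mult_left_mono one_le_power) auto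
    ultimately have a: "csteps (?z ^ 38) c + 300 \<le> (C + 300) * ?z ^ (39 * e)" by (simp add: algebra_simps)
    have "1 \<le> ?z ^ 21" using z2 by (intro one_le_power) simp
    then have "utime (?L ?z) \<le> 3000 * ?z ^ 21" by (simp add: utime_def)
    then have "t \<le> ((C + 300) * ?z ^ (39 * e)) * (3000 * ?z ^ 21)"
      using t(2) a by (meson mult_le_mono order_trans)
    also have "\<dots> = ((C + 300) * 3000) * ?z ^ (39 * e + 21)" by (simp add: power_add mult_ac)
    finally have "t \<le> ((C + 300) * 3000) * ?z ^ (39 * e + 21)" .
    then show "\<exists>t M. runs (wrap c) (input_memory n k w) t M \<and> t \<le> (C + 300) * 3000 * ?z ^ (39 * e + 21) \<and>
       output_sets n M = alg n k w"
      using t(1) det[OF M'] by (intro exI[of _ t] exI[of _ M'] conjI) simp_all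
  qed
  moreover have "alg n k w = ({i. i < n \<and> ar (sem c (initial n k w)) 5 0 i \<noteq> 0}, {i. i < n \<and> ar (sem c (initial n k w)) 5 0 i \<noteq> 0})"
    if a: "1000 < n" "wgraph {..<n} (real_weights w)" for n k w
  proof -
    from run[OF a(2), of k] obtain M'
      where M': "runs_le (wrap c) (input_memory n k w) ((csteps (input_size n k w ^ 38) c + 300) * utime (?L (input_size n k w))) M'"
      and o: "1000 < n \<longrightarrow> output_sets n M' = ({i. i < n \<and> ar (sem c (initial n k w)) 5 0 i \<noteq> 0}, {i. i < n \<and> ar (sem c (initial n k w)) 5 0 i \<noteq> 0})"
      by (elim exE conjE) (rule that; assumption)
    show ?thesis using det[OF M'] o a(1) by simp
  qed
  ultimately show ?thesis by (intro exI[of _ alg] conjI allI impI)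
qed

section \<open>The program and its correctness\<close>

definition unch :: "nat set \<Rightarrow> nat set \<Rightarrow> state \<Rightarrow> state \<Rightarrow> bool" where
  "unch V As s s' \<longleftrightarrow> (\<forall>x. x \<notin> V \<longrightarrow> vr s' x = vr s x) \<and> (\<forall>a. a \<notin> As \<longrightarrow> ar s' a = ar s a) \<and> io s' = io s"

lemma unch_refl [simp]: "unch V As s s"
  by (simp add: unch_def)

lemma unch_trans: "unch V As s s' \<Longrightarrow> unch V As s' s'' \<Longrightarrow> unch V As s s''"
  by (simp add: unch_def)

lemma unch_mono: "unch V As s s' \<Longrightarrow> V \<subseteq> V' \<Longrightarrow> As \<subseteq> As' \<Longrightarrow> unch V' As' s s'"
  unfolding unch_def by blast

lemma unch_vr: "unch V As s s' \<Longrightarrow> x \<notin> V \<Longrightarrow> vr s' x = vr s x"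
  by (simp add: unch_def)

lemma unch_ar: "unch V As s s' \<Longrightarrow> a \<notin> As \<Longrightarrow> ar s' a = ar s a"
  by (simp add: unch_def)

lemma unch_setv: "unch V As s s' \<Longrightarrow> x \<in> V \<Longrightarrow> unch V As s (setv x v s')"
  by (auto simp: unch_def)

lemma unch_seta: "unch V As s s' \<Longrightarrow> a \<in> As \<Longrightarrow> unch V As s (seta a i j v s')"
  by (auto simp: unch_def fun_eq_iff)

text \<open>The invariant speaks of the set \<open>P\<close> of indices already treated, so that
  sums and products over \<open>P\<close> can be tracked without mention of the downward
  order.\<close>

lemma loop_rule:
  assumes e: "eok e s" "eval e s = m" "m \<le> K" "m \<le> Q" and init: "Inv {} s"
    and step: "\<And>i P s'. i < m \<Longrightarrow> i \<notin> P \<Longrightarrow> P \<subseteq> {..<m} \<Longrightarrow> Inv P s' \<Longrightarrow>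
      ok Q K c (setv x i s') \<and> Inv (insert i P) (sem c (setv x i s'))"
    and fin: "\<And>s'. Inv {..<m} s' \<Longrightarrow> R (setv x 0 s')"
  shows "ok Q K (Loop x e c) s \<and> R (sem (Loop x e c) s)"
proof -
  let ?f = "\<lambda>i s. sem c (setv x i s)" and ?g = "\<lambda>i s. ok Q K c (setv x i s)"
  have main: "dall ?g ?f j s' \<and> Inv {..<m} (dloop ?f j s')" if "j \<le> m" "Inv {j..<m} s'" for j s'
    using that
  proof (induction j arbitrary: s')
    case 0
    then show ?case by (simp add: lessThan_atLeast0)
  next
    case (Suc j)
    have "insert j {Suc j..<m} = {j..<m}" using Suc.prems by auto
    then have st: "ok Q K c (setv x j s')" "Inv {j..<m} (?f j s')"
      using step[of j "{Suc j..<m}" s'] Suc.prems lessThan_atLeast0[of m] by (auto simp: ivl_subset)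
    then show ?case using Suc.IH[OF _ st(2)] Suc.prems by simp
  qed
  have "dall ?g ?f m s \<and> Inv {..<m} (dloop ?f m s)" using main[of m s] init by simp
  then show ?thesis using e fin by simp
qed

declare sem.simps(6) [simp del] ok.simps(6) [simp del] One_nat_def [simp del]

abbreviation "Pl \<equiv> Op Plus"
abbreviation "Mi \<equiv> Op Minus"
abbreviation "Ti \<equiv> Op Times"
abbreviation "Qu \<equiv> Op Quot"

abbreviation fij :: "com \<Rightarrow> com" where
  "fij c \<equiv> Loop 13 (Var 0) (Loop 14 (Var 0) c)"

locale dims =
  fixes n Q K :: nat
  assumes n0: "0 < n" and nK: "n \<le> K" and nQ: "n \<le> Q"
begin

lemma fi_rule:
  assumes n: "vr s 0 = n" and init: "Inv {} s"
    and ins: "\<And>P s' i. Inv P s' \<Longrightarrow> Inv P (setv x i s')"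
    and step: "\<And>i P s'. \<lbrakk>i < n; i \<notin> P; P \<subseteq> {..<n}; Inv P s'; vr s' x = i\<rbrakk> \<Longrightarrow>
        ok Q K c s' \<and> Inv (insert i P) (sem c s')"
  shows "ok Q K (Loop x (Var 0) c) s \<and> Inv {..<n} (sem (Loop x (Var 0) c) s)"
  by (rule loop_rule[where m = n and Inv = Inv]) (use assms nK nQ in \<open>auto\<close>)

lemma fij_rule:
  assumes n: "vr s 0 = n" and init: "Inv {} s"
    and keep: "\<And>P s'. Inv P s' \<Longrightarrow> vr s' 0 = n"
    and ins: "\<And>P s' i. Inv P s' \<Longrightarrow> Inv P (setv 13 i s')" "\<And>P s' i. Inv P s' \<Longrightarrow> Inv P (setv 14 i s')"
    and w: "13 \<notin> writes c"
    and step: "\<And>i j P s'. \<lbrakk>i < n; j < n; (i, j) \<notin> P; P \<subseteq> {..<n} \<times> {..<n}; Inv P s'; vr s' 13 = i; vr s' 14 = j\<rbrakk> \<Longrightarrow>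
        ok Q K c s' \<and> Inv (insert (i, j) P) (sem c s')"
  shows "ok Q K (fij c) s \<and> Inv ({..<n} \<times> {..<n}) (sem (fij c) s)"
proof (rule fi_rule[where Inv = "\<lambda>P. Inv (P \<times> {..<n})"])
  show "Inv ({} \<times> {..<n}) s" using init by simp
next
  fix i P s' assume i: "i < n" "i \<notin> P" "P \<subseteq> {..<n}" "Inv (P \<times> {..<n}) s'" "vr s' 13 = i"
  have "ok Q K (Loop 14 (Var 0) c) s' \<and>
    (Inv (P \<times> {..<n} \<union> {i} \<times> {..<n}) (sem (Loop 14 (Var 0) c) s') \<and> vr (sem (Loop 14 (Var 0) c) s') 13 = i)"
  proof (rule fi_rule[where Inv = "\<lambda>P' s''. Inv (P \<times> {..<n} \<union> {i} \<times> P') s'' \<and> vr s'' 13 = i"])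
    fix j P' s''
    assume j: "j < n" "j \<notin> P'" "P' \<subseteq> {..<n}" "Inv (P \<times> {..<n} \<union> {i} \<times> P') s'' \<and> vr s'' 13 = i" "vr s'' 14 = j"
    have eq: "insert (i, j) (P \<times> {..<n} \<union> {i} \<times> P') = P \<times> {..<n} \<union> {i} \<times> insert j P'" by auto
    have "ok Q K c s'' \<and> Inv (insert (i, j) (P \<times> {..<n} \<union> {i} \<times> P')) (sem c s'')"
      using i j by (intro step) auto
    moreover have "vr (sem c s'') 13 = vr s'' 13"
      by (rule sem_unwritten[OF w])
    ultimately show "ok Q K c s'' \<and> Inv (P \<times> {..<n} \<union> {i} \<times> insert j P') (sem c s'') \<and> vr (sem c s'') 13 = i"
      using j unfolding eq by simp
  qed (use i keep ins in auto)
  moreover have "P \<times> {..<n} \<union> {i} \<times> {..<n} = insert i P \<times> {..<n}" by auto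
  ultimately show "ok Q K (Loop 14 (Var 0) c) s' \<and> Inv (insert i P \<times> {..<n}) (sem (Loop 14 (Var 0) c) s')" by simp
qed (use assms in auto)

text \<open>The bound on the whole sum yields \<open>vr s' acc + h i \<le> Q\<close> in every round,
  because partial sums of naturals do not exceed it; this is what rules out overflow in the
  body.\<close>

lemma acc_fi:
  assumes n: "vr s 0 = n" and V: "x \<in> V" "acc \<in> V" "0 \<notin> V" "acc \<noteq> x"
    and step: "\<And>i s'. \<lbrakk>i < n; unch V {} s s'; vr s' x = i; vr s' acc + h i \<le> Q\<rbrakk> \<Longrightarrow>
      ok Q K c s' \<and> unch V {} s' (sem c s') \<and> vr (sem c s') acc = vr s' acc + h i"
    and bnd: "vr s acc + (\<Sum>i<n. h i) \<le> Q"
  shows "ok Q K (Loop x (Var 0) c) s \<and> unch V {} s (sem (Loop x (Var 0) c) s) \<and>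
    vr (sem (Loop x (Var 0) c) s) acc = vr s acc + (\<Sum>i<n. h i)"
proof (rule fi_rule[where Inv = "\<lambda>P s'. unch V {} s s' \<and> vr s' acc = vr s acc + (\<Sum>i\<in>P. h i)"])
  fix i P s' assume a: "i < n" "i \<notin> P" "P \<subseteq> {..<n}" "unch V {} s s' \<and> vr s' acc = vr s acc + (\<Sum>i\<in>P. h i)" "vr s' x = i"
  have fin: "finite P" using a(3) finite_subset by blast
  have "(\<Sum>i\<in>insert i P. h i) \<le> (\<Sum>i<n. h i)" using a by (intro sum_mono2) auto
  then have "vr s' acc + h i \<le> Q" using a bnd fin by simp
  then have st: "ok Q K c s'" "unch V {} s' (sem c s')" "vr (sem c s') acc = vr s' acc + h i"
    using step[of i s'] a by auto
  show "ok Q K c s' \<and> unch V {} s (sem c s') \<and> vr (sem c s') acc = vr s acc + (\<Sum>i\<in>insert i P. h i)"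
    using st a fin unch_trans[of V "{}" s s' "sem c s'"] by simp
qed (use n V in \<open>auto intro: unch_setv\<close>)

lemma acc_fij:
  assumes n: "vr s 0 = n" and V: "13 \<in> V" "14 \<in> V" "acc \<in> V" "0 \<notin> V" "acc \<noteq> 13" "acc \<noteq> 14" and w: "13 \<notin> writes c"
    and step: "\<And>i j s'. \<lbrakk>i < n; j < n; unch V {} s s'; vr s' 13 = i; vr s' 14 = j; vr s' acc + h i j \<le> Q\<rbrakk> \<Longrightarrow>
      ok Q K c s' \<and> unch V {} s' (sem c s') \<and> vr (sem c s') acc = vr s' acc + h i j"
    and bnd: "vr s acc + (\<Sum>i<n. \<Sum>j<n. h i j) \<le> Q"
  shows "ok Q K (fij c) s \<and> unch V {} s (sem (fij c) s) \<and>
    vr (sem (fij c) s) acc = vr s acc + (\<Sum>i<n. \<Sum>j<n. h i j)"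
proof -
  let ?h = "\<lambda>(i, j). h i j"
  have tot: "(\<Sum>i<n. \<Sum>j<n. h i j) = sum ?h ({..<n} \<times> {..<n})" by (simp add: sum.cartesian_product)
  have "ok Q K (fij c) s \<and> (unch V {} s (sem (fij c) s) \<and> vr (sem (fij c) s) acc = vr s acc + sum ?h ({..<n} \<times> {..<n}))"
  proof (rule fij_rule[where Inv = "\<lambda>P s'. unch V {} s s' \<and> vr s' acc = vr s acc + sum ?h P"])
    fix i j P s'
    assume a: "i < n" "j < n" "(i, j) \<notin> P" "P \<subseteq> {..<n} \<times> {..<n}" "unch V {} s s' \<and> vr s' acc = vr s acc + sum ?h P"
      "vr s' 13 = i" "vr s' 14 = j"
    have fin: "finite P" using a(4) by (rule finite_subset) simp
    have "sum ?h (insert (i, j) P) \<le> sum ?h ({..<n} \<times> {..<n})" using a by (intro sum_mono2) auto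
    then have "vr s' acc + h i j \<le> Q" using a bnd fin unfolding tot by simp
    then have st: "ok Q K c s'" "unch V {} s' (sem c s')" "vr (sem c s') acc = vr s' acc + h i j"
      using step[of i j s'] a by auto
    show "ok Q K c s' \<and> unch V {} s (sem c s') \<and> vr (sem c s') acc = vr s acc + sum ?h (insert (i, j) P)"
      using st a fin unch_trans[of V "{}" s s' "sem c s'"] by simp
  next
    show "vr s' 0 = n" if "unch V {} s s' \<and> vr s' acc = vr s acc + sum ?h P" for P s'
      using that V n unch_vr by metis
  qed (use n V w in \<open>auto intro: unch_setv\<close>)
  then show ?thesis unfolding tot .
qed

text \<open>Each entry is visited once, so at its turn it still has the old value; this allows
  updates in place. Entries outside the \<open>n\<close> by \<open>n\<close> block are never
  touched, which is used to copy from the rows behind the block.\<close>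

lemma map_fij:
  assumes n: "vr s 0 = n"
    and step: "\<And>i j s'. \<lbrakk>i < n; j < n; unch {13, 14} {a} s s'; vr s' 13 = i; vr s' 14 = j; ar s' a i j = ar s a i j;
        \<And>i' j'. \<not> (i' < n \<and> j' < n) \<Longrightarrow> ar s' a i' j' = ar s a i' j'\<rbrakk> \<Longrightarrow>
      eok f s' \<and> eval f s' = h i j \<and> h i j \<le> Q"
  shows "ok Q K (fij (Put a (Var 13) (Var 14) f)) s \<and> unch {13, 14} {a} s (sem (fij (Put a (Var 13) (Var 14) f)) s) \<and>
    ar (sem (fij (Put a (Var 13) (Var 14) f)) s) a = (\<lambda>i j. if i < n \<and> j < n then h i j else ar s a i j)"
proof -
  let ?c = "Put a (Var 13) (Var 14) f"
  have "ok Q K (fij ?c) s \<and> (unch {13, 14} {a} s (sem (fij ?c) s) \<and>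
    ar (sem (fij ?c) s) a = (\<lambda>i j. if (i, j) \<in> {..<n} \<times> {..<n} then h i j else ar s a i j))"
  proof (rule fij_rule[where Inv = "\<lambda>P s'. unch {13, 14} {a} s s' \<and> ar s' a = (\<lambda>i j. if (i, j) \<in> P then h i j else ar s a i j)"])
    fix i j P s'
    assume A: "i < n" "j < n" "(i, j) \<notin> P" "P \<subseteq> {..<n} \<times> {..<n}"
      "unch {13, 14} {a} s s' \<and> ar s' a = (\<lambda>i j. if (i, j) \<in> P then h i j else ar s a i j)"
      "vr s' 13 = i" "vr s' 14 = j"
    have st: "eok f s'" "eval f s' = h i j" "h i j \<le> Q" using step[of i j s'] A by force+
    have v0: "vr s' 0 = n" using A n unch_vr[of "{13, 14}" "{a}" s s' 0] by simp
    have "unch {13, 14} {a} s (sem ?c s')" using A by (auto intro: unch_seta)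
    then show "ok Q K ?c s' \<and> unch {13, 14} {a} s (sem ?c s') \<and>
       ar (sem ?c s') a = (\<lambda>i' j'. if (i', j') \<in> insert (i, j) P then h i' j' else ar s a i' j')"
      using st A v0 by (auto simp: fun_eq_iff)
  next
    show "vr s' 0 = n" if "unch {13, 14} {a} s s' \<and> ar s' a = (\<lambda>i j. if (i, j) \<in> P then h i j else ar s a i j)" for P s'
      using that n unch_vr[of "{13, 14}" "{a}" s s' 0] by simp
  qed (use n in \<open>auto intro: unch_setv\<close>)
  then show ?thesis by simp
qed

lemma sum_fij:
  assumes n: "vr s 0 = n" and acc: "acc \<noteq> 0" "acc \<noteq> 13" "acc \<noteq> 14"
    and f: "\<And>i j s'. \<lbrakk>i < n; j < n; unch {13, 14, acc} {} s s'; vr s' 13 = i; vr s' 14 = j\<rbrakk> \<Longrightarrow> eok f s' \<and> eval f s' = h i j"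
    and bnd: "(\<Sum>i<n. \<Sum>j<n. h i j) \<le> Q"
  shows "ok Q K (Asg acc (Num 0) ;; fij (Asg acc (Pl (Var acc) f))) s \<and>
    unch {13, 14, acc} {} s (sem (Asg acc (Num 0) ;; fij (Asg acc (Pl (Var acc) f))) s) \<and>
    vr (sem (Asg acc (Num 0) ;; fij (Asg acc (Pl (Var acc) f))) s) acc = (\<Sum>i<n. \<Sum>j<n. h i j)"
proof -
  let ?s = "setv acc 0 s" and ?c = "Asg acc (Pl (Var acc) f)"
  have u: "unch {13, 14, acc} {} s ?s" by (rule unch_setv) simp_all
  have m: "ok Q K (fij ?c) ?s \<and> unch {13, 14, acc} {} ?s (sem (fij ?c) ?s) \<and>
     vr (sem (fij ?c) ?s) acc = vr ?s acc + (\<Sum>i<n. \<Sum>j<n. h i j)"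
  proof (rule acc_fij)
    fix i j s' assume a: "i < n" "j < n" "unch {13, 14, acc} {} ?s s'" "vr s' 13 = i" "vr s' 14 = j" "vr s' acc + h i j \<le> Q"
    have "eok f s' \<and> eval f s' = h i j" using f[OF a(1,2) unch_trans[OF u a(3)] a(4,5)] .
    then show "ok Q K ?c s' \<and> unch {13, 14, acc} {} s' (sem ?c s') \<and> vr (sem ?c s') acc = vr s' acc + h i j"
      using a(6) by (auto intro: unch_setv)
  qed (use n acc bnd in auto)
  have "sem (Asg acc (Num 0) ;; fij ?c) s = sem (fij ?c) ?s" by simp
  moreover have "ok Q K (Asg acc (Num 0) ;; fij ?c) s" using m by simp
  ultimately show ?thesis using m unch_trans[OF u conjunct1[OF conjunct2[OF m]]] by simp
qed

lemma sum_fi: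
  assumes n: "vr s 0 = n" and acc: "acc \<noteq> 0" "acc \<noteq> 13"
    and f: "\<And>i s'. \<lbrakk>i < n; unch {13, acc} {} s s'; vr s' 13 = i\<rbrakk> \<Longrightarrow> eok f s' \<and> eval f s' = h i"
    and bnd: "(\<Sum>i<n. h i) \<le> Q"
  shows "ok Q K (Asg acc (Num 0) ;; Loop 13 (Var 0) (Asg acc (Pl (Var acc) f))) s \<and>
    unch {13, acc} {} s (sem (Asg acc (Num 0) ;; Loop 13 (Var 0) (Asg acc (Pl (Var acc) f))) s) \<and>
    vr (sem (Asg acc (Num 0) ;; Loop 13 (Var 0) (Asg acc (Pl (Var acc) f))) s) acc = (\<Sum>i<n. h i)"
proof -
  let ?s = "setv acc 0 s" and ?c = "Asg acc (Pl (Var acc) f)"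
  have u: "unch {13, acc} {} s ?s" by (rule unch_setv) simp_all
  have m: "ok Q K (Loop 13 (Var 0) ?c) ?s \<and> unch {13, acc} {} ?s (sem (Loop 13 (Var 0) ?c) ?s) \<and>
     vr (sem (Loop 13 (Var 0) ?c) ?s) acc = vr ?s acc + (\<Sum>i<n. h i)"
  proof (rule acc_fi)
    fix i s' assume a: "i < n" "unch {13, acc} {} ?s s'" "vr s' 13 = i" "vr s' acc + h i \<le> Q"
    have "eok f s' \<and> eval f s' = h i" using f[OF a(1) unch_trans[OF u a(2)] a(3)] .
    then show "ok Q K ?c s' \<and> unch {13, acc} {} s' (sem ?c s') \<and> vr (sem ?c s') acc = vr s' acc + h i"
      using a(4) by (auto intro: unch_setv)
  qed (use n acc bnd in auto)
  have "sem (Asg acc (Num 0) ;; Loop 13 (Var 0) ?c) s = sem (Loop 13 (Var 0) ?c) ?s" by simp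
  moreover have "ok Q K (Asg acc (Num 0) ;; Loop 13 (Var 0) ?c) s" using m by simp
  ultimately show ?thesis using m unch_trans[OF u conjunct1[OF conjunct2[OF m]]] by simp
qed

text \<open>The shape shared by the tests of the iteration. \<open>nop\<close> is a self-assignment
  and as such demands that its variable be at most \<open>Q\<close>, whence the condition on
  variable 16.\<close>

lemma cond_map:
  assumes n: "vr s 0 = n" and e: "eok e s" "(eval e s \<noteq> 0) = p" and v: "vr s 16 \<le> Q"
    and step: "\<And>i j s'. \<lbrakk>i < n; j < n; unch {13, 14} {2} s s'; vr s' 13 = i; vr s' 14 = j; ar s' 2 i j = ar s 2 i j\<rbrakk> \<Longrightarrow>
      eok f s' \<and> eval f s' = h i j \<and> h i j \<le> Q"
  shows "ok Q K (Cond e (fij (Put 2 (Var 13) (Var 14) f)) (Asg 16 (Var 16))) s \<and>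
    unch {13, 14, 16} {2} s (sem (Cond e (fij (Put 2 (Var 13) (Var 14) f)) (Asg 16 (Var 16))) s) \<and>
    ar (sem (Cond e (fij (Put 2 (Var 13) (Var 14) f)) (Asg 16 (Var 16))) s) 2 =
      (if p then (\<lambda>i j. if i < n \<and> j < n then h i j else ar s 2 i j) else ar s 2)"
proof (cases p)
  case True
  have m: "ok Q K (fij (Put 2 (Var 13) (Var 14) f)) s \<and> unch {13, 14} {2} s (sem (fij (Put 2 (Var 13) (Var 14) f)) s) \<and>
    ar (sem (fij (Put 2 (Var 13) (Var 14) f)) s) 2 = (\<lambda>i j. if i < n \<and> j < n then h i j else ar s 2 i j)"
    by (rule map_fij[OF n]) (rule step)
  have "unch {13, 14, 16} {2} s (sem (fij (Put 2 (Var 13) (Var 14) f)) s)"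
    by (rule unch_mono[OF conjunct1[OF conjunct2[OF m]]]) auto
  then show ?thesis using m True e by simp
next
  case False
  then show ?thesis using e v by (auto intro: unch_setv)
qed

end

section \<open>Selecting k vertices and keeping the best selection\<close>

definition heavy :: "nat \<Rightarrow> (nat \<Rightarrow> nat \<Rightarrow> nat) \<Rightarrow> nat \<Rightarrow> bool" where
  "heavy N X i \<longleftrightarrow> 2 * N \<le> 3 * X i i"

text \<open>A lexicographic order in one number: light vertices score below \<open>n\<close>, heavy
  ones at least \<open>n\<close> and by their degree into the heavy set, and the index breaks
  ties.\<close>

definition score :: "nat \<Rightarrow> nat \<Rightarrow> (nat \<Rightarrow> nat \<Rightarrow> nat) \<Rightarrow> (nat \<Rightarrow> nat \<Rightarrow> nat) \<Rightarrow> nat \<Rightarrow> nat" where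
  "score n N W X i = (if heavy N X i then 1 + (\<Sum>j<n. if heavy N X j then W i j else 0) else 0) * n + i"

text \<open>Nonzero exactly for the \<open>k\<close> vertices of highest score; the scores are distinct.\<close>

definition topk :: "nat \<Rightarrow> nat \<Rightarrow> (nat \<Rightarrow> nat) \<Rightarrow> nat \<Rightarrow> nat" where
  "topk n k f i = k - card {j. j < n \<and> f i < f j}"

text \<open>The summand 1 keeps the value positive, so that 0 can mean that no selection has been
  stored yet. Each edge counts twice.\<close>

definition weight_of :: "nat \<Rightarrow> (nat \<Rightarrow> nat \<Rightarrow> nat) \<Rightarrow> (nat \<Rightarrow> nat) \<Rightarrow> nat" where
  "weight_of n W f = 1 + (\<Sum>i<n. \<Sum>j<n. if f i \<noteq> 0 \<and> f j \<noteq> 0 then W i j else 0)"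

abbreviation "nop \<equiv> Asg 16 (Var 16)"

text \<open>Truncated subtraction as a comparison: \<open>a + 1 - b\<close> is nonzero iff
  \<open>b \<le> a\<close>.\<close>

abbreviation heavy_exp :: "nat \<Rightarrow> aexp" where
  "heavy_exp x \<equiv> Mi (Pl (Ti (Num 3) (Get 2 (Var x) (Var x))) (Num 1)) (Ti (Num 2) (Var 3))"

text \<open>Array 1 holds the integer weights and array 2 the current matrix; rows 0 and 1 of array
  3 hold scores and selection, row 0 of array 5 the best selection so far and variable 10 its
  weight.\<close>

definition score_body :: com where
  "score_body = Asg 16 (Num 0) ;; Cond (heavy_exp 13)
      (Asg 16 (Num 1) ;; Loop 14 (Var 0) (Cond (heavy_exp 14) (Asg 16 (Pl (Var 16) (Get 1 (Var 13) (Var 14)))) nop)) nop ;;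
    Put 3 (Num 0) (Var 13) (Pl (Ti (Var 16) (Var 0)) (Var 13))"

definition rank_body :: com where
  "rank_body = Asg 16 (Num 0) ;;
    Loop 14 (Var 0) (Cond (Mi (Get 3 (Num 0) (Var 14)) (Get 3 (Num 0) (Var 13))) (Asg 16 (Pl (Var 16) (Num 1))) nop) ;;
    Put 3 (Num 1) (Var 13) (Mi (Var 1) (Var 16))"

definition value_body :: com where
  "value_body = Cond (Get 3 (Num 1) (Var 13)) (Cond (Get 3 (Num 1) (Var 14)) (Asg 16 (Pl (Var 16) (Get 1 (Var 13) (Var 14)))) nop) nop"

definition rounding :: com where
  "rounding = Loop 13 (Var 0) score_body ;; Loop 13 (Var 0) rank_body ;;
    Asg 16 (Num 1) ;; fij value_body ;;
    Cond (Mi (Var 16) (Var 10))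
      (Asg 10 (Var 16) ;; Loop 13 (Var 0) (Put 5 (Num 0) (Var 13) (Get 3 (Num 1) (Var 13)))) nop"

text \<open>\<open>wb\<close> bounds the integer weights; \<open>q1\<close> then makes room for the
  scores, \<open>q2\<close> for the weight of a selection.\<close>

locale params = dims n Q K for n Q K +
  fixes k N KK E S T II wb :: nat and W :: "nat \<Rightarrow> nat \<Rightarrow> nat"
  assumes Wb: "\<And>i j. i < n \<Longrightarrow> j < n \<Longrightarrow> W i j \<le> wb"
    and q1: "(1 + n * wb) * n + n \<le> Q" and q2: "1 + n * n * wb \<le> Q" and q3: "k \<le> Q"
begin

definition env :: "state \<Rightarrow> bool" where
  "env s \<longleftrightarrow> vr s 0 = n \<and> vr s 1 = k \<and> vr s 3 = N \<and> vr s 4 = KK \<and> vr s 5 = E \<and> vr s 6 = S \<and> vr s 7 = T \<and>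
     vr s 8 = II \<and> (\<forall>i<n. \<forall>j<n. ar s 1 i j = W i j)"

lemma env_unch: "env s \<Longrightarrow> unch V As s s' \<Longrightarrow> V \<inter> {0, 1, 3, 4, 5, 6, 7, 8} = {} \<Longrightarrow> 1 \<notin> As \<Longrightarrow> env s'"
  unfolding env_def unch_def by auto

lemma sum_W_le: "i < n \<Longrightarrow> (\<Sum>j<n. if P j then W i j else 0) \<le> n * wb"
proof -
  assume i: "i < n"
  have "(\<Sum>j<n. if P j then W i j else 0) \<le> (\<Sum>j<n. wb)" using Wb i by (intro sum_mono) auto
  then show ?thesis by simp
qed

lemma score_body_ok:
  assumes c: "env s" and i: "i < n" "vr s 13 = i"
  shows "ok Q K score_body s \<and> unch {14, 16} {3} s (sem score_body s) \<and>
    ar (sem score_body s) 3 = (\<lambda>a b. if a = 0 \<and> b = i then score n N W (ar s 2) i else ar s 3 a b)"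
proof -
  let ?s1 = "setv 16 0 s"
  let ?L = "Loop 14 (Var 0) (Cond (heavy_exp 14) (Asg 16 (Pl (Var 16) (Get 1 (Var 13) (Var 14)))) nop)"
  let ?C = "Cond (heavy_exp 13) (Asg 16 (Num 1) ;; ?L) nop"
  let ?d = "if heavy N (ar s 2) i then 1 + (\<Sum>j<n. if heavy N (ar s 2) j then W i j else 0) else 0"
  have v: "vr s 0 = n" "vr s 3 = N" using c by (auto simp: env_def)
  have dQ: "?d \<le> 1 + n * wb" using sum_W_le[OF i(1)] by auto
  have nQ': "1 + n * wb \<le> (1 + n * wb) * n" using n0 mult_le_mono2[of 1 n "1 + n * wb"] by simp
  have C: "ok Q K ?C ?s1 \<and> unch {14, 16} {} ?s1 (sem ?C ?s1) \<and> vr (sem ?C ?s1) 16 = ?d"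
  proof (cases "heavy N (ar s 2) i")
    case True
    let ?s2 = "setv 16 1 ?s1"
    have "ok Q K ?L ?s2 \<and> unch {14, 16} {} ?s2 (sem ?L ?s2) \<and>
        vr (sem ?L ?s2) 16 = vr ?s2 16 + (\<Sum>j<n. if heavy N (ar s 2) j then W i j else 0)"
    proof (rule acc_fi)
      fix j s' assume a: "j < n" "unch {14, 16} {} ?s2 s'" "vr s' 14 = j"
        "vr s' 16 + (if heavy N (ar s 2) j then W i j else 0) \<le> Q"
      have u: "vr s' 0 = n" "vr s' 3 = N" "vr s' 13 = i" "ar s' 2 = ar s 2" "ar s' 1 i j = W i j"
        using unch_vr[OF a(2)] unch_ar[OF a(2)] v i c a(1) by (auto simp: env_def)
      show "ok Q K (Cond (heavy_exp 14) (Asg 16 (Pl (Var 16) (Get 1 (Var 13) (Var 14)))) nop) s' \<and>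
         unch {14, 16} {} s' (sem (Cond (heavy_exp 14) (Asg 16 (Pl (Var 16) (Get 1 (Var 13) (Var 14)))) nop) s') \<and>
         vr (sem (Cond (heavy_exp 14) (Asg 16 (Pl (Var 16) (Get 1 (Var 13) (Var 14)))) nop) s') 16 =
         vr s' 16 + (if heavy N (ar s 2) j then W i j else 0)"
        using u a by (auto simp: heavy_def intro: unch_setv)
    next
      show "vr ?s2 16 + (\<Sum>j<n. if heavy N (ar s 2) j then W i j else 0) \<le> Q"
        using sum_W_le[OF i(1), of "heavy N (ar s 2)"] q1 nQ' unfolding set_simps fun_upd_same by linarith
    qed (use v in auto)
    moreover have "1 \<le> Q" using q1 nQ' by linarith
    moreover have "unch {14, 16} {} ?s1 ?s2" by (rule unch_setv) simp_all
    ultimately show ?thesis using True v i unch_trans[of "{14, 16}" "{}" ?s1 ?s2 "sem ?L ?s2"] by (auto simp: heavy_def)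
  next
    case False
    then show ?thesis using v i by (auto simp: heavy_def intro: unch_setv)
  qed
  define C' where "C' = ?C"
  define s3 where "s3 = sem C' ?s1"
  have C1: "ok Q K C' ?s1" and C2: "unch {14, 16} {} ?s1 s3" and C3: "vr s3 16 = ?d"
    using C unfolding C'_def[symmetric] s3_def[symmetric] by simp_all
  have u1: "unch {14, 16} {3} s ?s1" by (auto intro: unch_setv)
  have "unch {14, 16} {3} ?s1 s3" using C2 by (auto intro: unch_mono)
  then have u3: "unch {14, 16} {3} s s3" using u1 by (rule unch_trans[rotated])
  have a3: "ar s3 3 = ar s 3" using unch_ar[OF C2, of 3] by simp
  have v3: "vr s3 0 = n" "vr s3 13 = i"
    using unch_vr[OF u3] v i by auto
  have "?d * n + i \<le> (1 + n * wb) * n + n" using dQ i by (intro add_mono mult_right_mono) auto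
  then have dn: "score n N W (ar s 2) i \<le> Q" using q1 unfolding score_def by linarith
  have ev: "vr s3 16 * n + i = score n N W (ar s 2) i" unfolding C3 score_def by simp
  have sb: "score_body = Asg 16 (Num 0) ;; C' ;; Put 3 (Num 0) (Var 13) (Pl (Ti (Var 16) (Var 0)) (Var 13))"
    by (simp add: score_body_def C'_def)
  have "sem score_body s = seta 3 0 i (score n N W (ar s 2) i) s3"
    unfolding sb using v3 ev by (simp add: s3_def[symmetric])
  moreover have "ok Q K score_body s" unfolding sb
    using C1 v3 ev dn i by (simp add: s3_def[symmetric])
  moreover have "unch {14, 16} {3} s (seta 3 0 i (score n N W (ar s 2) i) s3)" using u3 by (rule unch_seta) simp
  ultimately show ?thesis using a3 by (simp add: fun_eq_iff)
qed

lemma rank_body_ok: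
  assumes c: "env s" and i: "i < n" "vr s 13 = i"
  shows "ok Q K rank_body s \<and> unch {14, 16} {3} s (sem rank_body s) \<and>
    ar (sem rank_body s) 3 = (\<lambda>a b. if a = 1 \<and> b = i then topk n k (ar s 3 0) i else ar s 3 a b)"
proof -
  let ?s1 = "setv 16 0 s"
  let ?b = "Cond (Mi (Get 3 (Num 0) (Var 14)) (Get 3 (Num 0) (Var 13))) (Asg 16 (Pl (Var 16) (Num 1))) nop"
  let ?L = "Loop 14 (Var 0) ?b"
  let ?d = "\<Sum>j<n. if ar s 3 0 i < ar s 3 0 j then 1 else 0 :: nat"
  have v: "vr s 0 = n" "vr s 1 = k" using c by (auto simp: env_def)
  have d: "?d = card {j. j < n \<and> ar s 3 0 i < ar s 3 0 j}"
    by (simp add: sum.If_cases Int_def)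
  have dn: "?d \<le> n" using sum_mono[of "{..<n}" "\<lambda>j. if ar s 3 0 i < ar s 3 0 j then 1 else 0 :: nat" "\<lambda>_. 1"] by simp
  have L: "ok Q K ?L ?s1 \<and> unch {14, 16} {} ?s1 (sem ?L ?s1) \<and> vr (sem ?L ?s1) 16 = vr ?s1 16 + ?d"
  proof (rule acc_fi)
    fix j s' assume a: "j < n" "unch {14, 16} {} ?s1 s'" "vr s' 14 = j"
      "vr s' 16 + (if ar s 3 0 i < ar s 3 0 j then 1 else 0) \<le> Q"
    have u: "vr s' 0 = n" "vr s' 13 = i" "ar s' 3 = ar s 3"
      using unch_vr[OF a(2)] unch_ar[OF a(2)] v i by auto
    show "ok Q K ?b s' \<and> unch {14, 16} {} s' (sem ?b s') \<and>
       vr (sem ?b s') 16 = vr s' 16 + (if ar s 3 0 i < ar s 3 0 j then 1 else 0)"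
      using u a i by (auto intro: unch_setv)
  next
    show "vr ?s1 16 + ?d \<le> Q" using dn nQ by simp
  qed (use v in auto)
  define L' where "L' = ?L"
  define s3 where "s3 = sem L' ?s1"
  have L1: "ok Q K L' ?s1" and L2: "unch {14, 16} {} ?s1 s3" and L3: "vr s3 16 = ?d"
    using L unfolding L'_def[symmetric] s3_def[symmetric] by simp_all
  have u1: "unch {14, 16} {3} s ?s1" by (auto intro: unch_setv)
  have "unch {14, 16} {3} ?s1 s3" using L2 by (auto intro: unch_mono)
  then have u3: "unch {14, 16} {3} s s3" using u1 by (rule unch_trans[rotated])
  have a3: "ar s3 3 = ar s 3" using unch_ar[OF L2, of 3] by simp
  have v3: "vr s3 0 = n" "vr s3 13 = i" "vr s3 1 = k" using unch_vr[OF u3] v i by auto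
  have tp: "k - vr s3 16 = topk n k (ar s 3 0) i" unfolding L3 d topk_def by simp
  have rb: "rank_body = Asg 16 (Num 0) ;; L' ;; Put 3 (Num 1) (Var 13) (Mi (Var 1) (Var 16))"
    by (simp add: rank_body_def L'_def)
  have tq: "topk n k (ar s 3 0) i \<le> Q" using q3 by (simp add: topk_def)
  have "sem rank_body s = seta 3 1 i (topk n k (ar s 3 0) i) s3"
    unfolding rb using v3 tp by (simp add: s3_def[symmetric])
  moreover have "ok Q K rank_body s" unfolding rb
    using L1 v3 tp tq i by (simp add: s3_def[symmetric])
  moreover have "unch {14, 16} {3} s (seta 3 1 i (topk n k (ar s 3 0) i) s3)" using u3 by (rule unch_seta) simp
  ultimately show ?thesis using a3 by (simp add: fun_eq_iff)
qed

lemma rounding_ok: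
  assumes c: "env s"
  defines "f \<equiv> topk n k (score n N W (ar s 2))"
  shows "ok Q K rounding s \<and> unch {10, 13, 14, 16} {3, 5} s (sem rounding s) \<and>
    vr (sem rounding s) 10 = max (vr s 10) (weight_of n W f) \<and>
    (if vr s 10 < weight_of n W f then (\<forall>i<n. ar (sem rounding s) 5 0 i = f i)
     else ar (sem rounding s) 5 = ar s 5)"
proof -
  let ?V = "{10, 13, 14, 16} :: nat set"
  have v: "vr s 0 = n" using c by (auto simp: env_def)
  let ?L1 = "Loop 13 (Var 0) score_body" and ?L2 = "Loop 13 (Var 0) rank_body"
  have 1: "ok Q K ?L1 s \<and> (unch ?V {3, 5} s (sem ?L1 s) \<and> ar (sem ?L1 s) 5 = ar s 5 \<and> vr (sem ?L1 s) 10 = vr s 10 \<and>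
     (\<forall>i\<in>{..<n}. ar (sem ?L1 s) 3 0 i = score n N W (ar s 2) i))"
  proof (rule fi_rule[where Inv = "\<lambda>P s'. unch ?V {3, 5} s s' \<and> ar s' 5 = ar s 5 \<and> vr s' 10 = vr s 10 \<and>
      (\<forall>i\<in>P. ar s' 3 0 i = score n N W (ar s 2) i)"])
    fix i P s' assume a: "i < n" "unch ?V {3, 5} s s' \<and> ar s' 5 = ar s 5 \<and> vr s' 10 = vr s 10 \<and>
        (\<forall>i\<in>P. ar s' 3 0 i = score n N W (ar s 2) i)" "vr s' 13 = i"
    have c': "env s'" using a by (intro env_unch[OF c]) auto
    have X: "ar s' 2 = ar s 2" using a by (intro unch_ar[of ?V "{3, 5}"]) auto
    note b = score_body_ok[OF c' a(1,3)]
    have "unch ?V {3, 5} s' (sem score_body s')" using b by (auto intro: unch_mono)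
    then have "unch ?V {3, 5} s (sem score_body s')" using a unch_trans by blast
    moreover have "ar (sem score_body s') 5 = ar s' 5" "vr (sem score_body s') 10 = vr s' 10"
      using unch_ar[OF conjunct1[OF conjunct2[OF b]], of 5] unch_vr[OF conjunct1[OF conjunct2[OF b]], of 10] by simp_all
    ultimately show "ok Q K score_body s' \<and> unch ?V {3, 5} s (sem score_body s') \<and> ar (sem score_body s') 5 = ar s 5 \<and>
        vr (sem score_body s') 10 = vr s 10 \<and>
        (\<forall>i\<in>insert i P. ar (sem score_body s') 3 0 i = score n N W (ar s 2) i)"
      using b a X by simp
  qed (use v in \<open>auto intro: unch_setv\<close>)
  define s1 where "s1 = sem ?L1 s"
  have c1: "env s1" unfolding s1_def using 1 by (intro env_unch[OF c]) auto
  have top1: "topk n k (ar s1 3 0) i = f i" if "i < n" for i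
  proof -
    have "{j. j < n \<and> ar s1 3 0 i < ar s1 3 0 j} = {j. j < n \<and> score n N W (ar s 2) i < score n N W (ar s 2) j}"
      using 1 that unfolding s1_def by auto
    then show ?thesis unfolding f_def topk_def by simp
  qed
  have 2: "ok Q K ?L2 s1 \<and> (unch ?V {3, 5} s1 (sem ?L2 s1) \<and> ar (sem ?L2 s1) 5 = ar s1 5 \<and> vr (sem ?L2 s1) 10 = vr s1 10 \<and>
     ar (sem ?L2 s1) 3 0 = ar s1 3 0 \<and> (\<forall>i\<in>{..<n}. ar (sem ?L2 s1) 3 1 i = f i))"
  proof (rule fi_rule[where Inv = "\<lambda>P s'. unch ?V {3, 5} s1 s' \<and> ar s' 5 = ar s1 5 \<and> vr s' 10 = vr s1 10 \<and>
      ar s' 3 0 = ar s1 3 0 \<and> (\<forall>i\<in>P. ar s' 3 1 i = f i)"])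
    fix i P s' assume a: "i < n" "unch ?V {3, 5} s1 s' \<and> ar s' 5 = ar s1 5 \<and> vr s' 10 = vr s1 10 \<and>
        ar s' 3 0 = ar s1 3 0 \<and> (\<forall>i\<in>P. ar s' 3 1 i = f i)" "vr s' 13 = i"
    have c': "env s'" using a by (intro env_unch[OF c1]) auto
    note b = rank_body_ok[OF c' a(1,3)]
    have "unch ?V {3, 5} s' (sem rank_body s')" using b by (auto intro: unch_mono)
    then have "unch ?V {3, 5} s1 (sem rank_body s')" using a unch_trans by blast
    moreover have "ar (sem rank_body s') 5 = ar s' 5" "vr (sem rank_body s') 10 = vr s' 10"
      using unch_ar[OF conjunct1[OF conjunct2[OF b]], of 5] unch_vr[OF conjunct1[OF conjunct2[OF b]], of 10] by simp_all
    moreover have "ar (sem rank_body s') 3 0 = ar s' 3 0" using conjunct2[OF conjunct2[OF b]] by (simp add: fun_eq_iff)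
    ultimately show "ok Q K rank_body s' \<and> unch ?V {3, 5} s1 (sem rank_body s') \<and> ar (sem rank_body s') 5 = ar s1 5 \<and>
        vr (sem rank_body s') 10 = vr s1 10 \<and> ar (sem rank_body s') 3 0 = ar s1 3 0 \<and>
        (\<forall>i\<in>insert i P. ar (sem rank_body s') 3 1 i = f i)"
      using b a top1 by simp
  qed (use c1 in \<open>auto simp: env_def intro: unch_setv\<close>)
  define s2 where "s2 = sem ?L2 s1"
  have c2: "env s2" unfolding s2_def using 2 by (intro env_unch[OF c1]) auto
  have f2: "ar s2 3 1 i = f i" if "i < n" for i using 2 that unfolding s2_def by auto
  define s3 where "s3 = setv 16 1 s2"
  have c3: "env s3" "vr s3 0 = n" unfolding s3_def using c2 by (auto simp: env_def)
  let ?h = "\<lambda>i j. if f i \<noteq> 0 \<and> f j \<noteq> 0 then W i j else 0"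
  have hb: "1 + (\<Sum>i<n. \<Sum>j<n. ?h i j) \<le> Q"
  proof -
    have "(\<Sum>i<n. \<Sum>j<n. ?h i j) \<le> (\<Sum>i<n. n * wb)"
    proof (rule sum_mono)
      fix i assume "i \<in> {..<n}"
      then show "(\<Sum>j<n. ?h i j) \<le> n * wb" using sum_W_le[of i "\<lambda>j. f i \<noteq> 0 \<and> f j \<noteq> 0"] by simp
    qed
    then show ?thesis using q2 by simp
  qed
  have 3: "ok Q K (fij value_body) s3 \<and> unch {13, 14, 16} {} s3 (sem (fij value_body) s3) \<and>
     vr (sem (fij value_body) s3) 16 = vr s3 16 + (\<Sum>i<n. \<Sum>j<n. ?h i j)"
  proof (rule acc_fij)
    fix i j s' assume a: "i < n" "j < n" "unch {13, 14, 16} {} s3 s'" "vr s' 13 = i" "vr s' 14 = j" "vr s' 16 + ?h i j \<le> Q"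
    have u: "vr s' 0 = n" "ar s' 3 = ar s2 3" "ar s' 1 i j = W i j"
      using unch_vr[OF a(3)] unch_ar[OF a(3)] c3 a(1,2) by (auto simp: env_def s3_def)
    show "ok Q K value_body s' \<and> unch {13, 14, 16} {} s' (sem value_body s') \<and>
       vr (sem value_body s') 16 = vr s' 16 + ?h i j"
      using u a f2 by (auto simp: value_body_def intro: unch_setv)
  next
    show "vr s3 16 + (\<Sum>i<n. \<Sum>j<n. ?h i j) \<le> Q" using hb by (simp add: s3_def)
  qed (use c3 in \<open>auto simp: value_body_def\<close>)
  define s4 where "s4 = sem (fij value_body) s3"
  have v4: "vr s4 16 = weight_of n W f" using 3 unfolding s4_def weight_of_def by (simp add: s3_def)
  have u34: "unch ?V {3, 5} s3 s4" using 3 unfolding s4_def by (auto intro: unch_mono)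
  have u23: "unch ?V {3, 5} s2 s3" unfolding s3_def by (auto intro: unch_setv)
  have u4: "unch ?V {3, 5} s s4"
    using 1 2 u23 u34 unfolding s1_def[symmetric] s2_def[symmetric] by (meson unch_trans)
  have c4: "env s4" using u4 by (intro env_unch[OF c]) auto
  have a4: "ar s4 3 = ar s2 3" "ar s4 5 = ar s 5" "vr s4 10 = vr s 10"
  proof -
    have u: "unch {13, 14, 16} {} s3 s4" using 3 unfolding s4_def by simp
    show "ar s4 3 = ar s2 3" using unch_ar[OF u, of 3] by (simp add: s3_def)
    have "ar s2 5 = ar s 5" "vr s2 10 = vr s 10" using 1 2 unfolding s1_def[symmetric] s2_def[symmetric] by simp_all
    then show "ar s4 5 = ar s 5" "vr s4 10 = vr s 10"
      using unch_ar[OF u, of 5] unch_vr[OF u, of 10] by (simp_all add: s3_def)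
  qed
  let ?B = "Loop 13 (Var 0) (Put 5 (Num 0) (Var 13) (Get 3 (Num 1) (Var 13)))"
  let ?C = "Cond (Mi (Var 16) (Var 10)) (Asg 10 (Var 16) ;; ?B) nop"
  have C: "ok Q K ?C s4 \<and> unch ?V {3, 5} s4 (sem ?C s4) \<and> vr (sem ?C s4) 10 = max (vr s 10) (weight_of n W f) \<and>
    (if vr s 10 < weight_of n W f then (\<forall>i<n. ar (sem ?C s4) 5 0 i = f i) else ar (sem ?C s4) 5 = ar s 5)"
  proof (cases "vr s 10 < weight_of n W f")
    case True
    define s5 where "s5 = setv 10 (weight_of n W f) s4"
    have c5: "vr s5 0 = n" using c4 by (simp add: s5_def env_def)
    have B: "ok Q K ?B s5 \<and> (unch {13} {5} s5 (sem ?B s5) \<and> (\<forall>i\<in>{..<n}. ar (sem ?B s5) 5 0 i = f i))"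
    proof (rule fi_rule[where Inv = "\<lambda>P s'. unch {13} {5} s5 s' \<and> (\<forall>i\<in>P. ar s' 5 0 i = f i)"])
      fix i P s' assume a: "i < n" "i \<notin> P" "P \<subseteq> {..<n}" "unch {13} {5} s5 s' \<and> (\<forall>i\<in>P. ar s' 5 0 i = f i)" "vr s' 13 = i"
      have u: "vr s' 0 = n" "ar s' 3 = ar s2 3"
        using unch_vr[of "{13}" "{5}" s5 s' 0] unch_ar[of "{13}" "{5}" s5 s' 3] a c5 a4 by (auto simp: s5_def)
      have "f i \<le> Q" using q3 by (simp add: f_def topk_def)
      then show "ok Q K (Put 5 (Num 0) (Var 13) (Get 3 (Num 1) (Var 13))) s' \<and>
         unch {13} {5} s5 (sem (Put 5 (Num 0) (Var 13) (Get 3 (Num 1) (Var 13))) s') \<and>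
         (\<forall>i\<in>insert i P. ar (sem (Put 5 (Num 0) (Var 13) (Get 3 (Num 1) (Var 13))) s') 5 0 i = f i)"
        using u a f2 by (auto intro: unch_seta)
    qed (use c5 in \<open>auto intro: unch_setv\<close>)
    have w: "weight_of n W f \<le> Q" using hb by (simp add: weight_of_def)
    have u5: "unch ?V {3, 5} s4 s5" unfolding s5_def by (auto intro: unch_setv)
    have u6: "unch ?V {3, 5} s5 (sem ?B s5)" using B by (auto intro: unch_mono)
    have s6: "sem ?C s4 = sem ?B s5" using v4 a4 True unfolding s5_def by (simp only: sem.simps(1-5)) simp
    have "ok Q K ?C s4" using B v4 a4 True w unfolding s5_def by (simp only: ok.simps(1-5) sem.simps(1-5)) simp
    moreover have "unch ?V {3, 5} s4 (sem ?B s5)" using u5 u6 by (rule unch_trans)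
    moreover have "vr (sem ?B s5) 10 = weight_of n W f"
      using unch_vr[OF conjunct1[OF conjunct2[OF B]], of 10] by (simp add: s5_def)
    ultimately show ?thesis unfolding s6 using B True by simp
  next
    case False
    have w: "weight_of n W f \<le> Q" using hb by (simp add: weight_of_def)
    have "sem ?C s4 = setv 16 (weight_of n W f) s4" "ok Q K ?C s4" using False v4 a4 w by simp_all
    then show ?thesis using False a4 by (auto intro: unch_setv)
  qed
  have s3: "sem (Asg 16 (Num 1)) s2 = s3" by (simp add: s3_def)
  have s: "sem rounding s = sem ?C s4"
    unfolding rounding_def sem.simps(4) s1_def[symmetric] s2_def[symmetric] s3 s4_def[symmetric] ..
  have o: "ok Q K (Asg 16 (Num 1)) s2" using q2 by simp
  have okr: "ok Q K rounding s"
    unfolding rounding_def ok.simps(4) sem.simps(4) s1_def[symmetric] s2_def[symmetric] s3 s4_def[symmetric]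
    using conjunct1[OF 1] conjunct1[OF 2] o conjunct1[OF 3] conjunct1[OF C] by (intro conjI)
  show ?thesis unfolding s
    by (rule conjI[OF okr conjI[OF unch_trans[OF u4 C[THEN conjunct2, THEN conjunct1]] C[THEN conjunct2, THEN conjunct2]]])
qed

end

section \<open>Corrections of an integer matrix and the code for them\<close>

definition shrink_diag :: "nat \<Rightarrow> nat \<Rightarrow> nat \<Rightarrow> (nat \<Rightarrow> nat \<Rightarrow> nat) \<Rightarrow> nat \<Rightarrow> nat \<Rightarrow> nat" where
  "shrink_diag n k N X = (if k * N + n \<le> (\<Sum>i<n. X i i)
     then (\<lambda>i j. if i < n \<and> j < n then X i j - (if i = j then 1 else 0) else X i j) else X)"

text \<open>As in \<open>shrink_diag\<close>, the slack in the threshold is the squared length of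
  the step, so that a step that is taken surely reduces the distance to the planted matrix.\<close>

definition shrink_all :: "nat \<Rightarrow> nat \<Rightarrow> nat \<Rightarrow> (nat \<Rightarrow> nat \<Rightarrow> nat) \<Rightarrow> nat \<Rightarrow> nat \<Rightarrow> nat" where
  "shrink_all n k N X = (if k * k * N + n * n \<le> (\<Sum>i<n. \<Sum>j<n. X i j)
     then (\<lambda>i j. if i < n \<and> j < n then X i j - 1 else X i j) else X)"

text \<open>A step along the normal of the constraint \<open>X i j + X j i \<le> 2 * X i i\<close>,
  which keeps the matrix symmetric. The sweep of the program is described as a sequence of such
  steps in unspecified order.\<close>

definition estep :: "nat \<Rightarrow> (nat \<Rightarrow> nat \<Rightarrow> nat) \<Rightarrow> (nat \<Rightarrow> nat \<Rightarrow> nat) \<Rightarrow> bool" where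
  "estep n X Y \<longleftrightarrow> (\<exists>i j. i < n \<and> j < n \<and> X i i + 1 < X i j \<and>
     Y = (\<lambda>a b. if a = i \<and> b = i then X i i + 2
                else if a = i \<and> b = j \<or> a = j \<and> b = i then X a b - 1 else X a b))"

text \<open>A step of length at most \<open>KK\<close> along the direction \<open>P - R\<close>,
  whose norm is at most \<sigma> in every use, clipped to \<open>[0, N]\<close>: the inner truncated
  subtraction cuts at 0, and \<open>N - (N - v)\<close> is the minimum of \<open>N\<close> and
  \<open>v\<close>. Positive and negative part are separate because the machine has no negative
  numbers.\<close>

definition push :: "nat \<Rightarrow> nat \<Rightarrow> nat \<Rightarrow> (nat \<Rightarrow> nat \<Rightarrow> nat) \<Rightarrow> (nat \<Rightarrow> nat \<Rightarrow> nat) \<Rightarrow> nat \<Rightarrow>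
    (nat \<Rightarrow> nat \<Rightarrow> nat) \<Rightarrow> nat \<Rightarrow> nat \<Rightarrow> nat" where
  "push n N KK P R \<sigma> X = (\<lambda>i j. if i < n \<and> j < n
     then N - (N - (X i j + (KK * P i j) div \<sigma> - (KK * R i j) div \<sigma>)) else X i j)"

text \<open>The share of the planted set in the total weight \<open>S\<close> is guessed as
  \<open>g / N\<close>, so that \<open>N + 1\<close> guesses cover all possibilities with an error
  of \<open>S / N\<close>.\<close>

definition raise_weight :: "nat \<Rightarrow> nat \<Rightarrow> nat \<Rightarrow> nat \<Rightarrow> nat \<Rightarrow> nat \<Rightarrow> (nat \<Rightarrow> nat \<Rightarrow> nat) \<Rightarrow>
    (nat \<Rightarrow> nat \<Rightarrow> nat) \<Rightarrow> nat \<Rightarrow> nat \<Rightarrow> nat" where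
  "raise_weight n N KK E S g W X = (if (\<Sum>i<n. \<Sum>j<n. W i j * X i j) + E * S \<le> g * S
     then push n N KK W (\<lambda>_ _. 0) S X else X)"

text \<open>The difference of the two components is the power \<open>(n N I - X)\<^sup>t\<close>.\<close>

primrec pow_pair :: "nat \<Rightarrow> nat \<Rightarrow> (nat \<Rightarrow> nat \<Rightarrow> nat) \<Rightarrow> nat \<Rightarrow> (nat \<Rightarrow> nat \<Rightarrow> nat) \<times> (nat \<Rightarrow> nat \<Rightarrow> nat)" where
  "pow_pair n N X 0 = ((\<lambda>i j. if i = j then 1 else 0), (\<lambda>i j. 0))"
| "pow_pair n N X (Suc t) =
    ((\<lambda>i j. n * N * fst (pow_pair n N X t) i j + (\<Sum>l<n. snd (pow_pair n N X t) i l * X l j)),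
     (\<lambda>i j. n * N * snd (pow_pair n N X t) i j + (\<Sum>l<n. fst (pow_pair n N X t) i l * X l j)))"

text \<open>The power \<open>Z = A - B\<close>, a polynomial in \<open>X\<close>, is positive
  semidefinite and concentrates on the eigenvectors of \<open>X\<close> with the lowest eigenvalues.
  If the inner product of \<open>Z\<close> and \<open>X\<close> is at most \<open>- E\<close> times
  the trace of \<open>Z\<close>, then \<open>Z\<close> is itself the normal of a violated
  inequality.\<close>

definition raise_psd :: "nat \<Rightarrow> nat \<Rightarrow> nat \<Rightarrow> nat \<Rightarrow> nat \<Rightarrow> (nat \<Rightarrow> nat \<Rightarrow> nat) \<Rightarrow> nat \<Rightarrow> nat \<Rightarrow> nat" where
  "raise_psd n N KK E T X = (let A = fst (pow_pair n N X T); B = snd (pow_pair n N X T);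
      a = (\<Sum>i<n. A i i); b = (\<Sum>i<n. B i i) in
    if (\<Sum>i<n. \<Sum>j<n. A i j * X i j) + E * a \<le> (\<Sum>i<n. \<Sum>j<n. B i j * X i j) + E * b
    then push n N KK (\<lambda>i j. A i j - B i j) (\<lambda>i j. B i j - A i j) (a - b) X else X)"

abbreviation "xij \<equiv> Get 2 (Var 13) (Var 14)"
text \<open>The Kronecker delta: one of the two truncated differences is positive unless the indices
  agree.\<close>

abbreviation "delta_exp \<equiv> Mi (Num 1) (Pl (Mi (Var 13) (Var 14)) (Mi (Var 14) (Var 13)))"

definition diag_com :: com where
  "diag_com = (Asg 16 (Num 0) ;; Loop 13 (Var 0) (Asg 16 (Pl (Var 16) (Get 2 (Var 13) (Var 13))))) ;;
    Cond (Mi (Pl (Var 16) (Num 1)) (Pl (Ti (Var 1) (Var 3)) (Var 0)))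
      (fij (Put 2 (Var 13) (Var 14) (Mi xij delta_exp))) nop"

definition all_com :: com where
  "all_com = (Asg 16 (Num 0) ;; fij (Asg 16 (Pl (Var 16) xij))) ;;
    Cond (Mi (Pl (Var 16) (Num 1)) (Pl (Ti (Ti (Var 1) (Var 1)) (Var 3)) (Ti (Var 0) (Var 0))))
      (fij (Put 2 (Var 13) (Var 14) (Mi xij (Num 1)))) nop"

text \<open>The idle branch stores a constant because \<open>nop\<close> would demand a bound for
  variable 16.\<close>

definition entry_body :: com where
  "entry_body = Cond (Mi xij (Pl (Get 2 (Var 13) (Var 13)) (Num 1)))
     (Put 2 (Var 13) (Var 14) (Mi xij (Num 1)) ;;
      Put 2 (Var 14) (Var 13) (Mi (Get 2 (Var 14) (Var 13)) (Num 1)) ;;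
      Put 2 (Var 13) (Var 13) (Pl (Get 2 (Var 13) (Var 13)) (Num 2))) (Asg 15 (Num 0))"

definition weight_com :: com where
  "weight_com = (Asg 16 (Num 0) ;; fij (Asg 16 (Pl (Var 16) (Ti (Get 1 (Var 13) (Var 14)) xij)))) ;;
    Cond (Mi (Pl (Ti (Var 11) (Var 6)) (Num 1)) (Pl (Var 16) (Ti (Var 5) (Var 6))))
      (fij (Put 2 (Var 13) (Var 14)
         (Mi (Var 3) (Mi (Var 3) (Pl xij (Qu (Ti (Var 4) (Get 1 (Var 13) (Var 14))) (Var 6))))))) nop"

text \<open>The product goes to the rows \<open>n + i\<close>, so that the old power remains
  readable until the multiplication is complete.\<close>

definition mult_body :: com where
  "mult_body = Asg 16 (Ti (Ti (Var 0) (Var 3)) (Get 6 (Var 13) (Var 14))) ;;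
    Asg 17 (Ti (Ti (Var 0) (Var 3)) (Get 7 (Var 13) (Var 14))) ;;
    Loop 15 (Var 0) (Asg 16 (Pl (Var 16) (Ti (Get 7 (Var 13) (Var 15)) (Get 2 (Var 15) (Var 14)))) ;;
      Asg 17 (Pl (Var 17) (Ti (Get 6 (Var 13) (Var 15)) (Get 2 (Var 15) (Var 14))))) ;;
    Put 6 (Pl (Var 0) (Var 13)) (Var 14) (Var 16) ;; Put 7 (Pl (Var 0) (Var 13)) (Var 14) (Var 17)"

definition power_body :: com where
  "power_body = fij mult_body ;;
     fij (Put 6 (Var 13) (Var 14) (Get 6 (Pl (Var 0) (Var 13)) (Var 14))) ;;
     fij (Put 7 (Var 13) (Var 14) (Get 7 (Pl (Var 0) (Var 13)) (Var 14)))"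

definition power_com :: com where
  "power_com = fij (Put 6 (Var 13) (Var 14) delta_exp) ;; fij (Put 7 (Var 13) (Var 14) (Num 0)) ;;
     Loop 18 (Var 7) power_body"

definition psd_com :: com where
  "psd_com = power_com ;;
    (Asg 16 (Num 0) ;; fij (Asg 16 (Pl (Var 16) (Ti (Get 6 (Var 13) (Var 14)) xij)))) ;;
    (Asg 17 (Num 0) ;; fij (Asg 17 (Pl (Var 17) (Ti (Get 7 (Var 13) (Var 14)) xij)))) ;;
    (Asg 19 (Num 0) ;; Loop 13 (Var 0) (Asg 19 (Pl (Var 19) (Get 6 (Var 13) (Var 13))))) ;;
    (Asg 20 (Num 0) ;; Loop 13 (Var 0) (Asg 20 (Pl (Var 20) (Get 7 (Var 13) (Var 13))))) ;;
    Cond (Mi (Pl (Pl (Var 17) (Ti (Var 5) (Var 20))) (Num 1)) (Pl (Var 16) (Ti (Var 5) (Var 19))))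
      (fij (Put 2 (Var 13) (Var 14) (Mi (Var 3) (Mi (Var 3)
         (Mi (Pl xij (Qu (Ti (Var 4) (Mi (Get 6 (Var 13) (Var 14)) (Get 7 (Var 13) (Var 14)))) (Mi (Var 19) (Var 20))))
             (Qu (Ti (Var 4) (Mi (Get 7 (Var 13) (Var 14)) (Get 6 (Var 13) (Var 14)))) (Mi (Var 19) (Var 20)))))))) nop"

definition improve :: com where
  "improve = diag_com ;; all_com ;; fij entry_body ;; weight_com ;; psd_com"

section \<open>Verification of the corrections\<close>

abbreviation "tmpv \<equiv> {13, 14, 15, 16, 17, 18, 19, 20} :: nat set"
abbreviation "tmpa \<equiv> {2, 6, 7} :: nat set"

text \<open>\<open>q4\<close> to \<open>q6\<close> cover the sums formed by the tests: entries of
  the matrix, weights times entries, and entries of the power times entries.\<close>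

locale params2 = params +
  assumes q4: "n * n * N \<le> Q" and q5: "n * n * (wb * N) \<le> Q" and q6: "n * n * ((2 * n * N) ^ T * N) \<le> Q"
    and N0: "0 < N" and TK: "T \<le> K" and TQ: "T \<le> Q"
begin

definition rng :: "(nat \<Rightarrow> nat \<Rightarrow> nat) \<Rightarrow> bool" where
  "rng X \<longleftrightarrow> (\<forall>i<n. \<forall>j<n. X i j \<le> N)"

lemma NQ: "N \<le> Q"
proof -
  have "1 * 1 * N \<le> n * n * N" using n0 by (intro mult_le_mono) auto
  then show ?thesis using q4 by linarith
qed

lemma sum_sum_le: "(\<Sum>i<n. \<Sum>j<n. h i j) \<le> n * n * (m::nat)" if "\<And>i j. i < n \<Longrightarrow> j < n \<Longrightarrow> h i j \<le> m"
proof -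
  have "(\<Sum>i<n. \<Sum>j<n. h i j) \<le> (\<Sum>i<n. \<Sum>j<n. m)" using that by (intro sum_mono) auto
  then show ?thesis by simp
qed

lemma sum_le: "(\<Sum>i<n. h i) \<le> n * (m::nat)" if "\<And>i. i < n \<Longrightarrow> h i \<le> m"
proof -
  have "(\<Sum>i<n. h i) \<le> (\<Sum>i<n. m)" using that by (intro sum_mono) auto
  then show ?thesis by simp
qed

lemma diag_com_ok:
  assumes c: "env s" and X: "rng (ar s 2)"
  shows "ok Q K diag_com s \<and> unch tmpv tmpa s (sem diag_com s) \<and> ar (sem diag_com s) 2 = shrink_diag n k N (ar s 2)"
proof -
  have v: "vr s 0 = n" "vr s 1 = k" "vr s 3 = N" using c by (auto simp: env_def)
  let ?c1 = "Asg 16 (Num 0) ;; Loop 13 (Var 0) (Asg 16 (Pl (Var 16) (Get 2 (Var 13) (Var 13))))"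
  have tr: "(\<Sum>i<n. ar s 2 i i) \<le> Q"
  proof -
    have "(\<Sum>i<n. ar s 2 i i) \<le> n * N" using X by (intro sum_le) (simp add: rng_def)
    also have "\<dots> \<le> n * n * N" using n0 by simp
    finally show ?thesis using q4 by simp
  qed
  have 1: "ok Q K ?c1 s \<and> unch {13, 16} {} s (sem ?c1 s) \<and> vr (sem ?c1 s) 16 = (\<Sum>i<n. ar s 2 i i)"
  proof (rule sum_fi[OF v(1) _ _ _ tr])
    fix i s' assume a: "i < n" "unch {13, 16} {} s s'" "vr s' 13 = i"
    have "vr s' 0 = n" "ar s' 2 = ar s 2" using unch_vr[OF a(2), of 0] unch_ar[OF a(2), of 2] v by simp_all
    then show "eok (Get 2 (Var 13) (Var 13)) s' \<and> eval (Get 2 (Var 13) (Var 13)) s' = ar s 2 i i" using a by simp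
  qed auto
  define s1 where "s1 = sem ?c1 s"
  have u1: "unch {13, 16} {} s s1" and w1: "vr s1 16 = (\<Sum>i<n. ar s 2 i i)" using 1 by (simp_all add: s1_def)
  have v1: "vr s1 0 = n" "vr s1 1 = k" "vr s1 3 = N" "ar s1 2 = ar s 2"
    using unch_vr[OF u1, of 0] unch_vr[OF u1, of 1] unch_vr[OF u1, of 3] unch_ar[OF u1, of 2] v by simp_all
  let ?e = "Mi (Pl (Var 16) (Num 1)) (Pl (Ti (Var 1) (Var 3)) (Var 0))"
  let ?c2 = "Cond ?e (fij (Put 2 (Var 13) (Var 14) (Mi xij delta_exp))) nop"
  let ?h = "\<lambda>i j. ar s 2 i j - (if i = j then 1 else 0)"
  have 2: "ok Q K ?c2 s1 \<and> unch {13, 14, 16} {2} s1 (sem ?c2 s1) \<and>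
    ar (sem ?c2 s1) 2 = (if k * N + n \<le> (\<Sum>i<n. ar s 2 i i) then (\<lambda>i j. if i < n \<and> j < n then ?h i j else ar s1 2 i j) else ar s1 2)"
  proof (rule cond_map[OF v1(1)])
    fix i j s' assume a: "i < n" "j < n" "unch {13, 14} {2} s1 s'" "vr s' 13 = i" "vr s' 14 = j" "ar s' 2 i j = ar s1 2 i j"
    have "vr s' 0 = n" using unch_vr[OF a(3), of 0] v1 by simp
    moreover have "?h i j \<le> Q" using X a NQ le_trans[of "ar s 2 i j" N Q] by (auto simp: rng_def intro: le_trans[OF diff_le_self])
    ultimately show "eok (Mi xij delta_exp) s' \<and> eval (Mi xij delta_exp) s' = ?h i j \<and> ?h i j \<le> Q"
      using a v1 by auto
  qed (use v1 w1 tr in auto)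
  have "sem diag_com s = sem ?c2 s1" unfolding diag_com_def s1_def by simp
  moreover have "ok Q K diag_com s" unfolding diag_com_def ok.simps(4)[of _ _ ?c1] s1_def[symmetric] using 1 2 by blast
  moreover have "unch tmpv tmpa s s1" by (rule unch_mono[OF u1]) auto
  moreover have "unch tmpv tmpa s1 (sem ?c2 s1)" by (rule unch_mono[OF conjunct1[OF conjunct2[OF 2]]]) auto
  ultimately show ?thesis using conjunct2[OF conjunct2[OF 2]] v1 unch_trans[of tmpv tmpa s s1 "sem ?c2 s1"]
    by (simp add: shrink_diag_def cong: if_cong)
qed

lemma all_com_ok:
  assumes c: "env s" and X: "rng (ar s 2)"
  shows "ok Q K all_com s \<and> unch tmpv tmpa s (sem all_com s) \<and> ar (sem all_com s) 2 = shrink_all n k N (ar s 2)"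
proof -
  have v: "vr s 0 = n" "vr s 1 = k" "vr s 3 = N" using c by (auto simp: env_def)
  let ?c1 = "Asg 16 (Num 0) ;; fij (Asg 16 (Pl (Var 16) xij))"
  let ?S = "\<Sum>i<n. \<Sum>j<n. ar s 2 i j"
  have tr: "?S \<le> Q" using sum_sum_le[of "ar s 2" N] X q4 by (simp add: rng_def)
  have 1: "ok Q K ?c1 s \<and> unch {13, 14, 16} {} s (sem ?c1 s) \<and> vr (sem ?c1 s) 16 = ?S"
  proof (rule sum_fij[OF v(1) _ _ _ _ tr])
    fix i j s' assume a: "i < n" "j < n" "unch {13, 14, 16} {} s s'" "vr s' 13 = i" "vr s' 14 = j"
    have "vr s' 0 = n" "ar s' 2 = ar s 2" using unch_vr[OF a(3), of 0] unch_ar[OF a(3), of 2] v by simp_all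
    then show "eok xij s' \<and> eval xij s' = ar s 2 i j" using a by simp
  qed auto
  define s1 where "s1 = sem ?c1 s"
  have u1: "unch {13, 14, 16} {} s s1" and w1: "vr s1 16 = ?S" using 1 by (simp_all add: s1_def)
  have v1: "vr s1 0 = n" "vr s1 1 = k" "vr s1 3 = N" "ar s1 2 = ar s 2"
    using unch_vr[OF u1, of 0] unch_vr[OF u1, of 1] unch_vr[OF u1, of 3] unch_ar[OF u1, of 2] v by simp_all
  let ?e = "Mi (Pl (Var 16) (Num 1)) (Pl (Ti (Ti (Var 1) (Var 1)) (Var 3)) (Ti (Var 0) (Var 0)))"
  let ?c2 = "Cond ?e (fij (Put 2 (Var 13) (Var 14) (Mi xij (Num 1)))) nop"
  let ?h = "\<lambda>i j. ar s 2 i j - 1"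
  have 2: "ok Q K ?c2 s1 \<and> unch {13, 14, 16} {2} s1 (sem ?c2 s1) \<and>
    ar (sem ?c2 s1) 2 = (if k * k * N + n * n \<le> ?S then (\<lambda>i j. if i < n \<and> j < n then ?h i j else ar s1 2 i j) else ar s1 2)"
  proof (rule cond_map[OF v1(1)])
    fix i j s' assume a: "i < n" "j < n" "unch {13, 14} {2} s1 s'" "vr s' 13 = i" "vr s' 14 = j" "ar s' 2 i j = ar s1 2 i j"
    have "vr s' 0 = n" using unch_vr[OF a(3), of 0] v1 by simp
    moreover have "?h i j \<le> Q" using X a NQ le_trans[of "ar s 2 i j" N Q] by (auto simp: rng_def intro: le_trans[OF diff_le_self])
    ultimately show "eok (Mi xij (Num 1)) s' \<and> eval (Mi xij (Num 1)) s' = ?h i j \<and> ?h i j \<le> Q"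
      using a v1 by auto
  qed (use v1 w1 tr in auto)
  have "sem all_com s = sem ?c2 s1" unfolding all_com_def s1_def by simp
  moreover have "ok Q K all_com s" unfolding all_com_def ok.simps(4)[of _ _ ?c1] s1_def[symmetric] using 1 2 by blast
  moreover have "unch tmpv tmpa s s1" by (rule unch_mono[OF u1]) auto
  moreover have "unch tmpv tmpa s1 (sem ?c2 s1)" by (rule unch_mono[OF conjunct1[OF conjunct2[OF 2]]]) auto
  ultimately show ?thesis using conjunct2[OF conjunct2[OF 2]] v1 unch_trans[of tmpv tmpa s s1 "sem ?c2 s1"]
    by (simp add: shrink_all_def cong: if_cong)
qed

lemma rng_estep: "estep n X Y \<Longrightarrow> rng X \<Longrightarrow> rng Y"
  unfolding estep_def rng_def
proof (elim exE conjE, intro allI impI)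
  fix i j a b assume a: "i < n" "j < n" "X i i + 1 < X i j"
    "Y = (\<lambda>a b. if a = i \<and> b = i then X i i + 2 else if a = i \<and> b = j \<or> a = j \<and> b = i then X a b - 1 else X a b)"
    "\<forall>i<n. \<forall>j<n. X i j \<le> N" "a < n" "b < n"
  have "X i i + 2 \<le> N" using a(1,2,3,5) by (metis Suc_leI add_2_eq_Suc' add.commute le_trans plus_1_eq_Suc)
  then show "Y a b \<le> N" using a by (auto intro: le_trans[OF diff_le_self])
qed

lemma entry_com_ok:
  assumes c: "env s" and X: "rng (ar s 2)"
  shows "ok Q K (fij entry_body) s \<and> unch tmpv tmpa s (sem (fij entry_body) s) \<and> rng (ar (sem (fij entry_body) s) 2) \<and>
    (ar (sem (fij entry_body) s) 2 = ar s 2 \<and> (\<forall>i<n. \<forall>j<n. ar s 2 i j \<le> ar s 2 i i + 1) \<or>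
     (estep n)\<^sup>+\<^sup>+ (ar s 2) (ar (sem (fij entry_body) s) 2))"
proof -
  \<comment> \<open>Either nothing has changed and the pairs seen so far are in order, or some
    correction was made. In the second case constraints met earlier may fail again, which is
    harmless since the distance has dropped.\<close>
  let ?I = "\<lambda>P s'. unch tmpv tmpa s s' \<and> rng (ar s' 2) \<and>
    (ar s' 2 = ar s 2 \<and> (\<forall>(i, j)\<in>P. ar s 2 i j \<le> ar s 2 i i + 1) \<or> (estep n)\<^sup>+\<^sup>+ (ar s 2) (ar s' 2))"
  have "ok Q K (fij entry_body) s \<and> ?I ({..<n} \<times> {..<n}) (sem (fij entry_body) s)"
  proof (rule fij_rule[where Inv = ?I])
    show "vr s 0 = n" using c by (simp add: env_def)
    show "?I {} s" using X by simp
    show "13 \<notin> writes entry_body" by (simp add: entry_body_def)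
    show "vr s' 0 = n" if "?I P s'" for P s'
      using unch_vr[OF conjunct1[OF that], of 0] c by (simp add: env_def)
    show "?I P (setv 13 i s')" "?I P (setv 14 i s')" if "?I P s'" for P s' i
      using that by (auto intro: unch_setv)
  next
    fix i j P s' assume a: "i < n" "j < n" "?I P s'" "vr s' 13 = i" "vr s' 14 = j"
    let ?X = "ar s' 2"
    have u: "unch tmpv tmpa s s'" using a by simp
    have v0: "vr s' 0 = n" using unch_vr[OF u, of 0] c by (simp add: env_def)
    show "ok Q K entry_body s' \<and> ?I (insert (i, j) P) (sem entry_body s')"
    proof (cases "?X i i + 1 < ?X i j")
      case True
      then have ij: "i \<noteq> j" by auto
      define Y where "Y = (\<lambda>a b. if a = i \<and> b = i then ?X i i + 2 else if a = i \<and> b = j \<or> a = j \<and> b = i then ?X a b - 1 else ?X a b)"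
      have es: "estep n ?X Y" unfolding estep_def Y_def using a(1,2) True by blast
      have rX': "rng ?X" using a(3) by blast
      have rY: "rng Y" by (rule rng_estep[OF es rX'])
      have rX: "?X i j \<le> N" "?X j i \<le> N" using rX' a(1,2) by (simp_all add: rng_def)
      have b: "?X i j - 1 \<le> Q" "?X j i - 1 \<le> Q" "?X i i + 2 \<le> Q"
        using rX NQ True by linarith+
      let ?s = "seta 2 i i (?X i i + 2) (seta 2 j i (?X j i - 1) (seta 2 i j (?X i j - 1) s'))"
      have se: "sem entry_body s' = ?s" using True ij a(4,5) by (simp add: entry_body_def)
      have ok: "ok Q K entry_body s'" using True ij a(1,2,4,5) v0 b by (simp add: entry_body_def)
      have "unch tmpv tmpa s ?s" by (intro unch_seta) (use u in auto)
      moreover have arY: "ar ?s 2 = Y" unfolding Y_def using ij by (auto simp: fun_eq_iff)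
      moreover have "(estep n)\<^sup>+\<^sup>+ (ar s 2) Y"
      proof (cases "?X = ar s 2")
        case True
        then show ?thesis using es by simp
      next
        case False
        then have tr: "(estep n)\<^sup>+\<^sup>+ (ar s 2) ?X" using a(3) by blast
        show ?thesis using tranclp.trancl_into_trancl[of "estep n" "ar s 2" ?X Y] tr es by simp
      qed
      ultimately show ?thesis unfolding se using ok rY by simp
    next
      case False
      have se: "sem entry_body s' = setv 15 0 s'" using False a(4,5) by (simp add: entry_body_def)
      have ok: "ok Q K entry_body s'" using False a v0 by (simp add: entry_body_def)
      have "unch tmpv tmpa s (setv 15 0 s')" using u by (rule unch_setv) simp
      then show ?thesis unfolding se using ok a(3) False by (auto simp: not_less)
    qed
  qed
  then show ?thesis by auto
qed

lemma weight_com_ok: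
  assumes c: "env s" and X: "rng (ar s 2)"
  shows "ok Q K weight_com s \<and> unch tmpv tmpa s (sem weight_com s) \<and>
    ar (sem weight_com s) 2 = raise_weight n N KK E S (vr s 11) W (ar s 2)"
proof -
  have v: "vr s 0 = n" "vr s 3 = N" "vr s 4 = KK" "vr s 5 = E" "vr s 6 = S" using c by (auto simp: env_def)
  let ?c1 = "Asg 16 (Num 0) ;; fij (Asg 16 (Pl (Var 16) (Ti (Get 1 (Var 13) (Var 14)) xij)))"
  let ?S = "\<Sum>i<n. \<Sum>j<n. W i j * ar s 2 i j"
  have tr: "?S \<le> Q" using sum_sum_le[of "\<lambda>i j. W i j * ar s 2 i j" "wb * N"] X q5 Wb
    by (simp add: rng_def mult_le_mono)
  have 1: "ok Q K ?c1 s \<and> unch {13, 14, 16} {} s (sem ?c1 s) \<and> vr (sem ?c1 s) 16 = ?S"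
  proof (rule sum_fij[OF v(1) _ _ _ _ tr])
    fix i j s' assume a: "i < n" "j < n" "unch {13, 14, 16} {} s s'" "vr s' 13 = i" "vr s' 14 = j"
    have "vr s' 0 = n" "ar s' 2 = ar s 2" "ar s' 1 i j = W i j"
      using unch_vr[OF a(3), of 0] unch_ar[OF a(3), of 2] unch_ar[OF a(3), of 1] v c a(1,2) by (simp_all add: env_def)
    then show "eok (Ti (Get 1 (Var 13) (Var 14)) xij) s' \<and> eval (Ti (Get 1 (Var 13) (Var 14)) xij) s' = W i j * ar s 2 i j" using a by simp
  qed auto
  define s1 where "s1 = sem ?c1 s"
  have u1: "unch {13, 14, 16} {} s s1" and w1: "vr s1 16 = ?S" using 1 by (simp_all add: s1_def)
  have v1: "vr s1 0 = n" "vr s1 3 = N" "vr s1 4 = KK" "vr s1 5 = E" "vr s1 6 = S" "vr s1 11 = vr s 11" "ar s1 2 = ar s 2" "ar s1 1 = ar s 1"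
    using unch_vr[OF u1, of 0] unch_vr[OF u1, of 3] unch_vr[OF u1, of 4] unch_vr[OF u1, of 5] unch_vr[OF u1, of 6]
      unch_vr[OF u1, of 11] unch_ar[OF u1, of 2] unch_ar[OF u1, of 1] v by simp_all
  let ?e = "Mi (Pl (Ti (Var 11) (Var 6)) (Num 1)) (Pl (Var 16) (Ti (Var 5) (Var 6)))"
  let ?f = "Mi (Var 3) (Mi (Var 3) (Pl xij (Qu (Ti (Var 4) (Get 1 (Var 13) (Var 14))) (Var 6))))"
  let ?c2 = "Cond ?e (fij (Put 2 (Var 13) (Var 14) ?f)) nop"
  let ?h = "\<lambda>i j. N - (N - (ar s 2 i j + (KK * W i j) div S))"
  have 2: "ok Q K ?c2 s1 \<and> unch {13, 14, 16} {2} s1 (sem ?c2 s1) \<and>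
    ar (sem ?c2 s1) 2 = (if ?S + E * S \<le> vr s 11 * S then (\<lambda>i j. if i < n \<and> j < n then ?h i j else ar s1 2 i j) else ar s1 2)"
  proof (rule cond_map[OF v1(1)])
    fix i j s' assume a: "i < n" "j < n" "unch {13, 14} {2} s1 s'" "vr s' 13 = i" "vr s' 14 = j" "ar s' 2 i j = ar s1 2 i j"
    have "vr s' 0 = n" "vr s' 3 = N" "vr s' 4 = KK" "vr s' 6 = S" "ar s' 1 i j = W i j"
      using unch_vr[OF a(3), of 0] unch_vr[OF a(3), of 3] unch_vr[OF a(3), of 4] unch_vr[OF a(3), of 6]
        unch_ar[OF a(3), of 1] v1 c a(1,2) by (simp_all add: env_def)
    moreover have "?h i j \<le> Q" using NQ by simp
    ultimately show "eok ?f s' \<and> eval ?f s' = ?h i j \<and> ?h i j \<le> Q" using a v1 by simp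
  qed (use v1 w1 tr in auto)
  have "sem weight_com s = sem ?c2 s1" unfolding weight_com_def s1_def by simp
  moreover have "ok Q K weight_com s" unfolding weight_com_def ok.simps(4)[of _ _ ?c1] s1_def[symmetric] using 1 2 by blast
  moreover have "unch tmpv tmpa s s1" by (rule unch_mono[OF u1]) auto
  moreover have "unch tmpv tmpa s1 (sem ?c2 s1)" by (rule unch_mono[OF conjunct1[OF conjunct2[OF 2]]]) auto
  ultimately show ?thesis using conjunct2[OF conjunct2[OF 2]] v1 unch_trans[of tmpv tmpa s s1 "sem ?c2 s1"]
    by (simp add: raise_weight_def push_def cong: if_cong)
qed

end

context params2
begin

lemma Z_le: "t \<le> T \<Longrightarrow> (2 * n * N) ^ t \<le> (2 * n * N) ^ T"
  using n0 N0 by (intro power_increasing) (simp_all add: One_nat_def Suc_le_eq)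

lemma nZ_Q: "n * (2 * n * N) ^ T \<le> Q" and Z_Q: "(2 * n * N) ^ T \<le> Q"
proof -
  let ?Z = "(2 * n * N) ^ T"
  have "?Z \<le> n * ?Z" using n0 by simp
  moreover have "n * ?Z \<le> n * (n * (?Z * N))"
  proof (rule mult_le_mono2)
    have "1 * (?Z * 1) \<le> n * (?Z * N)" using n0 N0 by (intro mult_le_mono) (simp_all add: One_nat_def Suc_le_eq)
    then show "?Z \<le> n * (?Z * N)" by simp
  qed
  moreover have "n * (n * (?Z * N)) \<le> Q" using q6 by (simp only: mult.assoc)
  ultimately show "n * ?Z \<le> Q" "?Z \<le> Q" by linarith+
qed

text \<open>One multiplication contributes a factor \<open>n * N\<close> from the diagonal term and
  at most another \<open>n * N\<close> from the sum, hence the base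
  \<open>2 * n * N\<close>.\<close>

lemma pow_pair_le:
  assumes "rng X" "i < n" "j < n"
  shows "fst (pow_pair n N X t) i j \<le> (2 * n * N) ^ t \<and> snd (pow_pair n N X t) i j \<le> (2 * n * N) ^ t"
  using assms(2,3)
proof (induction t arbitrary: i j)
  case (Suc t)
  let ?z = "(2 * n * N) ^ t"
  have X: "X l j \<le> N" if "l < n" for l using assms(1) Suc.prems that by (simp add: rng_def)
  have s: "(\<Sum>l<n. h l * X l j) \<le> n * (?z * N)" if "\<And>l. l < n \<Longrightarrow> h l \<le> ?z" for h
    using that X by (intro sum_le mult_le_mono) auto
  have "n * N * h + c \<le> (2 * n * N) ^ Suc t" if "h \<le> ?z" "c \<le> n * (?z * N)" for h c
  proof -
    have "n * N * h + c \<le> n * N * ?z + n * (?z * N)" using that by (intro add_mono mult_le_mono) auto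
    then show ?thesis by (simp add: algebra_simps)
  qed
  then show ?case using Suc.IH s Suc.prems by simp
qed simp

lemma mult_body_ok:
  assumes v: "vr s 0 = n" "vr s 3 = N" and ij: "i < n" "j < n" "vr s 13 = i" "vr s 14 = j" and X: "rng (ar s 2)" and t: "t < T"
    and A: "\<And>i j. i < n \<Longrightarrow> j < n \<Longrightarrow> ar s 6 i j = fst (pow_pair n N (ar s 2) t) i j"
    and B: "\<And>i j. i < n \<Longrightarrow> j < n \<Longrightarrow> ar s 7 i j = snd (pow_pair n N (ar s 2) t) i j"
  shows "ok Q K mult_body s \<and> (\<exists>s3. unch {15, 16, 17} {} s s3 \<and>
    sem mult_body s = seta 7 (n + i) j (snd (pow_pair n N (ar s 2) (Suc t)) i j)
       (seta 6 (n + i) j (fst (pow_pair n N (ar s 2) (Suc t)) i j) s3))"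
proof -
  let ?A = "fst (pow_pair n N (ar s 2) t)" and ?B = "snd (pow_pair n N (ar s 2) t)" and ?X = "ar s 2"
  let ?A' = "fst (pow_pair n N (ar s 2) (Suc t)) i j" and ?B' = "snd (pow_pair n N (ar s 2) (Suc t)) i j"
  have b: "?A' \<le> Q" "?B' \<le> Q"
    using pow_pair_le[OF X ij(1,2), of "Suc t"] Z_le[of "Suc t"] Z_Q t by auto
  have A': "?A' = n * N * ?A i j + (\<Sum>l<n. ?B i l * ?X l j)" and B': "?B' = n * N * ?B i j + (\<Sum>l<n. ?A i l * ?X l j)"
    by simp_all
  define s2 where "s2 = setv 17 (n * N * ?B i j) (setv 16 (n * N * ?A i j) s)"
  have u2: "unch {15, 16, 17} {} s s2" unfolding s2_def by (intro unch_setv) auto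
  let ?c = "Asg 16 (Pl (Var 16) (Ti (Get 7 (Var 13) (Var 15)) (Get 2 (Var 15) (Var 14)))) ;;
      Asg 17 (Pl (Var 17) (Ti (Get 6 (Var 13) (Var 15)) (Get 2 (Var 15) (Var 14))))"
  have sub: "n * N * ?A i j + (\<Sum>l\<in>P. ?B i l * ?X l j) \<le> Q" "n * N * ?B i j + (\<Sum>l\<in>P. ?A i l * ?X l j) \<le> Q"
    if "P \<subseteq> {..<n}" for P
  proof -
    have "(\<Sum>l\<in>P. ?B i l * ?X l j) \<le> (\<Sum>l<n. ?B i l * ?X l j)" "(\<Sum>l\<in>P. ?A i l * ?X l j) \<le> (\<Sum>l<n. ?A i l * ?X l j)"
      using that by (intro sum_mono2; auto)+
    then show "n * N * ?A i j + (\<Sum>l\<in>P. ?B i l * ?X l j) \<le> Q" "n * N * ?B i j + (\<Sum>l\<in>P. ?A i l * ?X l j) \<le> Q"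
      using b unfolding A' B' by linarith+
  qed
  let ?I = "\<lambda>P s'. unch {15, 16, 17} {} s s' \<and> vr s' 16 = n * N * ?A i j + (\<Sum>l\<in>P. ?B i l * ?X l j) \<and>
     vr s' 17 = n * N * ?B i j + (\<Sum>l\<in>P. ?A i l * ?X l j)"
  have L: "ok Q K (Loop 15 (Var 0) ?c) s2 \<and> ?I {..<n} (sem (Loop 15 (Var 0) ?c) s2)"
  proof (rule fi_rule[where Inv = ?I])
    show "vr s2 0 = n" using v by (simp add: s2_def)
    show "?I {} s2" using u2 by (simp add: s2_def)
    show "?I P (setv 15 l s')" if "?I P s'" for P s' l
      using that unch_setv[of "{15, 16, 17}" "{}" s s' 15 l] by simp
  next
    fix l P s' assume a: "l < n" "l \<notin> P" "P \<subseteq> {..<n}" "?I P s'" "vr s' 15 = l"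
    have u: "unch {15, 16, 17} {} s s'" using a(4) by simp
    have w: "vr s' 0 = n" "vr s' 13 = i" "vr s' 14 = j" "ar s' = ar s"
      using unch_vr[OF u, of 0] unch_vr[OF u, of 13] unch_vr[OF u, of 14] unch_ar[OF u] v ij by (simp_all add: fun_eq_iff)
    have fin: "finite P" using a(3) by (rule finite_subset) simp
    have s16: "vr s' 16 + ?B i l * ?X l j = n * N * ?A i j + (\<Sum>l\<in>insert l P. ?B i l * ?X l j)"
      and s17: "vr s' 17 + ?A i l * ?X l j = n * N * ?B i j + (\<Sum>l\<in>insert l P. ?A i l * ?X l j)"
      using a(2,4) fin by simp_all
    have q: "vr s' 16 + ?B i l * ?X l j \<le> Q" "vr s' 17 + ?A i l * ?X l j \<le> Q"
      unfolding s16 s17 using a(1,3) by (intro sub; simp)+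
    have se: "sem ?c s' = setv 17 (vr s' 17 + ?A i l * ?X l j) (setv 16 (vr s' 16 + ?B i l * ?X l j) s')"
      using w a(1,5) A[OF ij(1) a(1)] B[OF ij(1) a(1)] by simp
    have "ok Q K ?c s'" using w a(1,5) A[OF ij(1) a(1)] B[OF ij(1) a(1)] q ij by simp
    moreover have "unch {15, 16, 17} {} s (sem ?c s')" unfolding se by (intro unch_setv u) simp_all
    ultimately show "ok Q K ?c s' \<and> ?I (insert l P) (sem ?c s')" unfolding se using s16 s17 by simp
  qed
  define L' where "L' = Loop 15 (Var 0) ?c"
  define s3 where "s3 = sem L' s2"
  have L1: "ok Q K L' s2" and u3: "unch {15, 16, 17} {} s s3" and w3: "vr s3 16 = ?A'" "vr s3 17 = ?B'"
    using L unfolding L'_def[symmetric] s3_def[symmetric] A' B' by simp_all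
  have v3: "vr s3 0 = n" "vr s3 13 = i" "vr s3 14 = j"
    using unch_vr[OF u3, of 0] unch_vr[OF u3, of 13] unch_vr[OF u3, of 14] v ij by simp_all
  let ?P = "Put 6 (Pl (Var 0) (Var 13)) (Var 14) (Var 16) ;; Put 7 (Pl (Var 0) (Var 13)) (Var 14) (Var 17)"
  let ?a1 = "Asg 16 (Ti (Ti (Var 0) (Var 3)) (Get 6 (Var 13) (Var 14)))"
  let ?a2 = "Asg 17 (Ti (Ti (Var 0) (Var 3)) (Get 7 (Var 13) (Var 14)))"
  define P' where "P' = ?P"
  have mb: "mult_body = ?a1 ;; ?a2 ;; L' ;; P'" by (simp add: mult_body_def L'_def P'_def)
  have e2: "sem ?a2 (sem ?a1 s) = s2" using v ij A[OF ij(1,2)] B[OF ij(1,2)] by (simp add: s2_def)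
  have o2: "ok Q K ?a1 s" "ok Q K ?a2 (sem ?a1 s)"
    using v ij A[OF ij(1,2)] B[OF ij(1,2)] sub[of "{}"] by simp_all
  have eP: "sem P' s3 = seta 7 (n + i) j ?B' (seta 6 (n + i) j ?A' s3)"
    unfolding P'_def sem.simps(1-5) eval.simps binop_val.simps set_simps v3 w3 ..
  have oP: "ok Q K P' s3"
    unfolding P'_def ok.simps(1-5) sem.simps(1-5) eval.simps eok.simps binop_val.simps set_simps v3 w3 using b ij(2) by (intro conjI TrueI)
  have "ok Q K mult_body s" unfolding mb ok.simps(4) sem.simps(4) e2 s3_def[symmetric] using o2 L1 oP by (intro conjI)
  moreover have "sem mult_body s = seta 7 (n + i) j ?B' (seta 6 (n + i) j ?A' s3)"
    unfolding mb sem.simps(4) e2 s3_def[symmetric] by (rule eP)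
  ultimately show ?thesis using u3 by (intro conjI exI[of _ s3])
qed

definition holds_pow :: "(nat \<Rightarrow> nat \<Rightarrow> nat) \<Rightarrow> nat \<Rightarrow> state \<Rightarrow> bool" where
  "holds_pow X t s \<longleftrightarrow> (\<forall>i<n. \<forall>j<n. ar s 6 i j = fst (pow_pair n N X t) i j \<and> ar s 7 i j = snd (pow_pair n N X t) i j)"

lemma power_body_ok:
  assumes c: "env s" and X: "rng (ar s 2)" and t: "t < T" and H: "holds_pow (ar s 2) t s"
  shows "ok Q K power_body s \<and> unch {13, 14, 15, 16, 17} {6, 7} s (sem power_body s) \<and> holds_pow (ar s 2) (Suc t) (sem power_body s)"
proof -
  let ?X = "ar s 2" and ?V = "{13, 14, 15, 16, 17} :: nat set"
  let ?A' = "fst (pow_pair n N ?X (Suc t))" and ?B' = "snd (pow_pair n N ?X (Suc t))"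
  have v: "vr s 0 = n" "vr s 3 = N" using c by (auto simp: env_def)
  have b: "?A' i j \<le> Q" "?B' i j \<le> Q" if "i < n" "j < n" for i j
    using pow_pair_le[OF X that, of "Suc t"] Z_le[of "Suc t"] Z_Q t by auto
  let ?I = "\<lambda>P s'. unch ?V {6, 7} s s' \<and> holds_pow ?X t s' \<and>
     (\<forall>(i, j)\<in>P. ar s' 6 (n + i) j = ?A' i j \<and> ar s' 7 (n + i) j = ?B' i j)"
  have 1: "ok Q K (fij mult_body) s \<and> ?I ({..<n} \<times> {..<n}) (sem (fij mult_body) s)"
  proof (rule fij_rule[where Inv = ?I])
    show "vr s' 0 = n" if "?I P s'" for P s'
      using unch_vr[OF conjunct1[OF that], of 0] v by simp
    show "?I P (setv 13 i s')" if "?I P s'" for P s' i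
      using that unch_setv[of ?V "{6, 7}" s s' 13 i] by (simp add: holds_pow_def)
    show "?I P (setv 14 i s')" if "?I P s'" for P s' i
      using that unch_setv[of ?V "{6, 7}" s s' 14 i] by (simp add: holds_pow_def)
    show "13 \<notin> writes mult_body" by (simp add: mult_body_def)
  next
    fix i j P s' assume a: "i < n" "j < n" "(i, j) \<notin> P" "P \<subseteq> {..<n} \<times> {..<n}" "?I P s'" "vr s' 13 = i" "vr s' 14 = j"
    have u: "unch ?V {6, 7} s s'" and h: "holds_pow ?X t s'" using a(5) by simp_all
    have w: "vr s' 0 = n" "vr s' 3 = N" "ar s' 2 = ?X" using unch_vr[OF u, of 0] unch_vr[OF u, of 3] unch_ar[OF u, of 2] v by simp_all
    have "ok Q K mult_body s' \<and> (\<exists>s3. unch {15, 16, 17} {} s' s3 \<and>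
        sem mult_body s' = seta 7 (n + i) j (snd (pow_pair n N (ar s' 2) (Suc t)) i j)
          (seta 6 (n + i) j (fst (pow_pair n N (ar s' 2) (Suc t)) i j) s3))"
    proof (rule mult_body_ok[OF w(1,2) a(1,2,6,7) _ t])
      show "rng (ar s' 2)" using X w by simp
    qed (use h w in \<open>simp_all add: holds_pow_def\<close>)
    then obtain s3 where ok: "ok Q K mult_body s'" and u3: "unch {15, 16, 17} {} s' s3"
      and se: "sem mult_body s' = seta 7 (n + i) j (?B' i j) (seta 6 (n + i) j (?A' i j) s3)"
      unfolding w(3) by (elim exE conjE) (rule that; assumption)
    have "unch ?V {6, 7} s' s3" by (rule unch_mono[OF u3]) auto
    then have "unch ?V {6, 7} s s3" by (rule unch_trans[OF u])
    then have "unch ?V {6, 7} s (sem mult_body s')" unfolding se by (intro unch_seta) simp_all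
    moreover have e: "ar s3 6 = ar s' 6" "ar s3 7 = ar s' 7" using unch_ar[OF u3] by simp_all
    have "holds_pow ?X t (sem mult_body s')" using h e unfolding se holds_pow_def by simp
    moreover have "\<forall>(i', j')\<in>insert (i, j) P. ar (sem mult_body s') 6 (n + i') j' = ?A' i' j' \<and> ar (sem mult_body s') 7 (n + i') j' = ?B' i' j'"
      using a(5) e unfolding se by auto
    ultimately show "ok Q K mult_body s' \<and> ?I (insert (i, j) P) (sem mult_body s')" using ok by (intro conjI)
  qed (use v H in simp_all)
  define s1 where "s1 = sem (fij mult_body) s"
  have u1: "unch ?V {6, 7} s s1" and n1: "\<And>i j. i < n \<Longrightarrow> j < n \<Longrightarrow> ar s1 6 (n + i) j = ?A' i j \<and> ar s1 7 (n + i) j = ?B' i j"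
    using 1 unfolding s1_def[symmetric] by auto
  have v1: "vr s1 0 = n" using unch_vr[OF u1, of 0] v by simp
  let ?c2 = "fij (Put 6 (Var 13) (Var 14) (Get 6 (Pl (Var 0) (Var 13)) (Var 14)))"
  have 2: "ok Q K ?c2 s1 \<and> unch {13, 14} {6} s1 (sem ?c2 s1) \<and> ar (sem ?c2 s1) 6 = (\<lambda>i j. if i < n \<and> j < n then ?A' i j else ar s1 6 i j)"
  proof (rule map_fij[OF v1])
    fix i j s' assume a: "i < n" "j < n" "unch {13, 14} {6} s1 s'" "vr s' 13 = i" "vr s' 14 = j"
      "\<And>i' j'. \<not> (i' < n \<and> j' < n) \<Longrightarrow> ar s' 6 i' j' = ar s1 6 i' j'"
    have "vr s' 0 = n" using unch_vr[OF a(3), of 0] v1 by simp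
    then show "eok (Get 6 (Pl (Var 0) (Var 13)) (Var 14)) s' \<and> eval (Get 6 (Pl (Var 0) (Var 13)) (Var 14)) s' = ?A' i j \<and> ?A' i j \<le> Q"
      using a(1,2,4,5) a(6)[of "n + i" j] n1[OF a(1,2)] b[OF a(1,2)] by (simp del: pow_pair.simps)
  qed
  define s2 where "s2 = sem ?c2 s1"
  have u2: "unch {13, 14} {6} s1 s2" and a2: "ar s2 6 = (\<lambda>i j. if i < n \<and> j < n then ?A' i j else ar s1 6 i j)" and ok2: "ok Q K ?c2 s1"
    using 2 unfolding s2_def[symmetric] by simp_all
  have v2: "vr s2 0 = n" "ar s2 7 = ar s1 7" using unch_vr[OF u2, of 0] unch_ar[OF u2, of 7] v1 by simp_all
  let ?c3 = "fij (Put 7 (Var 13) (Var 14) (Get 7 (Pl (Var 0) (Var 13)) (Var 14)))"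
  have 3: "ok Q K ?c3 s2 \<and> unch {13, 14} {7} s2 (sem ?c3 s2) \<and> ar (sem ?c3 s2) 7 = (\<lambda>i j. if i < n \<and> j < n then ?B' i j else ar s2 7 i j)"
  proof (rule map_fij[OF v2(1)])
    fix i j s' assume a: "i < n" "j < n" "unch {13, 14} {7} s2 s'" "vr s' 13 = i" "vr s' 14 = j"
      "\<And>i' j'. \<not> (i' < n \<and> j' < n) \<Longrightarrow> ar s' 7 i' j' = ar s2 7 i' j'"
    have "vr s' 0 = n" using unch_vr[OF a(3), of 0] v2 by simp
    then show "eok (Get 7 (Pl (Var 0) (Var 13)) (Var 14)) s' \<and> eval (Get 7 (Pl (Var 0) (Var 13)) (Var 14)) s' = ?B' i j \<and> ?B' i j \<le> Q"
      using a(1,2,4,5) a(6)[of "n + i" j] n1[OF a(1,2)] b[OF a(1,2)] v2 by (simp del: pow_pair.simps)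
  qed
  define s3 where "s3 = sem ?c3 s2"
  have u3: "unch {13, 14} {7} s2 s3" and a3: "ar s3 7 = (\<lambda>i j. if i < n \<and> j < n then ?B' i j else ar s2 7 i j)" and ok3: "ok Q K ?c3 s2"
    using 3 unfolding s3_def[symmetric] by simp_all
  have "sem power_body s = s3" unfolding power_body_def sem.simps(4) s1_def[symmetric] s2_def[symmetric] s3_def[symmetric] ..
  moreover have "ok Q K power_body s"
    unfolding power_body_def ok.simps(4) sem.simps(4) s1_def[symmetric] s2_def[symmetric] using conjunct1[OF 1] ok2 ok3 by (intro conjI)
  moreover have "unch ?V {6, 7} s s3"
    by (rule unch_trans[OF unch_trans[OF u1 unch_mono[OF u2]] unch_mono[OF u3]]) auto
  moreover have "holds_pow ?X (Suc t) s3" unfolding holds_pow_def using a3 unch_ar[OF u3, of 6] a2 by (simp del: pow_pair.simps)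
  ultimately show ?thesis by simp
qed

lemma power_com_ok:
  assumes c: "env s" and X: "rng (ar s 2)"
  shows "ok Q K power_com s \<and> unch {13, 14, 15, 16, 17, 18} {6, 7} s (sem power_com s) \<and> holds_pow (ar s 2) T (sem power_com s)"
proof -
  let ?X = "ar s 2" and ?V = "{13, 14, 15, 16, 17, 18} :: nat set"
  have v: "vr s 0 = n" "vr s 7 = T" using c by (auto simp: env_def)
  let ?c1 = "fij (Put 6 (Var 13) (Var 14) delta_exp)" and ?c2 = "fij (Put 7 (Var 13) (Var 14) (Num 0))"
  have Q1: "1 \<le> Q" using q2 by simp
  have 1: "ok Q K ?c1 s \<and> unch {13, 14} {6} s (sem ?c1 s) \<and> ar (sem ?c1 s) 6 = (\<lambda>i j. if i < n \<and> j < n then if i = j then 1 else 0 else ar s 6 i j)"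
  proof (rule map_fij[OF v(1)])
    fix i j and s' :: state assume "i < n" "j < n" "vr s' 13 = i" "vr s' 14 = j"
    then show "eok delta_exp s' \<and> eval delta_exp s' = (if i = j then 1 else 0) \<and> (if i = j then 1 else 0) \<le> Q"
      using Q1 by auto
  qed
  define s1 where "s1 = sem ?c1 s"
  have ok1: "ok Q K ?c1 s" and u1: "unch {13, 14} {6} s s1" and a1: "ar s1 6 = (\<lambda>i j. if i < n \<and> j < n then if i = j then 1 else 0 else ar s 6 i j)"
    using 1 unfolding s1_def[symmetric] by simp_all
  have v1: "vr s1 0 = n" using unch_vr[OF u1, of 0] v by simp
  have 2: "ok Q K ?c2 s1 \<and> unch {13, 14} {7} s1 (sem ?c2 s1) \<and> ar (sem ?c2 s1) 7 = (\<lambda>i j. if i < n \<and> j < n then 0 else ar s1 7 i j)"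
    by (rule map_fij[OF v1]) simp
  define s2 where "s2 = sem ?c2 s1"
  have ok2: "ok Q K ?c2 s1" and u2: "unch {13, 14} {7} s1 s2" and a2: "ar s2 7 = (\<lambda>i j. if i < n \<and> j < n then 0 else ar s1 7 i j)"
    using 2 unfolding s2_def[symmetric] by simp_all
  have us2: "unch ?V {6, 7} s s2" by (rule unch_trans[OF unch_mono[OF u1] unch_mono[OF u2]]) auto
  have X2: "ar s2 2 = ?X" "vr s2 7 = T" using unch_ar[OF us2, of 2] unch_vr[OF us2, of 7] v by simp_all
  have h0: "holds_pow ?X 0 s2" unfolding holds_pow_def using a2 unch_ar[OF u2, of 6] a1 by simp
  \<comment> \<open>The exponent reached is the number of completed rounds, hence
    \<open>card P\<close> and not the loop variable, which counts downwards.\<close>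
  let ?I = "\<lambda>P s'. unch ?V {6, 7} s s' \<and> holds_pow ?X (card P) s'"
  have L: "ok Q K (Loop 18 (Var 7) power_body) s2 \<and> ?I {..<T} (sem (Loop 18 (Var 7) power_body) s2)"
  proof (rule loop_rule[where Inv = ?I and m = T])
    show "eval (Var 7) s2 = T" using X2 by simp
    show "?I {} s2" using us2 h0 by simp
  next
    fix t P s' assume a: "t < T" "t \<notin> P" "P \<subseteq> {..<T}" "?I P s'"
    let ?s = "setv 18 t s'"
    have fin: "finite P" using a(3) by (rule finite_subset) simp
    have cP: "card (insert t P) = Suc (card P)" using fin a(2) by simp
    have "card (insert t P) \<le> card {..<T}" using a by (intro card_mono) auto
    then have lt: "card P < T" using cP by simp
    have u: "unch ?V {6, 7} s ?s" using conjunct1[OF a(4)] by (rule unch_setv) simp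
    have c': "env ?s" by (rule env_unch[OF c u]) auto
    have X': "ar ?s 2 = ?X" using unch_ar[OF u, of 2] by simp
    have H': "holds_pow (ar ?s 2) (card P) ?s" using conjunct2[OF a(4)] unfolding X' by (simp add: holds_pow_def)
    have r: "rng (ar ?s 2)" using X X' by simp
    note pb = power_body_ok[OF c' r lt H']
    have "unch ?V {6, 7} s (sem power_body ?s)"
      by (rule unch_trans[OF u unch_mono[OF conjunct1[OF conjunct2[OF pb]]]]) auto
    then show "ok Q K power_body ?s \<and> ?I (insert t P) (sem power_body ?s)"
      unfolding cP using conjunct1[OF pb] conjunct2[OF conjunct2[OF pb]] unfolding X' by (intro conjI)
  next
    fix s' assume "?I {..<T} s'"
    then show "?I {..<T} (setv 18 0 s')" using unch_setv[of ?V "{6, 7}" s s' 18 0] by (simp add: holds_pow_def)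
  qed (use TK TQ in simp_all)
  have "ok Q K power_com s"
    unfolding power_com_def ok.simps(4) sem.simps(4) s1_def[symmetric] s2_def[symmetric] using ok1 ok2 conjunct1[OF L] by (intro conjI)
  moreover have "sem power_com s = sem (Loop 18 (Var 7) power_body) s2"
    unfolding power_com_def sem.simps(4) s1_def[symmetric] s2_def[symmetric] ..
  ultimately show ?thesis using conjunct2[OF L] by simp
qed

end

section \<open>The search over targets and iterates\<close>

definition improves :: "nat \<Rightarrow> nat \<Rightarrow> nat \<Rightarrow> nat \<Rightarrow> nat \<Rightarrow> nat \<Rightarrow> nat \<Rightarrow> (nat \<Rightarrow> nat \<Rightarrow> nat) \<Rightarrow> nat \<Rightarrow>
    (nat \<Rightarrow> nat \<Rightarrow> nat) \<Rightarrow> (nat \<Rightarrow> nat \<Rightarrow> nat) \<Rightarrow> bool" where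
  "improves n k N KK E S T W g X X' \<longleftrightarrow>
    (\<exists>X1 Y. X1 = shrink_all n k N (shrink_diag n k N X) \<and>
      (Y = X1 \<and> (\<forall>i<n. \<forall>j<n. Y i j \<le> Y i i + 1) \<or> (estep n)\<^sup>+\<^sup>+ X1 Y) \<and>
      X' = raise_psd n N KK E T (raise_weight n N KK E S g W Y))"

text \<open>The two output sets coincide, so each entry is written to both halves. Cells below 60
  still serve as registers; they are filled by \<open>finish\<close>.\<close>

definition best_com :: com where
  "best_com = Loop 13 (Var 0) (Cond (Mi (Var 13) (Num 59)) (Out (Var 13) (Get 5 (Num 0) (Var 13))) (Asg 15 (Num 0)) ;;
     Out (Pl (Var 0) (Var 13)) (Get 5 (Num 0) (Var 13)))"

text \<open>Each target starts from the matrix with all entries \<open>N\<close>. Rounding precedes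
  improvement, so this matrix, for which every vertex is heavy, is rounded as well.\<close>

definition search :: com where
  "search = Asg 10 (Num 0) ;;
    Loop 11 (Pl (Var 3) (Num 1)) (fij (Put 2 (Var 13) (Var 14) (Var 3)) ;; Loop 12 (Var 8) (rounding ;; improve)) ;;
    best_com"

context params2
begin

lemma rng_push: "rng (push n N c P R \<sigma> X)"
  by (simp add: rng_def push_def)

lemma psd_com_ok:
  assumes c: "env s" and X: "rng (ar s 2)"
  shows "ok Q K psd_com s \<and> unch tmpv tmpa s (sem psd_com s) \<and> ar (sem psd_com s) 2 = raise_psd n N KK E T (ar s 2)"
proof -
  let ?X = "ar s 2"
  define A where "A = fst (pow_pair n N ?X T)"
  define B where "B = snd (pow_pair n N ?X T)"
  have v: "vr s 0 = n" "vr s 3 = N" "vr s 4 = KK" "vr s 5 = E" using c by (auto simp: env_def)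
  note pc = power_com_ok[OF c X]
  define s1 where "s1 = sem power_com s"
  have u1: "unch {13, 14, 15, 16, 17, 18} {6, 7} s s1" and h1: "holds_pow ?X T s1" and ok1: "ok Q K power_com s"
    using pc unfolding s1_def[symmetric] by simp_all
  have v1: "vr s1 0 = n" "vr s1 3 = N" "vr s1 4 = KK" "vr s1 5 = E" "ar s1 2 = ?X"
    using unch_vr[OF u1, of 0] unch_vr[OF u1, of 3] unch_vr[OF u1, of 4] unch_vr[OF u1, of 5] unch_ar[OF u1, of 2] v by simp_all
  have AB1: "ar s1 6 i j = A i j" "ar s1 7 i j = B i j" if "i < n" "j < n" for i j
    using h1 that unfolding holds_pow_def A_def B_def by simp_all
  have bd: "A i j \<le> (2 * n * N) ^ T" "B i j \<le> (2 * n * N) ^ T" if "i < n" "j < n" for i j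
    using pow_pair_le[OF X that, of T] by (simp_all add: A_def B_def)
  have XN: "?X i j \<le> N" if "i < n" "j < n" for i j using X that by (simp add: rng_def)
  have q: "(\<Sum>i<n. \<Sum>j<n. A i j * ?X i j) \<le> Q" "(\<Sum>i<n. \<Sum>j<n. B i j * ?X i j) \<le> Q"
    by (rule order_trans[OF sum_sum_le q6], rule mult_le_mono, erule (1) bd, erule (1) XN)+
  have "(\<Sum>i<n. A i i) \<le> n * (2 * n * N) ^ T" "(\<Sum>i<n. B i i) \<le> n * (2 * n * N) ^ T"
    using bd by (intro sum_le; blast)+
  then have qt: "(\<Sum>i<n. A i i) \<le> Q" "(\<Sum>i<n. B i i) \<le> Q" using nZ_Q by linarith+
  let ?c2 = "Asg 16 (Num 0) ;; fij (Asg 16 (Pl (Var 16) (Ti (Get 6 (Var 13) (Var 14)) xij)))"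
  let ?c3 = "Asg 17 (Num 0) ;; fij (Asg 17 (Pl (Var 17) (Ti (Get 7 (Var 13) (Var 14)) xij)))"
  let ?c4 = "Asg 19 (Num 0) ;; Loop 13 (Var 0) (Asg 19 (Pl (Var 19) (Get 6 (Var 13) (Var 13))))"
  let ?c5 = "Asg 20 (Num 0) ;; Loop 13 (Var 0) (Asg 20 (Pl (Var 20) (Get 7 (Var 13) (Var 13))))"
  have 2: "ok Q K ?c2 s1 \<and> unch {13, 14, 16} {} s1 (sem ?c2 s1) \<and> vr (sem ?c2 s1) 16 = (\<Sum>i<n. \<Sum>j<n. A i j * ?X i j)"
  proof (rule sum_fij[OF v1(1) _ _ _ _ q(1)])
    fix i j s' assume a: "i < n" "j < n" "unch {13, 14, 16} {} s1 s'" "vr s' 13 = i" "vr s' 14 = j"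
    have "vr s' 0 = n" "ar s' 2 = ?X" "ar s' 6 = ar s1 6"
      using unch_vr[OF a(3), of 0] unch_ar[OF a(3), of 2] unch_ar[OF a(3), of 6] v1 by simp_all
    then show "eok (Ti (Get 6 (Var 13) (Var 14)) xij) s' \<and> eval (Ti (Get 6 (Var 13) (Var 14)) xij) s' = A i j * ?X i j"
      using a AB1[OF a(1,2)] by simp
  qed simp_all
  define s2 where "s2 = sem ?c2 s1"
  have ok2: "ok Q K ?c2 s1" and u2: "unch {13, 14, 16} {} s1 s2" and w2: "vr s2 16 = (\<Sum>i<n. \<Sum>j<n. A i j * ?X i j)"
    using 2 unfolding s2_def[symmetric] by simp_all
  have v2: "vr s2 0 = n" "ar s2 = ar s1"
    using unch_vr[OF u2, of 0] unch_ar[OF u2] v1 by (simp_all add: fun_eq_iff)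
  have 3: "ok Q K ?c3 s2 \<and> unch {13, 14, 17} {} s2 (sem ?c3 s2) \<and> vr (sem ?c3 s2) 17 = (\<Sum>i<n. \<Sum>j<n. B i j * ?X i j)"
  proof (rule sum_fij[OF v2(1) _ _ _ _ q(2)])
    fix i j s' assume a: "i < n" "j < n" "unch {13, 14, 17} {} s2 s'" "vr s' 13 = i" "vr s' 14 = j"
    have "vr s' 0 = n" "ar s' 2 = ?X" "ar s' 7 = ar s1 7"
      using unch_vr[OF a(3), of 0] unch_ar[OF a(3), of 2] unch_ar[OF a(3), of 7] v1 v2 by simp_all
    then show "eok (Ti (Get 7 (Var 13) (Var 14)) xij) s' \<and> eval (Ti (Get 7 (Var 13) (Var 14)) xij) s' = B i j * ?X i j"
      using a AB1[OF a(1,2)] by simp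
  qed simp_all
  define s3 where "s3 = sem ?c3 s2"
  have ok3: "ok Q K ?c3 s2" and u3: "unch {13, 14, 17} {} s2 s3" and w3: "vr s3 17 = (\<Sum>i<n. \<Sum>j<n. B i j * ?X i j)"
    using 3 unfolding s3_def[symmetric] by simp_all
  have v3: "vr s3 0 = n" "ar s3 = ar s1"
    using unch_vr[OF u3, of 0] unch_ar[OF u3] v2 by (simp_all add: fun_eq_iff)
  have 4: "ok Q K ?c4 s3 \<and> unch {13, 19} {} s3 (sem ?c4 s3) \<and> vr (sem ?c4 s3) 19 = (\<Sum>i<n. A i i)"
  proof (rule sum_fi[OF v3(1) _ _ _ qt(1)])
    fix i s' assume a: "i < n" "unch {13, 19} {} s3 s'" "vr s' 13 = i"
    have "vr s' 0 = n" "ar s' 6 = ar s1 6" using unch_vr[OF a(2), of 0] unch_ar[OF a(2), of 6] v3 by simp_all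
    then show "eok (Get 6 (Var 13) (Var 13)) s' \<and> eval (Get 6 (Var 13) (Var 13)) s' = A i i"
      using a AB1[OF a(1,1)] by simp
  qed simp_all
  define s4 where "s4 = sem ?c4 s3"
  have ok4: "ok Q K ?c4 s3" and u4: "unch {13, 19} {} s3 s4" and w4: "vr s4 19 = (\<Sum>i<n. A i i)"
    using 4 unfolding s4_def[symmetric] by simp_all
  have v4: "vr s4 0 = n" "ar s4 = ar s1"
    using unch_vr[OF u4, of 0] unch_ar[OF u4] v3 by (simp_all add: fun_eq_iff)
  have 5: "ok Q K ?c5 s4 \<and> unch {13, 20} {} s4 (sem ?c5 s4) \<and> vr (sem ?c5 s4) 20 = (\<Sum>i<n. B i i)"
  proof (rule sum_fi[OF v4(1) _ _ _ qt(2)])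
    fix i s' assume a: "i < n" "unch {13, 20} {} s4 s'" "vr s' 13 = i"
    have "vr s' 0 = n" "ar s' 7 = ar s1 7" using unch_vr[OF a(2), of 0] unch_ar[OF a(2), of 7] v4 by simp_all
    then show "eok (Get 7 (Var 13) (Var 13)) s' \<and> eval (Get 7 (Var 13) (Var 13)) s' = B i i"
      using a AB1[OF a(1,1)] by simp
  qed simp_all
  define s5 where "s5 = sem ?c5 s4"
  have ok5: "ok Q K ?c5 s4" and u5: "unch {13, 20} {} s4 s5" and w5: "vr s5 20 = (\<Sum>i<n. B i i)"
    using 5 unfolding s5_def[symmetric] by simp_all
  have us5: "unch {13, 14, 16, 17, 19, 20} {} s1 s5"
    by (rule unch_trans[OF unch_trans[OF unch_trans[OF unch_mono[OF u2] unch_mono[OF u3]] unch_mono[OF u4]] unch_mono[OF u5]]) auto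
  have v5: "vr s5 0 = n" "vr s5 3 = N" "vr s5 4 = KK" "vr s5 5 = E" "ar s5 = ar s1"
    using unch_vr[OF us5, of 0] unch_vr[OF us5, of 3] unch_vr[OF us5, of 4] unch_vr[OF us5, of 5] unch_ar[OF us5] v1 by (simp_all add: fun_eq_iff)
  have w5': "vr s5 16 = (\<Sum>i<n. \<Sum>j<n. A i j * ?X i j)" "vr s5 17 = (\<Sum>i<n. \<Sum>j<n. B i j * ?X i j)" "vr s5 19 = (\<Sum>i<n. A i i)"
    using unch_vr[OF u5, of 19] unch_vr[OF u5, of 16] unch_vr[OF u5, of 17] unch_vr[OF u4, of 16] unch_vr[OF u4, of 17] unch_vr[OF u3, of 16] w2 w3 w4
    by simp_all
  let ?e = "Mi (Pl (Pl (Var 17) (Ti (Var 5) (Var 20))) (Num 1)) (Pl (Var 16) (Ti (Var 5) (Var 19)))"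
  let ?f = "Mi (Var 3) (Mi (Var 3)
         (Mi (Pl xij (Qu (Ti (Var 4) (Mi (Get 6 (Var 13) (Var 14)) (Get 7 (Var 13) (Var 14)))) (Mi (Var 19) (Var 20))))
             (Qu (Ti (Var 4) (Mi (Get 7 (Var 13) (Var 14)) (Get 6 (Var 13) (Var 14)))) (Mi (Var 19) (Var 20)))))"
  let ?c6 = "Cond ?e (fij (Put 2 (Var 13) (Var 14) ?f)) nop"
  let ?tr = "(\<Sum>i<n. A i i) - (\<Sum>i<n. B i i)"
  let ?h = "\<lambda>i j. N - (N - (?X i j + (KK * (A i j - B i j)) div ?tr - (KK * (B i j - A i j)) div ?tr))"
  let ?p = "(\<Sum>i<n. \<Sum>j<n. A i j * ?X i j) + E * (\<Sum>i<n. A i i) \<le> (\<Sum>i<n. \<Sum>j<n. B i j * ?X i j) + E * (\<Sum>i<n. B i i)"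
  have 6: "ok Q K ?c6 s5 \<and> unch {13, 14, 16} {2} s5 (sem ?c6 s5) \<and>
    ar (sem ?c6 s5) 2 = (if ?p then (\<lambda>i j. if i < n \<and> j < n then ?h i j else ar s5 2 i j) else ar s5 2)"
  proof (rule cond_map[OF v5(1)])
    show "vr s5 16 \<le> Q" using w5' q by simp
    show "(eval ?e s5 \<noteq> 0) = ?p" using w5 w5' v5 by auto
  next
    fix i j s' assume a: "i < n" "j < n" "unch {13, 14} {2} s5 s'" "vr s' 13 = i" "vr s' 14 = j" "ar s' 2 i j = ar s5 2 i j"
    have w: "vr s' 0 = n" "vr s' 3 = N" "vr s' 4 = KK" "vr s' 19 = (\<Sum>i<n. A i i)" "vr s' 20 = (\<Sum>i<n. B i i)" "ar s' 6 = ar s1 6" "ar s' 7 = ar s1 7"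
      using unch_vr[OF a(3), of 0] unch_vr[OF a(3), of 3] unch_vr[OF a(3), of 4] unch_vr[OF a(3), of 19] unch_vr[OF a(3), of 20]
        unch_ar[OF a(3), of 6] unch_ar[OF a(3), of 7] v5 w5 w5' by simp_all
    have x: "ar s' 2 i j = ?X i j" using a(6) v5(5) v1(5) by simp
    have "eval ?f s' = ?h i j"
      by (simp only: eval.simps binop_val.simps a(4,5) w x AB1[OF a(1,2)])
    moreover have "?h i j \<le> Q" by (rule order_trans[OF diff_le_self NQ])
    moreover have "eok ?f s'" by (simp only: eok.simps eval.simps a(2,5) w simp_thms)
    ultimately show "eok ?f s' \<and> eval ?f s' = ?h i j \<and> ?h i j \<le> Q" by (intro conjI)
  qed simp
  have "ok Q K psd_com s"
    unfolding psd_com_def ok.simps(4)[of _ _ power_com] ok.simps(4)[of _ _ ?c2] ok.simps(4)[of _ _ ?c3] ok.simps(4)[of _ _ ?c4] ok.simps(4)[of _ _ ?c5]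
      s1_def[symmetric] s2_def[symmetric] s3_def[symmetric] s4_def[symmetric] s5_def[symmetric]
    using ok1 ok2 ok3 ok4 ok5 conjunct1[OF 6] by (intro conjI)
  moreover have "sem psd_com s = sem ?c6 s5"
    unfolding psd_com_def sem.simps(4)[of power_com] sem.simps(4)[of ?c2] sem.simps(4)[of ?c3] sem.simps(4)[of ?c4] sem.simps(4)[of ?c5]
      s1_def[symmetric] s2_def[symmetric] s3_def[symmetric] s4_def[symmetric] s5_def[symmetric] ..
  moreover have "unch tmpv tmpa s (sem ?c6 s5)"
    by (rule unch_trans[OF unch_trans[OF unch_mono[OF u1] unch_mono[OF us5]] unch_mono[OF conjunct1[OF conjunct2[OF 6]]]]) auto
  moreover have "ar (sem ?c6 s5) 2 = raise_psd n N KK E T ?X"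
  proof -
    have "ar s5 2 = ?X" using v5(5) v1(5) by simp
    then show ?thesis using conjunct2[OF conjunct2[OF 6]]
      unfolding raise_psd_def Let_def A_def[symmetric] B_def[symmetric] push_def by (simp only:)
  qed
  ultimately show ?thesis by simp
qed

lemma improve_ok:
  assumes c: "env s" and X: "rng (ar s 2)"
  shows "ok Q K improve s \<and> unch tmpv tmpa s (sem improve s) \<and> rng (ar (sem improve s) 2) \<and>
    improves n k N KK E S T W (vr s 11) (ar s 2) (ar (sem improve s) 2)"
proof -
  have cl: "env s'" if "unch tmpv tmpa s s'" for s' by (rule env_unch[OF c that]) auto
  note a = diag_com_ok[OF c X]
  define s1 where "s1 = sem diag_com s"
  have u1: "unch tmpv tmpa s s1" and x1: "ar s1 2 = shrink_diag n k N (ar s 2)" and ok1: "ok Q K diag_com s"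
    using a unfolding s1_def[symmetric] by simp_all
  have r1: "rng (ar s1 2)" using X unfolding x1 shrink_diag_def rng_def by (auto intro: le_trans[OF diff_le_self])
  note a = all_com_ok[OF cl[OF u1] r1]
  define s2 where "s2 = sem all_com s1"
  have u2: "unch tmpv tmpa s1 s2" and x2: "ar s2 2 = shrink_all n k N (ar s1 2)" and ok2: "ok Q K all_com s1"
    using a unfolding s2_def[symmetric] by simp_all
  have us2: "unch tmpv tmpa s s2" by (rule unch_trans[OF u1 u2])
  have r2: "rng (ar s2 2)" using r1 unfolding x2 shrink_all_def rng_def by (auto intro: le_trans[OF diff_le_self])
  note a = entry_com_ok[OF cl[OF us2] r2]
  define s3 where "s3 = sem (fij entry_body) s2"
  have u3: "unch tmpv tmpa s2 s3" and r3: "rng (ar s3 2)" and ok3: "ok Q K (fij entry_body) s2"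
    and x3: "ar s3 2 = ar s2 2 \<and> (\<forall>i<n. \<forall>j<n. ar s2 2 i j \<le> ar s2 2 i i + 1) \<or> (estep n)\<^sup>+\<^sup>+ (ar s2 2) (ar s3 2)"
    using a unfolding s3_def[symmetric] by simp_all
  have us3: "unch tmpv tmpa s s3" by (rule unch_trans[OF us2 u3])
  note a = weight_com_ok[OF cl[OF us3] r3]
  define s4 where "s4 = sem weight_com s3"
  have v11: "vr s3 11 = vr s 11" using unch_vr[OF us3, of 11] by simp
  have u4: "unch tmpv tmpa s3 s4" and x4: "ar s4 2 = raise_weight n N KK E S (vr s 11) W (ar s3 2)" and ok4: "ok Q K weight_com s3"
    using a unfolding s4_def[symmetric] v11 by simp_all
  have us4: "unch tmpv tmpa s s4" by (rule unch_trans[OF us3 u4])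
  have r4: "rng (ar s4 2)" using r3 rng_push unfolding x4 raise_weight_def by simp
  note a = psd_com_ok[OF cl[OF us4] r4]
  define s5 where "s5 = sem psd_com s4"
  have u5: "unch tmpv tmpa s4 s5" and x5: "ar s5 2 = raise_psd n N KK E T (ar s4 2)" and ok5: "ok Q K psd_com s4"
    using a unfolding s5_def[symmetric] by simp_all
  have us5: "unch tmpv tmpa s s5" by (rule unch_trans[OF us4 u5])
  have r5: "rng (ar s5 2)" using r4 rng_push unfolding x5 raise_psd_def Let_def by simp
  have se: "sem improve s = s5" unfolding improve_def sem.simps(4) s1_def[symmetric] s2_def[symmetric] s3_def[symmetric] s4_def[symmetric] s5_def[symmetric] ..
  have oki: "ok Q K improve s" unfolding improve_def ok.simps(4) sem.simps(4) s1_def[symmetric] s2_def[symmetric] s3_def[symmetric] s4_def[symmetric]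
    using ok1 ok2 ok3 ok4 ok5 by (intro conjI)
  have "improves n k N KK E S T W (vr s 11) (ar s 2) (ar s5 2)"
    unfolding improves_def
  proof (intro exI conjI)
    show "ar s2 2 = shrink_all n k N (shrink_diag n k N (ar s 2))" using x1 x2 by simp
    show "ar s3 2 = ar s2 2 \<and> (\<forall>i<n. \<forall>j<n. ar s3 2 i j \<le> ar s3 2 i i + 1) \<or> (estep n)\<^sup>+\<^sup>+ (ar s2 2) (ar s3 2)"
      using x3 by auto
    show "ar s5 2 = raise_psd n N KK E T (raise_weight n N KK E S (vr s 11) W (ar s3 2))" using x4 x5 by simp
  qed
  then show ?thesis unfolding se using oki us5 r5 by (intro conjI)
qed

end

locale params3 = params2 +
  fixes b :: nat
  assumes N1K: "N + 1 \<le> K" and N1Q: "N + 1 \<le> Q" and IIK: "II \<le> K" and IIQ: "II \<le> Q" and nb: "2 * n \<le> b" and n60: "60 \<le> n"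
begin

definition wt :: "(nat \<Rightarrow> nat \<Rightarrow> nat) \<Rightarrow> nat" where
  "wt X = weight_of n W (topk n k (score n N W X))"

definition best_ok :: "state \<Rightarrow> bool" where
  "best_ok s \<longleftrightarrow> vr s 10 = 0 \<or> (\<exists>X. (\<forall>i<n. ar s 5 0 i = topk n k (score n N W X) i) \<and> vr s 10 = wt X)"

text \<open>The record of one inner loop that the analysis needs: \<open>v\<close> is at least the
  weight of each rounded iterate. The iterate that passes all tests need not be the last one, hence
  the whole sequence is kept.\<close>

definition traj :: "nat \<Rightarrow> nat \<Rightarrow> nat \<Rightarrow> (nat \<Rightarrow> nat \<Rightarrow> nat \<Rightarrow> nat) \<Rightarrow> bool" where
  "traj g m v Xs \<longleftrightarrow> (\<forall>i<n. \<forall>j<n. Xs 0 i j = N) \<and>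
     (\<forall>l<m. improves n k N KK E S T W g (Xs l) (Xs (Suc l))) \<and> (\<forall>l<m. wt (Xs l) \<le> v) \<and> (\<forall>l\<le>m. rng (Xs l))"

abbreviation "allv \<equiv> insert 10 (insert 11 (insert 12 tmpv))"
abbreviation "alla \<equiv> {2, 3, 5, 6, 7} :: nat set"

lemma rounding_ok':
  assumes c: "env s" and bo: "best_ok s"
  shows "ok Q K rounding s \<and> unch {10, 13, 14, 16} {3, 5} s (sem rounding s) \<and> best_ok (sem rounding s) \<and>
    wt (ar s 2) \<le> vr (sem rounding s) 10 \<and> vr s 10 \<le> vr (sem rounding s) 10"
proof -
  note r = rounding_ok[OF c]
  have v: "vr (sem rounding s) 10 = max (vr s 10) (wt (ar s 2))" using r unfolding wt_def by simp
  have "best_ok (sem rounding s)"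
  proof (cases "vr s 10 < wt (ar s 2)")
    case True
    then have "\<forall>i<n. ar (sem rounding s) 5 0 i = topk n k (score n N W (ar s 2)) i" using r unfolding wt_def by simp
    then show ?thesis unfolding best_ok_def using v True by (intro disjI2 exI[of _ "ar s 2"]) simp
  next
    case False
    then have "ar (sem rounding s) 5 = ar s 5" using r unfolding wt_def by simp
    then show ?thesis using bo v False unfolding best_ok_def by simp
  qed
  then show ?thesis unfolding v using r[THEN conjunct1] r[THEN conjunct2, THEN conjunct1] by (intro conjI) simp_all
qed

lemma inner_ok:
  assumes c: "env s" and X: "\<And>i j. i < n \<Longrightarrow> j < n \<Longrightarrow> ar s 2 i j = N" and bo: "best_ok s"
  shows "ok Q K (Loop 12 (Var 8) (rounding ;; improve)) s \<and>
    unch (allv - {11}) alla s (sem (Loop 12 (Var 8) (rounding ;; improve)) s) \<and> best_ok (sem (Loop 12 (Var 8) (rounding ;; improve)) s) \<and>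
    vr s 10 \<le> vr (sem (Loop 12 (Var 8) (rounding ;; improve)) s) 10 \<and>
    (\<exists>Xs. traj (vr s 11) II (vr (sem (Loop 12 (Var 8) (rounding ;; improve)) s) 10) Xs)"
proof -
  let ?g = "vr s 11" and ?V = "allv - {11}"
  let ?I = "\<lambda>P s'. unch ?V alla s s' \<and> best_ok s' \<and> vr s 10 \<le> vr s' 10 \<and>
     (\<exists>Xs. traj ?g (card P) (vr s' 10) Xs \<and> Xs (card P) = ar s' 2)"
  have v8: "vr s 8 = II" using c by (simp add: env_def)
  have "ok Q K (Loop 12 (Var 8) (rounding ;; improve)) s \<and> ?I {..<II} (sem (Loop 12 (Var 8) (rounding ;; improve)) s)"
  proof (rule loop_rule[where Inv = ?I and m = II])
    show "eval (Var 8) s = II" using v8 by simp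
    have "traj ?g 0 (vr s 10) (\<lambda>_. ar s 2)" unfolding traj_def rng_def using X by simp
    then show "?I {} s" using bo by (intro conjI exI[of _ "\<lambda>_. ar s 2"]) simp_all
  next
    fix t P s' assume a: "t < II" "t \<notin> P" "P \<subseteq> {..<II}" "?I P s'"
    define s0 where "s0 = setv 12 t s'"
    have fin: "finite P" using a(3) by (rule finite_subset) simp
    have cP: "card (insert t P) = Suc (card P)" using fin a(2) by simp
    obtain Xs where Xs: "traj ?g (card P) (vr s' 10) Xs" "Xs (card P) = ar s' 2" using a(4) by (elim conjE exE) (rule that; assumption)
    have u0: "unch ?V alla s s0" unfolding s0_def using conjunct1[OF a(4)] by (rule unch_setv) simp
    have e0: "ar s0 = ar s'" "vr s0 10 = vr s' 10" by (simp_all add: s0_def)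
    have b0: "best_ok s0" using a(4) unfolding best_ok_def e0 by simp
    have c0: "env s0" by (rule env_unch[OF c u0]) auto
    note r = rounding_ok'[OF c0 b0]
    define s1 where "s1 = sem rounding s0"
    have okr: "ok Q K rounding s0" and u1: "unch {10, 13, 14, 16} {3, 5} s0 s1" and b1: "best_ok s1"
      and w1: "wt (ar s0 2) \<le> vr s1 10" "vr s0 10 \<le> vr s1 10"
      using r unfolding s1_def[symmetric] by simp_all
    have us1: "unch ?V alla s s1" by (rule unch_trans[OF u0 unch_mono[OF u1]]) auto
    have c1: "env s1" by (rule env_unch[OF c us1]) auto
    have X1: "ar s1 2 = Xs (card P)" using unch_ar[OF u1, of 2] e0 Xs by simp
    have g1: "vr s1 11 = ?g" using unch_vr[OF us1, of 11] by simp
    have rX: "rng (ar s1 2)" using Xs(1) unfolding X1 traj_def by simp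
    note i = improve_ok[OF c1 rX]
    define s2 where "s2 = sem improve s1"
    have oki: "ok Q K improve s1" and u2: "unch tmpv tmpa s1 s2" and r2: "rng (ar s2 2)"
      and i2: "improves n k N KK E S T W ?g (Xs (card P)) (ar s2 2)"
      using i unfolding s2_def[symmetric] g1 X1 by simp_all
    have us2: "unch ?V alla s s2" by (rule unch_trans[OF us1 unch_mono[OF u2]]) auto
    have k2: "vr s2 10 = vr s1 10" "ar s2 5 = ar s1 5" using unch_vr[OF u2, of 10] unch_ar[OF u2, of 5] by simp_all
    have b2: "best_ok s2" using b1 unfolding best_ok_def k2 .
    define Xs' where "Xs' l = (if l \<le> card P then Xs l else ar s2 2)" for l
    have "traj ?g (Suc (card P)) (vr s2 10) Xs'"
      unfolding traj_def
    proof (intro conjI allI impI)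
      show "Xs' 0 i j = N" if "i < n" "j < n" for i j using Xs(1) that by (simp add: Xs'_def traj_def)
      show "rng (Xs' l)" for l using Xs(1) r2 by (simp add: Xs'_def traj_def)
      fix l assume l: "l < Suc (card P)"
      show "improves n k N KK E S T W ?g (Xs' l) (Xs' (Suc l))"
        using l Xs(1) i2 by (cases "l = card P") (simp_all add: Xs'_def traj_def)
      show "wt (Xs' l) \<le> vr s2 10"
      proof (cases "l = card P")
        case True
        then show ?thesis using w1 k2 Xs(2) e0 by (simp add: Xs'_def)
      next
        case False
        then have "wt (Xs l) \<le> vr s' 10" using l Xs(1) by (simp add: traj_def)
        then show ?thesis using l False w1 k2 e0 by (simp add: Xs'_def)
      qed
    qed
    moreover have "Xs' (Suc (card P)) = ar s2 2" by (simp add: Xs'_def)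
    moreover have "vr s 10 \<le> vr s2 10" using a(4) w1 k2 e0 by simp
    moreover have se: "sem (rounding ;; improve) s0 = s2" unfolding sem.simps(4) s1_def[symmetric] s2_def[symmetric] ..
    moreover have "ok Q K (rounding ;; improve) s0" unfolding ok.simps(4) s1_def[symmetric] using okr oki by (intro conjI)
    ultimately show "ok Q K (rounding ;; improve) (setv 12 t s') \<and> ?I (insert t P) (sem (rounding ;; improve) (setv 12 t s'))"
      unfolding s0_def[symmetric] se cP using us2 b2 by (intro conjI exI[of _ Xs'])
  next
    fix s' assume a: "?I {..<II} s'"
    have "unch ?V alla s (setv 12 0 s')" using conjunct1[OF a] by (rule unch_setv) simp
    then show "?I {..<II} (setv 12 0 s')" using a by (simp add: best_ok_def)
  qed (use IIK IIQ in simp_all)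
  then show ?thesis by (simp, elim conjE exE) (intro conjI exI; assumption)
qed

lemma best_com_ok:
  assumes c: "vr s 0 = n" "vr s 2 = b" and q: "\<And>i. i < n \<Longrightarrow> ar s 5 0 i \<le> Q"
  shows "ok Q K best_com s \<and> ar (sem best_com s) 5 = ar s 5 \<and>
    (\<forall>i<n. (60 \<le> i \<longrightarrow> io (sem best_com s) i = ar s 5 0 i) \<and> io (sem best_com s) (n + i) = ar s 5 0 i)"
proof -
  let ?c1 = "Cond (Mi (Var 13) (Num 59)) (Out (Var 13) (Get 5 (Num 0) (Var 13))) (Asg 15 (Num 0))"
  let ?c2 = "Out (Pl (Var 0) (Var 13)) (Get 5 (Num 0) (Var 13))"
  let ?I = "\<lambda>P (s' :: state). vr s' 0 = n \<and> vr s' 2 = b \<and> ar s' 5 = ar s 5 \<and>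
     (\<forall>i\<in>P. (60 \<le> i \<longrightarrow> io s' i = ar s 5 0 i) \<and> io s' (n + i) = ar s 5 0 i)"
  have "ok Q K best_com s \<and> ?I {..<n} (sem best_com s)" unfolding best_com_def
  proof (rule fi_rule[where Inv = ?I])
    fix i P and s' :: state assume a: "i < n" "i \<notin> P" "P \<subseteq> {..<n}" "?I P s'" "vr s' 13 = i"
    have P: "\<And>j. j \<in> P \<Longrightarrow> j < n" using a(3) by auto
    show "ok Q K (?c1 ;; ?c2) s' \<and> ?I (insert i P) (sem (?c1 ;; ?c2) s')"
    proof (cases "60 \<le> i")
      case True
      have "sem (?c1 ;; ?c2) s' = seto (n + i) (ar s 5 0 i) (seto i (ar s 5 0 i) s')"
        using True a by simp
      moreover have "ok Q K (?c1 ;; ?c2) s'" using True a nb n60 q[OF a(1)] by simp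
      ultimately show ?thesis using a(1,4) P by auto
    next
      case False
      have "sem (?c1 ;; ?c2) s' = seto (n + i) (ar s 5 0 i) (setv 15 0 s')"
        using False a by simp
      moreover have "ok Q K (?c1 ;; ?c2) s'" using False a nb n60 q[OF a(1)] by simp
      ultimately show ?thesis using a(1,4) P False by auto
    qed
  qed (use c in simp_all)
  then show ?thesis by simp
qed

lemma search_ok:
  assumes c: "env s" and b: "vr s 2 = b" and II0: "0 < II"
  shows "ok Q K search s \<and>
    (\<exists>v X. (\<forall>i<n. ar (sem search s) 5 0 i = topk n k (score n N W X) i) \<and> v = wt X \<and> (\<forall>g\<le>N. \<exists>Xs. traj g II v Xs)) \<and>
    (\<forall>i<n. (60 \<le> i \<longrightarrow> io (sem search s) i = ar (sem search s) 5 0 i) \<and> io (sem search s) (n + i) = ar (sem search s) 5 0 i)"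
proof -
  define s0 where "s0 = setv 10 0 s"
  let ?x = "fij (Put 2 (Var 13) (Var 14) (Var 3))" and ?y = "Loop 12 (Var 8) (rounding ;; improve)"
  let ?L = "Loop 11 (Pl (Var 3) (Num 1)) (?x ;; ?y)"
  have c0: "env s0" using c by (simp add: s0_def env_def)
  have v0: "vr s0 3 = N" "vr s0 2 = b" using c b by (simp_all add: s0_def env_def)
  let ?I = "\<lambda>P s'. unch allv alla s0 s' \<and> best_ok s' \<and> (\<forall>g\<in>P. \<exists>Xs. traj g II (vr s' 10) Xs)"
  have mono: "traj g II v' Xs" if "traj g II v Xs" "v \<le> v'" for g v v' Xs
    using that unfolding traj_def by (auto intro: order_trans)
  have L: "ok Q K ?L s0 \<and> ?I {..<N + 1} (sem ?L s0)"
  proof (rule loop_rule[where Inv = ?I and m = "N + 1"])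
    show "eval (Pl (Var 3) (Num 1)) s0 = N + 1" using v0 by simp
    show "?I {} s0" by (simp add: best_ok_def s0_def)
  next
    fix g P s' assume a: "g < N + 1" "g \<notin> P" "P \<subseteq> {..<N + 1}" "?I P s'"
    define t0 where "t0 = setv 11 g s'"
    have u0: "unch allv alla s0 t0" unfolding t0_def using conjunct1[OF a(4)] by (rule unch_setv) simp
    have cc: "env t0" by (rule env_unch[OF c0 u0]) auto
    have w: "vr t0 0 = n" "vr t0 3 = N" "vr t0 11 = g" using cc by (simp_all add: env_def t0_def)
    have x: "ok Q K ?x t0 \<and> unch {13, 14} {2} t0 (sem ?x t0) \<and> ar (sem ?x t0) 2 = (\<lambda>i j. if i < n \<and> j < n then N else ar t0 2 i j)"
    proof (rule map_fij[OF w(1)])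
      fix i j s'' assume "unch {13, 14} {2} t0 s''"
      then show "eok (Var 3) s'' \<and> eval (Var 3) s'' = N \<and> N \<le> Q" using unch_vr[of "{13, 14}" "{2}" t0 s'' 3] w NQ by simp
    qed
    define t1 where "t1 = sem ?x t0"
    have okx: "ok Q K ?x t0" and u1: "unch {13, 14} {2} t0 t1" and x1: "\<And>i j. i < n \<Longrightarrow> j < n \<Longrightarrow> ar t1 2 i j = N"
      using x unfolding t1_def[symmetric] by simp_all
    have us1: "unch allv alla s0 t1" by (rule unch_trans[OF u0 unch_mono[OF u1]]) auto
    have c1: "env t1" by (rule env_unch[OF c0 us1]) auto
    have k1: "vr t1 10 = vr s' 10" "ar t1 5 = ar s' 5" "vr t1 11 = g"
      using unch_vr[OF u1, of 10] unch_ar[OF u1, of 5] unch_vr[OF u1, of 11] by (simp_all add: t0_def)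
    have b1: "best_ok t1" using a(4) unfolding best_ok_def k1 by simp
    note y = inner_ok[OF c1 x1 b1]
    define t2 where "t2 = sem ?y t1"
    have oky: "ok Q K ?y t1" and u2: "unch (allv - {11}) alla t1 t2" and b2: "best_ok t2" and le: "vr t1 10 \<le> vr t2 10"
      and tr: "\<exists>Xs. traj g II (vr t2 10) Xs"
      using y unfolding t2_def[symmetric] k1 by simp_all
    have us2: "unch allv alla s0 t2" by (rule unch_trans[OF us1 unch_mono[OF u2]]) auto
    have "\<forall>g'\<in>insert g P. \<exists>Xs. traj g' II (vr t2 10) Xs"
    proof
      fix g' assume "g' \<in> insert g P"
      then show "\<exists>Xs. traj g' II (vr t2 10) Xs"
      proof
        assume "g' \<in> P"
        then obtain Xs where "traj g' II (vr s' 10) Xs" using a(4) by auto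
        then show ?thesis using mono[of g' "vr s' 10" Xs "vr t2 10"] le k1 by auto
      qed (use tr in simp)
    qed
    moreover have se: "sem (?x ;; ?y) t0 = t2" unfolding sem.simps(4) t1_def[symmetric] t2_def[symmetric] ..
    moreover have "ok Q K (?x ;; ?y) t0" unfolding ok.simps(4) t1_def[symmetric] using okx oky by (intro conjI)
    ultimately show "ok Q K (?x ;; ?y) (setv 11 g s') \<and> ?I (insert g P) (sem (?x ;; ?y) (setv 11 g s'))"
      unfolding t0_def[symmetric] se using us2 b2 by (intro conjI)
  next
    fix s' assume a: "?I {..<N + 1} s'"
    have "unch allv alla s0 (setv 11 0 s')" using conjunct1[OF a] by (rule unch_setv) simp
    then show "?I {..<N + 1} (setv 11 0 s')" using a by (simp add: best_ok_def)
  qed (use N1K N1Q in simp_all)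
  define s1 where "s1 = sem ?L s0"
  have okL: "ok Q K ?L s0" and u1: "unch allv alla s0 s1" and b1: "best_ok s1" and t1: "\<And>g. g \<le> N \<Longrightarrow> \<exists>Xs. traj g II (vr s1 10) Xs"
    using L unfolding s1_def[symmetric] by (simp_all add: One_nat_def)
  \<comment> \<open>At least one matrix was rounded, and the summand 1 in \<open>weight_of\<close>
    makes its value positive; hence a selection has been stored.\<close>
  have "vr s1 10 \<noteq> 0"
  proof -
    obtain Xs where "traj 0 II (vr s1 10) Xs" using t1[of 0] by auto
    then have "wt (Xs 0) \<le> vr s1 10" using II0 by (simp add: traj_def)
    then show ?thesis by (simp add: wt_def weight_of_def)
  qed
  then obtain X where X: "\<forall>i<n. ar s1 5 0 i = topk n k (score n N W X) i" "vr s1 10 = wt X"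
    using b1 unfolding best_ok_def by auto
  have c1: "vr s1 0 = n" "vr s1 2 = b" using unch_vr[OF u1, of 0] unch_vr[OF u1, of 2] c0 v0 by (simp_all add: env_def)
  have "ar s1 5 0 i \<le> Q" if "i < n" for i using X that q3 by (simp add: topk_def)
  note bc = best_com_ok[OF c1 this]
  have s0: "sem (Asg 10 (Num 0)) s = s0" by (simp add: s0_def)
  have se: "sem search s = sem best_com s1" unfolding search_def sem.simps(4)[of "Asg 10 (Num 0)"] sem.simps(4)[of ?L] s0 s1_def[symmetric] ..
  have "ok Q K search s" unfolding search_def ok.simps(4)[of _ _ "Asg 10 (Num 0)"] ok.simps(4)[of _ _ ?L] s0 s1_def[symmetric]
    using okL bc by simp
  then show ?thesis unfolding se using bc X t1 by (intro conjI exI[of _ "vr s1 10"] exI[of _ X]) simp_all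
qed

end

section \<open>Reading the weights over a common denominator\<close>

abbreviation tri :: "com \<Rightarrow> com" where
  "tri c \<equiv> Loop 13 (Var 0) (Loop 14 (Var 13) c)"

text \<open>Only the strict lower triangle is read: cells of row 0 have been overwritten as
  registers, and symmetry with zero diagonal supplies the rest.\<close>

definition Tri :: "nat \<Rightarrow> (nat \<times> nat) set" where
  "Tri n = {(i, j). i < n \<and> j < i}"

lemma seta_other: "\<not> (i' = i \<and> j' = j) \<Longrightarrow> ar (seta a i j v s) a i' j' = ar s a i' j'"
  by auto

lemma finite_Tri: "finite (Tri n)"
  by (rule finite_subset[of _ "{..<n} \<times> {..<n}"]) (auto simp: Tri_def)

lemma (in dims) tri_rule:
  assumes n: "vr s 0 = n" and init: "Inv {} s"
    and ins: "\<And>P s' i. Inv P s' \<Longrightarrow> Inv P (setv 13 i s')" "\<And>P s' i. Inv P s' \<Longrightarrow> Inv P (setv 14 i s')"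
    and w: "13 \<notin> writes c"
    and step: "\<And>i j P s'. \<lbrakk>i < n; j < i; (i, j) \<notin> P; P \<subseteq> Tri n; Inv P s'; vr s' 13 = i; vr s' 14 = j\<rbrakk> \<Longrightarrow>
        ok Q K c s' \<and> Inv (insert (i, j) P) (sem c s')"
  shows "ok Q K (tri c) s \<and> Inv (Tri n) (sem (tri c) s)"
proof -
  let ?R = "\<lambda>P. {(i, j). i \<in> P \<and> j < i}"
  have "ok Q K (tri c) s \<and> Inv (?R {..<n}) (sem (tri c) s)"
  proof (rule fi_rule[where Inv = "\<lambda>P. Inv (?R P)"])
    show "Inv (?R {}) s" using init by simp
  next
    fix i P s' assume i: "i < n" "i \<notin> P" "P \<subseteq> {..<n}" "Inv (?R P) s'" "vr s' 13 = i"
    let ?J = "\<lambda>P' s''. Inv (?R P \<union> {i} \<times> P') s'' \<and> vr s'' 13 = i"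
    have "ok Q K (Loop 14 (Var 13) c) s' \<and> ?J {..<i} (sem (Loop 14 (Var 13) c) s')"
    proof (rule loop_rule[where Inv = ?J and m = i])
      fix j P' s''
      assume j: "j < i" "j \<notin> P'" "P' \<subseteq> {..<i}" "?J P' s''"
      let ?s = "setv 14 j s''"
      have eq: "insert (i, j) (?R P \<union> {i} \<times> P') = ?R P \<union> {i} \<times> insert j P'" by auto
      have J: "Inv (?R P \<union> {i} \<times> P') ?s" "vr ?s 13 = i" using j(4) ins(2) by simp_all
      have "ok Q K c ?s \<and> Inv (insert (i, j) (?R P \<union> {i} \<times> P')) (sem c ?s)"
        by (rule step[OF i(1) j(1) _ _ J]) (use i j in \<open>auto simp: Tri_def\<close>)
      moreover have "vr (sem c ?s) 13 = vr ?s 13" by (rule sem_unwritten[OF w])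
      ultimately show "ok Q K c ?s \<and> ?J (insert j P') (sem c ?s)" using J unfolding eq by simp
    next
      fix s'' assume "?J {..<i} s''"
      then show "?J {..<i} (setv 14 0 s'')" using ins(2) by simp
    qed (use i nK nQ in simp_all)
    moreover have "?R P \<union> {i} \<times> {..<i} = ?R (insert i P)" by auto
    ultimately show "ok Q K (Loop 14 (Var 13) c) s' \<and> Inv (?R (insert i P)) (sem (Loop 14 (Var 13) c) s')" by simp
  qed (use n ins in auto)
  moreover have "?R {..<n} = Tri n" by (auto simp: Tri_def)
  ultimately show ?thesis by simp
qed

abbreviation "num_exp \<equiv> Inp (Pl (Ti (Num 2) (Pl (Ti (Var 13) (Var 0)) (Var 14))) (Num 2))"
abbreviation "den_exp \<equiv> Inp (Pl (Ti (Num 2) (Pl (Ti (Var 13) (Var 0)) (Var 14))) (Num 3))"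

text \<open>By repeated squaring the variables 4, 3, 5, 7, 8 receive the step length
  \<open>n ^ 10\<close>, the scale \<open>N = n ^ 18\<close>, the tolerance
  \<open>2 * n ^ 10\<close>, the exponent \<open>2 * n * N\<close> and the number of rounds
  \<open>n * n * N * N + 1\<close>. Variable 9 starts the product of the denominators.\<close>

definition consts_com :: com where
  "consts_com = Asg 21 (Ti (Var 0) (Var 0)) ;; Asg 22 (Ti (Var 21) (Var 21)) ;; Asg 22 (Ti (Var 22) (Var 22)) ;;
    Asg 4 (Ti (Var 22) (Var 21)) ;; Asg 22 (Ti (Var 22) (Var 22)) ;; Asg 3 (Ti (Var 22) (Var 21)) ;;
    Asg 5 (Ti (Num 2) (Var 4)) ;; Asg 7 (Ti (Num 2) (Ti (Var 0) (Var 3))) ;;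
    Asg 8 (Pl (Ti (Ti (Var 21) (Var 3)) (Var 3)) (Num 1)) ;; Asg 9 (Num 1)"

text \<open>Scaling by the product of all denominators makes the weights integral, since each
  denominator divides it exactly. Variable 6 accumulates the total weight over ordered
  pairs.\<close>

definition fill_body :: com where
  "fill_body = Asg 16 (Ti num_exp (Qu (Var 9) den_exp)) ;; Put 1 (Var 13) (Var 14) (Var 16) ;;
     Put 1 (Var 14) (Var 13) (Var 16) ;; Asg 6 (Pl (Var 6) (Ti (Num 2) (Var 16)))"

definition program :: com where
  "program = consts_com ;; tri (Asg 9 (Ti (Var 9) den_exp)) ;; Asg 6 (Num 0) ;; tri fill_body ;; search"

lemma wfc_program: "wfc program"
  by (simp add: program_def consts_com_def fill_body_def search_def best_com_def rounding_def improve_def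
      score_body_def rank_body_def value_body_def diag_com_def all_com_def entry_body_def weight_com_def
      psd_com_def power_com_def power_body_def mult_body_def wfx_def)

lemma sum_Tri:
  fixes h :: "nat \<Rightarrow> nat \<Rightarrow> nat"
  shows "(\<Sum>i<n. \<Sum>j<n. if j < i then h i j else if i < j then h j i else 0) = (\<Sum>(i, j)\<in>Tri n. 2 * h i j)"
proof -
  have "(\<Sum>i<n. \<Sum>j<n. if j < i then h i j else if i < j then h j i else 0)
      = (\<Sum>i<n. \<Sum>j<n. if j < i then h i j else 0) + (\<Sum>i<n. \<Sum>j<n. if i < j then h j i else 0)"
    unfolding sum.distrib[symmetric] by (intro sum.cong) auto
  also have "(\<Sum>i<n. \<Sum>j<n. if i < j then h j i else 0) = (\<Sum>j<n. \<Sum>i<n. if i < j then h j i else 0)" by (rule sum.swap)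
  also have "(\<Sum>i<n. \<Sum>j<n. if j < i then h i j else 0) = (\<Sum>(i, j)\<in>Tri n. h i j)"
  proof -
    have "(\<Sum>i<n. \<Sum>j<n. if j < i then h i j else 0) = (\<Sum>(i, j)\<in>{..<n} \<times> {..<n}. if j < i then h i j else 0)"
      by (rule sum.cartesian_product)
    also have "\<dots> = (\<Sum>(i, j)\<in>Tri n. h i j)"
      by (rule sum.mono_neutral_cong_right) (auto simp: Tri_def split: if_splits)
    finally show ?thesis .
  qed
  finally show ?thesis by (simp add: case_prod_unfold sum_distrib_left mult_2 sum.distrib)
qed

section \<open>Size estimates for an actual input\<close>

declare One_nat_def [simp]

locale instance_input =
  fixes n k :: nat and w :: "nat \<Rightarrow> nat \<Rightarrow> rat"
  assumes n1000: "1000 < n" and wg: "wgraph {..<n} (real_weights w)"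
begin

definition "z = input_size n k w"
definition "D0 = (2::nat) ^ z"
definition "Q = (2::nat) ^ (z ^ 21)"
definition "num i j = nat (fst (quotient_of (w i j)))"
definition "den i j = nat (snd (quotient_of (w i j)))"
definition "D = (\<Prod>(i, j)\<in>Tri n. den i j)"
definition "w0 i j = num i j * (D div den i j)"
definition "W i j = (if j < i then w0 i j else if i < j then w0 j i else 0)"
definition "S = (\<Sum>i<n. \<Sum>j<n. W i j)"
definition "wb = D0 ^ (n * n + 1)"

lemma den_pos: "1 \<le> den i j"
  using quotient_of_denom_pos'[of "w i j"] by (simp add: den_def)

lemma num_den: "real (num i j) = real (den i j) * real_of_rat (w i j)"
proof -
  have w0: "0 \<le> w i j" using wg by (simp add: wgraph_def)
  obtain p q where pq: "quotient_of (w i j) = (p, q)" by (cases "quotient_of (w i j)")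
  have q: "0 < q" using quotient_of_denom_pos[OF pq] .
  have e: "w i j = rat_of_int p / rat_of_int q" by (rule quotient_of_div[OF pq])
  then have p: "0 \<le> p" using w0 q by (simp add: zero_le_divide_iff)
  have "real_of_rat (w i j) = real_of_int p / real_of_int q" unfolding e by (simp add: of_rat_divide)
  then show ?thesis using p q by (simp add: num_def den_def pq)
qed

lemma D_pos: "0 < D"
proof -
  have "\<forall>x\<in>Tri n. (case x of (i, j) \<Rightarrow> den i j) \<noteq> 0" using den_pos by (auto simp: One_nat_def Suc_le_eq)
  then have "D \<noteq> 0" unfolding D_def using finite_Tri by (subst prod_zero_iff) auto
  then show ?thesis by simp
qed

lemma real_w0:
  assumes "(i, j) \<in> Tri n"
  shows "real (w0 i j) = real D * real_of_rat (w i j)"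
proof -
  have "den i j dvd D" unfolding D_def using dvd_prodI[OF finite_Tri assms, of "\<lambda>(i, j). den i j"] by simp
  then have "real (D div den i j) = real D / real (den i j)" by (simp add: real_of_nat_div)
  moreover have "real (den i j) \<noteq> 0" using den_pos[of i j] by simp
  ultimately show ?thesis unfolding w0_def by (simp add: num_den)
qed

lemma real_W:
  assumes "i < n" "j < n"
  shows "real (W i j) = real D * real_of_rat (w i j)"
proof -
  have "w i i = 0" "w j i = w i j" using wg by (simp_all add: wgraph_def)
  then show ?thesis using assms real_w0[of i j] real_w0[of j i] by (cases i j rule: linorder_cases) (auto simp: W_def Tri_def)
qed

lemma input_cell:
  assumes "i < n" "j < n"
  shows "input_memory n k w (2 * (i * n + j) + 2) = num i j" "input_memory n k w (2 * (i * n + j) + 3) = den i j"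
    "2 * (i * n + j) + 3 < input_length n"
proof -
  have "i * n + j < n * n"
  proof -
    have "i * n + j < i * n + n" using assms by simp
    also have "\<dots> = (i + 1) * n" by (simp add: add_mult_distrib)
    also have "\<dots> \<le> n * n" using assms by (intro mult_right_mono) auto
    finally show ?thesis .
  qed
  then show l: "2 * (i * n + j) + 3 < input_length n" by (simp add: input_length_def)
  have d: "(i * n + j) div n = i" "(i * n + j) mod n = j" using assms by auto
  have e: "(2 * (i * n + j) + 3 - 2) div 2 = i * n + j" "(2 * (i * n + j) + 2 - 2) div 2 = i * n + j" by auto
  show "input_memory n k w (2 * (i * n + j) + 2) = num i j"
    using l unfolding input_memory_def Let_def e d by (simp add: num_def)
  show "input_memory n k w (2 * (i * n + j) + 3) = den i j"
    using l unfolding input_memory_def Let_def e d by (simp add: den_def)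
qed

lemma z_ge: "2 * (n * n) + 2 \<le> z" using input_length_le_size[of n k w] by (simp add: z_def input_length_def)

lemma cell_D0: "input_memory n k w a \<le> D0"
  using input_memory_bound[of n k w a] by (simp add: D0_def z_def)

lemma nD0: "n \<le> D0" "k \<le> D0" using cell_D0[of 0] cell_D0[of 1] by (simp_all add: input_memory_def)

lemma D0_2: "2 \<le> D0"
  using n1000 nD0 by simp

text \<open>All sizes are measured as powers of \<open>D0\<close>, which bounds every number in the
  input; \<open>mul2\<close>, \<open>add2\<close> and \<open>up\<close> then reduce each estimate to
  one for exponents.\<close>

lemma Q_pow: "m \<le> z ^ 20 \<Longrightarrow> D0 ^ m \<le> Q"
proof -
  assume "m \<le> z ^ 20"
  then have "z * m \<le> z * z ^ 20" by (rule mult_le_mono2)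
  also have "\<dots> = z ^ 21" using power_Suc[of z 20] by simp
  finally have "(2::nat) ^ (z * m) \<le> 2 ^ (z ^ 21)" by (intro power_increasing) auto
  then show ?thesis by (simp add: D0_def Q_def power_mult)
qed

lemma z_self: "z \<le> z ^ 20" using z_ge by (intro self_le_power) auto

lemma nn_ge: "1000 * n \<le> n * n" using n1000 by (intro mult_right_mono) auto

lemma Q_pow': "m \<le> n * n + 100 \<Longrightarrow> D0 ^ m \<le> Q"
  using z_ge z_self nn_ge n1000 by (intro Q_pow) linarith

lemma pow_n: "n ^ m \<le> D0 ^ m" using nD0 by (intro power_mono) auto

lemma D_le: "D \<le> D0 ^ (n * n)"
proof -
  have "D \<le> (\<Prod>(i, j)\<in>Tri n. D0)" unfolding D_def
  proof (rule prod_mono, clarify)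
    fix i j assume "(i, j) \<in> Tri n"
    then have "i < n" "j < n" by (auto simp: Tri_def)
    then show "0 \<le> den i j \<and> den i j \<le> D0" using input_cell(2) cell_D0[of "2 * (i * n + j) + 3"] by simp
  qed
  also have "\<dots> = D0 ^ card (Tri n)" by simp
  also have "\<dots> \<le> D0 ^ (n * n)"
  proof (rule power_increasing)
    have "card (Tri n) \<le> card ({..<n} \<times> {..<n})" by (rule card_mono) (auto simp: Tri_def)
    then show "card (Tri n) \<le> n * n" by (simp add: card_cartesian_product)
  qed (use D0_2 in simp)
  finally show ?thesis .
qed

lemma w0_le: "(i, j) \<in> Tri n \<Longrightarrow> w0 i j \<le> wb"
proof -
  assume "(i, j) \<in> Tri n"
  then have "i < n" "j < n" by (auto simp: Tri_def)
  then have "num i j \<le> D0" using input_cell(1) cell_D0[of "2 * (i * n + j) + 2"] by simp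
  moreover have "D div den i j \<le> D0 ^ (n * n)" using D_le div_le_dividend order_trans by blast
  ultimately have "w0 i j \<le> D0 * D0 ^ (n * n)" unfolding w0_def by (rule mult_le_mono)
  then show ?thesis by (simp add: wb_def)
qed

lemma W_le: "i < n \<Longrightarrow> j < n \<Longrightarrow> W i j \<le> wb"
  using w0_le[of i j] w0_le[of j i] by (auto simp: W_def Tri_def)

lemma mul2: "a \<le> D0 ^ p \<Longrightarrow> c \<le> D0 ^ q \<Longrightarrow> a * c \<le> D0 ^ (p + q)"
  unfolding power_add by (rule mult_le_mono)

lemma add2: "a \<le> D0 ^ p \<Longrightarrow> c \<le> D0 ^ p \<Longrightarrow> a + c \<le> D0 ^ (p + 1)"
proof -
  assume "a \<le> D0 ^ p" "c \<le> D0 ^ p"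
  then have "a + c \<le> 2 * D0 ^ p" by simp
  also have "\<dots> \<le> D0 * D0 ^ p" using D0_2 by (intro mult_right_mono) auto
  finally show ?thesis by simp
qed

lemma up: "a \<le> D0 ^ p \<Longrightarrow> p \<le> q \<Longrightarrow> a \<le> D0 ^ q"
  using power_increasing[of p q D0] D0_2 by linarith

text \<open>\<open>n ^ 19 * 40\<close> is the exponent of \<open>D0\<close> in the bound for the
  matrix power: a base of at most \<open>D0 ^ 20\<close> raised to \<open>2 * n ^ 19\<close>. The
  summand 20 pays for the factors \<open>n * n * N\<close>.\<close>

lemma lt: "n ^ 19 * 40 + 20 \<le> z ^ 20"
proof -
  have "40 * n ^ 19 + 20 \<le> n ^ 20"
  proof -
    have "1 \<le> n ^ 19" using n1000 by (intro one_le_power) simp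
    then have "40 * n ^ 19 + 20 \<le> 1000 * n ^ 19" by linarith
    also have "\<dots> \<le> n * n ^ 19" using n1000 by (intro mult_right_mono) auto
    also have "\<dots> = n ^ 20" using power_Suc[of n 19] by simp
    finally show ?thesis .
  qed
  also have "n ^ 20 \<le> z ^ 20" using z_ge nn_ge by (intro power_mono) linarith+
  finally show ?thesis by (simp add: mult.commute)
qed

sublocale params3 n Q "z ^ 38" k "n ^ 18" "n ^ 10" "2 * n ^ 10" S "2 * (n * n ^ 18)" "n * n * n ^ 18 * n ^ 18 + 1" wb W "input_length n"
proof
  have zn: "n + 1 \<le> z" using z_ge nn_ge n1000 by linarith
  have z38: "z \<le> z ^ 38" using zn by (intro self_le_power) auto
  have nD: "n \<le> D0 ^ 1" and kD: "k \<le> D0 ^ 1" and wD: "wb \<le> D0 ^ (n * n + 1)" and oD: "1 \<le> D0 ^ 0" and o1: "1 \<le> D0 ^ 1" and two: "2 \<le> D0 ^ 1"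
    using nD0 D0_2 by (simp_all add: wb_def)
  \<comment> \<open>The number of rounds for one target is \<open>n ^ 38 + 1\<close>; this fixes the
    exponent 38 in the loop bound.\<close>
  have e38: "n * n * n ^ 18 * n ^ 18 = n ^ 38"
    by (simp only: power2_eq_square[symmetric] power_add[symmetric]) simp
  have e19: "n * n ^ 18 = n ^ 19" using power_Suc[of n 18] by simp
  show "0 < n" using n1000 by simp
  show "n \<le> z ^ 38" using zn z38 by linarith
  show "n \<le> Q" by (rule order_trans[OF nD Q_pow']) simp
  show "W i j \<le> wb" if "i < n" "j < n" for i j by (rule W_le[OF that])
  have nw: "n * wb \<le> D0 ^ (n * n + 2)" using mul2[OF nD wD] by (simp add: add_ac numeral_eq_Suc)
  have nw1: "1 + n * wb \<le> D0 ^ (n * n + 3)"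
    using add2[OF up[OF o1, of "n * n + 2"] nw] by (simp add: add_ac numeral_eq_Suc)
  have "(1 + n * wb) * n \<le> D0 ^ (n * n + 3 + 1)" by (rule mul2[OF nw1 nD])
  then have "(1 + n * wb) * n + n \<le> D0 ^ (n * n + 3 + 1 + 1)" by (rule add2[OF _ up[OF nD]]) simp
  then show "(1 + n * wb) * n + n \<le> Q" using Q_pow'[of "n * n + 3 + 1 + 1"] by simp
  have "n * n * wb \<le> D0 ^ (1 + 1 + (n * n + 1))" by (rule mul2[OF mul2[OF nD nD] wD])
  moreover have "1 \<le> D0 ^ (1 + 1 + (n * n + 1))" by (rule up[OF o1]) simp
  ultimately have "1 + n * n * wb \<le> D0 ^ (1 + 1 + (n * n + 1) + 1)" by (intro add2)
  then show "1 + n * n * wb \<le> Q" using Q_pow'[of "1 + 1 + (n * n + 1) + 1"] by simp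
  show "k \<le> Q" by (rule order_trans[OF kD Q_pow']) simp
  have "n * n * n ^ 18 \<le> D0 ^ (1 + 1 + 18)" by (rule mul2[OF mul2[OF nD nD] pow_n])
  then show "n * n * n ^ 18 \<le> Q" using Q_pow'[of "1 + 1 + 18"] by simp
  have "n * n * (wb * n ^ 18) \<le> D0 ^ (1 + 1 + (n * n + 1 + 18))" by (rule mul2[OF mul2[OF nD nD] mul2[OF wD pow_n]])
  then show "n * n * (wb * n ^ 18) \<le> Q" using Q_pow'[of "1 + 1 + (n * n + 1 + 18)"] by simp
  have "2 * n * n ^ 18 \<le> D0 ^ (1 + 1 + 18)" by (rule mul2[OF mul2[OF two nD] pow_n])
  then have "2 * n * n ^ 18 \<le> D0 ^ 20" by simp
  then have "(2 * n * n ^ 18) ^ (2 * (n * n ^ 18)) \<le> (D0 ^ 20) ^ (2 * (n * n ^ 18))" by (rule power_mono) simp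
  then have "(2 * n * n ^ 18) ^ (2 * (n * n ^ 18)) \<le> D0 ^ (20 * (2 * (n * n ^ 18)))" by (simp only: power_mult)
  then have "n * n * ((2 * n * n ^ 18) ^ (2 * (n * n ^ 18)) * n ^ 18) \<le> D0 ^ (1 + 1 + (20 * (2 * (n * n ^ 18)) + 18))"
    by (intro mul2 nD pow_n)
  moreover have "1 + 1 + (20 * (2 * (n * n ^ 18)) + 18) \<le> z ^ 20" unfolding e19 using lt by simp
  ultimately show "n * n * ((2 * n * n ^ 18) ^ (2 * (n * n ^ 18)) * n ^ 18) \<le> Q" using Q_pow order_trans by blast
  show "0 < n ^ 18" using n1000 by simp
  have n38: "n ^ 38 + 1 \<le> z ^ 38"
  proof -
    have "n ^ 38 + 1 \<le> (n + 1) ^ 38"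
    proof -
      have "n ^ 38 < (n + 1) ^ 38" by (rule power_strict_mono) auto
      then show ?thesis by simp
    qed
    also have "\<dots> \<le> z ^ 38" using zn by (intro power_mono) auto
    finally show ?thesis .
  qed
  have n1838: "n ^ 18 \<le> n ^ 38" "n ^ 20 \<le> n ^ 38" using n1000 by (intro power_increasing; simp)+
  have n1920: "2 * n ^ 19 \<le> n ^ 20" using n1000 power_Suc[of n 19] mult_right_mono[of 2 n "n ^ 19"] by simp
  show "2 * (n * n ^ 18) \<le> z ^ 38" unfolding e19 using n38 n1838 n1920 by linarith
  have Q38: "n ^ 38 + 1 \<le> Q"
  proof -
    have "n ^ 38 + 1 \<le> D0 ^ (38 + 1)" by (rule add2[OF pow_n up[OF oD]]) simp
    then show ?thesis using Q_pow'[of "38 + 1"] by simp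
  qed
  show "2 * (n * n ^ 18) \<le> Q" unfolding e19 using Q38 n1838 n1920 by linarith
  show "n ^ 18 + 1 \<le> z ^ 38" "n ^ 18 + 1 \<le> Q" using n38 Q38 n1838 by linarith+
  show "n * n * n ^ 18 * n ^ 18 + 1 \<le> z ^ 38" "n * n * n ^ 18 * n ^ 18 + 1 \<le> Q" unfolding e38 using n38 Q38 by simp_all
  show "2 * n \<le> input_length n" using nn_ge unfolding input_length_def by linarith
  show "60 \<le> n" using n1000 by simp
qed

lemma powQ: "m \<le> 40 \<Longrightarrow> n ^ m \<le> Q" "m \<le> 40 \<Longrightarrow> 2 * n ^ m \<le> Q" "m \<le> 40 \<Longrightarrow> n ^ m + 1 \<le> Q"
proof -
  assume m: "m \<le> 40"
  have one: "1 \<le> n ^ m" using n1000 by (intro one_le_power) simp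
  have "n ^ m + n ^ m \<le> D0 ^ (m + 1)" by (rule add2[OF pow_n pow_n])
  also have "\<dots> \<le> Q" using m by (intro Q_pow') simp
  finally have "n ^ m + n ^ m \<le> Q" .
  then show "n ^ m \<le> Q" "2 * n ^ m \<le> Q" "n ^ m + 1 \<le> Q" using one by linarith+
qed

lemma consts_ok:
  assumes v: "vr s 0 = n"
  shows "ok Q (z ^ 38) consts_com s \<and> sem consts_com s = setv 9 1 (setv 8 (n * n * n ^ 18 * n ^ 18 + 1) (setv 7 (2 * (n * n ^ 18))
    (setv 5 (2 * n ^ 10) (setv 3 (n ^ 18) (setv 22 (n ^ 16) (setv 4 (n ^ 10) (setv 22 (n ^ 8) (setv 22 (n ^ 4) (setv 21 (n * n) s)))))))))"
proof -
  have p: "n ^ 2 * n ^ 2 = n ^ 4" "n ^ 4 * n ^ 4 = n ^ 8" "n ^ 8 * n ^ 2 = n ^ 10" "n ^ 8 * n ^ 8 = n ^ 16" "n ^ 16 * n ^ 2 = n ^ 18"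
    "n ^ 2 * n ^ 18 * n ^ 18 = n ^ 38"
    by (simp_all flip: power_add)
  have p': "n * n = n ^ 2" "n * n ^ 18 = n ^ 19" using power_Suc[of n 18] by (simp_all add: power2_eq_square)
  note q = powQ(1)[of 2] powQ(1)[of 4] powQ(1)[of 8] powQ(1)[of 10] powQ(1)[of 16] powQ(1)[of 18] powQ(2)[of 10] powQ(2)[of 19] powQ(3)[of 38] powQ(1)[of 0]
  show ?thesis unfolding consts_com_def sem.simps(1-5) ok.simps(1-5) eval.simps eok.simps binop_val.simps set_simps
    using q by (simp add: v p p')
qed

lemma program_ok:
  "ok Q (z ^ 38) program (initial n k w) \<and>
    (\<exists>v X. (\<forall>i<n. ar (sem program (initial n k w)) 5 0 i = topk n k (score n (n ^ 18) W X) i) \<and> v = wt X \<and>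
       (\<forall>g\<le>n ^ 18. \<exists>Xs. traj g (n * n * n ^ 18 * n ^ 18 + 1) v Xs)) \<and>
    (\<forall>i<n. (60 \<le> i \<longrightarrow> io (sem program (initial n k w)) i = ar (sem program (initial n k w)) 5 0 i) \<and>
       io (sem program (initial n k w)) (n + i) = ar (sem program (initial n k w)) 5 0 i)"
proof -
  let ?s = "initial n k w" and ?K = "z ^ 38"
  have v: "vr ?s 0 = n" "vr ?s 1 = k" "vr ?s 2 = input_length n" by (simp_all add: initial_def input_memory_def)
  have io: "io ?s = input_memory n k w" and ar0: "ar ?s = (\<lambda>_ _ _. 0)" by (simp_all add: initial_def)
  note cs = consts_ok[OF v(1)]
  define s1 where "s1 = sem consts_com ?s"
  have v1: "vr s1 0 = n" "vr s1 1 = k" "vr s1 2 = input_length n" "vr s1 3 = n ^ 18" "vr s1 4 = n ^ 10" "vr s1 5 = 2 * n ^ 10"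
    "vr s1 7 = 2 * (n * n ^ 18)" "vr s1 8 = n * n * n ^ 18 * n ^ 18 + 1" "vr s1 9 = 1" "io s1 = input_memory n k w" "ar s1 = (\<lambda>_ _ _. 0)"
    unfolding s1_def conjunct2[OF cs] using v io ar0 by simp_all
  \<comment> \<open>A row index above 0 puts the cell behind position \<open>2 * n\<close>, beyond
    all registers.\<close>
  have cell: "60 \<le> 2 * (i * n + j) + 2" "2 * (i * n + j) + 3 < input_length n" "io s1 (2 * (i * n + j) + 2) = num i j" "io s1 (2 * (i * n + j) + 3) = den i j"
    if "i < n" "j < i" for i j
  proof -
    have "n \<le> i * n" using that by simp
    then have "60 \<le> i * n" using n1000 by linarith
    then show "60 \<le> 2 * (i * n + j) + 2" by simp
    have j: "j < n" using that by simp
    show "2 * (i * n + j) + 3 < input_length n" "io s1 (2 * (i * n + j) + 2) = num i j" "io s1 (2 * (i * n + j) + 3) = den i j"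
      using input_cell[OF that(1) j] v1 by simp_all
  qed
  let ?c2 = "Asg 9 (Ti (Var 9) den_exp)"
  let ?I = "\<lambda>P s'. unch {9, 13, 14} {} s1 s' \<and> vr s' 9 = (\<Prod>(i, j)\<in>P. den i j)"
  have 2: "ok Q ?K (tri ?c2) s1 \<and> ?I (Tri n) (sem (tri ?c2) s1)"
  proof (rule tri_rule[where Inv = ?I])
    show "?I {} s1" using v1 by simp
    show "?I P (setv 13 i s')" if "?I P s'" for P s' i using that unch_setv[of "{9, 13, 14}" "{}" s1 s' 13 i] by simp
    show "?I P (setv 14 i s')" if "?I P s'" for P s' i using that unch_setv[of "{9, 13, 14}" "{}" s1 s' 14 i] by simp
  next
    fix i j P s' assume a: "i < n" "j < i" "(i, j) \<notin> P" "P \<subseteq> Tri n" "?I P s'" "vr s' 13 = i" "vr s' 14 = j"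
    have u: "unch {9, 13, 14} {} s1 s'" using a(5) by simp
    have w: "vr s' 0 = n" "vr s' 2 = input_length n" "io s' = io s1" using unch_vr[OF u, of 0] unch_vr[OF u, of 2] u v1 by (simp_all add: unch_def)
    have fin: "finite P" using a(4) finite_Tri by (rule finite_subset)
    have pr: "vr s' 9 * den i j = (\<Prod>(i, j)\<in>insert (i, j) P. den i j)" using a(3,5) fin by (simp add: mult.commute)
    have "(\<Prod>(i, j)\<in>insert (i, j) P. den i j) dvd D" unfolding D_def
      using a finite_Tri by (intro prod_dvd_prod_subset) (auto simp: Tri_def)
    then have "(\<Prod>(i, j)\<in>insert (i, j) P. den i j) \<le> D" using D_pos by (rule dvd_imp_le)
    also have "D \<le> Q" using D_le Q_pow'[of "n * n"] by simp
    finally have q: "vr s' 9 * den i j \<le> Q" unfolding pr .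
    have ev: "eval den_exp s' = den i j" "eok den_exp s'" using cell[OF a(1,2)] w a(6,7) by simp_all
    have se: "sem ?c2 s' = setv 9 (vr s' 9 * den i j) s'" by (simp only: sem.simps eval.simps(2,3) ev binop_val.simps)
    have "ok Q ?K ?c2 s'" by (simp only: ok.simps eok.simps(2,3) eval.simps(2,3) ev binop_val.simps q simp_thms)
    moreover have "unch {9, 13, 14} {} s1 (sem ?c2 s')" unfolding se by (rule unch_setv[OF u]) simp
    ultimately show "ok Q ?K ?c2 s' \<and> ?I (insert (i, j) P) (sem ?c2 s')" unfolding se using pr by simp
  qed (use v1 in simp_all)
  define s2 where "s2 = sem (tri ?c2) s1"
  have ok2: "ok Q ?K (tri ?c2) s1" and u2: "unch {9, 13, 14} {} s1 s2" and d2: "vr s2 9 = D"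
    using 2 unfolding s2_def[symmetric] D_def by simp_all
  define s3 where "s3 = setv 6 0 s2"
  have u3: "unch {6, 9, 13, 14} {} s1 s3" unfolding s3_def by (rule unch_setv[OF unch_mono[OF u2]]) auto
  have v3: "vr s3 0 = n" "vr s3 9 = D" "vr s3 6 = 0" "ar s3 1 = (\<lambda>_ _. 0)"
    using unch_vr[OF u3, of 0] unch_ar[OF u3, of 1] v1 d2 by (simp_all add: s3_def)
  let ?V = "{6, 9, 13, 14, 16} :: nat set"
  let ?I = "\<lambda>P s'. unch ?V {1} s1 s' \<and> vr s' 9 = D \<and> (\<forall>(i, j)\<in>P. ar s' 1 i j = w0 i j \<and> ar s' 1 j i = w0 i j) \<and>
     (\<forall>i. ar s' 1 i i = 0) \<and> vr s' 6 = (\<Sum>(i, j)\<in>P. 2 * w0 i j)"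
  have Ssum: "S = (\<Sum>(i, j)\<in>Tri n. 2 * w0 i j)" unfolding S_def W_def by (rule sum_Tri)
  have SQ: "S \<le> Q"
  proof -
    have "S \<le> (\<Sum>i<n. \<Sum>j<n. wb)" unfolding S_def using W_le by (intro sum_mono) auto
    also have "\<dots> = n * n * wb" by simp
    finally show ?thesis using q2 by linarith
  qed
  have wbQ: "wb \<le> Q" unfolding wb_def by (rule Q_pow') simp
  have 4: "ok Q ?K (tri fill_body) s3 \<and> ?I (Tri n) (sem (tri fill_body) s3)"
  proof (rule tri_rule[where Inv = ?I])
    show "?I {} s3" using unch_mono[OF u3, of ?V "{1}"] v3 by auto
    show "13 \<notin> writes fill_body" by (simp add: fill_body_def)
    show "?I P (setv 13 i s')" if "?I P s'" for P s' i using that unch_setv[of ?V "{1}" s1 s' 13 i] by simp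
    show "?I P (setv 14 i s')" if "?I P s'" for P s' i using that unch_setv[of ?V "{1}" s1 s' 14 i] by simp
  next
    fix i j P s' assume a: "i < n" "j < i" "(i, j) \<notin> P" "P \<subseteq> Tri n" "?I P s'" "vr s' 13 = i" "vr s' 14 = j"
    have u: "unch ?V {1} s1 s'" and d: "vr s' 9 = D" using a(5) by simp_all
    have w: "vr s' 0 = n" "vr s' 2 = input_length n" "io s' = io s1" using unch_vr[OF u, of 0] unch_vr[OF u, of 2] u v1 by (simp_all add: unch_def)
    have fin: "finite P" using a(4) finite_Tri by (rule finite_subset)
    have T: "(i, j) \<in> Tri n" using a by (simp add: Tri_def)
    have sm: "vr s' 6 + 2 * w0 i j = (\<Sum>(i, j)\<in>insert (i, j) P. 2 * w0 i j)" using a(3,5) fin by simp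
    have "(\<Sum>(i, j)\<in>insert (i, j) P. 2 * w0 i j) \<le> S" unfolding Ssum using a(4) T finite_Tri by (intro sum_mono2) auto
    then have q: "vr s' 6 + 2 * w0 i j \<le> Q" unfolding sm using SQ by linarith
    have qw: "w0 i j \<le> Q" using w0_le[OF T] wbQ by linarith
    have ev: "eval den_exp s' = den i j" "eok den_exp s'" "eval num_exp s' = num i j" "eok num_exp s'"
      using cell[OF a(1,2)] w a(6,7) by simp_all
    let ?t1 = "setv 16 (w0 i j) s'"
    let ?t = "setv 6 (vr s' 6 + 2 * w0 i j) (seta 1 j i (w0 i j) (seta 1 i j (w0 i j) ?t1))"
    have e1: "sem (Asg 16 (Ti num_exp (Qu (Var 9) den_exp))) s' = ?t1"
      by (simp only: sem.simps eval.simps(2,3) ev binop_val.simps d w0_def)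
    have o1: "ok Q ?K (Asg 16 (Ti num_exp (Qu (Var 9) den_exp))) s'"
      using qw by (simp only: ok.simps eok.simps(2,3) eval.simps(2,3) ev binop_val.simps d w0_def simp_thms)
    have se: "sem fill_body s' = ?t" unfolding fill_body_def sem.simps(4) e1 using a(6,7) by simp
    have ok: "ok Q ?K fill_body s'" unfolding fill_body_def ok.simps(4) sem.simps(4) e1 using o1 a(1,2,6,7) q qw w by simp
    have "unch ?V {1} s1 ?t" by (intro unch_setv unch_seta u) simp_all
    moreover have "\<forall>(i', j')\<in>insert (i, j) P. ar ?t 1 i' j' = w0 i' j' \<and> ar ?t 1 j' i' = w0 i' j'"
    proof (clarify)
      fix i' j' assume "(i', j') \<in> insert (i, j) P"
      then consider "i' = i" "j' = j" | "(i', j') \<in> P" "\<not> (i' = i \<and> j' = j)" "j' < i'" using a(3,4) by (auto simp: Tri_def)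
      then show "ar ?t 1 i' j' = w0 i' j' \<and> ar ?t 1 j' i' = w0 i' j'"
      proof cases
        case 1
        have n: "\<not> (i = j \<and> j = i)" using a(2) by auto
        have "ar (seta 1 i j v t) 1 i j = v" for v t by simp
        then show ?thesis unfolding 1 by (simp only: set_simps(2) seta_other[OF n]) simp
      next
        case 2
        have "\<forall>(i, j)\<in>P. ar s' 1 i j = w0 i j \<and> ar s' 1 j i = w0 i j" using a(5) by (elim conjE)
        then have "ar s' 1 i' j' = w0 i' j' \<and> ar s' 1 j' i' = w0 i' j'" using 2(1) by blast
        moreover have n: "\<not> (i' = j \<and> j' = i)" "\<not> (j' = i \<and> i' = j)" "\<not> (j' = j \<and> i' = i)" using 2(2,3) a(2) by auto
        have "ar ?t 1 i' j' = ar s' 1 i' j'" "ar ?t 1 j' i' = ar s' 1 j' i'"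
          by (simp_all only: set_simps(2) seta_other[OF n(1)] seta_other[OF n(2)] seta_other[OF n(3)] seta_other[OF 2(2)])
        ultimately show ?thesis by (simp only: simp_thms)
      qed
    qed
    moreover have "\<forall>i'. ar ?t 1 i' i' = 0"
    proof -
      have z: "\<forall>i. ar s' 1 i i = 0" using a(5) by (elim conjE)
      have n: "\<not> (i' = i \<and> i' = j)" "\<not> (i' = j \<and> i' = i)" for i' using a(2) by auto
      show ?thesis using z by (simp only: set_simps(2) seta_other[OF n(1)] seta_other[OF n(2)] simp_thms)
    qed
    moreover have "vr ?t 9 = D" "vr ?t 6 = (\<Sum>(i, j)\<in>insert (i, j) P. 2 * w0 i j)" using d sm by (simp_all del: sum.insert)
    ultimately show "ok Q ?K fill_body s' \<and> ?I (insert (i, j) P) (sem fill_body s')" unfolding se using ok by (intro conjI)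
  qed (use v3 in simp_all)
  define s4 where "s4 = sem (tri fill_body) s3"
  have ok4: "ok Q ?K (tri fill_body) s3" and u4: "unch ?V {1} s1 s4" and w4: "\<And>i j. (i, j) \<in> Tri n \<Longrightarrow> ar s4 1 i j = w0 i j \<and> ar s4 1 j i = w0 i j"
    and z4: "\<And>i. ar s4 1 i i = 0" and S4: "vr s4 6 = S"
    using 4 unfolding s4_def[symmetric] Ssum by auto
  have "ar s4 1 i j = W i j" if "i < n" "j < n" for i j
    using w4[of i j] w4[of j i] z4 that by (cases i j rule: linorder_cases) (auto simp: W_def Tri_def)
  then have env: "env s4" unfolding env_def using v1 S4
      unch_vr[OF u4, of 0] unch_vr[OF u4, of 1] unch_vr[OF u4, of 3] unch_vr[OF u4, of 4] unch_vr[OF u4, of 5] unch_vr[OF u4, of 7] unch_vr[OF u4, of 8]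
    by simp
  have b4: "vr s4 2 = input_length n" using unch_vr[OF u4, of 2] v1 by simp
  note se = search_ok[OF env b4]
  have s3: "sem (Asg 6 (Num 0)) s2 = s3" by (simp add: s3_def)
  have sp: "sem program ?s = sem search s4"
    unfolding program_def sem.simps(4)[of consts_com] sem.simps(4)[of "tri ?c2"] sem.simps(4)[of "Asg 6 (Num 0)"] sem.simps(4)[of "tri fill_body"]
      s1_def[symmetric] s2_def[symmetric] s3 s4_def[symmetric] ..
  have o3: "ok Q ?K (Asg 6 (Num 0)) s2" by simp
  have "ok Q ?K program ?s"
    unfolding program_def ok.simps(4)[of _ _ consts_com] ok.simps(4)[of _ _ "tri ?c2"] ok.simps(4)[of _ _ "Asg 6 (Num 0)"] ok.simps(4)[of _ _ "tri fill_body"]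
      s1_def[symmetric] s2_def[symmetric] s3 s4_def[symmetric]
    using conjunct1[OF cs] ok2 o3 ok4 conjunct1[OF se] by (intro conjI) simp_all
  then show ?thesis unfolding sp using conjunct2[OF se] by (intro conjI) simp_all
qed

text \<open>All that the analysis uses of the program. The iterates belong to the integer weights
  \<open>W\<close>, a common positive multiple of the given ones, so orders of degrees and of
  weights agree.\<close>

lemma program_spec:
  "\<exists>W D v X. 0 < D \<and> (\<forall>i<n. \<forall>j<n. real (W i j) = real D * real_of_rat (w i j)) \<and>
    (\<forall>i<n. ar (sem program (initial n k w)) 5 0 i = topk n k (score n (n ^ 18) W X) i) \<and>
    v = weight_of n W (topk n k (score n (n ^ 18) W X)) \<and>
    (\<forall>g\<le>n ^ 18. \<exists>Xs. (\<forall>i<n. \<forall>j<n. Xs 0 i j = n ^ 18) \<and>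
      (\<forall>l<n * n * n ^ 18 * n ^ 18 + 1. improves n k (n ^ 18) (n ^ 10) (2 * n ^ 10) (\<Sum>i<n. \<Sum>j<n. W i j) (2 * (n * n ^ 18)) W g (Xs l) (Xs (Suc l)) \<and>
         weight_of n W (topk n k (score n (n ^ 18) W (Xs l))) \<le> v \<and> (\<forall>i<n. \<forall>j<n. Xs l i j \<le> n ^ 18)))"
proof -
  obtain v X where vX: "\<forall>i<n. ar (sem program (initial n k w)) 5 0 i = topk n k (score n (n ^ 18) W X) i" "v = wt X"
    "\<forall>g\<le>n ^ 18. \<exists>Xs. traj g (n * n * n ^ 18 * n ^ 18 + 1) v Xs"
    using program_ok by (elim conjE exE) (rule that; assumption)
  have t: "\<exists>Xs. (\<forall>i<n. \<forall>j<n. Xs 0 i j = n ^ 18) \<and>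
      (\<forall>l<n * n * n ^ 18 * n ^ 18 + 1. improves n k (n ^ 18) (n ^ 10) (2 * n ^ 10) (\<Sum>i<n. \<Sum>j<n. W i j) (2 * (n * n ^ 18)) W g (Xs l) (Xs (Suc l)) \<and>
         weight_of n W (topk n k (score n (n ^ 18) W (Xs l))) \<le> v \<and> (\<forall>i<n. \<forall>j<n. Xs l i j \<le> n ^ 18))" if "g \<le> n ^ 18" for g
  proof -
    obtain Xs where Xs: "traj g (n * n * n ^ 18 * n ^ 18 + 1) v Xs" using vX(3) \<open>g \<le> n ^ 18\<close> by blast
    show ?thesis using Xs unfolding traj_def wt_def rng_def unfolding S_def
      by (intro exI[of _ Xs]) (simp add: less_imp_le)
  qed
  show ?thesis using D_pos real_W vX(1,2) t unfolding wt_def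
    by (intro exI[of _ W] exI[of _ D] exI[of _ v] exI[of _ X] conjI allI impI) simp_all
qed

end

section \<open>Spectral bounds\<close>


text \<open>An eigenvalue \<open>z\<close> exists over the complex numbers. The squared norm
  \<open>s\<close> of its eigenvector is real and nonzero, and \<open>z * s\<close>, a value of the
  Hermitian form, is its own conjugate; hence \<open>z\<close> is real and a root of the real
  characteristic polynomial.\<close>

lemma real_symmetric_has_eigenvalue:
  fixes A :: "real mat"
  assumes A: "A \<in> carrier_mat n n" and n: "n \<noteq> 0"
    and sym: "\<And>i j. i < n \<Longrightarrow> j < n \<Longrightarrow> A $$ (i, j) = A $$ (j, i)"
  shows "\<exists>e. eigenvalue A e"
proof -
  let ?c = "complex_of_real"
  let ?C = "map_mat ?c A"
  have C: "?C \<in> carrier_mat n n" using A by auto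
  have "degree (char_poly ?C) = n" using degree_monic_char_poly[OF C] by simp
  then have "\<not> constant (poly (char_poly ?C))" using n by (simp add: constant_degree)
  from fundamental_theorem_of_algebra[OF this]
  obtain z where z: "poly (char_poly ?C) z = 0" by blast
  then have "eigenvalue ?C z" using eigenvalue_root_char_poly[OF C] by simp
  then obtain v where v: "v \<in> carrier_vec n" "v \<noteq> 0\<^sub>v n" "?C *\<^sub>v v = z \<cdot>\<^sub>v v"
    unfolding eigenvalue_def eigenvector_def using A by auto
  have ev: "(\<Sum>j<n. ?c (A $$ (i, j)) * v $ j) = z * v $ i" if "i < n" for i
  proof -
    have "(?C *\<^sub>v v) $ i = (\<Sum>j<n. ?c (A $$ (i, j)) * v $ j)"
      using that A v(1) by (simp add: scalar_prod_def lessThan_atLeast0)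
    then show ?thesis using v that by simp
  qed
  define s where "s = (\<Sum>i<n. cnj (v $ i) * v $ i)"
  have s1: "z * s = (\<Sum>i<n. \<Sum>j<n. ?c (A $$ (i, j)) * (cnj (v $ i) * v $ j))"
    unfolding s_def sum_distrib_left
  proof (intro sum.cong refl)
    fix i assume "i \<in> {..<n}"
    then have "z * (cnj (v $ i) * v $ i) = cnj (v $ i) * (\<Sum>j<n. ?c (A $$ (i, j)) * v $ j)"
      using ev[of i] by simp
    then show "z * (cnj (v $ i) * v $ i) = (\<Sum>j<n. ?c (A $$ (i, j)) * (cnj (v $ i) * v $ j))"
      by (simp add: sum_distrib_left mult_ac)
  qed
  have "cnj (z * s) = (\<Sum>i<n. \<Sum>j<n. ?c (A $$ (i, j)) * (v $ i * cnj (v $ j)))"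
    unfolding s1 by (simp add: cnj_sum)
  also have "\<dots> = (\<Sum>j<n. \<Sum>i<n. ?c (A $$ (i, j)) * (v $ i * cnj (v $ j)))"
    by (rule sum.swap)
  also have "\<dots> = z * s" unfolding s1 using sym
    by (intro sum.cong) (auto simp: mult_ac)
  finally have "cnj z * cnj s = z * s" by simp
  moreover have "cnj s = s" unfolding s_def by (simp add: cnj_sum mult.commute)
  moreover have "s \<noteq> 0"
  proof
    assume "s = 0"
    have "s = of_real (\<Sum>i<n. (cmod (v $ i))\<^sup>2)" unfolding s_def
      by (simp add: complex_norm_square mult.commute del: of_real_power)
    then have "(\<Sum>i<n. (cmod (v $ i))\<^sup>2) = 0" using \<open>s = 0\<close> by (metis of_real_eq_0_iff)
    then have "\<forall>i<n. v $ i = 0" by (subst (asm) sum_nonneg_eq_0_iff) auto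
    then have "v = 0\<^sub>v n" using v(1) by (intro eq_vecI) auto
    then show False using v by simp
  qed
  ultimately have "cnj z = z" by simp
  then have zr: "z = ?c (Re z)" by (simp add: complex_eq_iff)
  have "poly (char_poly ?C) z = ?c (poly (char_poly A) (Re z))"
    unfolding of_real_hom.char_poly_hom[OF A] by (subst zr) (rule of_real_hom.poly_map_poly)
  then have "poly (char_poly A) (Re z) = 0" using z by simp
  then show ?thesis using eigenvalue_root_char_poly[OF A] by blast
qed

text \<open>Completion to a basis, Gram-Schmidt and normalisation of the columns; Gram-Schmidt keeps
  the first vector, so the first column is a multiple of \<open>v\<close>.\<close>

lemma orthogonal_completion:
  fixes v :: "real vec"
  assumes v: "v \<in> carrier_vec n" and v0: "v \<noteq> 0\<^sub>v n" and n: "n \<noteq> 0"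
  shows "\<exists>W c. W \<in> carrier_mat n n \<and> W\<^sup>T * W = 1\<^sub>m n \<and> col W 0 = c \<cdot>\<^sub>v v"
proof -
  interpret cof_vec_space n "TYPE(real)" .
  define b where "b = basis_completion v"
  define ws where "ws = gram_schmidt n b"
  from basis_completion[OF v v0, folded b_def]
  have dist_b: "distinct b" and indep: "\<not> lin_dep (set b)" and b: "set b \<subseteq> carrier_vec n"
    and hdb: "hd b = v" and len_b: "length b = n" by auto
  from hdb len_b n obtain vs where bv: "b = v # vs" by (cases b, auto)
  from gram_schmidt_result[OF b dist_b indep refl, folded ws_def]
  have ws: "set ws \<subseteq> carrier_vec n" "corthogonal ws" "length ws = n" by (auto simp: len_b)
  have hdws: "hd ws = v" using gram_schmidt_hd[OF v, of vs, folded bv] unfolding ws_def .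
  have car: "ws ! i \<in> carrier_vec n" if "i < n" for i using ws that by auto
  have orth: "(ws ! i \<bullet> ws ! j = 0) = (i \<noteq> j)" if "i < n" "j < n" for i j
    using corthogonalD[OF ws(2), of i j] that ws(3) by (simp add: conjugate_vec_def vec_eq_iff)
  define r where "r i = sqrt (ws ! i \<bullet> ws ! i)" for i
  have nn: "ws ! i \<bullet> ws ! i \<ge> 0" for i unfolding scalar_prod_def by (auto intro!: sum_nonneg)
  define W where "W = mat n n (\<lambda>(i, j). (ws ! j) $ i / r j)"
  have W: "W \<in> carrier_mat n n" unfolding W_def by auto
  have "W\<^sup>T * W = 1\<^sub>m n"
  proof (rule eq_matI)
    fix i j assume "i < dim_row (1\<^sub>m n)" "j < dim_col (1\<^sub>m n)"
    then have ij: "i < n" "j < n" by auto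
    have "(W\<^sup>T * W) $$ (i, j) = (\<Sum>l<n. (ws ! i) $ l / r i * ((ws ! j) $ l / r j))"
      using ij W unfolding W_def by (simp add: scalar_prod_def lessThan_atLeast0)
    also have "\<dots> = (ws ! i \<bullet> ws ! j) / (r i * r j)"
      using car[OF ij(1)] car[OF ij(2)]
      by (simp add: scalar_prod_def sum_divide_distrib lessThan_atLeast0)
    also have "\<dots> = (if i = j then 1 else 0)"
      using orth[OF ij] orth[OF ij(1) ij(1)] nn[of i] by (auto simp: r_def)
    finally show "(W\<^sup>T * W) $$ (i, j) = 1\<^sub>m n $$ (i, j)" using ij by simp
  qed (auto simp: W_def)
  moreover have "col W 0 = (1 / r 0) \<cdot>\<^sub>v v"
  proof -
    have "ws ! 0 = v" using hd_conv_nth[of ws] hdws ws(3) n by auto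
    then show ?thesis using n v unfolding W_def by (intro eq_vecI) auto
  qed
  ultimately show ?thesis using W by blast
qed

text \<open>Deflation: in an orthonormal basis beginning with an eigenvector the first column of the
  matrix is a multiple of the first unit vector, by symmetry so is the first row, and the remaining
  block is handled by induction.\<close>

lemma real_symmetric_diagonalization:
  fixes A :: "real mat"
  assumes "A \<in> carrier_mat n n"
    and "\<And>i j. i < n \<Longrightarrow> j < n \<Longrightarrow> A $$ (i, j) = A $$ (j, i)"
  shows "\<exists>P D. P \<in> carrier_mat n n \<and> D \<in> carrier_mat n n \<and> P\<^sup>T * P = 1\<^sub>m n \<and>
    diagonal_mat D \<and> A = P * D * P\<^sup>T"
  using assms
proof (induction n arbitrary: A)
  case 0
  then show ?case by (intro exI[of _ "1\<^sub>m 0"] exI[of _ A]) (auto simp: diagonal_mat_def)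
next
  case (Suc n)
  note A = Suc.prems(1)
  have symA: "A\<^sup>T = A" using A Suc.prems(2) by (intro eq_matI) auto
  obtain e where "eigenvalue A e"
    using real_symmetric_has_eigenvalue[OF A _ Suc.prems(2)] by auto
  then obtain v where v: "v \<in> carrier_vec (Suc n)" "v \<noteq> 0\<^sub>v (Suc n)" "A *\<^sub>v v = e \<cdot>\<^sub>v v"
    unfolding eigenvalue_def eigenvector_def using A by auto
  obtain W c where W: "W \<in> carrier_mat (Suc n) (Suc n)" "W\<^sup>T * W = 1\<^sub>m (Suc n)"
    and col0: "col W 0 = c \<cdot>\<^sub>v v"
    using orthogonal_completion[OF v(1,2)] by auto
  have WT: "W\<^sup>T \<in> carrier_mat (Suc n) (Suc n)" using W by auto
  have WW: "W * W\<^sup>T = 1\<^sub>m (Suc n)"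
    using mat_mult_left_right_inverse[OF WT W(1) W(2)] .
  define A' where "A' = W\<^sup>T * (A * W)"
  have AW: "A * W \<in> carrier_mat (Suc n) (Suc n)" using A W by auto
  have A': "A' \<in> carrier_mat (Suc n) (Suc n)" unfolding A'_def using WT AW by auto
  have symA': "A'\<^sup>T = A'"
    unfolding A'_def using A W WT AW
    by (simp add: transpose_mult[OF WT AW] transpose_mult[OF A W(1)] symA assoc_mult_mat[OF WT A W(1)])
  have "col A' 0 = W\<^sup>T *\<^sub>v (A *\<^sub>v col W 0)"
    unfolding A'_def by (simp add: col_mult2[OF WT AW] col_mult2[OF A W(1)] del: col_mult2)
  also have "A *\<^sub>v col W 0 = e \<cdot>\<^sub>v col W 0"
    unfolding col0 using mult_mat_vec[OF A v(1)] v by (simp add: smult_smult_assoc mult.commute)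
  also have "W\<^sup>T *\<^sub>v (e \<cdot>\<^sub>v col W 0) = e \<cdot>\<^sub>v (W\<^sup>T *\<^sub>v col W 0)"
    using W by (intro mult_mat_vec[OF WT] carrier_vecI) auto
  also have "W\<^sup>T *\<^sub>v col W 0 = col (W\<^sup>T * W) 0"
    by (rule col_mult2[OF WT W(1), symmetric]) simp
  finally have c0: "col A' 0 = e \<cdot>\<^sub>v unit_vec (Suc n) 0" unfolding W(2) by simp
  have A'0: "A' $$ (i, 0) = (if i = 0 then e else 0)" if "i < Suc n" for i
    using arg_cong[OF c0, of "\<lambda>v. v $ i"] A' that by (auto simp: unit_vec_def)
  have A'0': "A' $$ (0, i) = (if i = 0 then e else 0)" if "i < Suc n" for i
  proof -
    have "A' $$ (0, i) = A'\<^sup>T $$ (i, 0)" using A' that by auto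
    then show ?thesis using symA' A'0[OF that] by simp
  qed
  define A3 where "A3 = mat n n (\<lambda>(i, j). A' $$ (Suc i, Suc j))"
  have A3: "A3 \<in> carrier_mat n n" unfolding A3_def by simp
  have "A3 $$ (i, j) = A3 $$ (j, i)" if "i < n" "j < n" for i j
  proof -
    have "A' $$ (Suc i, Suc j) = A'\<^sup>T $$ (Suc j, Suc i)" using A' that by auto
    then show ?thesis using symA' that by (simp add: A3_def)
  qed
  from Suc.IH[OF A3 this] obtain P3 D3 where PD: "P3 \<in> carrier_mat n n" "D3 \<in> carrier_mat n n"
    "P3\<^sup>T * P3 = 1\<^sub>m n" "diagonal_mat D3" "A3 = P3 * D3 * P3\<^sup>T" by blast
  define E where "E = mat 1 1 (\<lambda>_. e)"
  have E: "E \<in> carrier_mat 1 1" by (simp add: E_def)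
  let ?F = "\<lambda>a B. four_block_mat a (0\<^sub>m 1 n) (0\<^sub>m n 1) B"
  have A'blk: "A' = ?F E A3"
    using A' by (intro eq_matI) (auto simp: A3_def A'0 A'0' E_def)
  let ?P = "?F (1\<^sub>m 1) P3" and ?D = "?F E D3"
  have FT: "?P\<^sup>T = ?F (1\<^sub>m 1) P3\<^sup>T"
    by (subst transpose_four_block_mat[of _ 1 1 _ n _ n]) (use PD in auto)
  have mulF: "?F a B * ?F a' B' = ?F (a * a') (B * B')"
    if "a \<in> carrier_mat 1 1" "a' \<in> carrier_mat 1 1" "B \<in> carrier_mat n n" "B' \<in> carrier_mat n n" for a a' B B'
    by (subst mult_four_block_mat[of _ 1 1 _ n _ n _ _ 1 _ n]) (use that in auto)
  have PC: "?P \<in> carrier_mat (Suc n) (Suc n)" "?D \<in> carrier_mat (Suc n) (Suc n)"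
    "?P\<^sup>T \<in> carrier_mat (Suc n) (Suc n)"
    using PD E FT by auto
  have orthP: "?P\<^sup>T * ?P = 1\<^sub>m (Suc n)"
    unfolding FT by (subst mulF) (use PD in auto)
  have A'dec: "A' = ?P * ?D * ?P\<^sup>T"
    unfolding FT A'blk by (subst mulF, (use PD E in auto)[4])+ (use PD E in auto)
  have Adec: "A = W * A' * W\<^sup>T"
  proof -
    have "W * A' = (W * W\<^sup>T) * (A * W)" unfolding A'_def using W WT AW by (simp add: assoc_mult_mat[OF W(1) WT AW])
    also have "\<dots> = A * W" unfolding WW using AW by (rule left_mult_one_mat)
    finally have "W * A' * W\<^sup>T = A * W * W\<^sup>T" by simp
    also have "\<dots> = A * (W * W\<^sup>T)" by (rule assoc_mult_mat[OF A W(1) WT])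
    finally show ?thesis using WW A by simp
  qed
  let ?Q = "W * ?P"
  have Q: "?Q \<in> carrier_mat (Suc n) (Suc n)" using W PC by auto
  have QT: "?Q\<^sup>T = ?P\<^sup>T * W\<^sup>T" by (rule transpose_mult[OF W(1) PC(1)])
  have "?Q\<^sup>T * ?Q = ?P\<^sup>T * (W\<^sup>T * (W * ?P))"
    unfolding QT by (rule assoc_mult_mat[OF PC(3) WT Q])
  also have "W\<^sup>T * (W * ?P) = ?P" using assoc_mult_mat[OF WT W(1) PC(1)] W(2) PC(1) by (metis left_mult_one_mat)
  finally have 1: "?Q\<^sup>T * ?Q = 1\<^sub>m (Suc n)" using orthP by simp
  have PD1: "?P * ?D \<in> carrier_mat (Suc n) (Suc n)" using PC by auto
  have "A = W * (?P * ?D * ?P\<^sup>T) * W\<^sup>T" using Adec A'dec by simp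
  also have "W * (?P * ?D * ?P\<^sup>T) = W * (?P * ?D) * ?P\<^sup>T" 
    using assoc_mult_mat[OF W(1) PD1 PC(3)] by simp
  also have "W * (?P * ?D) = ?Q * ?D" using assoc_mult_mat[OF W(1) PC(1,2)] by simp
  also have "?Q * ?D * ?P\<^sup>T * W\<^sup>T = ?Q * ?D * ?Q\<^sup>T"
    unfolding QT using assoc_mult_mat[OF _ PC(3) WT] Q PC(2) by (metis mult_carrier_mat)
  finally have 2: "A = ?Q * ?D * ?Q\<^sup>T" .
  have "diagonal_mat ?D" using PD(2,4) E unfolding diagonal_mat_def by auto
  then show ?case using 1 2 Q PC by blast
qed

section \<open>Spectral decomposition with multiplicities\<close>

lemma proots_prod_linear: "proots (\<Prod>a\<leftarrow>es. [:- a, 1::real:]) = mset es"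
proof (induction es)
  case (Cons a es)
  have "(\<Prod>a\<leftarrow>es. [:- a, 1::real:]) \<noteq> 0" by auto
  then have "proots ([:- a, 1:] * (\<Prod>a\<leftarrow>es. [:- a, 1::real:])) = proots [:- a, 1:] + mset es"
    using Cons by (subst proots_mult) (auto simp del: mult_pCons_left)
  then show ?case by (simp del: mult_pCons_left)
qed simp

text \<open>The last conjunct ties the numbers \<mu>, with multiplicity, to the roots of the
  characteristic polynomial, the form in which expanders are defined.\<close>

lemma spectral_decomposition:
  fixes a :: "nat \<Rightarrow> nat \<Rightarrow> real"
  assumes sym: "\<And>i j. i < n \<Longrightarrow> j < n \<Longrightarrow> a i j = a j i"
  shows "\<exists>(v :: nat \<Rightarrow> nat \<Rightarrow> real) (\<mu> :: nat \<Rightarrow> real).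
    (\<forall>l<n. \<forall>m<n. (\<Sum>i<n. v l i * v m i) = (if l = m then 1 else 0)) \<and>
    (\<forall>i<n. \<forall>j<n. (\<Sum>l<n. v l i * v l j) = (if i = j then 1 else 0)) \<and>
    (\<forall>i<n. \<forall>j<n. a i j = (\<Sum>l<n. \<mu> l * v l i * v l j)) \<and>
    proots (char_poly (mat n n (\<lambda>(i, j). a i j))) = image_mset \<mu> (mset_set {..<n})"
proof -
  let ?A = "mat n n (\<lambda>(i, j). a i j)"
  have A: "?A \<in> carrier_mat n n" by simp
  obtain P D where P: "P \<in> carrier_mat n n" and D: "D \<in> carrier_mat n n" "diagonal_mat D"
    and PP: "P\<^sup>T * P = 1\<^sub>m n" and dec: "?A = P * D * P\<^sup>T"
    using real_symmetric_diagonalization[OF A] sym by auto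
  have PT: "P\<^sup>T \<in> carrier_mat n n" using P by auto
  have PP': "P * P\<^sup>T = 1\<^sub>m n" using mat_mult_left_right_inverse[OF PT P PP] .
  define v where "v l i = P $$ (i, l)" for l i
  define \<mu> where "\<mu> l = D $$ (l, l)" for l
  have 1: "(\<Sum>i<n. v l i * v m i) = (if l = m then 1 else 0)" if "l < n" "m < n" for l m
  proof -
    have "(P\<^sup>T * P) $$ (l, m) = (\<Sum>i<n. v l i * v m i)"
      using that P by (simp add: scalar_prod_def lessThan_atLeast0 v_def)
    then show ?thesis using PP that by simp
  qed
  have 2: "(\<Sum>l<n. v l i * v l j) = (if i = j then 1 else 0)" if "i < n" "j < n" for i j
  proof -
    have "(P * P\<^sup>T) $$ (i, j) = (\<Sum>l<n. v l i * v l j)"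
      using that P by (simp add: scalar_prod_def lessThan_atLeast0 v_def)
    then show ?thesis using PP' that by simp
  qed
  have PDe: "(P * D) $$ (i, l) = v l i * \<mu> l" if "i < n" "l < n" for i l
  proof -
    have "(P * D) $$ (i, l) = (\<Sum>m<n. P $$ (i, m) * D $$ (m, l))"
      using that P D by (simp add: scalar_prod_def lessThan_atLeast0)
    also have "\<dots> = (\<Sum>m<n. if m = l then P $$ (i, l) * D $$ (l, l) else 0)"
      using D that by (intro sum.cong) (auto simp: diagonal_mat_def)
    finally show ?thesis using that by (simp add: v_def \<mu>_def)
  qed
  have 3: "a i j = (\<Sum>l<n. \<mu> l * v l i * v l j)" if "i < n" "j < n" for i j
  proof -
    have "a i j = (P * D * P\<^sup>T) $$ (i, j)" using arg_cong[OF dec, of "\<lambda>A. A $$ (i, j)"] that by simp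
    also have "\<dots> = (\<Sum>l<n. (P * D) $$ (i, l) * v l j)"
      using that P D by (simp add: scalar_prod_def lessThan_atLeast0 v_def del: assoc_mult_mat)
    finally show ?thesis using that by (simp add: PDe mult_ac)
  qed
  have "similar_mat ?A D"
    unfolding similar_mat_def similar_mat_wit_def Let_def
    using P PT D PP PP' dec by (intro exI[of _ P] exI[of _ "P\<^sup>T"]) auto
  then have "char_poly ?A = char_poly D" by (rule char_poly_similar)
  also have "\<dots> = (\<Prod>a\<leftarrow>diag_mat D. [:- a, 1:])"
    using D by (intro char_poly_upper_triangular[OF D(1)]) (auto simp: diagonal_mat_def upper_triangular_def)
  finally have "proots (char_poly ?A) = mset (diag_mat D)" by (simp add: proots_prod_linear)
  also have "diag_mat D = map \<mu> [0..<n]" using D by (simp add: diag_mat_def \<mu>_def)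
  also have "mset (map \<mu> [0..<n]) = image_mset \<mu> (mset_set {..<n})"
    by (simp add: lessThan_atLeast0)
  finally show ?thesis using 1 2 3 by (intro exI[of _ v] exI[of _ \<mu>]) simp
qed

text \<open>In an eigenbasis the left side is the sum of the \<open>\<mu> l * q l\<close>, where
  \<open>q l \<ge> - \<epsilon>\<close> and the \<open>q l\<close> add up to the trace of
  \<open>x\<close>. The all-ones vector has the largest eigenvalue \<open>d\<close>; its share is
  the term with \<open>d / real m\<close>, and every other eigenvalue is replaced by
  \<open>lam\<close>.\<close>

lemma regular_spectral_bound:
  fixes a x :: "nat \<Rightarrow> nat \<Rightarrow> real"
  assumes m: "0 < m"
    and sym: "\<And>i j. i < m \<Longrightarrow> j < m \<Longrightarrow> a i j = a j i"
    and nonneg: "\<And>i j. i < m \<Longrightarrow> j < m \<Longrightarrow> 0 \<le> a i j"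
    and reg: "\<And>i. i < m \<Longrightarrow> (\<Sum>j<m. a i j) = d"
    and spec: "\<forall>t \<in># proots (char_poly (mat m m (\<lambda>(i, j). a i j))) -
        {#Max (set_mset (proots (char_poly (mat m m (\<lambda>(i, j). a i j)))))#}. \<bar>t\<bar> \<le> lam"
    and lam: "0 \<le> lam" and eps: "0 \<le> \<epsilon>"
    and x0: "\<And>i j. i < m \<Longrightarrow> j < m \<Longrightarrow> 0 \<le> x i j"
    and psd: "\<And>u. (\<Sum>i<m. \<Sum>j<m. u i * u j * x i j) \<ge> - \<epsilon> * (\<Sum>i<m. (u i)\<^sup>2)"
  shows "(\<Sum>i<m. \<Sum>j<m. a i j * x i j)
    \<le> lam * (\<Sum>i<m. x i i) + d / real m * (\<Sum>i<m. \<Sum>j<m. x i j) + 3 * lam * real m * \<epsilon>"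
proof -
  have "\<exists>(v :: nat \<Rightarrow> nat \<Rightarrow> real) (\<mu> :: nat \<Rightarrow> real).
    (\<forall>l<m. \<forall>k<m. (\<Sum>i<m. v l i * v k i) = (if l = k then 1 else 0)) \<and>
    (\<forall>i<m. \<forall>j<m. (\<Sum>l<m. v l i * v l j) = (if i = j then 1 else 0)) \<and>
    (\<forall>i<m. \<forall>j<m. a i j = (\<Sum>l<m. \<mu> l * v l i * v l j)) \<and>
    proots (char_poly (mat m m (\<lambda>(i, j). a i j))) = image_mset \<mu> (mset_set {..<m})"
    by (rule spectral_decomposition) (rule sym)
  then obtain v :: "nat \<Rightarrow> nat \<Rightarrow> real" and \<mu> :: "nat \<Rightarrow> real" where
    on': "\<forall>l<m. \<forall>k<m. (\<Sum>i<m. v l i * v k i) = (if l = k then 1 else 0)"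
    and co': "\<forall>i<m. \<forall>j<m. (\<Sum>l<m. v l i * v l j) = (if i = j then 1 else 0)"
    and dec': "\<forall>i<m. \<forall>j<m. a i j = (\<Sum>l<m. \<mu> l * v l i * v l j)"
    and roots: "proots (char_poly (mat m m (\<lambda>(i, j). a i j))) = image_mset \<mu> (mset_set {..<m})"
    by (elim exE conjE)
  note on = on'[rule_format] and co = co'[rule_format] and dec = dec'[rule_format]
  have ev: "(\<Sum>j<m. a i j * v l j) = \<mu> l * v l i" if "i < m" "l < m" for i l
  proof -
    have "(\<Sum>j<m. a i j * v l j) = (\<Sum>j<m. \<Sum>k<m. \<mu> k * v k i * (v k j * v l j))"
      using that by (intro sum.cong) (auto simp: dec sum_distrib_left sum_distrib_right mult_ac)
    also have "\<dots> = (\<Sum>k<m. \<mu> k * v k i * (\<Sum>j<m. v k j * v l j))"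
      by (subst sum.swap) (simp add: sum_distrib_left)
    also have "\<dots> = (\<Sum>k<m. if k = l then \<mu> l * v l i else 0)"
      using that by (intro sum.cong) (auto simp: on)
    finally show ?thesis using that by simp
  qed
  have d0: "0 \<le> d" using reg[OF m] nonneg[OF m] by (metis lessThan_iff sum_nonneg)
  \<comment> \<open>The row belonging to the largest entry of the eigenvector shows that no
    eigenvalue exceeds the degree in modulus.\<close>
  have mud: "\<bar>\<mu> l\<bar> \<le> d" if l: "l < m" for l
  proof -
    obtain i where i: "i < m" "\<And>j. j < m \<Longrightarrow> \<bar>v l j\<bar> \<le> \<bar>v l i\<bar>"
    proof -
      have "Max ((\<lambda>j. \<bar>v l j\<bar>) ` {..<m}) \<in> (\<lambda>j. \<bar>v l j\<bar>) ` {..<m}" using m by (intro Max_in) auto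
      then obtain i where "i < m" "Max ((\<lambda>j. \<bar>v l j\<bar>) ` {..<m}) = \<bar>v l i\<bar>" by auto
      moreover have "\<bar>v l j\<bar> \<le> Max ((\<lambda>j. \<bar>v l j\<bar>) ` {..<m})" if "j < m" for j using that by auto
      ultimately show ?thesis using that by metis
    qed
    have "v l i \<noteq> 0"
    proof
      assume "v l i = 0"
      then have "\<forall>j<m. v l j = 0" using i(2) by force
      then show False using on[OF l l] by simp
    qed
    have "\<bar>\<mu> l\<bar> * \<bar>v l i\<bar> = \<bar>\<Sum>j<m. a i j * v l j\<bar>" using ev[OF i(1) l] by (simp add: abs_mult)
    also have "\<dots> \<le> (\<Sum>j<m. \<bar>a i j * v l j\<bar>)" by (rule sum_abs)
    also have "\<dots> \<le> (\<Sum>j<m. a i j * \<bar>v l i\<bar>)"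
      using i nonneg by (intro sum_mono) (auto simp: abs_mult intro!: mult_mono)
    also have "\<dots> = d * \<bar>v l i\<bar>" using reg[OF i(1)] by (simp flip: sum_distrib_right)
    finally show ?thesis using \<open>v l i \<noteq> 0\<close> by simp
  qed
  define c where "c l = (\<Sum>i<m. v l i)" for l
  have cmu: "\<mu> l = d" if "l < m" "c l \<noteq> 0" for l
  proof -
    have "d * c l = (\<Sum>i<m. (\<Sum>j<m. a j i) * v l i)"
      unfolding c_def sum_distrib_left using reg sym by (intro sum.cong) auto
    also have "\<dots> = (\<Sum>j<m. \<Sum>i<m. a j i * v l i)" by (subst sum.swap) (simp add: sum_distrib_right)
    also have "\<dots> = \<mu> l * c l" unfolding c_def sum_distrib_left using ev that by (intro sum.cong) auto
    finally show ?thesis using that by simp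
  qed
  have one: "(\<Sum>l<m. c l * v l i) = 1" if "i < m" for i
  proof -
    have "(\<Sum>l<m. c l * v l i) = (\<Sum>j<m. \<Sum>l<m. v l j * v l i)"
      unfolding c_def sum_distrib_right by (rule sum.swap)
    also have "\<dots> = (\<Sum>j<m. if j = i then 1 else 0)" using co that by (intro sum.cong) auto
    finally show ?thesis using that by simp
  qed
  \<comment> \<open>An eigenvector that is not orthogonal to the all-ones vector. Its eigenvalue is
    \<open>d\<close>, the copy that the spectral hypothesis exempts; all others are at most
    \<open>lam\<close> in modulus.\<close>
  obtain l0 where l0: "l0 < m" "c l0 \<noteq> 0" using one[OF m] by (metis (no_types, lifting) lessThan_iff mult_zero_left sum.neutral zero_neq_one)
  have mu0: "\<mu> l0 = d" using cmu l0 by blast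
  have "Max (set_mset (image_mset \<mu> (mset_set {..<m}))) = d"
    using mud l0 mu0 by (intro Max_eqI) (auto simp: image_iff intro: abs_le_D1)
  moreover have "image_mset \<mu> (mset_set {..<m}) - {#d#} = image_mset \<mu> (mset_set ({..<m} - {l0}))"
  proof -
    have "mset_set {..<m} = add_mset l0 (mset_set ({..<m} - {l0}))"
      using l0 by (intro mset_set.remove) auto
    then show ?thesis using mu0 by simp
  qed
  ultimately have sp: "\<bar>\<mu> l\<bar> \<le> lam" if "l < m" "l \<noteq> l0" for l
    using spec that unfolding roots by auto
  define q where "q l = (\<Sum>i<m. \<Sum>j<m. v l i * v l j * x i j)" for l
  have qe: "- \<epsilon> \<le> q l" if "l < m" for l
    using psd[of "v l"] on[OF that that] unfolding q_def by (simp add: power2_eq_square)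
  have total: "(\<Sum>i<m. \<Sum>j<m. a i j * x i j) = (\<Sum>l<m. \<mu> l * q l)"
  proof -
    have "(\<Sum>i<m. \<Sum>j<m. a i j * x i j) = (\<Sum>i<m. \<Sum>j<m. \<Sum>l<m. \<mu> l * (v l i * v l j * x i j))"
      by (intro sum.cong) (auto simp: dec sum_distrib_left sum_distrib_right mult_ac)
    also have "\<dots> = (\<Sum>i<m. \<Sum>l<m. \<Sum>j<m. \<mu> l * (v l i * v l j * x i j))"
      by (intro sum.cong refl sum.swap)
    also have "\<dots> = (\<Sum>l<m. \<Sum>i<m. \<Sum>j<m. \<mu> l * (v l i * v l j * x i j))" by (rule sum.swap)
    finally show ?thesis by (simp add: q_def sum_distrib_left)
  qed
  have trace: "(\<Sum>l<m. q l) = (\<Sum>i<m. x i i)"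
  proof -
    have "(\<Sum>l<m. q l) = (\<Sum>i<m. \<Sum>l<m. \<Sum>j<m. v l i * v l j * x i j)"
      unfolding q_def by (rule sum.swap)
    also have "\<dots> = (\<Sum>i<m. \<Sum>j<m. \<Sum>l<m. v l i * v l j * x i j)"
      by (intro sum.cong refl sum.swap)
    also have "\<dots> = (\<Sum>i<m. \<Sum>j<m. if i = j then x i j else 0)"
      by (intro sum.cong) (auto simp: co simp flip: sum_distrib_right)
    finally show ?thesis by simp
  qed
  have xs: "0 \<le> (\<Sum>i<m. \<Sum>j<m. x i j)" using x0 by (intro sum_nonneg) auto
  \<comment> \<open>\<open>q l + \<epsilon>\<close> is nonnegative, so \<open>\<mu> l\<close> may be
    replaced by \<open>lam\<close> at the price of \<open>2 * lam * \<epsilon>\<close>.\<close>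
  have each: "\<mu> l * q l \<le> lam * q l + 2 * lam * \<epsilon>" if "l < m" "\<bar>\<mu> l\<bar> \<le> lam" for l
  proof -
    have "0 \<le> (lam - \<mu> l) * (q l + \<epsilon>)" using that qe[of l] by (intro mult_nonneg_nonneg) auto
    moreover have "(lam - \<mu> l) * \<epsilon> \<le> 2 * lam * \<epsilon>" using that eps by (intro mult_right_mono) auto
    ultimately show ?thesis by (simp add: algebra_simps)
  qed
  show ?thesis
  \<comment> \<open>If a second eigenvector meets the all-ones vector, \<open>d\<close> is a
    multiple eigenvalue and thus at most \<open>lam\<close> itself. Otherwise \<open>v l0\<close> is
    a multiple of the all-ones vector.\<close>
  proof (cases "\<exists>l1<m. l1 \<noteq> l0 \<and> c l1 \<noteq> 0")
    case True
    then have "d \<le> lam" using cmu sp by (metis abs_le_D1)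
    then have "\<bar>\<mu> l\<bar> \<le> lam" if "l < m" for l using mud that by fastforce
    then have "(\<Sum>l<m. \<mu> l * q l) \<le> (\<Sum>l<m. lam * q l + 2 * lam * \<epsilon>)"
      using each by (intro sum_mono) auto
    also have "\<dots> = lam * (\<Sum>i<m. x i i) + 2 * lam * real m * \<epsilon>"
      by (simp add: sum.distrib trace algebra_simps flip: sum_distrib_left)
    also have "\<dots> \<le> lam * (\<Sum>i<m. x i i) + 3 * lam * real m * \<epsilon>"
      using lam eps by (simp add: mult_right_mono)
    finally show ?thesis using total d0 xs by (smt (verit) divide_nonneg_nonneg mult_nonneg_nonneg of_nat_0_le_iff)
  next
    case False
    have v0: "c l0 * v l0 i = 1" if "i < m" for i
    proof -
      have "(\<Sum>l<m. c l * v l i) = (\<Sum>l<m. if l = l0 then c l0 * v l0 i else 0)"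
        using False by (intro sum.cong) auto
      then show ?thesis using one[OF that] l0 by simp
    qed
    have vi: "v l0 i = 1 / c l0" if "i < m" for i using v0[OF that] l0 by (simp add: field_simps)
    have "(\<Sum>i<m. v l0 i * v l0 i) = real m / (c l0)\<^sup>2"
      using vi by (simp add: power2_eq_square)
    then have cm: "(c l0)\<^sup>2 = real m" using on[OF l0(1) l0(1)] l0 by (simp add: field_simps)
    have q0: "q l0 = (\<Sum>i<m. \<Sum>j<m. x i j) / real m"
      unfolding q_def cm[symmetric] sum_divide_distrib
      by (intro sum.cong) (auto simp: vi power2_eq_square)
    have "(\<Sum>l<m. \<mu> l * q l) = d * q l0 + (\<Sum>l\<in>{..<m}-{l0}. \<mu> l * q l)"
      using l0 mu0 by (subst sum.remove[of _ l0]) auto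
    also have "(\<Sum>l\<in>{..<m}-{l0}. \<mu> l * q l) \<le> (\<Sum>l\<in>{..<m}-{l0}. lam * q l + 2 * lam * \<epsilon>)"
      using each sp by (intro sum_mono) auto
    also have "\<dots> = lam * (\<Sum>l\<in>{..<m}-{l0}. q l) + 2 * lam * \<epsilon> * real (m - 1)"
      using l0 by (simp add: sum.distrib flip: sum_distrib_left)
    also have "(\<Sum>l\<in>{..<m}-{l0}. q l) = (\<Sum>i<m. x i i) - q l0"
      using trace l0 by (subst (asm) sum.remove[of _ l0]) auto
    finally have "(\<Sum>l<m. \<mu> l * q l) \<le> d * q l0 + lam * (\<Sum>i<m. x i i) - lam * q l0 + 2 * lam * \<epsilon> * real (m - 1)"
      by (simp add: algebra_simps)
    moreover have "- lam * q l0 \<le> lam * \<epsilon>" using mult_left_mono[OF qe[OF l0(1)] lam] by simp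
    moreover have "2 * lam * \<epsilon> * real (m - 1) + lam * \<epsilon> \<le> 3 * lam * real m * \<epsilon>"
    proof -
      have "(2 * real (m - 1) + 1) * (lam * \<epsilon>) \<le> 3 * real m * (lam * \<epsilon>)"
        using m lam eps by (intro mult_right_mono) auto
      then show ?thesis by (simp add: algebra_simps)
    qed
    ultimately show ?thesis using total q0 by simp
  qed
qed

lemma expander_spectral_bound:
  fixes x :: "nat \<Rightarrow> nat \<Rightarrow> real"
  assumes ex: "expander V H d lam" and fin: "finite V" and ne: "V \<noteq> {}"
    and lam: "0 \<le> lam" and eps: "0 \<le> \<epsilon>"
    and x0: "\<And>i j. i \<in> V \<Longrightarrow> j \<in> V \<Longrightarrow> 0 \<le> x i j"
    and psd: "\<And>u. (\<Sum>i\<in>V. \<Sum>j\<in>V. u i * u j * x i j) \<ge> - \<epsilon> * (\<Sum>i\<in>V. (u i)\<^sup>2)"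
  shows "(\<Sum>i\<in>V. \<Sum>j\<in>V. H i j * x i j)
    \<le> lam * (\<Sum>i\<in>V. x i i) + d / real (card V) * (\<Sum>i\<in>V. \<Sum>j\<in>V. x i j) + 3 * lam * real (card V) * \<epsilon>"
proof -
  define m where "m = card V"
  define f where "f i = sorted_list_of_set V ! i" for i
  have bij: "bij_betw f {..<m} V"
    using bij_betw_nth[of "sorted_list_of_set V" "{..<m}" V] fin unfolding f_def m_def by simp
  have re1: "(\<Sum>i\<in>V. g i) = (\<Sum>i<m. g (f i))" for g :: "nat \<Rightarrow> real"
    by (rule sum.reindex_bij_betw[OF bij, symmetric])
  have fV: "f i \<in> V" if "i < m" for i using bij that by (auto simp: bij_betw_def)
  define h where "h = inv_into {..<m} f"
  have hf: "h (f i) = i" if "i < m" for i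
    unfolding h_def using bij that by (auto simp: bij_betw_def inv_into_f_f)
  have wg: "wgraph V H" and deg: "\<And>i. i \<in> V \<Longrightarrow> wdegree V H i = d"
    using ex unfolding expander_def by auto
  have "(\<Sum>i<m. \<Sum>j<m. H (f i) (f j) * x (f i) (f j))
    \<le> lam * (\<Sum>i<m. x (f i) (f i)) + d / real m * (\<Sum>i<m. \<Sum>j<m. x (f i) (f j)) + 3 * lam * real m * \<epsilon>"
  proof (rule regular_spectral_bound)
    show "0 < m" using ne fin by (simp add: m_def card_gt_0_iff)
    show "(\<Sum>j<m. H (f i) (f j)) = d" if "i < m" for i
      using deg[OF fV[OF that]] unfolding wdegree_def re1 .
    show "\<forall>t\<in>#proots (char_poly (mat m m (\<lambda>(i, j). H (f i) (f j)))) -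
        {#Max (set_mset (proots (char_poly (mat m m (\<lambda>(i, j). H (f i) (f j))))))#}. \<bar>t\<bar> \<le> lam"
      using ex unfolding expander_def adj_spectrum_def adj_mat_def m_def f_def by simp
    show "- \<epsilon> * (\<Sum>i<m. (u i)\<^sup>2) \<le> (\<Sum>i<m. \<Sum>j<m. u i * u j * x (f i) (f j))" for u
      using psd[of "u \<circ> h"] by (simp add: re1 hf)
  qed (use wg lam eps x0 fV in \<open>auto simp: wgraph_def\<close>)
  then show ?thesis unfolding re1 m_def[symmetric] .
qed

section \<open>The random cross edges\<close>

text \<open>Weighting the binomial coefficients with powers of \<open>r = u / n\<close> and
  completing the sum to \<open>(r + 1) ^ n\<close> gives the familiar bound
  \<open>(e * n / u) ^ u\<close>.\<close>

lemma sum_choose_le_exp: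
  fixes n u :: nat
  assumes "1 \<le> u" "u \<le> n"
  shows "(\<Sum>s\<le>u. real (n choose s)) \<le> exp (real u * (1 + ln (real n / real u)))"
proof -
  define r where "r = real u / real n"
  have r: "0 < r" "r \<le> 1" using assms by (auto simp: r_def)
  have "(\<Sum>s\<le>u. real (n choose s)) * r ^ u \<le> (\<Sum>s\<le>u. real (n choose s) * r ^ s)"
    unfolding sum_distrib_right using r by (intro sum_mono mult_left_mono power_decreasing) auto
  also have "\<dots> \<le> (\<Sum>s\<le>n. real (n choose s) * r ^ s)"
    using assms r by (intro sum_mono2) auto
  also have "\<dots> = (r + 1) ^ n"
    using binomial_ring[of r 1 n] by simp
  also have "\<dots> \<le> exp r ^ n" using r by (intro power_mono) (auto simp: add.commute intro: exp_ge_add_one_self)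
  also have "\<dots> = exp (real u)" using assms by (simp add: r_def flip: exp_of_nat_mult)
  finally have "(\<Sum>s\<le>u. real (n choose s)) \<le> exp (real u) / r ^ u" using r by (simp add: field_simps)
  also have "\<dots> = exp (real u) * (1 / r) ^ u" by (simp add: power_divide)
  also have "1 / r = exp (ln (real n / real u))" using assms by (simp add: r_def)
  also have "exp (real u) * exp (ln (real n / real u)) ^ u = exp (real u * (1 + ln (real n / real u)))"
    by (simp add: algebra_simps exp_add flip: exp_of_nat_mult)
  finally show ?thesis .
qed

lemma card_small_subsets:
  assumes "V \<subseteq> {..<n::nat}"
  shows "real (card {A. A \<subseteq> V \<and> card A \<le> u}) \<le> (\<Sum>s\<le>u. real (n choose s))"
proof -
  have fin: "finite {A. A \<subseteq> {..<n} \<and> P A}" for P by simp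
  have "card {A. A \<subseteq> V \<and> card A \<le> u} \<le> card (\<Union>s\<le>u. {A. A \<subseteq> {..<n} \<and> card A = s})"
    using assms by (intro card_mono) auto
  also have "\<dots> \<le> (\<Sum>s\<le>u. card {A. A \<subseteq> {..<n} \<and> card A = s})"
    by (intro card_UN_le) auto
  also have "\<dots> = (\<Sum>s\<le>u. n choose s)" by (simp add: n_subsets)
  finally show ?thesis by (simp flip: of_nat_sum)
qed

text \<open>The exponential moment method for a sum of independent Bernoulli variables;
  \<open>h\<close> is left open because it will be chosen in two ways.\<close>

lemma bernoulli_count_tail:
  fixes I B :: "'a set"
  assumes fin: "finite I" and BI: "B \<subseteq> I" and p: "0 \<le> p" "p \<le> 1" and h: "0 \<le> h"
  shows "measure_pmf.prob (Pi_pmf I False (\<lambda>_. bernoulli_pmf p)) {R. real (card {x\<in>B. R x}) \<ge> t}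
    \<le> exp (p * real (card B) * (exp h - 1) - h * t)"
proof -
  let ?P = "Pi_pmf I False (\<lambda>_. bernoulli_pmf p)"
  let ?f = "\<lambda>x r. if x \<in> B \<and> r then exp h else 1 :: real"
  have finB: "finite B" using fin BI finite_subset by blast
  have prod: "(\<Prod>x\<in>I. ?f x (R x)) = exp (h * real (card {x\<in>B. R x}))" for R
  proof -
    have "(\<Prod>x\<in>I. ?f x (R x)) = (\<Prod>x\<in>{x\<in>B. R x}. exp h)"
      using fin BI by (intro prod.mono_neutral_cong_right) auto
    then show ?thesis by (simp add: mult.commute flip: exp_of_nat_mult)
  qed
  have "set_pmf ?P \<subseteq> PiE_dflt I False (\<lambda>_. UNIV)"
    using set_Pi_pmf_subset'[OF fin, of False "\<lambda>_. bernoulli_pmf p"] by (auto simp: PiE_dflt_def)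
  then have finS: "finite (set_pmf ?P)" by (rule finite_subset) (use fin in \<open>auto intro: finite_PiE_dflt\<close>)
  have int: "integrable (measure_pmf ?P) g" for g :: "_ \<Rightarrow> real"
    using finS by (rule integrable_measure_pmf_finite)
  have "measure_pmf.expectation ?P (\<lambda>R. exp (h * real (card {x\<in>B. R x})))
      = (\<Prod>x\<in>I. measure_pmf.expectation (bernoulli_pmf p) (?f x))"
    unfolding prod[symmetric] using fin by (intro expectation_prod_Pi_pmf) (auto intro: integrable_measure_pmf_finite)
  also have "\<dots> = (\<Prod>x\<in>I. if x \<in> B then 1 + p * (exp h - 1) else 1)"
    using p by (intro prod.cong) (auto simp: algebra_simps)
  also have "\<dots> = (\<Prod>x\<in>B. 1 + p * (exp h - 1))"
    using fin BI by (intro prod.mono_neutral_cong_right) auto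
  also have "\<dots> = (1 + p * (exp h - 1)) ^ card B" by simp
  also have "\<dots> \<le> exp (p * (exp h - 1)) ^ card B"
    using p h by (intro power_mono exp_ge_add_one_self) (auto intro!: add_nonneg_nonneg)
  also have "\<dots> = exp (p * real (card B) * (exp h - 1))" by (simp add: mult_ac flip: exp_of_nat_mult)
  finally have E: "measure_pmf.expectation ?P (\<lambda>R. exp (h * real (card {x\<in>B. R x})))
    \<le> exp (p * real (card B) * (exp h - 1))" .
  have "measure_pmf.prob ?P {R. real (card {x\<in>B. R x}) \<ge> t}
    \<le> measure_pmf.prob ?P {R \<in> space ?P. exp (h * t) \<le> exp (h * real (card {x\<in>B. R x}))}"
    using h by (intro measure_pmf.finite_measure_mono) (auto intro: mult_left_mono)
  also have "\<dots> \<le> measure_pmf.expectation ?P (\<lambda>R. exp (h * real (card {x\<in>B. R x}))) / exp (h * t)"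
    using int by (intro integral_Markov_inequality_measure[where A = "space ?P"]) auto
  also have "\<dots> \<le> exp (p * real (card B) * (exp h - 1)) / exp (h * t)"
    using E by (intro divide_right_mono) auto
  finally show ?thesis by (simp add: exp_diff)
qed

lemma mult_exp_half_le: "y * exp (1 - y / 2) \<le> (2::real)"
  using exp_ge_add_one_self[of "y / 2 - 1"]
proof -
  have "y / 2 \<le> exp (y / 2 - 1)" using exp_ge_add_one_self[of "y / 2 - 1"] by simp
  then have "y / 2 * exp (1 - y / 2) \<le> exp (y / 2 - 1) * exp (1 - y / 2)" by (intro mult_right_mono) auto
  also have "\<dots> = 1" by (simp flip: exp_add)
  finally show ?thesis by simp
qed

text \<open>With \<open>y = 1 + ln (n / u)\<close> and \<open>q = sqrt (p * n)\<close>, the exponent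
  \<open>6 * u * y\<close> beats the number of pairs of sets of size at most \<open>u\<close>, which
  is at most \<open>exp (2 * u * y)\<close>. The moment parameter is \<open>h = 1\<close> if
  \<open>y \<le> q\<close>. For smaller sets it is \<open>h = y / q\<close>, and there the
  expectation is so small that the factor \<open>exp h\<close> does no harm.\<close>

lemma discrepancy_tail:
  fixes n :: nat
  assumes S: "S \<subseteq> {..<n}" and AU: "A \<subseteq> S" "U \<subseteq> {..<n} - S" and p: "0 < p" "p \<le> 1"
    and pn: "4 \<le> p * real n" and u: "u = max (card A) (card U)" "1 \<le> u"
  shows "measure_pmf.prob (cross_pmf n S p)
      {R. real (card {x \<in> A \<times> U. R x}) \<ge> 2 * p * real (card A) * real (card U) + 12 * sqrt (p * real n) * (real (card A) + real (card U))}
    \<le> exp (- 6 * (real u * (1 + ln (real n / real u))))"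
proof -
  define q where "q = sqrt (p * real n)"
  define y where "y = 1 + ln (real n / real u)"
  have q2: "2 \<le> q" using pn unfolding q_def by (intro real_le_rsqrt) simp
  have qq: "q * q = p * real n" using p by (simp add: q_def)
  have un: "u \<le> n"
    using card_mono[of "{..<n}" A] card_mono[of "{..<n}" U] AU S u by auto
  have y1: "1 \<le> y" using un u by (simp add: y_def)
  define \<mu> where "\<mu> = p * real (card A) * real (card U)"
  have mu0: "0 \<le> \<mu>" using p by (simp add: \<mu>_def)
  define t where "t = 2 * p * real (card A) * real (card U) + 12 * q * (real (card A) + real (card U))"
  have tl: "2 * \<mu> + 12 * q * real u \<le> t"
  proof -
    have "real u \<le> real (card A) + real (card U)" using u by auto
    then show ?thesis using q2 unfolding t_def \<mu>_def by (auto simp: mult.assoc intro!: mult_left_mono)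
  qed
  have tail: "measure_pmf.prob (cross_pmf n S p) {R. real (card {x \<in> A \<times> U. R x}) \<ge> t}
    \<le> exp (\<mu> * (exp h - 1) - h * t)" if "0 \<le> h" for h
  proof -
    have "finite S" using S finite_subset by blast
    then show ?thesis using AU p that
      bernoulli_count_tail[of "S \<times> ({..<n} - S)" "A \<times> U" p h t] unfolding cross_pmf_def \<mu>_def
      by (simp add: card_cartesian_product mult_ac Sigma_mono)
  qed
  have "\<exists>h\<ge>0. \<mu> * (exp h - 1) - h * t \<le> - 6 * (real u * y)"
  proof (cases "y \<le> q")
    case True
    have "exp (1::real) - 1 \<le> 2" using exp_le by simp
    then have "\<mu> * (exp 1 - 1) \<le> \<mu> * 2" using mu0 by (rule mult_left_mono)
    moreover have "12 * (real u * y) \<le> 12 * q * real u" using True mult_right_mono[of y q "real u"] by (simp add: mult.commute)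
    moreover have "0 \<le> real u * y" using y1 by simp
    ultimately show ?thesis using tl by (intro exI[of _ 1]) auto
  next
    case False
    define h where "h = y / q"
    have h0: "0 \<le> h" using y1 q2 by (simp add: h_def)
    \<comment> \<open>As \<open>u / n = exp (1 - y)\<close>, a large \<open>y\<close> makes
      \<open>p * u\<close> exponentially small compared with \<open>q * q\<close>.\<close>
    have "p * real u = q * q * exp (1 - y)"
    proof -
      have "exp (1 - y) = real u / real n" using u(2) un by (simp add: y_def exp_minus)
      then show ?thesis using u(2) un by (simp add: qq)
    qed
    then have "p * real u * exp h = q * q * exp (1 - y + h)" by (simp add: exp_add)
    also have "\<dots> \<le> y * y * exp (1 - y / 2)"
    proof -
      have "h \<le> y / 2" unfolding h_def using q2 y1 by (intro divide_left_mono) auto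
      then show ?thesis using False q2 by (intro mult_mono) auto
    qed
    also have "\<dots> \<le> y * 2" using mult_exp_half_le[of y] y1 by (simp add: mult.assoc mult_left_mono)
    finally have a: "p * real u * exp h \<le> 2 * y" by simp
    have "\<mu> \<le> p * real u * real u" unfolding \<mu>_def using p u by (intro mult_mono) auto
    then have "\<mu> * exp h \<le> (p * real u * real u) * exp h" by (intro mult_right_mono) auto
    also have "\<dots> = real u * (p * real u * exp h)" by simp
    also have "\<dots> \<le> real u * (2 * y)" using a by (intro mult_left_mono) auto
    finally have b: "\<mu> * exp h \<le> 2 * (real u * y)" by simp
    have "h * (12 * q * real u) = 12 * (real u * y)" using q2 by (simp add: h_def)
    moreover have "h * (12 * q * real u) \<le> h * t" using h0 tl mu0 by (intro mult_left_mono) auto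
    moreover have "0 \<le> real u * y" using y1 by simp
    moreover have "\<mu> * (exp h - 1) \<le> \<mu> * exp h" using mu0 by (simp add: algebra_simps)
    ultimately show ?thesis using b h0 by (intro exI[of _ h] conjI) linarith+
  qed
  then obtain h where h: "0 \<le> h" "\<mu> * (exp h - 1) - h * t \<le> - 6 * (real u * y)" by blast
  have "measure_pmf.prob (cross_pmf n S p) {R. real (card {x \<in> A \<times> U. R x}) \<ge> t} \<le> exp (- 6 * (real u * y))"
    using tail[OF h(1)] h(2) by (meson exp_le_cancel_iff order_trans)
  then show ?thesis unfolding t_def q_def y_def .
qed

text \<open>Only the upper side is asked for, with factor 2 on the expectation and an additive term
  linear in the sizes. In this form the bound can be summed over level sets and survives the
  deletion of edges.\<close>

definition low_discrepancy :: "nat \<Rightarrow> nat set \<Rightarrow> real \<Rightarrow> (nat \<times> nat \<Rightarrow> bool) \<Rightarrow> bool" where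
  "low_discrepancy n S p R \<longleftrightarrow> (\<forall>A U. A \<subseteq> S \<longrightarrow> U \<subseteq> {..<n} - S \<longrightarrow>
     real (card {x \<in> A \<times> U. R x})
       \<le> 2 * p * real (card A) * real (card U) + 12 * sqrt (p * real n) * (real (card A) + real (card U)))"

text \<open>A union bound over the size \<open>u\<close> of the larger set: there are at most
  \<open>exp (2 * \<phi> u)\<close> pairs, each failing with probability at most
  \<open>exp (- 6 * \<phi> u)\<close>, and \<open>\<phi> u \<ge> ln n\<close> leaves at most
  \<open>n powr (- 2)\<close> for each of the \<open>n\<close> values of \<open>u\<close>.\<close>

lemma low_discrepancy_prob:
  fixes n :: nat
  assumes S: "S \<subseteq> {..<n}" and p: "0 < p" "p \<le> 1" and pn: "4 \<le> p * real n"
  shows "measure_pmf.prob (cross_pmf n S p) {R. low_discrepancy n S p R} \<ge> 1 - real n powr (- 1)"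
proof -
  let ?M = "measure_pmf (cross_pmf n S p)"
  let ?t = "\<lambda>A U. 2 * p * real (card A) * real (card U) + 12 * sqrt (p * real n) * (real (card A) + real (card U))"
  let ?bad = "\<lambda>A U. {R. real (card {x \<in> A \<times> U. R x}) \<ge> ?t A U}"
  define O' where "O' = {..<n} - S"
  define \<phi> where "\<phi> u = real u * (1 + ln (real n / real u))" for u :: nat
  define I where "I u = {A. A \<subseteq> S \<and> card A \<le> u} \<times> {U. U \<subseteq> O' \<and> card U \<le> u}" for u
  define J where "J u = {(A, U) \<in> I u. max (card A) (card U) = u}" for u
  have finS: "finite S" "finite O'" using S finite_subset by (auto simp: O'_def)
  have finI: "finite (I u)" "finite (J u)" for u using finS by (auto simp: I_def J_def intro: finite_subset[of _ "I u"])
  have npos: "0 < n" using pn by (cases n) auto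
  have sub: "{R. \<not> low_discrepancy n S p R} \<subseteq> (\<Union>u\<in>{1..n}. \<Union>(A, U)\<in>J u. ?bad A U)"
  proof
    fix R assume "R \<in> {R. \<not> low_discrepancy n S p R}"
    then obtain A U where AU: "A \<subseteq> S" "U \<subseteq> O'" "real (card {x \<in> A \<times> U. R x}) > ?t A U"
      unfolding low_discrepancy_def O'_def by (simp only: mem_Collect_eq not_all not_imp not_le) blast
    define u where "u = max (card A) (card U)"
    have "u \<noteq> 0"
    proof
      assume "u = 0"
      then have "card A = 0" by (simp add: u_def)
      moreover have "finite A" using AU(1) finS(1) by (rule finite_subset)
      ultimately have "A = {}" by simp
      then have "{x \<in> A \<times> U. R x} = {}" by blast
      then have "?t A U < 0" using AU(3) by (simp only: card.empty of_nat_0)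
      moreover have "0 \<le> ?t A U" using p by (intro add_nonneg_nonneg mult_nonneg_nonneg) auto
      ultimately show False by linarith
    qed
    moreover have "u \<le> n"
      using card_mono[of "{..<n}" A] card_mono[of "{..<n}" U] AU S u_def by (auto simp: O'_def)
    ultimately have "u \<in> {1..n}" by auto
    moreover have "(A, U) \<in> J u" using AU by (auto simp: J_def I_def u_def)
    ultimately show "R \<in> (\<Union>u\<in>{1..n}. \<Union>(A, U)\<in>J u. ?bad A U)" using AU(3) by force
  qed
  have each: "measure ?M (\<Union>(A, U)\<in>J u. ?bad A U) \<le> real n powr (- 2)" if u: "u \<in> {1..n}" for u
  proof -
    have "measure ?M (\<Union>(A, U)\<in>J u. ?bad A U) \<le> (\<Sum>(A, U)\<in>J u. measure ?M (?bad A U))"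
      using measure_pmf.finite_measure_subadditive_finite[of "J u" "\<lambda>(A, U). ?bad A U"] finI
      by (simp add: case_prod_unfold)
    also have "\<dots> \<le> (\<Sum>(A, U)\<in>J u. exp (- 6 * \<phi> u))"
    proof (intro sum_mono, clarify)
      fix A U assume "(A, U) \<in> J u"
      then show "measure ?M (?bad A U) \<le> exp (- 6 * \<phi> u)"
        using discrepancy_tail[OF S, of A U p u] p pn u unfolding J_def I_def O'_def \<phi>_def by auto
    qed
    also have "\<dots> = real (card (J u)) * exp (- 6 * \<phi> u)" by simp
    also have "\<dots> \<le> (exp (\<phi> u) * exp (\<phi> u)) * exp (- 6 * \<phi> u)"
    proof (intro mult_right_mono)
      have "real (card (J u)) \<le> real (card (I u))" using finI by (intro of_nat_mono card_mono) (auto simp: J_def)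
      also have "\<dots> = real (card {A. A \<subseteq> S \<and> card A \<le> u}) * real (card {U. U \<subseteq> O' \<and> card U \<le> u})"
        by (simp add: I_def card_cartesian_product)
      also have "\<dots> \<le> (\<Sum>s\<le>u. real (n choose s)) * (\<Sum>s\<le>u. real (n choose s))"
        using S by (intro mult_mono card_small_subsets sum_nonneg) (auto simp: O'_def)
      also have "\<dots> \<le> exp (\<phi> u) * exp (\<phi> u)"
        unfolding \<phi>_def using u by (intro mult_mono sum_choose_le_exp sum_nonneg) auto
      finally show "real (card (J u)) \<le> exp (\<phi> u) * exp (\<phi> u)" .
    qed simp
    also have "\<dots> = exp (- 4 * \<phi> u)" by (simp flip: exp_add)
    also have "\<dots> \<le> exp (- 2 * ln (real n))"
    proof -
      \<comment> \<open>In \<open>\<phi> u = u + u * ln (n / u)\<close> the first summand covers the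
        loss \<open>ln u\<close>.\<close>
      have "ln (real n) \<le> \<phi> u"
      proof -
        have l: "0 \<le> ln (real n / real u)" using u by simp
        have "1 * ln (real n / real u) \<le> real u * ln (real n / real u)" using l u by (intro mult_right_mono) auto
        moreover have "ln (real u) \<le> real u" using u by (simp add: ln_le_minus_one order_trans[OF ln_le_minus_one])
        moreover have "ln (real n / real u) = ln (real n) - ln (real u)" using u npos by (simp add: ln_div)
        ultimately show ?thesis unfolding \<phi>_def distrib_left by linarith
      qed
      moreover have "0 \<le> ln (real n)" using npos by simp
      ultimately show ?thesis by simp
    qed
    also have "\<dots> = real n powr (- 2)" using npos by (simp add: powr_def)
    finally show ?thesis .
  qed
  have "measure ?M {R. \<not> low_discrepancy n S p R} \<le> measure ?M (\<Union>u\<in>{1..n}. \<Union>(A, U)\<in>J u. ?bad A U)"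
    using sub by (intro measure_pmf.finite_measure_mono) auto
  also have "\<dots> \<le> (\<Sum>u\<in>{1..n}. measure ?M (\<Union>(A, U)\<in>J u. ?bad A U))"
    by (intro measure_pmf.finite_measure_subadditive_finite) auto
  also have "\<dots> \<le> (\<Sum>u\<in>{1..n}. real n powr (- 2))" using each by (intro sum_mono) auto
  also have "\<dots> = real n powr 1 * real n powr (- 2)" using npos by simp
  also have "\<dots> = real n powr (- 1)" by (simp only: powr_add[symmetric]) simp
  finally have "measure ?M {R. \<not> low_discrepancy n S p R} \<le> real n powr (- 1)" .
  moreover have "measure ?M {R. low_discrepancy n S p R} = 1 - measure ?M {R. \<not> low_discrepancy n S p R}"
  proof -
    have "space ?M - {R. \<not> low_discrepancy n S p R} = {R. low_discrepancy n S p R}" by auto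
    then show ?thesis using measure_pmf.prob_compl[of "{R. \<not> low_discrepancy n S p R}" "cross_pmf n S p"] by simp
  qed
  ultimately show ?thesis by simp
qed

section \<open>Convergence of the iteration\<close>

text \<open>The squared Frobenius distance to \<open>t\<close>, the potential function of the
  iteration.\<close>

definition pot :: "nat \<Rightarrow> (nat \<Rightarrow> nat \<Rightarrow> real) \<Rightarrow> (nat \<Rightarrow> nat \<Rightarrow> nat) \<Rightarrow> real" where
  "pot n t X = (\<Sum>i<n. \<Sum>j<n. (real (X i j) - t i j)\<^sup>2)"

lemma pot_drop:
  assumes le: "\<And>i j. i < n \<Longrightarrow> j < n \<Longrightarrow> (real (X' i j) - t i j)\<^sup>2 \<le> (real (X i j) + \<delta> i j - t i j)\<^sup>2"
    and neg: "2 * (\<Sum>i<n. \<Sum>j<n. \<delta> i j * (real (X i j) - t i j)) + (\<Sum>i<n. \<Sum>j<n. (\<delta> i j)\<^sup>2) < 0"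
  shows "pot n t X' < pot n t X"
proof -
  have "pot n t X' \<le> (\<Sum>i<n. \<Sum>j<n. (real (X i j) + \<delta> i j - t i j)\<^sup>2)"
    unfolding pot_def using le by (intro sum_mono) auto
  also have "\<dots> = (\<Sum>i<n. \<Sum>j<n. (real (X i j) - t i j)\<^sup>2 + 2 * (\<delta> i j * (real (X i j) - t i j)) + (\<delta> i j)\<^sup>2)"
    by (intro sum.cong refl) (simp add: power2_eq_square algebra_simps)
  also have "\<dots> = pot n t X + (2 * (\<Sum>i<n. \<Sum>j<n. \<delta> i j * (real (X i j) - t i j)) + (\<Sum>i<n. \<Sum>j<n. (\<delta> i j)\<^sup>2))"
    by (simp add: pot_def sum.distrib sum_distrib_left)
  finally show ?thesis using neg by linarith
qed

text \<open>Clipping is the projection onto \<open>[0, N]\<close>, an interval that contains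
  \<open>t\<close>, so the distance cannot grow.\<close>

lemma clip_le:
  fixes x p r N :: nat and t :: real
  assumes "0 \<le> t" "t \<le> real N"
  shows "(real (N - (N - (x + p - r))) - t)\<^sup>2 \<le> (real x + (real p - real r) - t)\<^sup>2"
proof -
  have e: "real (N - (N - (x + p - r))) = min (real N) (max 0 (real x + (real p - real r)))"
    by (auto simp: min_def max_def of_nat_diff)
  show ?thesis unfolding e abs_le_square_iff[symmetric] using assms by (auto simp: min_def max_def)
qed

lemma diff_one_le:
  fixes x :: nat and t :: real
  assumes "0 \<le> t"
  shows "(real (x - 1) - t)\<^sup>2 \<le> (real x + (- 1) - t)\<^sup>2"
  unfolding abs_le_square_iff[symmetric] using assms by (cases x) auto

lemma sum_power2_le:
  fixes f :: "'a \<Rightarrow> real"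
  assumes "finite A" "\<And>x. x \<in> A \<Longrightarrow> 0 \<le> f x"
  shows "(\<Sum>x\<in>A. (f x)\<^sup>2) \<le> (\<Sum>x\<in>A. f x)\<^sup>2"
proof -
  have "(\<Sum>x\<in>A. (f x)\<^sup>2) \<le> (\<Sum>x\<in>A. f x * (\<Sum>y\<in>A. f y))"
  proof (rule sum_mono)
    fix x assume x: "x \<in> A"
    then have "f x \<le> (\<Sum>y\<in>A. f y)" using assms by (intro member_le_sum) auto
    then show "(f x)\<^sup>2 \<le> f x * (\<Sum>y\<in>A. f y)" unfolding power2_eq_square using assms(2)[OF x] by (intro mult_left_mono)
  qed
  then show ?thesis by (simp add: power2_eq_square sum_distrib_right)
qed

text \<open>The exact step, by the factor \<open>c = K / \<sigma>\<close>, has a linear term of at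
  most \<open>- 2 * K * K\<close>. Rounding moves each of the \<open>n * n\<close> entries by at
  most 1 against a difference of at most \<open>N\<close>, in all at most
  \<open>n * n * N = K * K\<close>; this fixes the relation between \<open>K\<close> and
  \<open>N\<close>. Twice the remaining \<open>- K * K\<close> outweighs the squared length of the
  step, which is at most \<open>K * K\<close>.\<close>

lemma push_drop:
  fixes P R X :: "nat \<Rightarrow> nat \<Rightarrow> nat" and t :: "nat \<Rightarrow> nat \<Rightarrow> real"
  assumes t: "\<And>i j. i < n \<Longrightarrow> j < n \<Longrightarrow> 0 \<le> t i j \<and> t i j \<le> real N"
    and X: "\<And>i j. i < n \<Longrightarrow> j < n \<Longrightarrow> X i j \<le> N"
    and PR: "\<And>i j. P i j = 0 \<or> R i j = 0" and \<sigma>: "0 < \<sigma>" and K: "0 < K" "K * K = n * n * N"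
    and sq: "(\<Sum>i<n. \<Sum>j<n. (real (P i j) - real (R i j))\<^sup>2) \<le> (real \<sigma>)\<^sup>2"
    and viol: "(\<Sum>i<n. \<Sum>j<n. (real (P i j) - real (R i j)) * (real (X i j) - t i j)) \<le> - 2 * real K * real \<sigma>"
  shows "pot n t (push n N K P R \<sigma> X) < pot n t X"
proof -
  define \<delta> where "\<delta> i j = real ((K * P i j) div \<sigma>) - real ((K * R i j) div \<sigma>)" for i j
  define z where "z i j = real (P i j) - real (R i j)" for i j
  define c where "c = real K / real \<sigma>"
  have c: "0 < c" using K \<sigma> by (simp add: c_def)
  have dv: "real ((K * m) div \<sigma>) \<le> c * real m" "c * real m - 1 \<le> real ((K * m) div \<sigma>)" for m
  proof -
    have "real ((K * m) div \<sigma>) \<le> real (K * m) / real \<sigma>" by (rule of_nat_div_le_of_nat)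
    then show "real ((K * m) div \<sigma>) \<le> c * real m" by (simp add: c_def)
    have "real (K * m) / real \<sigma> - real ((K * m) div \<sigma>) \<le> 1"
      using floor_divide_of_nat_eq[of "K * m" \<sigma>, where 'a = real] floor_correct[of "real (K * m) / real \<sigma>"] by linarith
    then show "c * real m - 1 \<le> real ((K * m) div \<sigma>)" by (simp add: c_def)
  qed
  \<comment> \<open>At most one of \<open>P i j\<close> and \<open>R i j\<close> is nonzero, so the
    two quotients together round the signed number toward zero; in particular the step does not get
    longer.\<close>
  have \<delta>: "\<bar>\<delta> i j - c * z i j\<bar> \<le> 1" "\<bar>\<delta> i j\<bar> \<le> \<bar>c * z i j\<bar>" for i j
    using PR[of i j] dv[of "P i j"] dv[of "R i j"] by (auto simp: \<delta>_def z_def)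
  have "(\<Sum>i<n. \<Sum>j<n. \<delta> i j * (real (X i j) - t i j)) \<le> (\<Sum>i<n. \<Sum>j<n. c * (z i j * (real (X i j) - t i j)) + real N)"
  proof (intro sum_mono)
    fix i j assume "i \<in> {..<n}" "j \<in> {..<n}"
    then have "\<bar>real (X i j) - t i j\<bar> \<le> real N" using t[of i j] X[of i j] by auto
    then have "\<bar>(\<delta> i j - c * z i j) * (real (X i j) - t i j)\<bar> \<le> 1 * real N"
      unfolding abs_mult using \<delta>(1) by (intro mult_mono) auto
    then have "(\<delta> i j - c * z i j) * (real (X i j) - t i j) \<le> real N" by linarith
    then show "\<delta> i j * (real (X i j) - t i j) \<le> c * (z i j * (real (X i j) - t i j)) + real N" by (simp add: algebra_simps)
  qed
  also have "\<dots> = c * (\<Sum>i<n. \<Sum>j<n. z i j * (real (X i j) - t i j)) + real (n * n * N)"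
    by (simp add: sum.distrib sum_distrib_left)
  also have "\<dots> \<le> c * (- 2 * real K * real \<sigma>) + real (n * n * N)"
    using viol c unfolding z_def by (intro add_right_mono mult_left_mono) auto
  also have "c * (- 2 * real K * real \<sigma>) = - 2 * real (K * K)" using \<sigma> by (simp add: c_def)
  finally have a: "(\<Sum>i<n. \<Sum>j<n. \<delta> i j * (real (X i j) - t i j)) \<le> - real (K * K)" using K by (simp add: mult_ac)
  have "(\<Sum>i<n. \<Sum>j<n. (\<delta> i j)\<^sup>2) \<le> (\<Sum>i<n. \<Sum>j<n. c\<^sup>2 * (z i j)\<^sup>2)"
    using \<delta>(2) by (intro sum_mono) (metis abs_le_square_iff power_mult_distrib)
  also have "\<dots> = c\<^sup>2 * (\<Sum>i<n. \<Sum>j<n. (z i j)\<^sup>2)" by (simp add: sum_distrib_left)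
  also have "\<dots> \<le> c\<^sup>2 * (real \<sigma>)\<^sup>2" using sq unfolding z_def by (intro mult_left_mono) auto
  also have "\<dots> = real (K * K)" using \<sigma> by (simp add: c_def power2_eq_square)
  finally have b: "(\<Sum>i<n. \<Sum>j<n. (\<delta> i j)\<^sup>2) \<le> real (K * K)" .
  have "0 < real (K * K)" using K(1) by simp
  show ?thesis
  proof (rule pot_drop)
    fix i j assume ij: "i < n" "j < n"
    then have e: "push n N K P R \<sigma> X i j = N - (N - (X i j + (K * P i j) div \<sigma> - (K * R i j) div \<sigma>))" by (simp add: push_def)
    show "(real (push n N K P R \<sigma> X i j) - t i j)\<^sup>2 \<le> (real (X i j) + \<delta> i j - t i j)\<^sup>2"
      unfolding e \<delta>_def using t[OF ij] by (intro clip_le) auto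
  next
    show "2 * (\<Sum>i<n. \<Sum>j<n. \<delta> i j * (real (X i j) - t i j)) + (\<Sum>i<n. \<Sum>j<n. (\<delta> i j)\<^sup>2) < 0"
      using a b \<open>0 < real (K * K)\<close> by linarith
  qed
qed

section \<open>Powers and quadratic forms in an eigenbasis\<close>

lemma spectral_product:
  fixes v :: "nat \<Rightarrow> nat \<Rightarrow> real"
  assumes ortho: "\<forall>l<n. \<forall>m<n. (\<Sum>i<n. v l i * v m i) = (if l = m then 1 else 0)"
  shows "(\<Sum>m<n. (\<Sum>l<n. \<alpha> l * v l i * v l m) * (\<Sum>r<n. \<beta> r * v r m * v r j)) = (\<Sum>l<n. \<alpha> l * \<beta> l * v l i * v l j)"
proof -
  have "(\<Sum>m<n. (\<Sum>l<n. \<alpha> l * v l i * v l m) * (\<Sum>r<n. \<beta> r * v r m * v r j))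
      = (\<Sum>m<n. \<Sum>l<n. \<Sum>r<n. \<alpha> l * \<beta> r * v l i * v r j * (v l m * v r m))"
    by (simp add: sum_product mult_ac)
  also have "\<dots> = (\<Sum>l<n. \<Sum>m<n. \<Sum>r<n. \<alpha> l * \<beta> r * v l i * v r j * (v l m * v r m))" by (rule sum.swap)
  also have "\<dots> = (\<Sum>l<n. \<Sum>r<n. \<Sum>m<n. \<alpha> l * \<beta> r * v l i * v r j * (v l m * v r m))" by (intro sum.cong refl sum.swap)
  also have "\<dots> = (\<Sum>l<n. \<Sum>r<n. \<alpha> l * \<beta> r * v l i * v r j * (if l = r then 1 else 0))"
    using ortho by (intro sum.cong refl) (simp flip: sum_distrib_left)
  also have "\<dots> = (\<Sum>l<n. \<Sum>r<n. if l = r then \<alpha> l * \<beta> l * v l i * v l j else 0)" by (intro sum.cong refl) auto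
  finally show ?thesis by simp
qed

lemma spectral_inner:
  fixes v :: "nat \<Rightarrow> nat \<Rightarrow> real"
  assumes ortho: "\<forall>l<n. \<forall>m<n. (\<Sum>i<n. v l i * v m i) = (if l = m then 1 else 0)"
  shows "(\<Sum>i<n. \<Sum>j<n. (\<Sum>l<n. \<alpha> l * v l i * v l j) * (\<Sum>r<n. \<beta> r * v r i * v r j)) = (\<Sum>l<n. \<alpha> l * \<beta> l)"
proof -
  have "(\<Sum>i<n. \<Sum>j<n. (\<Sum>l<n. \<alpha> l * v l i * v l j) * (\<Sum>r<n. \<beta> r * v r i * v r j))
      = (\<Sum>i<n. \<Sum>j<n. (\<Sum>l<n. \<alpha> l * v l i * v l j) * (\<Sum>r<n. \<beta> r * v r j * v r i))"
    by (simp add: mult_ac)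
  also have "\<dots> = (\<Sum>i<n. \<Sum>l<n. \<alpha> l * \<beta> l * v l i * v l i)" by (simp only: spectral_product[OF ortho])
  also have "\<dots> = (\<Sum>l<n. \<Sum>i<n. \<alpha> l * \<beta> l * (v l i * v l i))" by (subst sum.swap) (simp add: mult_ac)
  also have "\<dots> = (\<Sum>l<n. \<alpha> l * \<beta> l)" using ortho by (intro sum.cong refl) (simp flip: sum_distrib_left)
  finally show ?thesis .
qed

lemma spectral_quadratic:
  fixes v :: "nat \<Rightarrow> nat \<Rightarrow> real"
  shows "(\<Sum>i\<in>A. \<Sum>j\<in>A. u i * u j * (\<Sum>l<n. \<alpha> l * v l i * v l j)) = (\<Sum>l<n. \<alpha> l * (\<Sum>i\<in>A. u i * v l i)\<^sup>2)"
proof -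
  have "(\<Sum>l<n. \<alpha> l * (\<Sum>i\<in>A. u i * v l i)\<^sup>2) = (\<Sum>l<n. \<Sum>i\<in>A. \<Sum>j\<in>A. u i * u j * (\<alpha> l * v l i * v l j))"
    by (simp add: power2_eq_square sum_product sum_distrib_left mult_ac)
  also have "\<dots> = (\<Sum>i\<in>A. \<Sum>l<n. \<Sum>j\<in>A. u i * u j * (\<alpha> l * v l i * v l j))" by (rule sum.swap)
  also have "\<dots> = (\<Sum>i\<in>A. \<Sum>j\<in>A. \<Sum>l<n. u i * u j * (\<alpha> l * v l i * v l j))" by (intro sum.cong refl sum.swap)
  finally show ?thesis by (simp add: sum_distrib_left)
qed

text \<open>The difference \<open>Z\<close> of the pair is multiplied by
  \<open>n * N * I - X\<close> in each round, so it keeps the eigenvectors and its eigenvalues are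
  powers.\<close>

lemma pow_pair_spectral:
  assumes ortho: "\<forall>l<n. \<forall>m<n. (\<Sum>i<n. v l i * v m i) = (if l = m then 1 else 0)"
    and compl: "\<forall>i<n. \<forall>j<n. (\<Sum>l<n. v l i * v l j) = (if i = j then 1 else 0)"
    and dec: "\<forall>i<n. \<forall>j<n. (if i = j then real n * real N else 0) - real (X i j) = (\<Sum>l<n. \<mu> l * v l i * v l j)"
    and ij: "i < n" "j < n"
  shows "real (fst (pow_pair n N X e) i j) - real (snd (pow_pair n N X e) i j) = (\<Sum>l<n. \<mu> l ^ e * v l i * v l j)"
  using ij
proof (induction e arbitrary: i j)
  case 0
  then show ?case using compl by simp
next
  case (Suc e)
  let ?Z = "\<lambda>i j. real (fst (pow_pair n N X e) i j) - real (snd (pow_pair n N X e) i j)"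
  have "real (fst (pow_pair n N X (Suc e)) i j) - real (snd (pow_pair n N X (Suc e)) i j)
      = real n * real N * ?Z i j - (\<Sum>m<n. ?Z i m * real (X m j))"
    by (simp add: algebra_simps sum_subtractf)
  also have "real n * real N * ?Z i j = (\<Sum>m<n. if m = j then ?Z i m * (real n * real N) else 0)" using Suc.prems by simp
  also have "\<dots> - (\<Sum>m<n. ?Z i m * real (X m j)) = (\<Sum>m<n. ?Z i m * ((if m = j then real n * real N else 0) - real (X m j)))"
    unfolding sum_subtractf[symmetric] by (intro sum.cong refl) (simp add: algebra_simps)
  also have "\<dots> = (\<Sum>m<n. (\<Sum>l<n. \<mu> l ^ e * v l i * v l m) * (\<Sum>r<n. \<mu> r * v r m * v r j))"
  proof (rule sum.cong[OF refl])
    fix m assume "m \<in> {..<n}"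
    then have m: "m < n" by simp
    show "?Z i m * ((if m = j then real n * real N else 0) - real (X m j)) = (\<Sum>l<n. \<mu> l ^ e * v l i * v l m) * (\<Sum>r<n. \<mu> r * v r m * v r j)"
      unfolding Suc.IH[OF Suc.prems(1) m] dec[rule_format, OF m Suc.prems(2), symmetric] ..
  qed
  also have "\<dots> = (\<Sum>l<n. \<mu> l ^ Suc e * v l i * v l j)" unfolding spectral_product[OF ortho] by (simp add: mult_ac)
  finally show ?case .
qed

text \<open>
  Power iteration: if \<open>\<mu>\<close> had an entry above \<open>c + E\<close>, its power would dominate the sum and make it negative.
\<close>

lemma power_sum_bound:
  fixes \<mu> :: "nat \<Rightarrow> real"
  assumes nonneg: "\<And>l. l < n \<Longrightarrow> 0 \<le> \<mu> l" and c: "0 < c" and E: "0 < E" and big: "real n * c\<^sup>2 \<le> real T * E\<^sup>2"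
    and pos: "0 < (\<Sum>l<n. \<mu> l ^ T * (c - \<mu> l))" and l: "l < n"
  shows "\<mu> l \<le> c + E"
proof (rule ccontr)
  assume "\<not> \<mu> l \<le> c + E"
  then have gt: "c + E < \<mu> l" by simp
  have b: "\<mu> m ^ T * (c - \<mu> m) \<le> c ^ T * c" if "m < n" for m
  proof (cases "\<mu> m \<le> c")
    case True
    then show ?thesis using nonneg[OF that] c by (intro mult_mono power_mono) auto
  next
    case False
    then have "\<mu> m ^ T * (c - \<mu> m) \<le> 0" using nonneg[OF that] by (intro mult_nonneg_nonpos) auto
    moreover have "0 \<le> c ^ T * c" using c by simp
    ultimately show ?thesis by linarith
  qed
  have "(\<Sum>l<n. \<mu> l ^ T * (c - \<mu> l)) = \<mu> l ^ T * (c - \<mu> l) + (\<Sum>m\<in>{..<n} - {l}. \<mu> m ^ T * (c - \<mu> m))"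
    using l by (subst sum.remove[of _ l]) auto
  also have "\<dots> \<le> \<mu> l ^ T * (c - \<mu> l) + (\<Sum>m\<in>{..<n} - {l}. c ^ T * c)"
    using b by (intro add_left_mono sum_mono) auto
  also have "\<dots> \<le> \<mu> l ^ T * (c - \<mu> l) + real n * (c ^ T * c)"
    using c l by (simp add: card_Diff_singleton mult_right_mono)
  finally have 1: "\<mu> l ^ T * (\<mu> l - c) < real n * (c ^ T * c)" using pos by (simp add: algebra_simps)
  have "(c + E) ^ T * E \<le> \<mu> l ^ T * (\<mu> l - c)" using gt c E by (intro mult_mono power_mono) auto
  then have 2: "(c + E) ^ T * E < real n * (c ^ T * c)" using 1 by simp
  \<comment> \<open>Bernoulli's inequality replaces the exponential growth of
    \<open>((c + E) / c) ^ T\<close> by a linear one, which an exponent \<open>T\<close> of order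
    \<open>n * c\<^sup>2 / E\<^sup>2\<close> makes large enough.\<close>
  have "1 + real T * (E / c) \<le> (1 + E / c) ^ T" using c E by (intro Bernoulli_inequality) (simp add: less_imp_le order_trans[of "-1" 0])
  then have "c ^ T * (1 + real T * (E / c)) * E \<le> c ^ T * (1 + E / c) ^ T * E" using c E by (intro mult_right_mono mult_left_mono) auto
  also have "c ^ T * (1 + E / c) ^ T = (c + E) ^ T" using c by (simp add: power_mult_distrib[symmetric] distrib_left)
  finally have "c ^ T * (1 + real T * (E / c)) * E < c ^ T * (real n * c)" using 2 by (simp add: mult_ac)
  then have "(1 + real T * (E / c)) * E < real n * c" using c by (simp add: mult.assoc)
  then have "((1 + real T * (E / c)) * E) * c < (real n * c) * c" using c by simp
  moreover have "((1 + real T * (E / c)) * E) * c = E * c + real T * E\<^sup>2" using c by (simp add: field_simps power2_eq_square)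
  ultimately have "E * c + real T * E\<^sup>2 < real n * c\<^sup>2" by (simp add: power2_eq_square)
  moreover have "0 < E * c" using c E by simp
  ultimately show False using big by linarith
qed

section \<open>Each correction approaches the planted matrix\<close>

locale planted_matrix =
  fixes n k N :: nat and S :: "nat set"
  assumes S: "S \<subseteq> {..<n}" "card S = k" and n0: "1000 < n" and N: "N = n ^ 18"
begin

definition t :: "nat \<Rightarrow> nat \<Rightarrow> real" where
  "t i j = (if i \<in> S \<and> j \<in> S then real N else 0)"

definition ssym :: "(nat \<Rightarrow> nat \<Rightarrow> nat) \<Rightarrow> bool" where
  "ssym X \<longleftrightarrow> (\<forall>i<n. \<forall>j<n. X i j = X j i \<and> X i j \<le> N)"

lemma N0: "0 < N" using n0 by (simp add: N)

lemma t_bounds: "0 \<le> t i j \<and> t i j \<le> real N" by (simp add: t_def)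

lemma sum_t: "(\<Sum>i<n. \<Sum>j<n. f i j * t i j) = real N * (\<Sum>i\<in>S. \<Sum>j\<in>S. f i j)"
proof -
  have "(\<Sum>i<n. \<Sum>j<n. f i j * t i j) = (\<Sum>i<n. if i \<in> S then (\<Sum>j<n. if j \<in> S then f i j * real N else 0) else 0)"
    unfolding t_def by (intro sum.cong) (auto intro!: sum.cong)
  also have "\<dots> = (\<Sum>i\<in>S. \<Sum>j\<in>S. f i j * real N)"
    using S(1) by (simp add: sum.inter_restrict[symmetric] Int_absorb1)
  finally show ?thesis by (simp add: sum_distrib_left sum_distrib_right mult.commute)
qed

lemma sum_diag_t: "(\<Sum>i<n. t i i) = real (k * N)"
proof -
  have "(\<Sum>i<n. t i i) = (\<Sum>i<n. if i \<in> S then real N else 0)" unfolding t_def by simp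
  also have "\<dots> = (\<Sum>i\<in>S. real N)" using S(1) by (simp add: sum.inter_restrict[symmetric] Int_absorb1)
  finally show ?thesis using S by simp
qed

lemma shrink_diag_drop:
  assumes "ssym X"
  shows "ssym (shrink_diag n k N X) \<and> (shrink_diag n k N X = X \<and> (\<Sum>i<n. X i i) < k * N + n \<or> pot n t (shrink_diag n k N X) < pot n t X)"
proof (cases "k * N + n \<le> (\<Sum>i<n. X i i)")
  case True
  let ?d = "\<lambda>i j. if i = j then - 1 else 0 :: real"
  have "pot n t (shrink_diag n k N X) < pot n t X"
  proof (rule pot_drop)
    fix i j assume "i < n" "j < n"
    then show "(real (shrink_diag n k N X i j) - t i j)\<^sup>2 \<le> (real (X i j) + ?d i j - t i j)\<^sup>2"
      using True diff_one_le[of "t i j" "X i j"] t_bounds[of i j] by (cases "i = j") (simp_all add: shrink_diag_def)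
  next
    have "(\<Sum>i<n. \<Sum>j<n. ?d i j * (real (X i j) - t i j)) = (\<Sum>i<n. \<Sum>j<n. if i = j then - (real (X i i) - t i i) else 0)"
      by (intro sum.cong) auto
    also have "\<dots> = - ((\<Sum>i<n. real (X i i)) - (\<Sum>i<n. t i i))" by (simp add: sum_subtractf sum_negf flip: sum_negf)
    finally have a: "(\<Sum>i<n. \<Sum>j<n. ?d i j * (real (X i j) - t i j)) = real (k * N) - real (\<Sum>i<n. X i i)" unfolding sum_diag_t by simp
    have b: "(\<Sum>i<n. \<Sum>j<n. (?d i j)\<^sup>2) = real n"
    proof -
      have "(\<Sum>i<n. \<Sum>j<n. (?d i j)\<^sup>2) = (\<Sum>i<n. \<Sum>j<n. if i = j then 1 else 0)" by (intro sum.cong) auto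
      then show ?thesis by simp
    qed
    have "real (k * N + n) \<le> real (\<Sum>i<n. X i i)" using True by (simp only: of_nat_le_iff)
    then show "2 * (\<Sum>i<n. \<Sum>j<n. ?d i j * (real (X i j) - t i j)) + (\<Sum>i<n. \<Sum>j<n. (?d i j)\<^sup>2) < 0"
      unfolding a b using n0 by simp
  qed
  moreover have "ssym (shrink_diag n k N X)" using assms True unfolding ssym_def shrink_diag_def by (auto intro: le_trans[OF diff_le_self])
  ultimately show ?thesis by blast
next
  case False
  then show ?thesis using assms by (simp add: shrink_diag_def)
qed

lemma shrink_all_drop:
  assumes "ssym X"
  shows "ssym (shrink_all n k N X) \<and> (shrink_all n k N X = X \<and> (\<Sum>i<n. \<Sum>j<n. X i j) < k * k * N + n * n \<or> pot n t (shrink_all n k N X) < pot n t X)"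
proof (cases "k * k * N + n * n \<le> (\<Sum>i<n. \<Sum>j<n. X i j)")
  case True
  have "pot n t (shrink_all n k N X) < pot n t X"
  proof (rule pot_drop)
    fix i j assume "i < n" "j < n"
    then show "(real (shrink_all n k N X i j) - t i j)\<^sup>2 \<le> (real (X i j) + (- 1) - t i j)\<^sup>2"
      using True diff_one_le[of "t i j" "X i j"] t_bounds[of i j] by (simp add: shrink_all_def)
  next
    have st: "(\<Sum>i<n. \<Sum>j<n. t i j) = real (k * k * N)" using sum_t[of "\<lambda>_ _. 1"] S by simp
    have a: "(\<Sum>i<n. \<Sum>j<n. (- 1) * (real (X i j) - t i j)) = real (k * k * N) - real (\<Sum>i<n. \<Sum>j<n. X i j)"
      unfolding st[symmetric] by (simp add: sum_subtractf)
    have "real (k * k * N + n * n) \<le> real (\<Sum>i<n. \<Sum>j<n. X i j)" using True by (simp only: of_nat_le_iff)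
    moreover have q: "(\<Sum>i<n. \<Sum>j<n. (- 1 :: real)\<^sup>2) = real (n * n)" "0 < real (n * n)" using n0 by simp_all
    moreover have "x + z \<le> y \<Longrightarrow> 0 < z \<Longrightarrow> 2 * (x - y) + z < 0" for x y z :: real by auto
    ultimately show "2 * (\<Sum>i<n. \<Sum>j<n. (- 1) * (real (X i j) - t i j)) + (\<Sum>i<n. \<Sum>j<n. (- 1 :: real)\<^sup>2) < 0"
      unfolding a q(1) of_nat_add by blast
  qed
  moreover have "ssym (shrink_all n k N X)" using assms True unfolding ssym_def shrink_all_def by (auto intro: le_trans[OF diff_le_self])
  ultimately show ?thesis by blast
next
  case False
  then show ?thesis using assms by (simp add: shrink_all_def)
qed

text \<open>A gap \<open>X i j - X i i\<close> of at least 2 gives a linear gain of at least 8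
  against the squared step length \<open>4 + 1 + 1\<close>. A gap of 1 would gain only 4, hence the
  tolerance 1 in the constraint.\<close>

lemma estep_drop:
  assumes X: "ssym X" and e: "estep n X Y"
  shows "ssym Y \<and> pot n t Y < pot n t X"
proof -
  obtain i j where ij: "i < n" "j < n" "X i i + 1 < X i j"
    and Y: "Y = (\<lambda>a b. if a = i \<and> b = i then X i i + 2 else if a = i \<and> b = j \<or> a = j \<and> b = i then X a b - 1 else X a b)"
    using e unfolding estep_def by (elim exE conjE) (rule that; assumption)
  have ne: "i \<noteq> j" using ij by auto
  have sx: "X j i = X i j" "X i j \<le> N" using X ij by (simp_all add: ssym_def)
  have "ssym Y" unfolding ssym_def
  proof (intro allI impI)
    fix a b assume ab: "a < n" "b < n"
    then have "X a b = X b a" "X a b \<le> N" using X by (simp_all add: ssym_def)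
    then show "Y a b = Y b a \<and> Y a b \<le> N" using ij sx unfolding Y by auto
  qed
  moreover have "pot n t Y < pot n t X"
  proof -
    define d where "d a b = (if a = i \<and> b = i then 2 else if a = i \<and> b = j \<or> a = j \<and> b = i then - 1 else 0 :: real)" for a b
    have pt: "(\<Sum>a<n. \<Sum>b<n. if a = x then (if b = y then c else 0) else 0) = c" if "x < n" "y < n" for x y and c :: real
    proof -
      have "(\<Sum>b<n. if a = x then (if b = y then c else 0) else 0) = (if a = x then c else 0)" for a
        using that by (cases "a = x") simp_all
      then show ?thesis using that by simp
    qed
    have dg: "d a b * g a b = (if a = i then (if b = i then 2 * g i i else 0) else 0)
        + (if a = i then (if b = j then - g i j else 0) else 0) + (if a = j then (if b = i then - g j i else 0) else 0)" for a b g
      using ne by (simp add: d_def)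
    have su: "(\<Sum>a<n. \<Sum>b<n. d a b * g a b) = 2 * g i i - g i j - g j i" for g
      unfolding dg sum.distrib pt[OF ij(1,1)] pt[OF ij(1,2)] pt[OF ij(2,1)] by simp
    have sq: "(\<Sum>a<n. \<Sum>b<n. (d a b)\<^sup>2) = 6"
    proof -
      have "(\<Sum>a<n. \<Sum>b<n. (d a b)\<^sup>2) = (\<Sum>a<n. \<Sum>b<n. d a b * d a b)" by (simp add: power2_eq_square)
      also have "\<dots> = 2 * d i i - d i j - d j i" by (rule su)
      finally show ?thesis using ne by (simp add: d_def)
    qed
    show ?thesis
    proof (rule pot_drop)
      fix a b assume "a < n" "b < n"
      have "real (Y a b) = real (X a b) + d a b" using ij sx ne unfolding Y d_def by auto
      then show "(real (Y a b) - t a b)\<^sup>2 \<le> (real (X a b) + d a b - t a b)\<^sup>2" by simp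
    next
      have "t i j \<le> t i i" "t j i \<le> t i i" by (auto simp: t_def)
      moreover have "real (X i i) + 2 \<le> real (X i j)" using ij(3) by linarith
      ultimately show "2 * (\<Sum>a<n. \<Sum>b<n. d a b * (real (X a b) - t a b)) + (\<Sum>a<n. \<Sum>b<n. (d a b)\<^sup>2) < 0"
        unfolding su[of "\<lambda>a b. real (X a b) - t a b"] sq using sx(1) by simp
    qed
  qed
  ultimately show ?thesis by blast
qed

lemma esteps_drop: "(estep n)\<^sup>+\<^sup>+ X Y \<Longrightarrow> ssym X \<Longrightarrow> ssym Y \<and> pot n t Y < pot n t X"
proof (induction rule: tranclp.induct)
  case (r_into_trancl a b)
  then show ?case using estep_drop by blast
next
  case (trancl_into_trancl a b c)
  then show ?case using estep_drop[of b c] by force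
qed

text \<open>The condition on \<open>g\<close> says that the planted matrix reaches the target. The
  norm of \<open>W\<close> is at most the sum \<open>M\<close> of its entries, the normalisation
  used here, and the tolerance \<open>2 * n ^ 10\<close> is exactly the violation that
  \<open>push_drop\<close> asks for.\<close>

lemma raise_weight_drop:
  fixes W :: "nat \<Rightarrow> nat \<Rightarrow> nat"
  assumes X: "ssym X" and W: "\<And>i j. i < n \<Longrightarrow> j < n \<Longrightarrow> W i j = W j i"
    and M: "M = (\<Sum>i<n. \<Sum>j<n. W i j)" "0 < M" and g: "real g * real M \<le> real N * (\<Sum>i\<in>S. \<Sum>j\<in>S. real (W i j))"
  shows "ssym (raise_weight n N (n ^ 10) (2 * n ^ 10) M g W X) \<and>
    (raise_weight n N (n ^ 10) (2 * n ^ 10) M g W X = X \<and> g * M < (\<Sum>i<n. \<Sum>j<n. W i j * X i j) + 2 * n ^ 10 * M \<or>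
     pot n t (raise_weight n N (n ^ 10) (2 * n ^ 10) M g W X) < pot n t X)"
proof (cases "(\<Sum>i<n. \<Sum>j<n. W i j * X i j) + 2 * n ^ 10 * M \<le> g * M")
  case True
  let ?Y = "push n N (n ^ 10) W (\<lambda>_ _. 0) M X"
  have e: "raise_weight n N (n ^ 10) (2 * n ^ 10) M g W X = ?Y" using True by (simp add: raise_weight_def)
  have "pot n t ?Y < pot n t X"
  proof (rule push_drop)
    show "n ^ 10 * n ^ 10 = n * n * N" unfolding N by (simp flip: power_add power2_eq_square)
    have "(\<Sum>i<n. \<Sum>j<n. (real (W i j) - real 0)\<^sup>2) = (\<Sum>x\<in>{..<n} \<times> {..<n}. (case x of (i, j) \<Rightarrow> real (W i j))\<^sup>2)"
      unfolding sum.cartesian_product by (intro sum.cong) auto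
    also have "\<dots> \<le> (\<Sum>x\<in>{..<n} \<times> {..<n}. (case x of (i, j) \<Rightarrow> real (W i j)))\<^sup>2" by (rule sum_power2_le) auto
    also have "(\<Sum>x\<in>{..<n} \<times> {..<n}. (case x of (i, j) \<Rightarrow> real (W i j))) = real M" unfolding M by (simp add: sum.cartesian_product split_beta)
    finally show "(\<Sum>i<n. \<Sum>j<n. (real (W i j) - real 0)\<^sup>2) \<le> (real M)\<^sup>2" .
    have "(\<Sum>i<n. \<Sum>j<n. (real (W i j) - real 0) * (real (X i j) - t i j)) = real (\<Sum>i<n. \<Sum>j<n. W i j * X i j) - (\<Sum>i<n. \<Sum>j<n. real (W i j) * t i j)"
      by (simp add: right_diff_distrib sum_subtractf)
    also have "\<dots> \<le> real (\<Sum>i<n. \<Sum>j<n. W i j * X i j) - real g * real M" unfolding sum_t using g by simp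
    also have "\<dots> \<le> - 2 * real (n ^ 10) * real M"
    proof -
      have "real ((\<Sum>i<n. \<Sum>j<n. W i j * X i j) + 2 * n ^ 10 * M) \<le> real (g * M)" using True by (simp only: of_nat_le_iff)
      then show ?thesis by simp
    qed
    finally show "(\<Sum>i<n. \<Sum>j<n. (real (W i j) - real 0) * (real (X i j) - t i j)) \<le> - 2 * real (n ^ 10) * real M" .
  qed (use t_bounds X n0 M(2) in \<open>auto simp: ssym_def\<close>)
  moreover have "ssym ?Y" using X W unfolding ssym_def push_def by simp
  ultimately show ?thesis unfolding e by blast
next
  case False
  then show ?thesis using X by (simp add: raise_weight_def)
qed


abbreviation "KK \<equiv> n ^ 10"
abbreviation "EE \<equiv> 2 * n ^ 10"

text \<open>Entries in \<open>[0, N]\<close> make the quadratic form of \<open>X\<close> at most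
  \<open>n * N\<close> times the squared norm, so \<open>n * N * I - X\<close> has no negative
  eigenvalue. Its corner entry is positive, so not all eigenvalues vanish and its powers have
  positive trace.\<close>

lemma spectrum:
  assumes X: "ssym X"
  obtains v \<mu> where "\<forall>l<n. \<forall>m<n. (\<Sum>i<n. v l i * v m i) = (if l = m then 1 else 0)"
    "\<forall>i<n. \<forall>j<n. (\<Sum>l<n. v l i * v l j) = (if i = j then 1 else 0)"
    "\<forall>i<n. \<forall>j<n. (if i = j then real n * real N else 0) - real (X i j) = (\<Sum>l<n. \<mu> l * v l i * v l j)"
    "\<forall>l<n. 0 \<le> \<mu> l" "\<exists>l<n. 0 < \<mu> l"
proof -
  define Y where "Y i j = (if i = j then real n * real N else 0) - real (X i j)" for i j
  have sY: "\<And>i j. i < n \<Longrightarrow> j < n \<Longrightarrow> Y i j = Y j i" using X by (auto simp: Y_def ssym_def)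
  have sd: "\<exists>(v :: nat \<Rightarrow> nat \<Rightarrow> real) (\<mu> :: nat \<Rightarrow> real).
    (\<forall>l<n. \<forall>m<n. (\<Sum>i<n. v l i * v m i) = (if l = m then 1 else 0)) \<and>
    (\<forall>i<n. \<forall>j<n. (\<Sum>l<n. v l i * v l j) = (if i = j then 1 else 0)) \<and>
    (\<forall>i<n. \<forall>j<n. Y i j = (\<Sum>l<n. \<mu> l * v l i * v l j)) \<and>
    proots (char_poly (mat n n (\<lambda>(i, j). Y i j))) = image_mset \<mu> (mset_set {..<n})"
    by (rule spectral_decomposition) (rule sY)
  obtain v \<mu> where o: "\<forall>l<n. \<forall>m<n. (\<Sum>i<n. v l i * v m i) = (if l = m then 1 else 0)"
    and c: "\<forall>i<n. \<forall>j<n. (\<Sum>l<n. v l i * v l j) = (if i = j then 1 else 0)"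
    and d: "\<forall>i<n. \<forall>j<n. Y i j = (\<Sum>l<n. \<mu> l * v l i * v l j)"
    using sd by (elim exE conjE) (rule that; assumption)
  have nn: "0 \<le> \<mu> l" if l: "l < n" for l
  proof -
    have "(\<Sum>i<n. \<Sum>j<n. v l i * v l j * Y i j) = (\<Sum>i<n. \<Sum>j<n. v l i * v l j * (\<Sum>m<n. \<mu> m * v m i * v m j))" using d by simp
    also have "\<dots> = (\<Sum>m<n. \<mu> m * (\<Sum>i<n. v l i * v m i)\<^sup>2)" by (rule spectral_quadratic)
    also have "\<dots> = (\<Sum>m<n. if m = l then \<mu> l else 0)" using o l by (intro sum.cong refl) auto
    finally have e: "(\<Sum>i<n. \<Sum>j<n. v l i * v l j * Y i j) = \<mu> l" using l by simp
    have "(\<Sum>i<n. \<Sum>j<n. v l i * v l j * real (X i j)) \<le> (\<Sum>i<n. \<Sum>j<n. real N * ((v l i)\<^sup>2 + (v l j)\<^sup>2) / 2)"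
    proof (intro sum_mono)
      fix i j assume "i \<in> {..<n}" "j \<in> {..<n}"
      then have "real (X i j) \<le> real N" using X by (simp add: ssym_def)
      have "0 \<le> (v l i - v l j)\<^sup>2" by simp
      then have h: "v l i * v l j \<le> ((v l i)\<^sup>2 + (v l j)\<^sup>2) / 2" by (simp add: power2_eq_square algebra_simps)
      have "v l i * v l j * real (X i j) \<le> ((v l i)\<^sup>2 + (v l j)\<^sup>2) / 2 * real (X i j)" using h by (intro mult_right_mono) auto
      also have "\<dots> \<le> ((v l i)\<^sup>2 + (v l j)\<^sup>2) / 2 * real N" using \<open>real (X i j) \<le> real N\<close> by (intro mult_left_mono) auto
      finally show "v l i * v l j * real (X i j) \<le> real N * ((v l i)\<^sup>2 + (v l j)\<^sup>2) / 2" by (simp add: mult_ac)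
    qed
    also have "\<dots> = real N * (real n * (\<Sum>i<n. (v l i)\<^sup>2))"
      by (simp add: distrib_left sum.distrib add_divide_distrib flip: sum_distrib_left sum_divide_distrib)
    also have "(\<Sum>i<n. (v l i)\<^sup>2) = 1" using o l by (simp add: power2_eq_square)
    finally have x: "(\<Sum>i<n. \<Sum>j<n. v l i * v l j * real (X i j)) \<le> real N * real n" by simp
    have "(\<Sum>i<n. \<Sum>j<n. v l i * v l j * Y i j) = (\<Sum>i<n. \<Sum>j<n. (if i = j then real n * real N * (v l i * v l i) else 0)) - (\<Sum>i<n. \<Sum>j<n. v l i * v l j * real (X i j))"
      unfolding sum_subtractf[symmetric] Y_def by (intro sum.cong refl) (auto simp: algebra_simps)
    also have "(\<Sum>i<n. \<Sum>j<n. (if i = j then real n * real N * (v l i * v l i) else 0)) = real n * real N * (\<Sum>i<n. v l i * v l i)"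
      by (simp add: sum_distrib_left)
    also have "(\<Sum>i<n. v l i * v l i) = 1" using o l by simp
    finally show ?thesis using e x by (simp add: mult.commute)
  qed
  have "\<exists>l<n. 0 < \<mu> l"
  proof (rule ccontr)
    assume "\<not> (\<exists>l<n. 0 < \<mu> l)"
    then have "\<mu> l = 0" if "l < n" for l using nn that by force
    then have "Y 0 0 = 0" using d n0 by simp
    moreover have "real (X 0 0) \<le> real N" using X n0 by (simp add: ssym_def)
    moreover have "1 * real N < real n * real N" using n0 N0 by (intro mult_strict_right_mono) auto
    ultimately show False by (simp add: Y_def)
  qed
  then show ?thesis using that[OF o c d[unfolded Y_def]] nn by blast
qed

text \<open>If the test fires, \<open>Z\<close> separates: its inner product with the planted matrix
  is \<open>N\<close> times a value of a positive semidefinite form, hence nonnegative, whereas that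
  with \<open>X\<close> is clearly negative. If not, \<open>power_sum_bound\<close> limits the
  eigenvalues of \<open>n * N * I - X\<close> to \<open>n * N + 2 * EE\<close>, so \<open>X\<close>
  has none below \<open>- 2 * EE\<close>.\<close>

lemma raise_psd_drop:
  assumes X: "ssym X"
  defines "X' \<equiv> raise_psd n N KK EE (2 * (n * N)) X"
  shows "ssym X' \<and> (X' = X \<and> (\<forall>u. - 2 * real EE * (\<Sum>i<n. (u i)\<^sup>2) \<le> (\<Sum>i<n. \<Sum>j<n. u i * u j * real (X i j))) \<or> pot n t X' < pot n t X)"
proof -
  obtain v \<mu> where o: "\<forall>l<n. \<forall>m<n. (\<Sum>i<n. v l i * v m i) = (if l = m then 1 else 0)"
    and c: "\<forall>i<n. \<forall>j<n. (\<Sum>l<n. v l i * v l j) = (if i = j then 1 else 0)"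
    and d: "\<forall>i<n. \<forall>j<n. (if i = j then real n * real N else 0) - real (X i j) = (\<Sum>l<n. \<mu> l * v l i * v l j)"
    and nn: "\<forall>l<n. 0 \<le> \<mu> l" and ex: "\<exists>l<n. 0 < \<mu> l"
    by (rule spectrum[OF X])
  define e where "e = 2 * (n * N)"
  define A where "A = fst (pow_pair n N X e)"
  define B where "B = snd (pow_pair n N X e)"
  define a where "a = (\<Sum>i<n. A i i)"
  define b where "b = (\<Sum>i<n. B i i)"
  define Z where "Z i j = real (A i j) - real (B i j)" for i j
  have Z: "Z i j = (\<Sum>l<n. \<mu> l ^ e * v l i * v l j)" if "i < n" "j < n" for i j
    unfolding Z_def A_def B_def by (rule pow_pair_spectral[OF o c d that])
  have Zsym: "Z i j = Z j i" if "i < n" "j < n" for i j unfolding Z[OF that] Z[OF that(2,1)] by (simp add: mult_ac)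
  have tr: "real a - real b = (\<Sum>l<n. \<mu> l ^ e)"
  proof -
    have "real a - real b = (\<Sum>i<n. Z i i)" by (simp add: a_def b_def Z_def sum_subtractf)
    also have "\<dots> = (\<Sum>i<n. \<Sum>l<n. \<mu> l ^ e * (v l i * v l i))" using Z by (simp add: mult_ac)
    also have "\<dots> = (\<Sum>l<n. \<Sum>i<n. \<mu> l ^ e * (v l i * v l i))" by (rule sum.swap)
    also have "\<dots> = (\<Sum>l<n. \<mu> l ^ e)" using o by (intro sum.cong refl) (simp flip: sum_distrib_left)
    finally show ?thesis .
  qed
  have pos: "0 < (\<Sum>l<n. \<mu> l ^ e)"
  proof -
    obtain l where "l < n" "0 < \<mu> l" using ex by blast
    then show ?thesis using nn by (intro sum_pos2[of _ l]) auto
  qed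
  have ba: "b < a" "real (a - b) = (\<Sum>l<n. \<mu> l ^ e)" using tr pos by (auto simp: of_nat_diff)
  have XZ: "(\<Sum>i<n. \<Sum>j<n. Z i j * real (X i j)) = real n * real N * (\<Sum>l<n. \<mu> l ^ e) - (\<Sum>l<n. \<mu> l ^ e * \<mu> l)"
  proof -
    have "(\<Sum>i<n. \<Sum>j<n. Z i j * ((if i = j then real n * real N else 0) - real (X i j)))
        = (\<Sum>i<n. \<Sum>j<n. (\<Sum>l<n. \<mu> l ^ e * v l i * v l j) * (\<Sum>r<n. \<mu> r * v r i * v r j))" using Z d by simp
    also have "\<dots> = (\<Sum>l<n. \<mu> l ^ e * \<mu> l)" by (rule spectral_inner[OF o])
    finally have 1: "(\<Sum>i<n. \<Sum>j<n. Z i j * ((if i = j then real n * real N else 0) - real (X i j))) = (\<Sum>l<n. \<mu> l ^ e * \<mu> l)" .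
    have "(\<Sum>i<n. \<Sum>j<n. Z i j * ((if i = j then real n * real N else 0) - real (X i j)))
        = (\<Sum>i<n. \<Sum>j<n. (if i = j then real n * real N * Z i i else 0)) - (\<Sum>i<n. \<Sum>j<n. Z i j * real (X i j))"
      unfolding sum_subtractf[symmetric] by (intro sum.cong refl) (auto simp: algebra_simps)
    also have "(\<Sum>i<n. \<Sum>j<n. (if i = j then real n * real N * Z i i else 0)) = real n * real N * (\<Sum>i<n. Z i i)" by (simp add: sum_distrib_left)
    also have "(\<Sum>i<n. Z i i) = (\<Sum>l<n. \<mu> l ^ e)" unfolding tr[symmetric] by (simp add: a_def b_def Z_def sum_subtractf)
    finally show ?thesis using 1 by simp
  qed
  have cond: "real (\<Sum>i<n. \<Sum>j<n. A i j * X i j) - real (\<Sum>i<n. \<Sum>j<n. B i j * X i j) = (\<Sum>i<n. \<Sum>j<n. Z i j * real (X i j))"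
    by (simp add: Z_def left_diff_distrib sum_subtractf)
  show ?thesis
  proof (cases "(\<Sum>i<n. \<Sum>j<n. A i j * X i j) + EE * a \<le> (\<Sum>i<n. \<Sum>j<n. B i j * X i j) + EE * b")
    case True
    define P where "P i j = A i j - B i j" for i j
    define R where "R i j = B i j - A i j" for i j
    have PR: "real (P i j) - real (R i j) = Z i j" for i j by (auto simp: P_def R_def Z_def)
    have X': "X' = push n N KK P R (a - b) X"
      using True unfolding X'_def raise_psd_def Let_def P_def R_def a_def b_def A_def B_def e_def by simp
    have "pot n t (push n N KK P R (a - b) X) < pot n t X"
    proof (rule push_drop)
      show "KK * KK = n * n * N" unfolding N by (simp flip: power_add power2_eq_square)
      show "P i j = 0 \<or> R i j = 0" for i j by (simp add: P_def R_def) linarith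
      have "(\<Sum>i<n. \<Sum>j<n. (real (P i j) - real (R i j))\<^sup>2) = (\<Sum>i<n. \<Sum>j<n. (\<Sum>l<n. \<mu> l ^ e * v l i * v l j) * (\<Sum>l<n. \<mu> l ^ e * v l i * v l j))"
        unfolding PR using Z by (simp add: power2_eq_square)
      also have "\<dots> = (\<Sum>l<n. (\<mu> l ^ e)\<^sup>2)" unfolding spectral_inner[OF o] by (simp add: power2_eq_square)
      also have "\<dots> \<le> (\<Sum>l<n. \<mu> l ^ e)\<^sup>2" using nn by (intro sum_power2_le) auto
      finally show "(\<Sum>i<n. \<Sum>j<n. (real (P i j) - real (R i j))\<^sup>2) \<le> (real (a - b))\<^sup>2" unfolding ba .
      have "real ((\<Sum>i<n. \<Sum>j<n. A i j * X i j) + EE * a) \<le> real ((\<Sum>i<n. \<Sum>j<n. B i j * X i j) + EE * b)" using True by (simp only: of_nat_le_iff)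
      then have "(\<Sum>i<n. \<Sum>j<n. Z i j * real (X i j)) + real EE * (real a - real b) \<le> 0"
        unfolding cond[symmetric] of_nat_add of_nat_mult[of EE] by (simp only: right_diff_distrib)
      then have 1: "(\<Sum>i<n. \<Sum>j<n. Z i j * real (X i j)) \<le> - 2 * real KK * real (a - b)" using ba(1) by (simp add: of_nat_diff)
      have "(\<Sum>i<n. \<Sum>j<n. Z i j * t i j) = real N * (\<Sum>i\<in>S. \<Sum>j\<in>S. Z i j)" by (rule sum_t)
      also have "(\<Sum>i\<in>S. \<Sum>j\<in>S. Z i j) = (\<Sum>i\<in>S. \<Sum>j\<in>S. 1 * 1 * (\<Sum>l<n. \<mu> l ^ e * v l i * v l j))"
        using S(1) by (intro sum.cong refl) (auto simp: Z subset_iff)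
      also have "\<dots> = (\<Sum>l<n. \<mu> l ^ e * (\<Sum>i\<in>S. 1 * v l i)\<^sup>2)" by (rule spectral_quadratic)
      also have "0 \<le> real N * \<dots>" using nn by (intro mult_nonneg_nonneg sum_nonneg) auto
      finally have "0 \<le> (\<Sum>i<n. \<Sum>j<n. Z i j * t i j)" .
      then show "(\<Sum>i<n. \<Sum>j<n. (real (P i j) - real (R i j)) * (real (X i j) - t i j)) \<le> - 2 * real KK * real (a - b)"
        unfolding PR right_diff_distrib sum_subtractf using 1 by linarith
    qed (use t_bounds X n0 ba in \<open>auto simp: ssym_def\<close>)
    moreover have "ssym (push n N KK P R (a - b) X)"
      unfolding ssym_def
    proof (intro allI impI)
      fix i j assume ij: "i < n" "j < n"
      have "real (A i j) + real (B j i) = real (A j i) + real (B i j)" using Zsym[OF ij] by (simp add: Z_def)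
      then have "A i j + B j i = A j i + B i j" by linarith
      then have "P i j = P j i" "R i j = R j i" by (auto simp: P_def R_def)
      moreover have "X i j = X j i" using X ij by (simp add: ssym_def)
      ultimately show "push n N KK P R (a - b) X i j = push n N KK P R (a - b) X j i \<and> push n N KK P R (a - b) X i j \<le> N"
        using ij by (simp add: push_def)
    qed
    ultimately show ?thesis unfolding X' by blast
  next
    case False
    have X': "X' = X" using False unfolding X'_def raise_psd_def Let_def a_def b_def A_def B_def e_def by simp
    define cc where "cc = real n * real N + real EE"
    have "real ((\<Sum>i<n. \<Sum>j<n. B i j * X i j) + EE * b) < real ((\<Sum>i<n. \<Sum>j<n. A i j * X i j) + EE * a)" using False by (simp only: of_nat_less_iff not_le)
    then have "0 < (\<Sum>i<n. \<Sum>j<n. Z i j * real (X i j)) + real EE * (real a - real b)"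
      unfolding cond[symmetric] of_nat_add of_nat_mult[of EE] by (simp only: right_diff_distrib)
    then have "0 < (real n * real N * (\<Sum>l<n. \<mu> l ^ e) - (\<Sum>l<n. \<mu> l ^ e * \<mu> l)) + real EE * (\<Sum>l<n. \<mu> l ^ e)" unfolding XZ tr .
    also have "\<dots> = (\<Sum>l<n. \<mu> l ^ e * (cc - \<mu> l))"
    proof -
      have "(y * (\<Sum>l<n. \<mu> l ^ e) - (\<Sum>l<n. \<mu> l ^ e * \<mu> l)) + z * (\<Sum>l<n. \<mu> l ^ e) = (\<Sum>l<n. \<mu> l ^ e * (y + z - \<mu> l))" for y z :: real
        by (simp add: algebra_simps sum_subtractf sum.distrib sum_distrib_left)
      then show ?thesis unfolding cc_def .
    qed
    finally have p: "0 < (\<Sum>l<n. \<mu> l ^ e * (cc - \<mu> l))" .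
    \<comment> \<open>Here the exponents are balanced: \<open>cc \<le> 2 * n * N\<close> makes the
      left side at most \<open>4 * n ^ 39\<close>, while the right side is
      \<open>8 * n ^ 39\<close>.\<close>
    have big: "real n * cc\<^sup>2 \<le> real e * (real EE)\<^sup>2"
    proof -
      have "n ^ 10 \<le> n ^ 18" using n0 by (intro power_increasing) auto
      moreover have "2 * n ^ 18 \<le> n * n ^ 18" using n0 by (intro mult_right_mono) auto
      ultimately have "n * N + EE \<le> 2 * (n * N)" unfolding N by linarith
      then have "cc \<le> real (2 * (n * N))" unfolding cc_def by (metis of_nat_add of_nat_le_iff of_nat_mult)
      then have "real n * cc\<^sup>2 \<le> real n * (real (2 * (n * N)))\<^sup>2" unfolding cc_def by (intro mult_left_mono power_mono) auto
      also have "\<dots> = real (n * (2 * (n * N))\<^sup>2)" by simp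
      also have "n * (2 * (n * N))\<^sup>2 = 4 * n ^ 39" unfolding N by (simp add: power_mult_distrib flip: power_mult power_Suc power_add)
      also have "real (4 * n ^ 39) \<le> real (8 * n ^ 39)" by simp
      also have "8 * n ^ 39 = e * EE\<^sup>2" unfolding N e_def by (simp add: power_mult_distrib flip: power_mult power_Suc power_add)
      finally show ?thesis by simp
    qed
    have cp: "0 < cc" "0 < real EE" using n0 by (auto simp: cc_def intro: add_nonneg_pos)
    have up: "\<mu> l \<le> cc + real EE" if "l < n" for l
      using power_sum_bound[OF _ cp big p that] nn by blast
    have "- 2 * real EE * (\<Sum>i<n. (u i)\<^sup>2) \<le> (\<Sum>i<n. \<Sum>j<n. u i * u j * real (X i j))" for u :: "nat \<Rightarrow> real"
    proof -
      have n2: "(\<Sum>i<n. \<Sum>j<n. u i * u j * (if i = j then x else 0)) = x * (\<Sum>i<n. (u i)\<^sup>2)" for x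
      proof -
        have "(\<Sum>i<n. \<Sum>j<n. u i * u j * (if i = j then x else 0)) = (\<Sum>i<n. \<Sum>j<n. if i = j then x * (u i)\<^sup>2 else 0)"
          by (intro sum.cong refl) (auto simp: power2_eq_square)
        then show ?thesis by (simp add: sum_distrib_left)
      qed
      have "(\<Sum>i<n. \<Sum>j<n. u i * u j * ((if i = j then real n * real N else 0) - real (X i j)))
          = (\<Sum>i<n. \<Sum>j<n. u i * u j * (\<Sum>l<n. \<mu> l * v l i * v l j))" using d by simp
      also have "\<dots> = (\<Sum>l<n. \<mu> l * (\<Sum>i<n. u i * v l i)\<^sup>2)" by (rule spectral_quadratic)
      also have "\<dots> \<le> (\<Sum>l<n. (cc + real EE) * (\<Sum>i<n. u i * v l i)\<^sup>2)" using up by (intro sum_mono mult_right_mono) auto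
      also have "\<dots> = (\<Sum>i<n. \<Sum>j<n. u i * u j * (\<Sum>l<n. (cc + real EE) * v l i * v l j))" by (rule spectral_quadratic[symmetric])
      also have "\<dots> = (\<Sum>i<n. \<Sum>j<n. u i * u j * (if i = j then cc + real EE else 0))"
        using c by (intro sum.cong refl) (simp add: mult.assoc flip: sum_distrib_left)
      also have "\<dots> = (cc + real EE) * (\<Sum>i<n. (u i)\<^sup>2)" by (rule n2)
      finally have "real n * real N * (\<Sum>i<n. (u i)\<^sup>2) - (\<Sum>i<n. \<Sum>j<n. u i * u j * real (X i j)) \<le> (cc + real EE) * (\<Sum>i<n. (u i)\<^sup>2)"
        unfolding right_diff_distrib sum_subtractf n2 .
      then show ?thesis by (simp add: cc_def algebra_simps)
    qed
    then show ?thesis unfolding X' using X by blast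
  qed
qed

text \<open>All tests of a round pass up to their slack: the approximate feasibility from which the
  rounding analysis starts.\<close>

definition stable :: "nat \<Rightarrow> (nat \<Rightarrow> nat \<Rightarrow> nat) \<Rightarrow> (nat \<Rightarrow> nat \<Rightarrow> nat) \<Rightarrow> bool" where
  "stable g W X \<longleftrightarrow> ssym X \<and> (\<Sum>i<n. X i i) < k * N + n \<and> (\<Sum>i<n. \<Sum>j<n. X i j) < k * k * N + n * n \<and>
    (\<forall>i<n. \<forall>j<n. X i j \<le> X i i + 1) \<and>
    g * (\<Sum>i<n. \<Sum>j<n. W i j) < (\<Sum>i<n. \<Sum>j<n. W i j * X i j) + EE * (\<Sum>i<n. \<Sum>j<n. W i j) \<and>
    (\<forall>u. - 2 * real EE * (\<Sum>i<n. (u i)\<^sup>2) \<le> (\<Sum>i<n. \<Sum>j<n. u i * u j * real (X i j)))"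

text \<open>No stage increases the distance, and a stage that changes the matrix decreases it. If
  the distance is not lower in the end, every stage left the matrix alone, so all tests were passed
  by the same \<open>X\<close>.\<close>

lemma improves_drop:
  fixes W :: "nat \<Rightarrow> nat \<Rightarrow> nat"
  assumes X: "ssym X" and W: "\<And>i j. i < n \<Longrightarrow> j < n \<Longrightarrow> W i j = W j i"
    and M: "M = (\<Sum>i<n. \<Sum>j<n. W i j)" "0 < M" and g: "real g * real M \<le> real N * (\<Sum>i\<in>S. \<Sum>j\<in>S. real (W i j))"
    and imp: "improves n k N KK EE M (2 * (n * N)) W g X X'"
  shows "ssym X' \<and> (stable g W X \<or> pot n t X' < pot n t X)"
proof -
  define X0 where "X0 = shrink_diag n k N X"
  define X1 where "X1 = shrink_all n k N X0"
  obtain Y where Y: "Y = X1 \<and> (\<forall>i<n. \<forall>j<n. Y i j \<le> Y i i + 1) \<or> (estep n)\<^sup>+\<^sup>+ X1 Y"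
    and X': "X' = raise_psd n N KK EE (2 * (n * N)) (raise_weight n N KK EE M g W Y)"
    using imp[unfolded improves_def, folded X0_def, folded X1_def] by (elim exE conjE) (rule that; simp)
  define Z where "Z = raise_weight n N KK EE M g W Y"
  have 0: "ssym X0" "X0 = X \<and> (\<Sum>i<n. X i i) < k * N + n \<or> pot n t X0 < pot n t X"
    using shrink_diag_drop[OF X] unfolding X0_def by blast+
  have 1: "ssym X1" "X1 = X0 \<and> (\<Sum>i<n. \<Sum>j<n. X0 i j) < k * k * N + n * n \<or> pot n t X1 < pot n t X0"
    using shrink_all_drop[OF 0(1)] unfolding X1_def by blast+
  have 2: "ssym Y" "Y = X1 \<and> (\<forall>i<n. \<forall>j<n. Y i j \<le> Y i i + 1) \<or> pot n t Y < pot n t X1"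
    using Y 1(1) esteps_drop[of X1 Y] by blast+
  have 3: "ssym Z" "Z = Y \<and> g * M < (\<Sum>i<n. \<Sum>j<n. W i j * Y i j) + EE * M \<or> pot n t Z < pot n t Y"
    using raise_weight_drop[OF 2(1) W M g] unfolding Z_def by blast+
  have 4: "ssym X'" "X' = Z \<and> (\<forall>u. - 2 * real EE * (\<Sum>i<n. (u i)\<^sup>2) \<le> (\<Sum>i<n. \<Sum>j<n. u i * u j * real (Z i j))) \<or> pot n t X' < pot n t Z"
    using raise_psd_drop[OF 3(1)] unfolding X' Z_def by blast+
  have le: "pot n t X0 \<le> pot n t X" "pot n t X1 \<le> pot n t X0" "pot n t Y \<le> pot n t X1" "pot n t Z \<le> pot n t Y" "pot n t X' \<le> pot n t Z"
    using 0(2) 1(2) 2(2) 3(2) 4(2) by auto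
  show ?thesis
  proof (cases "pot n t X' < pot n t X")
    case True
    then show ?thesis using 4(1) by blast
  next
    case False
    then have e: "\<not> pot n t X0 < pot n t X" "\<not> pot n t X1 < pot n t X0" "\<not> pot n t Y < pot n t X1" "\<not> pot n t Z < pot n t Y" "\<not> pot n t X' < pot n t Z"
      using le by linarith+
    have a: "X0 = X" "(\<Sum>i<n. X i i) < k * N + n" using 0(2) e(1) by blast+
    have b: "X1 = X" "(\<Sum>i<n. \<Sum>j<n. X i j) < k * k * N + n * n" using 1(2) e(2) unfolding a(1) by blast+
    have c: "Y = X" "\<forall>i<n. \<forall>j<n. X i j \<le> X i i + 1" using 2(2) e(3) unfolding b(1) by blast+
    have d: "Z = X" "g * M < (\<Sum>i<n. \<Sum>j<n. W i j * X i j) + EE * M" using 3(2) e(4) unfolding c(1) by blast+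
    have f: "\<forall>u. - 2 * real EE * (\<Sum>i<n. (u i)\<^sup>2) \<le> (\<Sum>i<n. \<Sum>j<n. u i * u j * real (X i j))" using 4(2) e(5) unfolding d(1) by blast
    have "stable g W X" unfolding stable_def M(1)[symmetric] by (intro conjI X a(2) b(2) c(2) d(2) f)
    then show ?thesis using 4(1) by blast
  qed
qed

lemma pot_nonneg: "0 \<le> pot n t X"
  unfolding pot_def by (intro sum_nonneg) auto

lemma pot_int: "\<exists>z :: int. pot n t X = of_int z"
proof -
  have "pot n t X = of_int (\<Sum>i<n. \<Sum>j<n. (int (X i j) - (if i \<in> S \<and> j \<in> S then int N else 0))\<^sup>2)"
    unfolding pot_def t_def of_int_sum by (intro sum.cong refl) auto
  then show ?thesis by blast
qed

text \<open>Distances are integers, so each round from an unstable matrix takes at least 1 from an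
  initial value of at most \<open>n * n * N * N\<close>.\<close>

lemma stable_exists:
  fixes W :: "nat \<Rightarrow> nat \<Rightarrow> nat"
  assumes W: "\<And>i j. i < n \<Longrightarrow> j < n \<Longrightarrow> W i j = W j i"
    and M: "M = (\<Sum>i<n. \<Sum>j<n. W i j)" "0 < M" and g: "real g * real M \<le> real N * (\<Sum>i\<in>S. \<Sum>j\<in>S. real (W i j))"
    and Xs0: "\<And>i j. i < n \<Longrightarrow> j < n \<Longrightarrow> Xs 0 i j = N"
    and imp: "\<And>l. l < n * n * N * N + 1 \<Longrightarrow> improves n k N KK EE M (2 * (n * N)) W g (Xs l) (Xs (Suc l))"
  shows "\<exists>l < n * n * N * N + 1. stable g W (Xs l)"
proof (rule ccontr)
  assume no: "\<not> (\<exists>l < n * n * N * N + 1. stable g W (Xs l))"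
  have "l \<le> n * n * N * N + 1 \<Longrightarrow> ssym (Xs l) \<and> pot n t (Xs l) + real l \<le> real (n * n * N * N)" for l
  proof (induction l)
    case 0
    have "pot n t (Xs 0) \<le> (\<Sum>i<n. \<Sum>j<n. (real N)\<^sup>2)"
      unfolding pot_def
    proof (intro sum_mono)
      fix i j assume "i \<in> {..<n}" "j \<in> {..<n}"
      then show "(real (Xs 0 i j) - t i j)\<^sup>2 \<le> (real N)\<^sup>2" using Xs0[of i j] by (simp add: t_def)
    qed
    then show ?case using Xs0 by (simp add: ssym_def power2_eq_square mult_ac)
  next
    case (Suc l)
    then have l: "l < n * n * N * N + 1" by linarith
    then have IH: "ssym (Xs l)" "pot n t (Xs l) + real l \<le> real (n * n * N * N)" using Suc.IH by simp_all
    have "ssym (Xs (Suc l))" "pot n t (Xs (Suc l)) < pot n t (Xs l)"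
      using improves_drop[OF IH(1) W M g imp[OF l]] no l by blast+
    moreover obtain y z :: int where "pot n t (Xs (Suc l)) = of_int y" "pot n t (Xs l) = of_int z" using pot_int by metis
    ultimately show ?case using IH(2) by simp
  qed
  from this[of "n * n * N * N + 1"] pot_nonneg[of "Xs (n * n * N * N + 1)"] show False by simp
qed

end

section \<open>Rounding\<close>

lemma sum_restrict_square:
  fixes f :: "nat \<Rightarrow> nat \<Rightarrow> real"
  assumes "finite C" "U \<subseteq> C"
  shows "(\<Sum>i\<in>C. \<Sum>j\<in>C. if i \<in> U \<and> j \<in> U then f i j else 0) = (\<Sum>i\<in>U. \<Sum>j\<in>U. f i j)"
proof -
  have "(\<Sum>i\<in>C. \<Sum>j\<in>C. if i \<in> U \<and> j \<in> U then f i j else 0) = (\<Sum>i\<in>C. if i \<in> U then (\<Sum>j\<in>C. if j \<in> U then f i j else 0) else 0)"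
    by (intro sum.cong refl) simp
  also have "\<dots> = (\<Sum>i\<in>U. \<Sum>j\<in>U. f i j)"
    using assms by (simp add: sum.inter_restrict[symmetric] Int_absorb1)
  finally show ?thesis .
qed

text \<open>Replacing the values outside \<open>U \<inter> R\<close> by the threshold raises the
  mean over \<open>R\<close> and lowers that over \<open>U\<close>. Both sums then consist of the
  common part, whose mean is at most the threshold, and copies of the threshold; \<open>U\<close>
  has at least as many copies.\<close>

lemma threshold_average:
  fixes deg :: "nat \<Rightarrow> real"
  assumes fin: "finite R" "finite U" and le: "card R \<le> card U"
    and R: "\<And>i. i \<in> R \<Longrightarrow> deg i \<le> t" and U: "\<And>i. i \<in> U - R \<Longrightarrow> t \<le> deg i" and t: "0 \<le> t"
  shows "real (card U) * (\<Sum>i\<in>R. deg i) \<le> real (card R) * (\<Sum>i\<in>U. deg i)"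
proof -
  define s where "s = (\<Sum>i\<in>U \<inter> R. deg i)"
  define a where "a = (\<Sum>i\<in>R - U. deg i)"
  define c where "c = (\<Sum>i\<in>U - R. deg i)"
  define u1 where "u1 = real (card (U - R))"
  define u2 where "u2 = real (card (U \<inter> R))"
  define r1 where "r1 = real (card (R - U))"
  have cU: "real (card U) = u1 + u2"
    unfolding u1_def u2_def by (metis fin(2) card_Diff_subset_Int[of U R] card_mono Int_lower1 fin of_nat_add le_add_diff_inverse2 finite_Int)
  have cR: "real (card R) = r1 + u2"
    unfolding r1_def u2_def by (metis fin(1) card_Diff_subset_Int[of R U] card_mono Int_lower1 fin of_nat_add le_add_diff_inverse2 finite_Int Int_commute)
  have sR: "(\<Sum>i\<in>R. deg i) = s + a" unfolding s_def a_def using sum.Int_Diff[OF fin(1), of deg U] by (simp add: Int_commute)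
  have sU: "(\<Sum>i\<in>U. deg i) = s + c" unfolding s_def c_def using sum.Int_Diff[OF fin(2), of deg R] by simp
  have s: "s \<le> u2 * t" unfolding s_def u2_def using R by (intro sum_bounded_above) auto
  have a: "a \<le> r1 * t" unfolding a_def r1_def using R by (intro sum_bounded_above) auto
  have c: "u1 * t \<le> c" unfolding c_def u1_def using U by (intro sum_bounded_below) auto
  have nn: "0 \<le> u1" "0 \<le> u2" "0 \<le> r1" by (simp_all add: u1_def u2_def r1_def)
  have "r1 \<le> u1" using le cU cR by linarith
  then have "(u1 - r1) * s \<le> (u1 - r1) * (u2 * t)" using s by (intro mult_left_mono) auto
  moreover have "(u1 + u2) * a \<le> (u1 + u2) * (r1 * t)" using a nn by (intro mult_left_mono) auto
  moreover have "(r1 + u2) * (u1 * t) \<le> (r1 + u2) * c" using c nn by (intro mult_left_mono) auto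
  ultimately show ?thesis unfolding cU cR sR sU by (simp add: algebra_simps)
qed

lemma layer_cake:
  fixes X :: "nat \<Rightarrow> nat"
  assumes "finite A" "\<And>i. i \<in> A \<Longrightarrow> X i \<le> N"
  shows "(\<Sum>\<theta>=1..N. real (card {i \<in> A. \<theta> \<le> X i})) = (\<Sum>i\<in>A. real (X i))"
proof -
  have "(\<Sum>\<theta>=1..N. real (card {i \<in> A. \<theta> \<le> X i})) = (\<Sum>\<theta>=1..N. \<Sum>i\<in>A. if \<theta> \<le> X i then 1 else 0)"
    using assms(1) by (intro sum.cong refl) (simp add: sum.If_cases Int_def)
  also have "\<dots> = (\<Sum>i\<in>A. \<Sum>\<theta>=1..N. if \<theta> \<le> X i then 1 else 0)" by (rule sum.swap)
  also have "\<dots> = (\<Sum>i\<in>A. real (X i))"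
  proof (rule sum.cong[OF refl])
    fix i assume "i \<in> A"
    then have "{1..N} \<inter> {\<theta>. \<theta> \<le> X i} = {1..X i}" using assms(2)[of i] by auto
    then show "(\<Sum>\<theta>=1..N. if \<theta> \<le> X i then 1 else 0) = real (X i)" by (simp add: sum.If_cases)
  qed
  finally show ?thesis .
qed

text \<open>What remains of an instance once the random event is fixed: the exact weight inside
  \<open>S\<close> and upper bounds elsewhere, which persist when edges are deleted.
  \<open>outer\<close> is the expander inequality for matrices that are positive semidefinite up to
  \<epsilon>.\<close>

locale planted_graph =
  fixes n k :: nat and S :: "nat set" and w :: "nat \<Rightarrow> nat \<Rightarrow> real" and p q lam d' d :: real
  assumes S: "S \<subseteq> {..<n}" "card S = k" and k: "0 < k" "k < n" and n: "1000 < n"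
    and w0: "\<And>i j. 0 \<le> w i j" and wsym: "\<And>i j. w i j = w j i"
    and params: "0 \<le> p" "0 \<le> q" "0 \<le> lam" "0 \<le> d'"
    and dens: "(\<Sum>i\<in>S. \<Sum>j\<in>S. w i j) = real k * d"
    and cross: "\<And>A U. A \<subseteq> S \<Longrightarrow> U \<subseteq> {..<n} - S \<Longrightarrow>
      (\<Sum>i\<in>A. \<Sum>j\<in>U. w i j) \<le> 2 * p * real (card A) * real (card U) + 12 * q * (real (card A) + real (card U))"
    and outer: "\<And>x \<epsilon>. 0 \<le> \<epsilon> \<Longrightarrow> (\<And>i j. i \<in> {..<n} - S \<Longrightarrow> j \<in> {..<n} - S \<Longrightarrow> 0 \<le> x i j) \<Longrightarrow>
      (\<And>u. - \<epsilon> * (\<Sum>i\<in>{..<n} - S. (u i)\<^sup>2) \<le> (\<Sum>i\<in>{..<n} - S. \<Sum>j\<in>{..<n} - S. u i * u j * x i j)) \<Longrightarrow>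
      (\<Sum>i\<in>{..<n} - S. \<Sum>j\<in>{..<n} - S. w i j * x i j)
        \<le> lam * (\<Sum>i\<in>{..<n} - S. x i i) + d' / (real n - real k) * (\<Sum>i\<in>{..<n} - S. \<Sum>j\<in>{..<n} - S. x i j)
          + 3 * lam * real n * \<epsilon>"
begin

definition C :: "nat set" where "C = {..<n} - S"
definition D :: real where "D = d' / (real n - real k)"
definition wt :: "nat set \<Rightarrow> nat set \<Rightarrow> real" where "wt A U = (\<Sum>i\<in>A. \<Sum>j\<in>U. w i j)"
text \<open>For \<open>p = \<delta> * d / k\<close> and \<open>q = sqrt (p * n)\<close>, division by
  \<open>d\<close> gives the sum in parentheses in \<nu>; the coefficient 100 becomes the constant
  \<xi>.\<close>

definition \<sigma> :: real where "\<sigma> = 6 * p * real k + 100 * q + lam + D * real k"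

lemma finite_S[simp]: "finite S" using S finite_subset by blast
lemma finite_C[simp]: "finite C" by (simp add: C_def)
lemma card_C: "card C = n - k" using S by (simp add: C_def card_Diff_subset)
lemma D_nonneg: "0 \<le> D" using params k by (simp add: D_def)
lemma S_Un_C: "S \<union> C = {..<n}" "S \<inter> C = {}" using S by (auto simp: C_def)

lemma wt_nonneg: "0 \<le> wt A U" unfolding wt_def by (intro sum_nonneg w0)

lemma wt_sym: "wt A U = wt U A"
  unfolding wt_def by (subst sum.swap) (simp add: wsym)

lemma wt_mono:
  assumes "A \<subseteq> A'" "U \<subseteq> U'" "finite A'" "finite U'"
  shows "wt A U \<le> wt A' U'"
proof -
  have "wt A U \<le> (\<Sum>i\<in>A. \<Sum>j\<in>U'. w i j)" unfolding wt_def using assms by (intro sum_mono sum_mono2) (auto simp: w0)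
  also have "\<dots> \<le> wt A' U'" unfolding wt_def using assms by (intro sum_mono2) (auto simp: w0 sum_nonneg)
  finally show ?thesis .
qed

lemma wt_Un_left: "A \<inter> A' = {} \<Longrightarrow> finite A \<Longrightarrow> finite A' \<Longrightarrow> wt (A \<union> A') U = wt A U + wt A' U"
  unfolding wt_def by (subst sum.union_disjoint) auto

lemma wt_Un_right: "U \<inter> U' = {} \<Longrightarrow> finite U \<Longrightarrow> finite U' \<Longrightarrow> wt A (U \<union> U') = wt A U + wt A U'"
  using wt_Un_left[of U U' A] by (simp add: wt_sym[of A])

lemma wt_square:
  assumes "A \<inter> B = {}" "finite A" "finite B"
  shows "wt (A \<union> B) (A \<union> B) = wt A A + 2 * wt A B + wt B B"
  using assms wt_sym[of B A] by (simp add: wt_Un_left wt_Un_right)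

lemma wt_cross:
  assumes "A \<subseteq> S" "U \<subseteq> C"
  shows "wt A U \<le> 2 * p * real (card A) * real (card U) + 12 * q * (real (card A) + real (card U))"
  using cross assms unfolding wt_def C_def by blast

text \<open>The expander inequality at the indicator matrix of \<open>U\<close>, which is positive
  semidefinite without error.\<close>

lemma wt_outer:
  assumes U: "U \<subseteq> C"
  shows "wt U U \<le> lam * real (card U) + D * (real (card U))\<^sup>2"
proof -
  let ?x = "\<lambda>i j. if i \<in> U \<and> j \<in> U then 1 else 0 :: real"
  have r: "(\<Sum>i\<in>C. \<Sum>j\<in>C. f i j * ?x i j) = (\<Sum>i\<in>U. \<Sum>j\<in>U. f i j)" for f
  proof -
    have "(\<Sum>i\<in>C. \<Sum>j\<in>C. f i j * ?x i j) = (\<Sum>i\<in>C. \<Sum>j\<in>C. if i \<in> U \<and> j \<in> U then f i j else 0)"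
      by (intro sum.cong refl) simp
    then show ?thesis using sum_restrict_square[OF finite_C U] by simp
  qed
  have q: "(\<Sum>i\<in>C. \<Sum>j\<in>C. u i * u j * ?x i j) = (\<Sum>i\<in>U. u i)\<^sup>2" for u :: "nat \<Rightarrow> real"
    unfolding r by (simp add: power2_eq_square sum_product)
  have "(\<Sum>i\<in>C. \<Sum>j\<in>C. w i j * ?x i j) \<le> lam * (\<Sum>i\<in>C. ?x i i) + D * (\<Sum>i\<in>C. \<Sum>j\<in>C. ?x i j) + 3 * lam * real n * 0"
    unfolding C_def D_def
  proof (rule outer)
    show "- 0 * (\<Sum>i\<in>{..<n} - S. (u i)\<^sup>2) \<le> (\<Sum>i\<in>{..<n} - S. \<Sum>j\<in>{..<n} - S. u i * u j * ?x i j)" for u :: "nat \<Rightarrow> real"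
      using q[of u] unfolding C_def by simp
  qed auto
  moreover have "(\<Sum>i\<in>C. \<Sum>j\<in>C. ?x i j) = (real (card U))\<^sup>2" using q[of "\<lambda>_. 1"] by simp
  moreover have "(\<Sum>i\<in>C. ?x i i) = real (card U)"
    using U by (simp add: sum.inter_restrict[symmetric] Int_absorb1)
  ultimately show ?thesis unfolding r wt_def by simp
qed

lemma card_split:
  assumes "T \<subseteq> {..<n}"
  shows "card T = card (T \<inter> S) + card (T \<inter> C)" "T = (T \<inter> S) \<union> (T \<inter> C)" "(T \<inter> S) \<inter> (T \<inter> C) = {}" "finite T"
proof -
  show e: "T = (T \<inter> S) \<union> (T \<inter> C)" "(T \<inter> S) \<inter> (T \<inter> C) = {}" using assms by (auto simp: C_def)
  show f: "finite T" using assms finite_subset by blast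
  show "card T = card (T \<inter> S) + card (T \<inter> C)"
    using card_Un_disjoint[OF _ _ e(2)] f e(1) by simp
qed

lemma card_Int_S: "card (T \<inter> S) \<le> k" using card_mono[of S "T \<inter> S"] S by simp

text \<open>Selections can be compared only by their total weight. This bound, for an arbitrary set
  of size \<open>k\<close>, converts such a comparison into one of the weights inside
  \<open>S\<close>.\<close>

lemma inside_loss:
  assumes Q: "Q \<subseteq> {..<n}" "card Q = k"
  shows "wt Q Q \<le> wt (Q \<inter> S) (Q \<inter> S) + real k * (4 * p * real k + 24 * q + lam + D * real k)"
proof -
  note sp = card_split[OF Q(1)]
  define a where "a = real (card (Q \<inter> S))"
  define b where "b = real (card (Q \<inter> C))"
  have ab: "a + b = real k" "0 \<le> a" "0 \<le> b" using sp(1) Q by (simp_all add: a_def b_def)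
  have "wt Q Q = wt (Q \<inter> S) (Q \<inter> S) + 2 * wt (Q \<inter> S) (Q \<inter> C) + wt (Q \<inter> C) (Q \<inter> C)"
    by (subst (1 2) sp(2)) (rule wt_square[OF sp(3)]; simp add: sp(4))
  moreover have "wt (Q \<inter> S) (Q \<inter> C) \<le> 2 * p * a * b + 12 * q * (a + b)"
    unfolding a_def b_def by (rule wt_cross) auto
  moreover have "wt (Q \<inter> C) (Q \<inter> C) \<le> lam * b + D * b\<^sup>2" unfolding b_def by (rule wt_outer) auto
  moreover have "2 * p * a * b \<le> 2 * p * real k * real k" using ab params by (intro mult_mono) auto
  moreover have "lam * b \<le> lam * real k" using ab params by (intro mult_left_mono) auto
  moreover have "D * b\<^sup>2 \<le> D * (real k)\<^sup>2" using ab D_nonneg by (intro mult_left_mono power_mono) auto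
  ultimately have "wt Q Q \<le> wt (Q \<inter> S) (Q \<inter> S) + 2 * (2 * p * real k * real k + 12 * q * real k) + (lam * real k + D * (real k)\<^sup>2)"
    unfolding ab(1) by argo
  then show ?thesis by (simp add: algebra_simps power2_eq_square)
qed

text \<open>The discarded vertices \<open>R\<close> are at most as many as the wrong ones
  \<open>U = T \<inter> C\<close>, because \<open>T\<close> has at most \<open>k\<close> vertices in
  \<open>S\<close>, and they have the lowest degrees in \<open>T\<close>. By
  \<open>threshold_average\<close> their mean degree is at most that of \<open>U\<close>, which
  \<open>wt_cross\<close> and \<open>wt_outer\<close> control. So little is lost even if all of
  \<open>R\<close> lies in \<open>S\<close>.\<close>

lemma rounding_loss:
  assumes T: "T \<subseteq> {..<n}" and Q: "Q \<subseteq> {..<n}" "card Q = k"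
    and le: "card T \<le> k \<Longrightarrow> T \<subseteq> Q" and gt: "k < card T \<Longrightarrow> Q \<subseteq> T"
    and deg: "\<And>i j. k < card T \<Longrightarrow> i \<in> Q \<Longrightarrow> j \<in> T - Q \<Longrightarrow> (\<Sum>l\<in>T. w j l) \<le> (\<Sum>l\<in>T. w i l)"
  defines "r \<equiv> real (card T - k)" and "b \<equiv> real (card (T \<inter> C))"
  shows "wt (T \<inter> S) (T \<inter> S) \<le> wt (Q \<inter> S) (Q \<inter> S) + 2 * (lam * r + D * b * r + 2 * p * r * real k + 12 * q * (r + real k))"
proof (cases "card T \<le> k")
  case True
  then have "wt (T \<inter> S) (T \<inter> S) \<le> wt (Q \<inter> S) (Q \<inter> S)" using le by (intro wt_mono) auto
  moreover have "0 \<le> 2 * (lam * r + D * b * r + 2 * p * r * real k + 12 * q * (r + real k))"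
    using params D_nonneg unfolding r_def b_def by (intro mult_nonneg_nonneg add_nonneg_nonneg) auto
  ultimately show ?thesis by linarith
next
  case False
  then have kT: "k < card T" by simp
  note sp = card_split[OF T]
  define R where "R = T - Q"
  define U where "U = T \<inter> C"
  define dg where "dg i = (\<Sum>l\<in>T. w i l)" for i
  have fin: "finite R" "finite U" "finite Q" using sp(4) Q finite_subset by (auto simp: R_def U_def)
  have cR: "card R = card T - k" unfolding R_def using card_Diff_subset[of Q T] fin(3) gt[OF kT] Q(2) by simp
  have cRU: "card R \<le> card U" using cR sp(1) card_Int_S[of T] unfolding U_def by linarith
  have Rne: "R \<noteq> {}" using cR kT by auto
  define th where "th = Max (dg ` R)"
  have th: "\<And>i. i \<in> R \<Longrightarrow> dg i \<le> th" unfolding th_def using fin by auto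
  have "th \<in> dg ` R" unfolding th_def using fin Rne by (intro Max_in) auto
  then obtain j where j: "j \<in> R" "th = dg j" by blast
  have th2: "th \<le> dg i" if "i \<in> U - R" for i
    using deg[OF kT, of i j] that j unfolding R_def U_def dg_def by auto
  have th0: "0 \<le> th" unfolding j(2) dg_def by (intro sum_nonneg w0)
  have avg: "real (card U) * (\<Sum>i\<in>R. dg i) \<le> real (card R) * (\<Sum>i\<in>U. dg i)"
    by (rule threshold_average[OF fin(1,2) cRU th th2 th0])
  have rb: "real (card R) = r" "real (card U) = b" using cR by (simp_all add: r_def b_def U_def)
  have pos: "0 < r" "r \<le> b" using kT cRU rb cR by (simp_all add: r_def)
  have dgR: "(\<Sum>i\<in>R. dg i) = wt R T" "(\<Sum>i\<in>U. dg i) = wt U T" by (simp_all add: wt_def dg_def)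
  have "wt U T = wt U (T \<inter> S) + wt U U"
    unfolding U_def by (subst (2) sp(2)) (rule wt_Un_right[OF sp(3)]; simp add: sp(4))
  also have "wt U (T \<inter> S) \<le> 2 * p * real (card (T \<inter> S)) * b + 12 * q * (real (card (T \<inter> S)) + b)"
    unfolding rb(2)[symmetric] U_def by (subst wt_sym) (rule wt_cross; auto)
  also have "2 * p * real (card (T \<inter> S)) * b \<le> 2 * p * real k * b"
    using card_Int_S[of T] params pos by (intro mult_right_mono mult_left_mono) auto
  also have "12 * q * (real (card (T \<inter> S)) + b) \<le> 12 * q * (real k + b)"
    using card_Int_S[of T] params pos by (intro mult_left_mono) auto
  also have "wt U U \<le> lam * b + D * b\<^sup>2" unfolding rb(2)[symmetric] by (rule wt_outer) (simp add: U_def)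
  finally have U: "wt U T \<le> 2 * p * real k * b + 12 * q * (real k + b) + (lam * b + D * b\<^sup>2)" by simp
  have "b * wt R T \<le> r * wt U T" using avg unfolding rb dgR .
  also have "\<dots> \<le> r * (2 * p * real k * b + 12 * q * (real k + b) + (lam * b + D * b\<^sup>2))"
    using U pos by (intro mult_left_mono) auto
  also have "\<dots> = b * (lam * r + D * b * r + 2 * p * r * real k + 12 * q * r) + 12 * q * real k * r"
    by (simp add: algebra_simps power2_eq_square)
  \<comment> \<open>The term \<open>12 * q * real k\<close> does not scale with the size of
    \<open>U\<close>; \<open>r \<le> b\<close> supplies the factor \<open>b\<close> that is
    cancelled next.\<close>
  also have "12 * q * real k * r \<le> 12 * q * real k * b" using pos params by (intro mult_left_mono) auto
  finally have "b * wt R T \<le> b * (lam * r + D * b * r + 2 * p * r * real k + 12 * q * (r + real k))"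
    by (simp add: algebra_simps)
  then have R: "wt R T \<le> lam * r + D * b * r + 2 * p * r * real k + 12 * q * (r + real k)" using pos by simp
  have e: "T \<inter> S = (Q \<inter> S) \<union> (R \<inter> S)" "(Q \<inter> S) \<inter> (R \<inter> S) = {}" using gt[OF kT] by (auto simp: R_def)
  have "wt (T \<inter> S) (T \<inter> S) = wt (Q \<inter> S) (Q \<inter> S) + 2 * wt (Q \<inter> S) (R \<inter> S) + wt (R \<inter> S) (R \<inter> S)"
    unfolding e(1) using wt_square[OF e(2)] by simp
  also have "\<dots> \<le> wt (Q \<inter> S) (Q \<inter> S) + 2 * (wt (R \<inter> S) (Q \<inter> S) + wt (R \<inter> S) (R \<inter> S))"
    using wt_sym[of "Q \<inter> S" "R \<inter> S"] wt_nonneg[of "R \<inter> S" "R \<inter> S"] by simp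
  also have "wt (R \<inter> S) (Q \<inter> S) + wt (R \<inter> S) (R \<inter> S) = wt (R \<inter> S) (T \<inter> S)"
    unfolding e(1) using wt_Un_right[OF e(2)] by simp
  finally have "wt (T \<inter> S) (T \<inter> S) \<le> wt (Q \<inter> S) (Q \<inter> S) + 2 * wt (R \<inter> S) (T \<inter> S)" .
  moreover have "wt (R \<inter> S) (T \<inter> S) \<le> wt R T" using fin sp(4) by (intro wt_mono) auto
  ultimately show ?thesis using R by argo
qed

section \<open>Losses of the relaxation and of the selection\<close>

lemma \<sigma>_bounds: "0 \<le> \<sigma>" "lam \<le> \<sigma>" "D \<le> \<sigma>" "D * real k \<le> \<sigma>" "4 * p * real k + 24 * q + lam + D * real k \<le> \<sigma>"
  "2 * p * real k + 12 * q \<le> \<sigma>"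
proof -
  have nn: "0 \<le> p * real k" "0 \<le> D * real k" using params D_nonneg by auto
  have e: "\<sigma> = 6 * (p * real k) + 100 * q + lam + D * real k" by (simp add: \<sigma>_def)
  show 0: "0 \<le> \<sigma>" "lam \<le> \<sigma>" "D * real k \<le> \<sigma>" using e nn params by linarith+
  have "4 * (p * real k) + 24 * q + lam + D * real k \<le> \<sigma>" "2 * (p * real k) + 12 * q \<le> \<sigma>" using e nn params by linarith+
  then show "4 * p * real k + 24 * q + lam + D * real k \<le> \<sigma>" "2 * p * real k + 12 * q \<le> \<sigma>" by simp_all
  have "D * 1 \<le> D * real k" using D_nonneg k by (intro mult_left_mono) auto
  then show "D \<le> \<sigma>" using 0 by simp
qed

text \<open>For the case distinction on the total weight: if it is huge compared with \<sigma>, then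
  so is \<open>real k * d\<close>.\<close>

lemma total_weight: "wt {..<n} {..<n} \<le> real k * d + 4 * (real n)\<^sup>2 * \<sigma>"
proof -
  have "wt {..<n} {..<n} = wt S S + 2 * wt S C + wt C C"
    unfolding S_Un_C(1)[symmetric] by (rule wt_square) (simp_all add: S_Un_C(2))
  also have "wt S S = real k * d" using dens by (simp add: wt_def)
  also have "wt S C \<le> (real n)\<^sup>2 * \<sigma>"
  proof -
    have "wt S C \<le> 2 * p * real k * real (n - k) + 12 * q * (real k + real (n - k))"
      using wt_cross[of S C] S card_C by simp
    also have "\<dots> \<le> 2 * p * real k * real n + 12 * q * real n" using params k by (intro add_mono mult_left_mono) auto
    also have "\<dots> = (2 * p * real k + 12 * q) * real n" by (simp add: algebra_simps)
    also have "\<dots> \<le> \<sigma> * (real n)\<^sup>2" using \<sigma>_bounds n by (intro mult_mono) (auto simp: power2_eq_square)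
    finally show ?thesis by (simp add: mult.commute)
  qed
  also have "wt C C \<le> 2 * (real n)\<^sup>2 * \<sigma>"
  proof -
    have "wt C C \<le> lam * real (n - k) + D * (real (n - k))\<^sup>2" using wt_outer[of C] card_C by simp
    also have "\<dots> \<le> \<sigma> * (real n)\<^sup>2 + \<sigma> * (real n)\<^sup>2"
    proof (intro add_mono mult_mono)
      have "real (n - k) \<le> real n" by simp
      also have "\<dots> \<le> (real n)\<^sup>2" using n by (simp add: power2_eq_square)
      finally show "real (n - k) \<le> (real n)\<^sup>2" .
    qed (use \<sigma>_bounds params D_nonneg in \<open>auto intro: power_mono\<close>)
    finally show ?thesis by simp
  qed
  finally show ?thesis by simp
qed

text \<open>Up to 1, \<open>X i j\<close> is at most the minimum of the two diagonal entries, which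
  counts the levels \<theta> reached by both. At each level the pairs form a rectangle between a
  subset of \<open>S\<close> and one of \<open>C\<close>, so the discrepancy bound applies; summing
  the sizes over the levels returns the diagonal entries.\<close>

lemma fractional_cross:
  fixes X :: "nat \<Rightarrow> nat \<Rightarrow> nat"
  assumes XN: "\<And>i j. i < n \<Longrightarrow> j < n \<Longrightarrow> X i j \<le> N" and Xsym: "\<And>i j. i < n \<Longrightarrow> j < n \<Longrightarrow> X i j = X j i"
    and diag: "\<And>i j. i < n \<Longrightarrow> j < n \<Longrightarrow> X i j \<le> X i i + 1"
  shows "(\<Sum>i\<in>S. \<Sum>j\<in>C. w i j * real (X i j)) \<le> (2 * p * real k + 12 * q) * (\<Sum>i<n. real (X i i)) + real n * \<sigma>"
proof -
  define A where "A \<theta> = {i \<in> S. \<theta> \<le> X i i}" for \<theta>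
  define U where "U \<theta> = {i \<in> C. \<theta> \<le> X i i}" for \<theta>
  have lt: "i < n" if "i \<in> S \<or> i \<in> C" for i using that S by (auto simp: C_def)
  have fin: "finite (A \<theta>)" "finite (U \<theta>)" for \<theta> by (simp_all add: A_def U_def)
  have mn: "real (min (X i i) (X j j)) = (\<Sum>\<theta>=1..N. if \<theta> \<le> X i i \<and> \<theta> \<le> X j j then 1 else 0)" if "i < n" "j < n" for i j
  proof -
    have "{1..N} \<inter> {\<theta>. \<theta> \<le> X i i \<and> \<theta> \<le> X j j} = {1..min (X i i) (X j j)}" using XN[OF that(1) that(1)] by auto
    then show ?thesis by (simp add: sum.If_cases)
  qed
  have "(\<Sum>i\<in>S. \<Sum>j\<in>C. w i j * real (X i j)) \<le> (\<Sum>i\<in>S. \<Sum>j\<in>C. w i j * real (min (X i i) (X j j)) + w i j)"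
  proof (intro sum_mono)
    fix i j assume ij: "i \<in> S" "j \<in> C"
    have "X i j \<le> min (X i i) (X j j) + 1" using diag[of i j] diag[of j i] Xsym[of i j] lt ij by simp
    then have "real (X i j) \<le> real (min (X i i) (X j j)) + 1" by linarith
    then have "w i j * real (X i j) \<le> w i j * (real (min (X i i) (X j j)) + 1)" by (intro mult_left_mono w0)
    then show "w i j * real (X i j) \<le> w i j * real (min (X i i) (X j j)) + w i j" by (simp add: distrib_left)
  qed
  also have "\<dots> = (\<Sum>i\<in>S. \<Sum>j\<in>C. w i j * real (min (X i i) (X j j))) + wt S C" by (simp only: sum.distrib wt_def)
  also have "(\<Sum>i\<in>S. \<Sum>j\<in>C. w i j * real (min (X i i) (X j j))) = (\<Sum>i\<in>S. \<Sum>j\<in>C. \<Sum>\<theta>=1..N. if \<theta> \<le> X i i \<and> \<theta> \<le> X j j then w i j else 0)"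
    using mn lt by (intro sum.cong refl) (simp add: sum_distrib_left if_distrib cong: if_cong)
  also have "\<dots> = (\<Sum>i\<in>S. \<Sum>\<theta>=1..N. \<Sum>j\<in>C. if \<theta> \<le> X i i \<and> \<theta> \<le> X j j then w i j else 0)" by (intro sum.cong refl sum.swap)
  also have "\<dots> = (\<Sum>\<theta>=1..N. \<Sum>i\<in>S. \<Sum>j\<in>C. if \<theta> \<le> X i i \<and> \<theta> \<le> X j j then w i j else 0)" by (rule sum.swap)
  also have "\<dots> = (\<Sum>\<theta>=1..N. wt (A \<theta>) (U \<theta>))"
  proof (rule sum.cong[OF refl])
    fix \<theta>
    have "(\<Sum>i\<in>S. \<Sum>j\<in>C. if \<theta> \<le> X i i \<and> \<theta> \<le> X j j then w i j else 0) = (\<Sum>i\<in>S. if \<theta> \<le> X i i then (\<Sum>j\<in>C. if \<theta> \<le> X j j then w i j else 0) else 0)"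
      by (intro sum.cong refl) simp
    also have "\<dots> = (\<Sum>i\<in>A \<theta>. \<Sum>j\<in>U \<theta>. w i j)" by (simp add: A_def U_def sum.inter_filter)
    finally show "(\<Sum>i\<in>S. \<Sum>j\<in>C. if \<theta> \<le> X i i \<and> \<theta> \<le> X j j then w i j else 0) = wt (A \<theta>) (U \<theta>)" by (simp add: wt_def)
  qed
  \<comment> \<open>In the product of the two sizes the level set inside \<open>S\<close> is
    replaced by \<open>k\<close>; the other size must stay, since its sum over the levels is bounded
    by the trace.\<close>
  also have "\<dots> \<le> (\<Sum>\<theta>=1..N. 12 * q * real (card (A \<theta>)) + (2 * p * real k + 12 * q) * real (card (U \<theta>)))"
  proof (intro sum_mono)
    fix \<theta>
    have "wt (A \<theta>) (U \<theta>) \<le> 2 * p * real (card (A \<theta>)) * real (card (U \<theta>)) + 12 * q * (real (card (A \<theta>)) + real (card (U \<theta>)))"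
      by (rule wt_cross) (auto simp: A_def U_def)
    moreover have "card (A \<theta>) \<le> k" unfolding S(2)[symmetric] by (rule card_mono) (auto simp: A_def)
    then have "2 * p * real (card (A \<theta>)) * real (card (U \<theta>)) \<le> 2 * p * real k * real (card (U \<theta>))" using params by (intro mult_right_mono mult_left_mono) auto
    ultimately show "wt (A \<theta>) (U \<theta>) \<le> 12 * q * real (card (A \<theta>)) + (2 * p * real k + 12 * q) * real (card (U \<theta>))" by (simp add: algebra_simps)
  qed
  also have "\<dots> = 12 * q * (\<Sum>\<theta>=1..N. real (card (A \<theta>))) + (2 * p * real k + 12 * q) * (\<Sum>\<theta>=1..N. real (card (U \<theta>)))"
    unfolding sum.distrib sum_distrib_left[symmetric] ..
  also have "(\<Sum>\<theta>=1..N. real (card (A \<theta>))) = (\<Sum>i\<in>S. real (X i i))" unfolding A_def using XN lt by (intro layer_cake) auto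
  also have "(\<Sum>\<theta>=1..N. real (card (U \<theta>))) = (\<Sum>i\<in>C. real (X i i))" unfolding U_def using XN lt by (intro layer_cake) auto
  also have "12 * q * (\<Sum>i\<in>S. real (X i i)) \<le> (2 * p * real k + 12 * q) * (\<Sum>i\<in>S. real (X i i))"
    using params by (intro mult_right_mono sum_nonneg) auto
  also have "wt S C \<le> real n * \<sigma>"
  proof -
    have "wt S C \<le> 2 * p * real k * real (n - k) + 12 * q * (real k + real (n - k))" using wt_cross[of S C] S card_C by simp
    also have "\<dots> \<le> 2 * p * real k * real n + 12 * q * real n" using params k by (intro add_mono mult_left_mono) auto
    also have "\<dots> = (2 * p * real k + 12 * q) * real n" by (simp add: algebra_simps)
    also have "\<dots> \<le> \<sigma> * real n" using \<sigma>_bounds by (intro mult_right_mono) auto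
    finally show ?thesis by (simp add: mult.commute)
  qed
  finally have "(\<Sum>i\<in>S. \<Sum>j\<in>C. w i j * real (X i j))
    \<le> (2 * p * real k + 12 * q) * ((\<Sum>i\<in>S. real (X i i)) + (\<Sum>i\<in>C. real (X i i))) + real n * \<sigma>" by (simp add: distrib_left)
  also have "(\<Sum>i\<in>S. real (X i i)) + (\<Sum>i\<in>C. real (X i i)) = (\<Sum>i<n. real (X i i))"
    unfolding S_Un_C(1)[symmetric] using sum.union_disjoint[OF finite_S finite_C S_Un_C(2), of "\<lambda>i. real (X i i)"] by simp
  finally show ?thesis .
qed

lemma sum_square_split:
  fixes f :: "nat \<Rightarrow> nat \<Rightarrow> real"
  assumes "\<And>i j. i < n \<Longrightarrow> j < n \<Longrightarrow> f i j = f j i"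
  shows "(\<Sum>i<n. \<Sum>j<n. f i j) = (\<Sum>i\<in>S. \<Sum>j\<in>S. f i j) + 2 * (\<Sum>i\<in>S. \<Sum>j\<in>C. f i j) + (\<Sum>i\<in>C. \<Sum>j\<in>C. f i j)"
proof -
  note u = sum.union_disjoint[OF finite_S finite_C S_Un_C(2)]
  have "(\<Sum>i\<in>C. \<Sum>j\<in>S. f i j) = (\<Sum>i\<in>C. \<Sum>j\<in>S. f j i)" using assms S by (intro sum.cong refl) (auto simp: C_def)
  also have "\<dots> = (\<Sum>i\<in>S. \<Sum>j\<in>C. f i j)" by (rule sum.swap)
  finally show ?thesis unfolding S_Un_C(1)[symmetric] u sum.distrib by simp
qed

text \<open>
  The conditions are those of the approximate relaxation, scaled by \<open>N\<close>; \<open>n ^ 16\<close> is the order of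
  the rounding errors, which are negligible against \<open>N\<close>.
\<close>

lemma fractional_loss:
  fixes X :: "nat \<Rightarrow> nat \<Rightarrow> nat"
  assumes N: "N = n ^ 18"
    and XN: "\<And>i j. i < n \<Longrightarrow> j < n \<Longrightarrow> X i j \<le> N" and Xsym: "\<And>i j. i < n \<Longrightarrow> j < n \<Longrightarrow> X i j = X j i"
    and diag: "\<And>i j. i < n \<Longrightarrow> j < n \<Longrightarrow> X i j \<le> X i i + 1"
    and tr: "(\<Sum>i<n. X i i) \<le> k * N + n" and tot: "(\<Sum>i<n. \<Sum>j<n. X i j) \<le> k * k * N + n * n"
    and psd: "\<And>u. - (4 * real n ^ 10) * (\<Sum>i<n. (u i)\<^sup>2) \<le> (\<Sum>i<n. \<Sum>j<n. u i * u j * real (X i j))"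
    and obj: "real N * (real k * d) \<le> (\<Sum>i<n. \<Sum>j<n. w i j * real (X i j)) + 3 * real n ^ 16 * \<sigma>"
  shows "real N * (real k * d) - (\<Sum>i\<in>S. \<Sum>j\<in>S. w i j * real (X i j))
    \<le> real N * (real k * (4 * p * real k + 24 * q + lam + D * real k) + \<sigma> / 100)"
proof -
  define Z where "Z = real n ^ 16"
  have trr: "(\<Sum>i<n. real (X i i)) \<le> real k * real N + real n"
  proof -
    have "real (\<Sum>i<n. X i i) \<le> real (k * N + n)" using tr by (simp only: of_nat_le_iff)
    then show ?thesis by simp
  qed
  have totr: "(\<Sum>i<n. \<Sum>j<n. real (X i j)) \<le> (real k)\<^sup>2 * real N + (real n)\<^sup>2"
  proof -
    have "real (\<Sum>i<n. \<Sum>j<n. X i j) \<le> real (k * k * N + n * n)" using tot by (simp only: of_nat_le_iff)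
    then show ?thesis by (simp add: power2_eq_square)
  qed
  have CV: "C \<subseteq> {..<n}" by (auto simp: C_def)
  have out: "(\<Sum>i\<in>C. \<Sum>j\<in>C. w i j * real (X i j)) \<le> lam * (\<Sum>i\<in>C. real (X i i)) + D * (\<Sum>i\<in>C. \<Sum>j\<in>C. real (X i j)) + 3 * lam * real n * (4 * real n ^ 10)"
    unfolding C_def D_def
  proof (rule outer)
    fix u :: "nat \<Rightarrow> real"
    \<comment> \<open>A test vector on \<open>C\<close> is extended by 0, so the principal submatrix
      on \<open>C\<close> inherits the lower bound on its quadratic form.\<close>
    define u' where "u' i = (if i \<in> C then u i else 0)" for i
    have "(\<Sum>i<n. (u' i)\<^sup>2) = (\<Sum>i<n. if i \<in> C then (u i)\<^sup>2 else 0)" by (intro sum.cong refl) (simp add: u'_def)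
    also have "\<dots> = (\<Sum>i\<in>C. (u i)\<^sup>2)" using CV by (simp add: sum.inter_restrict[symmetric] Int_absorb1)
    finally have 1: "(\<Sum>i<n. (u' i)\<^sup>2) = (\<Sum>i\<in>C. (u i)\<^sup>2)" .
    have "(\<Sum>i<n. \<Sum>j<n. u' i * u' j * real (X i j)) = (\<Sum>i<n. \<Sum>j<n. if i \<in> C \<and> j \<in> C then u i * u j * real (X i j) else 0)"
      by (intro sum.cong refl) (simp add: u'_def)
    also have "\<dots> = (\<Sum>i\<in>C. \<Sum>j\<in>C. u i * u j * real (X i j))" using CV by (intro sum_restrict_square) auto
    finally show "- (4 * real n ^ 10) * (\<Sum>i\<in>{..<n} - S. (u i)\<^sup>2) \<le> (\<Sum>i\<in>{..<n} - S. \<Sum>j\<in>{..<n} - S. u i * u j * real (X i j))"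
      using psd[of u'] 1 unfolding C_def by simp
  qed auto
  have "(\<Sum>i\<in>C. real (X i i)) \<le> (\<Sum>i<n. real (X i i))" using CV by (intro sum_mono2) auto
  then have o1: "lam * (\<Sum>i\<in>C. real (X i i)) \<le> lam * (real k * real N + real n)" using trr params by (intro mult_left_mono) auto
  have "(\<Sum>i\<in>C. \<Sum>j\<in>C. real (X i j)) \<le> (\<Sum>i\<in>C. \<Sum>j<n. real (X i j))" using CV by (intro sum_mono sum_mono2) auto
  also have "\<dots> \<le> (\<Sum>i<n. \<Sum>j<n. real (X i j))" using CV by (intro sum_mono2 sum_nonneg) auto
  finally have o2: "D * (\<Sum>i\<in>C. \<Sum>j\<in>C. real (X i j)) \<le> D * ((real k)\<^sup>2 * real N + (real n)\<^sup>2)" using totr D_nonneg by (intro mult_left_mono) auto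
  have "(\<Sum>i\<in>S. \<Sum>j\<in>C. w i j * real (X i j)) \<le> (2 * p * real k + 12 * q) * (\<Sum>i<n. real (X i i)) + real n * \<sigma>"
    by (rule fractional_cross[OF XN Xsym diag])
  moreover have "(2 * p * real k + 12 * q) * (\<Sum>i<n. real (X i i)) \<le> (2 * p * real k + 12 * q) * (real k * real N + real n)"
    using trr params by (intro mult_left_mono) auto
  ultimately have cr: "(\<Sum>i\<in>S. \<Sum>j\<in>C. w i j * real (X i j)) \<le> (2 * p * real k + 12 * q) * (real k * real N) + (2 * p * real k + 12 * q) * real n + real n * \<sigma>"
    unfolding distrib_left[symmetric] by linarith
  have sp: "(\<Sum>i<n. \<Sum>j<n. w i j * real (X i j)) = (\<Sum>i\<in>S. \<Sum>j\<in>S. w i j * real (X i j)) + 2 * (\<Sum>i\<in>S. \<Sum>j\<in>C. w i j * real (X i j)) + (\<Sum>i\<in>C. \<Sum>j\<in>C. w i j * real (X i j))"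
    by (rule sum_square_split) (metis Xsym wsym)
  have n1: "1 \<le> real n" using n by simp
  have pw: "real n \<le> Z" "(real n)\<^sup>2 \<le> Z" "real n ^ 11 \<le> Z"
    unfolding Z_def using power_increasing[of 1 16 "real n"] power_increasing[of 2 16 "real n"] power_increasing[of 11 16 "real n"] n1 by simp_all
  \<comment> \<open>As \<open>n > 1000\<close>, the error unit \<open>n ^ 16\<close> is at most a
    millionth of \<open>N\<close>, so a fixed number of error terms fits into
    \<open>\<sigma> * N / 100\<close>.\<close>
  have ZN: "1000000 * Z \<le> real N"
  proof -
    have "1000\<^sup>2 \<le> (real n)\<^sup>2" using n by (intro power_mono) auto
    then have "1000000 * Z \<le> (real n)\<^sup>2 * Z" using pw(1) n1 by (intro mult_right_mono) auto
    also have "\<dots> = real N" unfolding Z_def N by (simp flip: power_add)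
    finally show ?thesis .
  qed
  have \<sigma>0: "0 \<le> \<sigma>" by (rule \<sigma>_bounds)
  have e1: "(2 * p * real k + 12 * q) * real n \<le> \<sigma> * Z" using \<sigma>_bounds pw n1 params by (intro mult_mono) auto
  have e2: "\<sigma> * real n \<le> \<sigma> * Z" using \<sigma>0 pw by (intro mult_left_mono) auto
  have e3: "lam * real n \<le> \<sigma> * Z" using \<sigma>_bounds pw params by (intro mult_mono) auto
  have e4: "D * (real n)\<^sup>2 \<le> \<sigma> * Z" using \<sigma>_bounds pw D_nonneg by (intro mult_mono) auto
  have e5: "lam * real n ^ 11 \<le> \<sigma> * Z" using \<sigma>_bounds pw params by (intro mult_mono) auto
  have e5': "3 * lam * real n * (4 * real n ^ 10) = 12 * (lam * real n ^ 11)" by (simp add: power_Suc[symmetric] del: power_Suc)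
  have "\<sigma> * (1000000 * Z) \<le> \<sigma> * real N" using ZN \<sigma>0 by (intro mult_left_mono)
  then have e6: "1000000 * (\<sigma> * Z) \<le> \<sigma> * real N" by simp
  have e0: "0 \<le> \<sigma> * Z" using \<sigma>0 by (simp add: Z_def)
  have obj': "real N * (real k * d) \<le> (\<Sum>i<n. \<Sum>j<n. w i j * real (X i j)) + 3 * (\<sigma> * Z)" using obj unfolding Z_def by (simp add: mult_ac)
  have f1: "lam * (real k * real N + real n) = lam * real k * real N + lam * real n"
    "D * ((real k)\<^sup>2 * real N + (real n)\<^sup>2) = D * real k * (real k * real N) + D * (real n)\<^sup>2"
    by (simp_all add: algebra_simps power2_eq_square)
  have g: "real N * (real k * (4 * p * real k + 24 * q + lam + D * real k) + \<sigma> / 100)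
    = 2 * ((2 * p * real k + 12 * q) * (real k * real N)) + lam * real k * real N + D * real k * (real k * real N) + \<sigma> * real N / 100"
    by (simp add: algebra_simps)
  show ?thesis unfolding g
    using obj' cr out o1 o2 e0 e1 e2 e3 e4 e5 e6 unfolding sp f1 e5' mult.commute[of "real n" \<sigma>] by argo
qed

text \<open>A pair in \<open>S\<close> that is not heavy at both ends has \<open>X i j\<close> at
  most about \<open>2 * N / 3\<close>, so it forfeits a third of its weight in the objective; 33 /
  100 leaves room for the tolerance in the constraint. The size bound is Markov's inequality for the
  trace.\<close>

lemma heavy_core:
  fixes X :: "nat \<Rightarrow> nat \<Rightarrow> nat"
  assumes N: "N = n ^ 18"
    and XN: "\<And>i j. i < n \<Longrightarrow> j < n \<Longrightarrow> X i j \<le> N" and Xsym: "\<And>i j. i < n \<Longrightarrow> j < n \<Longrightarrow> X i j = X j i"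
    and diag: "\<And>i j. i < n \<Longrightarrow> j < n \<Longrightarrow> X i j \<le> X i i + 1"
    and tr: "(\<Sum>i<n. X i i) \<le> k * N + n"
    and loss: "real N * (real k * d) - (\<Sum>i\<in>S. \<Sum>j\<in>S. w i j * real (X i j)) \<le> real N * L"
  defines "T \<equiv> {i. i < n \<and> 2 * N \<le> 3 * X i i}"
  shows "real k * d \<le> wt (T \<inter> S) (T \<inter> S) + L / (33 / 100)" "2 * card T \<le> 3 * k"
proof -
  have "n ^ 1 \<le> n ^ 18" using n by (intro power_increasing) auto
  then have N1: "1000 < N" using n unfolding N by simp
  have pt: "33 / 100 * real N * (w i j - (if i \<in> T \<inter> S \<and> j \<in> T \<inter> S then w i j else 0)) \<le> w i j * (real N - real (X i j))" if ij: "i \<in> S" "j \<in> S" for i j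
  proof (cases "i \<in> T \<and> j \<in> T")
    case True
    have "X i j \<le> N" using ij S XN by auto
    then show ?thesis using True ij w0[of i j] by simp
  next
    case False
    have lt: "i < n" "j < n" using ij S by auto
    have "3 * X i j < 2 * N + 3" using False diag[OF lt] diag[OF lt(2,1)] Xsym[OF lt] lt by (auto simp: T_def)
    then have "33 / 100 * real N \<le> real N - real (X i j)" using N1 by linarith
    then have "w i j * (33 / 100 * real N) \<le> w i j * (real N - real (X i j))" by (intro mult_left_mono w0)
    then show ?thesis using False by (auto simp: mult_ac)
  qed
  have "33 / 100 * real N * (real k * d - wt (T \<inter> S) (T \<inter> S))
     = (\<Sum>i\<in>S. \<Sum>j\<in>S. 33 / 100 * real N * (w i j - (if i \<in> T \<inter> S \<and> j \<in> T \<inter> S then w i j else 0)))"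
    unfolding sum_distrib_left[symmetric] sum_subtractf dens
    using sum_restrict_square[of S "T \<inter> S" w] by (simp add: wt_def)
  also have "\<dots> \<le> (\<Sum>i\<in>S. \<Sum>j\<in>S. w i j * (real N - real (X i j)))" by (intro sum_mono pt)
  also have "\<dots> = real N * (real k * d) - (\<Sum>i\<in>S. \<Sum>j\<in>S. w i j * real (X i j))"
    unfolding dens[symmetric] by (simp add: right_diff_distrib sum_subtractf sum_distrib_left mult.commute)
  also have "\<dots> \<le> real N * L" by (rule loss)
  finally have "real N * (33 / 100 * (real k * d - wt (T \<inter> S) (T \<inter> S))) \<le> real N * L" by (simp add: mult_ac)
  then have "33 / 100 * (real k * d - wt (T \<inter> S) (T \<inter> S)) \<le> L" using N1 by simp
  then show "real k * d \<le> wt (T \<inter> S) (T \<inter> S) + L / (33 / 100)" by (simp add: field_simps)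
  have "2 * N * card T = (\<Sum>i\<in>T. 2 * N)" by simp
  also have "\<dots> \<le> (\<Sum>i\<in>T. 3 * X i i)" by (intro sum_mono) (simp add: T_def)
  also have "\<dots> \<le> (\<Sum>i<n. 3 * X i i)" by (intro sum_mono2) (auto simp: T_def)
  also have "\<dots> = 3 * (\<Sum>i<n. X i i)" by (simp add: sum_distrib_left)
  also have "\<dots> \<le> 3 * (k * N + n)" using tr by simp
  also have "\<dots> < (3 * k + 1) * N"
  proof -
    have "n ^ 2 \<le> n ^ 18" using n by (intro power_increasing) auto
    moreover have "3 * n < n\<^sup>2" using n by (simp add: power2_eq_square)
    ultimately show ?thesis unfolding N by (simp add: algebra_simps)
  qed
  finally have "N * (2 * card T) < N * (3 * k + 1)" by (simp add: mult_ac)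
  then have "2 * card T < 3 * k + 1" by (metis mult_less_cancel1)
  then show "2 * card T \<le> 3 * k" by simp
qed

text \<open>Three losses add up: restriction to heavy pairs, about three times the loss of the
  relaxation; cutting down to \<open>k\<close> vertices; and comparison by total weight. The
  constant 6 is dictated by the \<open>D\<close> terms, whose total coefficient is slightly above
  5.5.\<close>

theorem rounded_dense:
  fixes X :: "nat \<Rightarrow> nat \<Rightarrow> nat"
  assumes N: "N = n ^ 18"
    and XN: "\<And>i j. i < n \<Longrightarrow> j < n \<Longrightarrow> X i j \<le> N" and Xsym: "\<And>i j. i < n \<Longrightarrow> j < n \<Longrightarrow> X i j = X j i"
    and diag: "\<And>i j. i < n \<Longrightarrow> j < n \<Longrightarrow> X i j \<le> X i i + 1"
    and tr: "(\<Sum>i<n. X i i) \<le> k * N + n" and tot: "(\<Sum>i<n. \<Sum>j<n. X i j) \<le> k * k * N + n * n"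
    and psd: "\<And>u. - (4 * real n ^ 10) * (\<Sum>i<n. (u i)\<^sup>2) \<le> (\<Sum>i<n. \<Sum>j<n. u i * u j * real (X i j))"
    and obj: "real N * (real k * d) \<le> (\<Sum>i<n. \<Sum>j<n. w i j * real (X i j)) + 3 * real n ^ 16 * \<sigma>"
  defines "T \<equiv> {i. i < n \<and> 2 * N \<le> 3 * X i i}"
  assumes Q: "Q \<subseteq> {..<n}" "card Q = k"
    and le: "card T \<le> k \<Longrightarrow> T \<subseteq> Q" and gt: "k < card T \<Longrightarrow> Q \<subseteq> T"
    and deg: "\<And>i j. k < card T \<Longrightarrow> i \<in> Q \<Longrightarrow> j \<in> T - Q \<Longrightarrow> (\<Sum>l\<in>T. w j l) \<le> (\<Sum>l\<in>T. w i l)"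
    and Q': "Q' \<subseteq> {..<n}" "card Q' = k" "wt Q Q \<le> wt Q' Q'"
  shows "real k * d - 6 * real k * \<sigma> \<le> wt (Q' \<inter> S) (Q' \<inter> S)"
proof -
  let ?\<tau> = "4 * p * real k + 24 * q + lam + D * real k"
  define L where "L = real k * ?\<tau> + \<sigma> / 100"
  have loss: "real N * (real k * d) - (\<Sum>i\<in>S. \<Sum>j\<in>S. w i j * real (X i j)) \<le> real N * L"
    unfolding L_def by (rule fractional_loss[OF N XN Xsym diag tr tot psd obj])
  have hc: "real k * d \<le> wt (T \<inter> S) (T \<inter> S) + L / (33 / 100)" "2 * card T \<le> 3 * k"
    unfolding T_def by (rule heavy_core[OF N XN Xsym diag tr loss]; assumption)+
  define r where "r = real (card T - k)"
  define b where "b = real (card (T \<inter> C))"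
  have T: "T \<subseteq> {..<n}" by (auto simp: T_def)
  have rl: "wt (T \<inter> S) (T \<inter> S) \<le> wt (Q \<inter> S) (Q \<inter> S) + 2 * (lam * r + D * b * r + 2 * p * r * real k + 12 * q * (r + real k))"
    unfolding r_def b_def by (rule rounding_loss[OF T Q le gt deg])
  have r: "0 \<le> r" "r \<le> real k / 2" using hc(2) unfolding r_def by linarith+
  have "card (T \<inter> C) \<le> card T" using card_split(4)[OF T] by (intro card_mono) auto
  then have b: "0 \<le> b" "b \<le> 3 / 2 * real k" using hc(2) unfolding b_def by linarith+
  have "lam * r \<le> lam * (real k / 2)" using r params by (intro mult_left_mono) auto
  moreover have "D * b * r \<le> D * (3 / 2 * real k) * (real k / 2)" using r b D_nonneg by (intro mult_mono) auto
  moreover have "2 * p * r * real k \<le> 2 * p * (real k / 2) * real k" using r params by (intro mult_right_mono mult_left_mono) auto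
  moreover have "12 * q * (r + real k) \<le> 12 * q * (real k / 2 + real k)" using r params by (intro mult_left_mono) auto
  ultimately have loss2: "lam * r + D * b * r + 2 * p * r * real k + 12 * q * (r + real k)
    \<le> lam * (real k / 2) + D * (3 / 2 * real k) * (real k / 2) + 2 * p * (real k / 2) * real k + 12 * q * (real k / 2 + real k)" by linarith
  have "wt (Q \<inter> S) (Q \<inter> S) \<le> wt Q Q" using Q finite_subset[OF Q(1)] by (intro wt_mono) auto
  then have in': "wt (Q \<inter> S) (Q \<inter> S) \<le> wt (Q' \<inter> S) (Q' \<inter> S) + real k * ?\<tau>"
    using Q'(3) inside_loss[OF Q'(1,2)] by linarith
  have "\<sigma> * 1 \<le> \<sigma> * real k" using k \<sigma>_bounds(1) by (intro mult_left_mono) auto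
  then have \<sigma>k: "\<sigma> \<le> real k * \<sigma>" by (simp add: mult.commute)
  \<comment> \<open>In terms of these four monomials all remaining inequalities are linear.\<close>
  define a1 where "a1 = real k * (p * real k)"
  define a2 where "a2 = real k * q"
  define a3 where "a3 = real k * lam"
  define a4 where "a4 = real k * (D * real k)"
  have a: "0 \<le> a1" "0 \<le> a2" "0 \<le> a3" "0 \<le> a4" using params D_nonneg by (simp_all add: a1_def a2_def a3_def a4_def)
  have t: "real k * ?\<tau> = 4 * a1 + 24 * a2 + a3 + a4" by (simp add: a1_def a2_def a3_def a4_def algebra_simps)
  have s: "real k * \<sigma> = 6 * a1 + 100 * a2 + a3 + a4" by (simp add: a1_def a2_def a3_def a4_def \<sigma>_def algebra_simps)
  have l2: "lam * (real k / 2) + D * (3 / 2 * real k) * (real k / 2) + 2 * p * (real k / 2) * real k + 12 * q * (real k / 2 + real k)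
    = a3 / 2 + 3 / 4 * a4 + a1 + 18 * a2" by (simp add: a1_def a2_def a3_def a4_def algebra_simps)
  have "L \<le> (4 * a1 + 24 * a2 + a3 + a4) + (6 * a1 + 100 * a2 + a3 + a4) / 100" unfolding L_def t using \<sigma>k unfolding s by argo
  then have "L / (33 / 100) \<le> 13 * a1 + 77 * a2 + 307 / 100 * a3 + 307 / 100 * a4" using a by (simp add: field_simps)
  moreover have "wt (T \<inter> S) (T \<inter> S) \<le> wt (Q \<inter> S) (Q \<inter> S) + 2 * (a3 / 2 + 3 / 4 * a4 + a1 + 18 * a2)"
    using rl loss2 unfolding l2 by argo
  moreover note in'[unfolded t] hc(1) a
  ultimately have "real k * d - 6 * (6 * a1 + 100 * a2 + a3 + a4) \<le> wt (Q' \<inter> S) (Q' \<inter> S)" by argo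
  then show ?thesis unfolding s[symmetric] by (simp only: mult.assoc)
qed

text \<open>\<open>rounding_loss\<close> with all vertices counted as heavy. The loss is large in
  terms of \<open>n\<close>, which is affordable when \<open>real k * d\<close> is far larger than
  \<sigma>.\<close>

theorem greedy_dense:
  assumes Q: "Q \<subseteq> {..<n}" "card Q = k"
    and deg: "\<And>i j. i \<in> Q \<Longrightarrow> j \<in> {..<n} - Q \<Longrightarrow> (\<Sum>l<n. w j l) \<le> (\<Sum>l<n. w i l)"
    and Q': "Q' \<subseteq> {..<n}" "card Q' = k" "wt Q Q \<le> wt Q' Q'"
  shows "real k * d - 7 * (real n)\<^sup>2 * \<sigma> \<le> wt (Q' \<inter> S) (Q' \<inter> S)"
proof -
  let ?\<tau> = "4 * p * real k + 24 * q + lam + D * real k"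
  define r where "r = real (n - k)"
  have "wt ({..<n} \<inter> S) ({..<n} \<inter> S) \<le> wt (Q \<inter> S) (Q \<inter> S)
      + 2 * (lam * real (card {..<n} - k) + D * real (card ({..<n} \<inter> C)) * real (card {..<n} - k) + 2 * p * real (card {..<n} - k) * real k + 12 * q * (real (card {..<n} - k) + real k))"
    using k by (intro rounding_loss Q deg) (use Q in auto)
  moreover have "{..<n} \<inter> S = S" "{..<n} \<inter> C = C" using S by (auto simp: C_def)
  ultimately have rl: "real k * d \<le> wt (Q \<inter> S) (Q \<inter> S) + 2 * (lam * r + D * r * r + 2 * p * r * real k + 12 * q * (r + real k))"
    using dens by (simp add: wt_def r_def card_C)
  have rn: "0 \<le> r" "r + real k = real n" "r \<le> real n" using k by (auto simp: r_def of_nat_diff)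
  define Z where "Z = (real n)\<^sup>2"
  have nZ: "real n \<le> Z" using n by (simp add: Z_def power2_eq_square)
  have "lam * r \<le> \<sigma> * Z" using rn nZ \<sigma>_bounds params by (intro mult_mono) auto
  moreover have "D * r * r \<le> \<sigma> * Z"
    unfolding mult.assoc using rn \<sigma>_bounds D_nonneg by (intro mult_mono) (auto simp: Z_def power2_eq_square intro: mult_mono)
  moreover have "2 * p * r * real k + 12 * q * (r + real k) \<le> \<sigma> * Z"
  proof -
    have "2 * p * real k * r \<le> 2 * p * real k * real n" using rn params by (intro mult_left_mono) auto
    then have "2 * p * r * real k + 12 * q * (r + real k) \<le> (2 * p * real k + 12 * q) * real n" unfolding rn by (simp add: algebra_simps)
    also have "\<dots> \<le> \<sigma> * Z" using nZ \<sigma>_bounds by (intro mult_mono) auto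
    finally show ?thesis .
  qed
  ultimately have rl2: "lam * r + D * r * r + 2 * p * r * real k + 12 * q * (r + real k) \<le> 3 * (\<sigma> * Z)" by linarith
  have "wt (Q \<inter> S) (Q \<inter> S) \<le> wt Q Q" using Q finite_subset[OF Q(1)] by (intro wt_mono) auto
  then have in': "wt (Q \<inter> S) (Q \<inter> S) \<le> wt (Q' \<inter> S) (Q' \<inter> S) + real k * ?\<tau>"
    using Q'(3) inside_loss[OF Q'(1,2)] by linarith
  have "real k * ?\<tau> \<le> Z * \<sigma>" using \<sigma>_bounds nZ k D_nonneg params by (intro mult_mono) auto
  then have "real k * d - 7 * (\<sigma> * Z) \<le> wt (Q' \<inter> S) (Q' \<inter> S)" using rl rl2 in' unfolding mult.commute[of Z \<sigma>] by argo
  then show ?thesis unfolding Z_def by (simp add: mult_ac)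
qed

end

section \<open>The main theorem\<close>

definition top_set :: "nat \<Rightarrow> nat \<Rightarrow> (nat \<Rightarrow> nat) \<Rightarrow> nat set" where
  "top_set n k f = {i. i < n \<and> topk n k f i \<noteq> 0}"

text \<open>As the values are distinct, the rank of a vertex is injective into \<open>{..<n}\<close>
  and thus a bijection, so exactly \<open>k\<close> vertices have rank below
  \<open>k\<close>.\<close>

lemma top_set:
  assumes inj: "inj_on f {..<n}" and k: "k \<le> n"
  shows "top_set n k f \<subseteq> {..<n}" "card (top_set n k f) = k"
    "\<And>i j. i \<in> top_set n k f \<Longrightarrow> j < n \<Longrightarrow> j \<notin> top_set n k f \<Longrightarrow> f j < f i"
proof -
  define r where "r i = card {j. j < n \<and> f i < f j}" for i
  have Q: "top_set n k f = {i. i < n \<and> r i < k}" by (simp add: top_set_def topk_def r_def not_le)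
  have mono: "r j < r i" if "f i < f j" "j < n" for i j
    unfolding r_def by (rule psubset_card_mono) (use that in auto)
  have injr: "inj_on r {..<n}"
  proof (rule inj_onI)
    fix i j assume "i \<in> {..<n}" "j \<in> {..<n}" "r i = r j"
    then have "\<not> f i < f j" "\<not> f j < f i" using mono by fastforce+
    then have "f i = f j" by simp
    then show "i = j" using inj \<open>i \<in> {..<n}\<close> \<open>j \<in> {..<n}\<close> by (auto dest: inj_onD)
  qed
  have "r ` {..<n} \<subseteq> {..<n}"
  proof
    fix y assume "y \<in> r ` {..<n}"
    then obtain i where i: "i < n" "y = r i" by auto
    have "{j. j < n \<and> f i < f j} \<subset> {..<n}" using i by auto
    then have "r i < card {..<n}" unfolding r_def by (intro psubset_card_mono) auto
    then show "y \<in> {..<n}" using i by simp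
  qed
  then have img: "r ` {..<n} = {..<n}" using injr by (intro card_subset_eq) (auto simp: card_image)
  have "r ` top_set n k f = {..<k}"
  proof
    show "r ` top_set n k f \<subseteq> {..<k}" by (auto simp: Q)
    show "{..<k} \<subseteq> r ` top_set n k f"
    proof
      fix y assume y: "y \<in> {..<k}"
      then have "y \<in> r ` {..<n}" using img k by auto
      then show "y \<in> r ` top_set n k f" using y by (auto simp: Q)
    qed
  qed
  moreover have "inj_on r (top_set n k f)" using injr by (rule inj_on_subset) (auto simp: Q)
  ultimately show "card (top_set n k f) = k" using card_image by fastforce
  show "top_set n k f \<subseteq> {..<n}" by (auto simp: Q)
  fix i j assume ij: "i \<in> top_set n k f" "j < n" "j \<notin> top_set n k f"
  then have "r i < r j" "i < n" by (auto simp: Q)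
  show "f j < f i"
  proof (rule ccontr)
    assume "\<not> f j < f i"
    then have "f i < f j \<or> f i = f j" by auto
    then show False
    proof
      assume "f i < f j"
      then show False using mono[of i j] ij(2) \<open>r i < r j\<close> by simp
    next
      assume "f i = f j"
      then show False using \<open>r i < r j\<close> by (simp add: r_def)
    qed
  qed
qed

lemma score_inj: "inj_on (score n N W X) {..<n}"
proof (rule inj_onI)
  fix i j assume "i \<in> {..<n}" "j \<in> {..<n}" and e: "score n N W X i = score n N W X j"
  then have "i < n" "j < n" by simp_all
  then have "score n N W X i mod n = i" "score n N W X j mod n = j"
    by (simp_all only: score_def mod_mult_self3 mod_less)
  then show "i = j" unfolding e by (rule trans[OF sym])
qed

lemma score_heavy:
  assumes "i < n"
  shows "heavy N X i \<longleftrightarrow> n \<le> score n N W X i"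
proof (cases "heavy N X i")
  case True
  define s where "s = (\<Sum>j<n. if heavy N X j then W i j else 0)"
  have "score n N W X i = (1 + s) * n + i" using True by (simp only: score_def s_def if_True)
  then show ?thesis using True by simp
next
  case False
  then have "score n N W X i = i" by (simp only: score_def if_False mult_zero_left add_0)
  then show ?thesis using False assms by simp
qed

text \<open>The tie-breaking index is below \<open>n\<close>, so it cannot outweigh a difference in
  degree.\<close>

lemma score_degree:
  assumes "i < n" "heavy N X i" "heavy N X j" "score n N W X j < score n N W X i"
  shows "(\<Sum>l\<in>{l. l < n \<and> heavy N X l}. W j l) \<le> (\<Sum>l\<in>{l. l < n \<and> heavy N X l}. W i l)"
proof -
  have s: "(\<Sum>l<n. if heavy N X l then W a l else 0) = (\<Sum>l\<in>{l. l < n \<and> heavy N X l}. W a l)" for a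
  proof -
    have "{l. l < n \<and> heavy N X l} = {l \<in> {..<n}. heavy N X l}" by auto
    then show ?thesis by (simp only: sum.inter_filter finite_lessThan)
  qed
  define a where "a = (\<Sum>l\<in>{l. l < n \<and> heavy N X l}. W i l)"
  define b where "b = (\<Sum>l\<in>{l. l < n \<and> heavy N X l}. W j l)"
  have "(1 + b) * n + j < (1 + a) * n + i" using assms(4) assms(2,3)[THEN eqTrueI] by (simp only: score_def s a_def b_def if_True)
  then have "(1 + b) * n < (1 + a) * n + n" using assms(1) by linarith
  then have "(1 + b) * n < (2 + a) * n" by simp
  then have "1 + b < 2 + a" by (rule mult_less_cancel2[THEN iffD1, THEN conjunct2])
  then show ?thesis unfolding a_def b_def by simp
qed

text \<open>Heavy vertices outrank light ones, so a heavy vertex that is left out forces every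
  selected vertex to be heavy; the rest is counting.\<close>

lemma top_heavy:
  fixes W X :: "nat \<Rightarrow> nat \<Rightarrow> nat"
  assumes k: "k \<le> n" and T_def: "T = {i. i < n \<and> heavy N X i}" and Q_def: "Q = top_set n k (score n N W X)"
  shows "card T \<le> k \<Longrightarrow> T \<subseteq> Q" "k < card T \<Longrightarrow> Q \<subseteq> T"
    "k < card T \<Longrightarrow> i \<in> Q \<Longrightarrow> j \<in> T - Q \<Longrightarrow> (\<Sum>l\<in>T. W j l) \<le> (\<Sum>l\<in>T. W i l)"
proof -
  note ts = top_set[OF score_inj[of n N W X] k, folded Q_def]
  have finT: "finite T" by (simp add: T_def)
  have finQ: "finite Q" using ts(1) finite_subset by blast
  have up: "i \<in> T" if "i \<in> Q" "j \<in> T" "j \<notin> Q" for i j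
    using ts(3)[of i j] score_heavy[of i n N X W] score_heavy[of j n N X W] that ts(1) by (auto simp: T_def)
  show 1: "T \<subseteq> Q" if "card T \<le> k"
  proof (rule ccontr)
    assume "\<not> T \<subseteq> Q"
    then obtain j where j: "j \<in> T" "j \<notin> Q" by blast
    then have "insert j Q \<subseteq> T" using up by blast
    then have "card (insert j Q) \<le> card T" using finT by (intro card_mono)
    then show False using that j finQ ts(2) by simp
  qed
  show 2: "Q \<subseteq> T" if "k < card T"
  proof -
    have "\<not> T \<subseteq> Q" using that card_mono[OF finQ, of T] ts(2) by auto
    then show ?thesis using up by blast
  qed
  show "(\<Sum>l\<in>T. W j l) \<le> (\<Sum>l\<in>T. W i l)" if "k < card T" "i \<in> Q" "j \<in> T - Q"
    unfolding T_def using that 2 ts(1,3) by (intro score_degree) (auto simp: T_def)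
qed

text \<open>Deletion leaves each entry of \<open>D\<close> between 0 and its original value, so the
  discrepancy bound for \<open>R\<close> and, as the entries of \<open>x\<close> are nonnegative,
  the expander inequality for \<open>H\<close> carry over. Inside \<open>S\<close> neither random
  edges nor \<open>H\<close> contribute, so the weight there is exactly that of
  \<open>B\<close>.\<close>

lemma planted_graph_output:
  assumes out: "DkSExp_output n S d d' lam R w" and low: "low_discrepancy n S p R"
    and R: "\<And>x. R x \<Longrightarrow> x \<in> S \<times> ({..<n} - S)"
    and S: "S \<subseteq> {..<n}" "card S = k" "0 < k" "k < n" "1000 < n" and lam: "0 \<le> lam" and p: "0 \<le> p"
  shows "planted_graph n k S w p (sqrt (p * real n)) lam d' d" "wgraph {..<n} w"
proof -
  obtain B H D where B: "wgraph S B" "avg_degree S B = d" and H: "expander ({..<n} - S) H d' lam"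
    and D: "wgraph {..<n} D" "\<forall>i j. D i j = cross_weight R i j + H i j \<or> D i j = 0" and w: "w = (\<lambda>i j. B i j + D i j)"
    using out unfolding DkSExp_output_def by (elim exE conjE) (rule that; assumption)
  define C where "C = {..<n} - S"
  have Hg: "wgraph C H" "\<forall>i\<in>C. wdegree C H i = d'" using H unfolding expander_def C_def by auto
  have B0: "0 \<le> B i j" "B i j = B j i" "i \<notin> S \<or> j \<notin> S \<Longrightarrow> B i j = 0" "B i i = 0" for i j using B(1) unfolding wgraph_def by blast+
  have H0: "0 \<le> H i j" "i \<notin> C \<or> j \<notin> C \<Longrightarrow> H i j = 0" for i j using Hg(1) unfolding wgraph_def by blast+
  have D0: "0 \<le> D i j" "D i j = D j i" "i \<notin> {..<n} \<or> j \<notin> {..<n} \<Longrightarrow> D i j = 0" "D i i = 0" for i j using D(1) unfolding wgraph_def by blast+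
  have cw0: "0 \<le> cross_weight R i j" for i j by (simp add: cross_weight_def)
  have Dle: "D i j \<le> cross_weight R i j + H i j" for i j using D(2)[rule_format, of i j] H0(1)[of i j] cw0[of i j] by linarith
  show "wgraph {..<n} w"
    unfolding wgraph_def w
  proof (intro conjI allI impI)
    fix i j
    show "0 \<le> B i j + D i j" using B0(1) D0(1) by (simp add: add_nonneg_nonneg)
    show "B i j + D i j = B j i + D j i" using B0(2)[of i j] D0(2)[of i j] by simp
    show "B i i + D i i = 0" using B0(4) D0(4) by simp
    assume "B i j + D i j \<noteq> 0"
    then have "B i j \<noteq> 0 \<or> D i j \<noteq> 0" by auto
    then show "i \<in> {..<n}" "j \<in> {..<n}" using B0(3)[of i j] D0(3)[of i j] S(1) by blast+
  qed
  have fin: "finite S" "finite C" using S finite_subset by (auto simp: C_def)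
  have cC: "card C = n - k" "C \<noteq> {}"
  proof -
    show "card C = n - k" using S by (simp add: C_def card_Diff_subset finite_subset)
    then show "C \<noteq> {}" using S by auto
  qed
  have SS: "w i j = B i j" if "i \<in> S" "j \<in> S" for i j
  proof -
    have "cross_weight R i j = 0" using R[of "(i, j)"] R[of "(j, i)"] that by (auto simp: cross_weight_def)
    moreover have "H i j = 0" using H0(2) that by (simp add: C_def)
    ultimately show ?thesis using Dle[of i j] D0(1)[of i j] by (simp add: w)
  qed
  have SC: "w i j \<le> (if R (i, j) then 1 else 0)" if "i \<in> S" "j \<in> C" for i j
  proof -
    have "B i j = 0" "H i j = 0" using B0(3) H0(2) that by (auto simp: C_def)
    moreover have "\<not> R (j, i)" using R[of "(j, i)"] that by auto
    ultimately show ?thesis using Dle[of i j] by (simp add: w cross_weight_def)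
  qed
  have CC: "w i j \<le> H i j" if "i \<in> C" "j \<in> C" for i j
  proof -
    have "B i j = 0" using B0(3) that by (auto simp: C_def)
    moreover have "cross_weight R i j = 0" using R[of "(i, j)"] R[of "(j, i)"] that by (auto simp: cross_weight_def C_def)
    ultimately show ?thesis using Dle[of i j] by (simp add: w)
  qed
  show "planted_graph n k S w p (sqrt (p * real n)) lam d' d"
  proof unfold_locales
    show "0 \<le> w i j" for i j using B0(1) D0(1) by (simp add: w add_nonneg_nonneg)
    show "w i j = w j i" for i j using B0(2)[of i j] D0(2)[of i j] by (simp add: w)
    show "0 \<le> d'"
    proof -
      obtain c where "c \<in> C" using cC by blast
      then have "d' = wdegree C H c" using Hg(2) by simp
      then show ?thesis unfolding wdegree_def using H0(1) by (simp add: sum_nonneg)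
    qed
    have "(\<Sum>i\<in>S. \<Sum>j\<in>S. w i j) = (\<Sum>i\<in>S. wdegree S B i)" unfolding wdegree_def using SS by (intro sum.cong refl) auto
    also have "\<dots> = real k * d" using B(2) S unfolding avg_degree_def by (auto simp: field_simps)
    finally show "(\<Sum>i\<in>S. \<Sum>j\<in>S. w i j) = real k * d" .
  next
    fix A U assume A: "A \<subseteq> S" and U: "U \<subseteq> {..<n} - S"
    have fA: "finite A" "finite U" using finite_subset[OF A fin(1)] finite_subset[OF U] by simp_all
    have "(\<Sum>i\<in>A. \<Sum>j\<in>U. w i j) \<le> (\<Sum>i\<in>A. \<Sum>j\<in>U. if R (i, j) then 1 else 0)"
      using A U SC by (intro sum_mono) (auto simp: C_def subset_iff)
    also have "\<dots> = (\<Sum>x\<in>A \<times> U. if R x then 1 else 0)" by (simp add: sum.cartesian_product split_beta)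
    also have "\<dots> = real (card {x \<in> A \<times> U. R x})" using fA by (simp add: sum.inter_filter[symmetric])
    also have "\<dots> \<le> 2 * p * real (card A) * real (card U) + 12 * sqrt (p * real n) * (real (card A) + real (card U))"
      using low A U unfolding low_discrepancy_def by simp
    finally show "(\<Sum>i\<in>A. \<Sum>j\<in>U. w i j) \<le> 2 * p * real (card A) * real (card U) + 12 * sqrt (p * real n) * (real (card A) + real (card U))" .
  next
    fix x :: "nat \<Rightarrow> nat \<Rightarrow> real" and \<epsilon> :: real
    assume \<epsilon>: "0 \<le> \<epsilon>" and x0: "\<And>i j. i \<in> {..<n} - S \<Longrightarrow> j \<in> {..<n} - S \<Longrightarrow> 0 \<le> x i j"
      and psd: "\<And>u. - \<epsilon> * (\<Sum>i\<in>{..<n} - S. (u i)\<^sup>2) \<le> (\<Sum>i\<in>{..<n} - S. \<Sum>j\<in>{..<n} - S. u i * u j * x i j)"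
    have "(\<Sum>i\<in>C. \<Sum>j\<in>C. w i j * x i j) \<le> (\<Sum>i\<in>C. \<Sum>j\<in>C. H i j * x i j)"
      using CC x0 by (intro sum_mono mult_right_mono) (auto simp: C_def)
    also have "\<dots> \<le> lam * (\<Sum>i\<in>C. x i i) + d' / real (card C) * (\<Sum>i\<in>C. \<Sum>j\<in>C. x i j) + 3 * lam * real (card C) * \<epsilon>"
      unfolding C_def by (rule expander_spectral_bound[OF H _ _ lam \<epsilon> x0 psd]) (use cC in \<open>auto simp: C_def\<close>)
    also have "real (card C) = real n - real k" using cC(1) S by (simp add: of_nat_diff)
    also have "3 * lam * (real n - real k) * \<epsilon> \<le> 3 * lam * real n * \<epsilon>"
      using lam \<epsilon> by (intro mult_right_mono mult_left_mono) auto
    finally show "(\<Sum>i\<in>{..<n} - S. \<Sum>j\<in>{..<n} - S. w i j * x i j)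
        \<le> lam * (\<Sum>i\<in>{..<n} - S. x i i) + d' / (real n - real k) * (\<Sum>i\<in>{..<n} - S. \<Sum>j\<in>{..<n} - S. x i j) + 3 * lam * real n * \<epsilon>"
      unfolding C_def by simp
  qed (use S lam p in auto)
qed

lemma weight_of_top:
  fixes W :: "nat \<Rightarrow> nat \<Rightarrow> nat" and w :: "nat \<Rightarrow> nat \<Rightarrow> real"
  assumes "\<forall>i<n. \<forall>j<n. real (W i j) = real D * w i j"
  shows "real (weight_of n W (topk n k f)) = 1 + real D * (\<Sum>i\<in>top_set n k f. \<Sum>j\<in>top_set n k f. w i j)"
proof -
  have "real (\<Sum>i<n. \<Sum>j<n. if topk n k f i \<noteq> 0 \<and> topk n k f j \<noteq> 0 then W i j else 0)
      = (\<Sum>i<n. \<Sum>j<n. if i \<in> top_set n k f \<and> j \<in> top_set n k f then real D * w i j else 0)"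
    unfolding of_nat_sum by (intro sum.cong refl) (use assms in \<open>auto simp: top_set_def\<close>)
  also have "\<dots> = (\<Sum>i\<in>top_set n k f. \<Sum>j\<in>top_set n k f. real D * w i j)"
    by (rule sum_restrict_square) (auto simp: top_set_def)
  finally show ?thesis by (simp add: weight_of_def sum_distrib_left)
qed

text \<open>Two regimes. If the total weight is at most \<open>n ^ 6 * \<sigma>\<close>, the errors
  of the integer relaxation are negligible and a stable iterate loses at most
  \<open>6 * k * \<sigma>\<close>. Otherwise the start matrix already yields a sufficient choice by
  degree.\<close>

lemma planted_recovery:
  fixes w :: "nat \<Rightarrow> nat \<Rightarrow> rat"
  assumes pg: "planted_graph n k S (real_weights w) p q lam d' d" and wg: "wgraph {..<n} (real_weights w)" and d: "0 < d"
    and \<sigma>_eq: "\<sigma> = 6 * p * real k + 100 * q + lam + d' / (real n - real k) * real k" and \<sigma>: "0 < \<sigma>" "12 * \<sigma> \<le> d"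
    and Q'_eq: "Q' = {i. i < n \<and> ar (sem program (initial n k w)) 5 0 i \<noteq> 0}"
  shows "card Q' = k" "Q' \<subseteq> {..<n}"
    "real k * d - real k * sqrt (3 * \<sigma> * d) \<le> (\<Sum>i\<in>Q' \<inter> S. \<Sum>j\<in>Q' \<inter> S. real_of_rat (w i j))"
proof -
  interpret pg: planted_graph n k S "real_weights w" p q lam d' d by (rule pg)
  have \<sigma>pg: "pg.\<sigma> = \<sigma>" unfolding \<sigma>_eq pg.\<sigma>_def pg.D_def ..
  have ii: "instance_input n w" using pg.n wg by (simp add: instance_input_def)
  define N where "N = n ^ 18"
  obtain W D v X where D: "0 < D" and W: "\<forall>i<n. \<forall>j<n. real (W i j) = real D * real_of_rat (w i j)"
    and X: "\<forall>i<n. ar (sem program (initial n k w)) 5 0 i = topk n k (score n N W X) i"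
    and v: "v = weight_of n W (topk n k (score n N W X))"
    and tj: "\<forall>g\<le>N. \<exists>Xs. (\<forall>i<n. \<forall>j<n. Xs 0 i j = N) \<and>
      (\<forall>l<n * n * N * N + 1. improves n k N (n ^ 10) (2 * n ^ 10) (\<Sum>i<n. \<Sum>j<n. W i j) (2 * (n * N)) W g (Xs l) (Xs (Suc l)) \<and>
         weight_of n W (topk n k (score n N W (Xs l))) \<le> v \<and> (\<forall>i<n. \<forall>j<n. Xs l i j \<le> N))"
    using instance_input.program_spec[OF ii, of k, folded N_def] by (elim exE conjE) (rule that; assumption)
  have kn: "k \<le> n" using pg.k by simp
  have Q'_top: "Q' = top_set n k (score n N W X)" unfolding Q'_eq top_set_def using X by auto
  note ts = top_set[OF score_inj kn]
  show Q': "card Q' = k" "Q' \<subseteq> {..<n}" unfolding Q'_top by (rule ts)+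
  have better: "pg.wt (top_set n k (score n N W Y)) (top_set n k (score n N W Y)) \<le> pg.wt Q' Q'"
    if "weight_of n W (topk n k (score n N W Y)) \<le> v" for Y
  proof -
    have "real (weight_of n W (topk n k (score n N W Y))) \<le> real (weight_of n W (topk n k (score n N W X)))"
      using that unfolding v by (simp only: of_nat_le_iff)
    then show ?thesis unfolding weight_of_top[OF W] pg.wt_def Q'_top using D by simp
  qed
  have degr: "(\<Sum>l\<in>T. real_of_rat (w j l)) \<le> (\<Sum>l\<in>T. real_of_rat (w i l))"
    if "T \<subseteq> {..<n}" "i < n" "j < n" "(\<Sum>l\<in>T. W j l) \<le> (\<Sum>l\<in>T. W i l)" for T i j
  proof -
    have e: "real (\<Sum>l\<in>T. W a l) = real D * (\<Sum>l\<in>T. real_of_rat (w a l))" if "a < n" for a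
      unfolding sum_distrib_left of_nat_sum using W that \<open>T \<subseteq> {..<n}\<close> by (intro sum.cong refl) auto
    have "real (\<Sum>l\<in>T. W j l) \<le> real (\<Sum>l\<in>T. W i l)" using that(4) by (simp only: of_nat_le_iff)
    then show ?thesis unfolding e[OF that(2)] e[OF that(3)] using D by simp
  qed
  define Sw where "Sw = pg.wt {..<n} {..<n}"
  have SS: "pg.wt S S = real k * d" using pg.dens by (simp add: pg.wt_def)
  have kd: "0 < real k * d" using pg.k d by simp
  have Sw: "real k * d \<le> Sw" unfolding Sw_def SS[symmetric] using pg.S by (intro pg.wt_mono) auto
  have M: "real (\<Sum>i<n. \<Sum>j<n. W i j) = real D * Sw"
    unfolding Sw_def pg.wt_def sum_distrib_left of_nat_sum using W by (intro sum.cong refl) auto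
  have "real k * d - real k * sqrt (3 * \<sigma> * d) \<le> pg.wt (Q' \<inter> S) (Q' \<inter> S)"
  proof (cases "Sw \<le> real n ^ 6 * \<sigma>")
    case True
    interpret pm: planted_matrix n k N S
      using pg.S pg.n by unfold_locales (auto simp: N_def)
    \<comment> \<open>The largest integral target that the planted matrix reaches; rounding down
      costs at most \<open>Sw\<close>.\<close>
    define g where "g = nat \<lfloor>real N * (real k * d) / Sw\<rfloor>"
    have q0: "0 \<le> real N * (real k * d) / Sw" using kd Sw by simp
    have g1: "real g \<le> real N * (real k * d) / Sw" "real N * (real k * d) / Sw - 1 < real g"
      using q0 unfolding g_def by (simp_all add: of_nat_nat)
    then have g2: "real g * Sw \<le> real N * (real k * d)" "real N * (real k * d) \<le> real g * Sw + Sw"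
      using kd Sw by (simp_all add: field_simps)
    have "real g * Sw \<le> real N * Sw" using g2(1) mult_left_mono[OF Sw, of "real N"] by linarith
    then have gN: "g \<le> N" using kd Sw by simp
    obtain Xs where Xs0: "\<forall>i<n. \<forall>j<n. Xs 0 i j = N" and Xs: "\<forall>l<n * n * N * N + 1.
        improves n k N (n ^ 10) (2 * n ^ 10) (\<Sum>i<n. \<Sum>j<n. W i j) (2 * (n * N)) W g (Xs l) (Xs (Suc l)) \<and>
         weight_of n W (topk n k (score n N W (Xs l))) \<le> v \<and> (\<forall>i<n. \<forall>j<n. Xs l i j \<le> N)"
      using tj[rule_format, OF gN] by (elim exE conjE) (rule that; assumption)
    have "\<exists>l < n * n * N * N + 1. pm.stable g W (Xs l)"
    proof (rule pm.stable_exists[OF _ refl])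
      fix i j assume "i < n" "j < n"
      then have "real (W i j) = real (W j i)" using W pg.wsym[of i j] by simp
      then show "W i j = W j i" by simp
      show "Xs 0 i j = N" using Xs0 \<open>i < n\<close> \<open>j < n\<close> by simp
    next
      have "0 < real D * Sw" using D kd Sw by simp
      then show "0 < (\<Sum>i<n. \<Sum>j<n. W i j)" unfolding M[symmetric] by (simp only: of_nat_0_less_iff)
      have "(\<Sum>i\<in>S. \<Sum>j\<in>S. real (W i j)) = real D * (real k * d)"
        unfolding SS[symmetric] pg.wt_def sum_distrib_left using W pg.S by (intro sum.cong refl) auto
      then show "real g * real (\<Sum>i<n. \<Sum>j<n. W i j) \<le> real N * (\<Sum>i\<in>S. \<Sum>j\<in>S. real (W i j))"
        unfolding M using mult_left_mono[OF g2(1), of "real D"] by (simp add: mult_ac)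
    next
      show "improves n k N (n ^ 10) (2 * n ^ 10) (\<Sum>i<n. \<Sum>j<n. W i j) (2 * (n * N)) W g (Xs l) (Xs (Suc l))" if "l < n * n * N * N + 1" for l
        by (rule conjunct1[OF Xs[rule_format, OF that]])
    qed
    then obtain l where l: "l < n * n * N * N + 1" and st: "pm.stable g W (Xs l)" by blast
    define Y where "Y = Xs l"
    have y: "pm.ssym Y" "(\<Sum>i<n. Y i i) < k * N + n" "(\<Sum>i<n. \<Sum>j<n. Y i j) < k * k * N + n * n" "\<forall>i<n. \<forall>j<n. Y i j \<le> Y i i + 1"
      "g * (\<Sum>i<n. \<Sum>j<n. W i j) < (\<Sum>i<n. \<Sum>j<n. W i j * Y i j) + 2 * n ^ 10 * (\<Sum>i<n. \<Sum>j<n. W i j)"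
      "\<forall>u. - 2 * real (2 * n ^ 10) * (\<Sum>i<n. (u i)\<^sup>2) \<le> (\<Sum>i<n. \<Sum>j<n. u i * u j * real (Y i j))"
      using st unfolding pm.stable_def Y_def by blast+
    define Q where "Q = top_set n k (score n N W Y)"
    define T where "T = {i. i < n \<and> heavy N Y i}"
    note th = top_heavy[OF kn T_def Q_def]
    have "real k * d - 6 * real k * pg.\<sigma> \<le> pg.wt (Q' \<inter> S) (Q' \<inter> S)"
    proof (rule pg.rounded_dense[where Q = Q and X = Y])
      show "N = n ^ 18" by (rule N_def)
      show "Y i j \<le> N" "Y i j = Y j i" "Y i j \<le> Y i i + 1" if "i < n" "j < n" for i j
        using y(1,4) that unfolding pm.ssym_def by auto
      show "(\<Sum>i<n. Y i i) \<le> k * N + n" "(\<Sum>i<n. \<Sum>j<n. Y i j) \<le> k * k * N + n * n" using y(2,3) by simp_all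
      show "- (4 * real n ^ 10) * (\<Sum>i<n. (u i)\<^sup>2) \<le> (\<Sum>i<n. \<Sum>j<n. u i * u j * real (Y i j))" for u
        using y(6)[rule_format, of u] by simp
      have WY: "real (\<Sum>i<n. \<Sum>j<n. W i j * Y i j) = real D * (\<Sum>i<n. \<Sum>j<n. real_of_rat (w i j) * real (Y i j))"
        unfolding sum_distrib_left of_nat_sum of_nat_mult using W by (intro sum.cong refl) auto
      have "real (g * (\<Sum>i<n. \<Sum>j<n. W i j)) \<le> real ((\<Sum>i<n. \<Sum>j<n. W i j * Y i j) + 2 * n ^ 10 * (\<Sum>i<n. \<Sum>j<n. W i j))"
        using y(5) by (simp only: of_nat_le_iff less_imp_le)
      then have "real D * (real g * Sw) \<le> real D * ((\<Sum>i<n. \<Sum>j<n. real_of_rat (w i j) * real (Y i j)) + 2 * real n ^ 10 * Sw)"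
        unfolding of_nat_mult of_nat_add WY M by (simp add: algebra_simps)
      then have gS: "real g * Sw \<le> (\<Sum>i<n. \<Sum>j<n. real_of_rat (w i j) * real (Y i j)) + 2 * real n ^ 10 * Sw" using D by simp
      have n1: "1 \<le> real n ^ 10" using pg.n by (intro one_le_power) auto
      \<comment> \<open>The rounding of \<open>g\<close> and the tolerance \<open>2 * n ^ 10\<close>
        together cost at most \<open>3 * n ^ 10 * Sw\<close>, which the case assumption turns into
        \<open>3 * n ^ 16 * \<sigma>\<close>.\<close>
      have "1 * Sw \<le> real n ^ 10 * Sw" using n1 kd Sw by (intro mult_right_mono) auto
      moreover have "real n ^ 10 * Sw \<le> real n ^ 10 * (real n ^ 6 * \<sigma>)" using True by (intro mult_left_mono) auto
      moreover have "real n ^ 10 * (real n ^ 6 * \<sigma>) = real n ^ 16 * \<sigma>" by (simp flip: power_add mult.assoc)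
      moreover have "2 * real n ^ 10 * Sw = 2 * (real n ^ 10 * Sw)" "3 * real n ^ 16 * pg.\<sigma> = 3 * (real n ^ 16 * \<sigma>)" unfolding \<sigma>pg by simp_all
      ultimately show "real N * (real k * d) \<le> (\<Sum>i<n. \<Sum>j<n. real_of_rat (w i j) * real (Y i j)) + 3 * real n ^ 16 * pg.\<sigma>"
        using g2(2) gS by linarith
      show "Q \<subseteq> {..<n}" "card Q = k" unfolding Q_def by (rule ts)+
      have Te: "{i. i < n \<and> 2 * N \<le> 3 * Y i i} = T" by (simp add: T_def heavy_def)
      show "card {i. i < n \<and> 2 * N \<le> 3 * Y i i} \<le> k \<Longrightarrow> {i. i < n \<and> 2 * N \<le> 3 * Y i i} \<subseteq> Q" unfolding Te by (rule th(1))
      show "k < card {i. i < n \<and> 2 * N \<le> 3 * Y i i} \<Longrightarrow> Q \<subseteq> {i. i < n \<and> 2 * N \<le> 3 * Y i i}" unfolding Te by (rule th(2))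
      show "(\<Sum>l\<in>{i. i < n \<and> 2 * N \<le> 3 * Y i i}. real_of_rat (w j l)) \<le> (\<Sum>l\<in>{i. i < n \<and> 2 * N \<le> 3 * Y i i}. real_of_rat (w i l))"
        if "k < card {i. i < n \<and> 2 * N \<le> 3 * Y i i}" "i \<in> Q" "j \<in> {i. i < n \<and> 2 * N \<le> 3 * Y i i} - Q" for i j
      proof (rule degr)
        note that' = that[unfolded Te]
        show "{i. i < n \<and> 2 * N \<le> 3 * Y i i} \<subseteq> {..<n}" by auto
        show "i < n" using \<open>Q \<subseteq> {..<n}\<close> that(2) by auto
        show "j < n" using that(3) by auto
        show "(\<Sum>l\<in>{i. i < n \<and> 2 * N \<le> 3 * Y i i}. W j l) \<le> (\<Sum>l\<in>{i. i < n \<and> 2 * N \<le> 3 * Y i i}. W i l)"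
          unfolding Te by (rule th(3)[OF that'])
      qed
      show "Q' \<subseteq> {..<n}" "card Q' = k" by (rule Q')+
      show "pg.wt Q Q \<le> pg.wt Q' Q'" unfolding Q_def Y_def
        by (rule better) (rule conjunct1[OF conjunct2[OF Xs[rule_format, OF l]]])
    qed
    \<comment> \<open>For positive \<sigma> this amounts to \<open>12 * \<sigma> \<le> d\<close>;
      here the linear loss is exchanged for the square root.\<close>
    moreover have "6 * \<sigma> \<le> sqrt (3 * \<sigma> * d)"
    proof (rule real_le_rsqrt)
      have "3 * \<sigma> * (12 * \<sigma>) \<le> 3 * \<sigma> * d" using \<sigma> by (intro mult_left_mono) auto
      then show "(6 * \<sigma>)\<^sup>2 \<le> 3 * \<sigma> * d" by (simp add: power2_eq_square)
    qed
    then have "real k * (6 * \<sigma>) \<le> real k * sqrt (3 * \<sigma> * d)" by (intro mult_left_mono) auto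
    moreover have "6 * real k * \<sigma> = real k * (6 * \<sigma>)" by simp
    ultimately show ?thesis unfolding \<sigma>pg by linarith
  next
    case False
    \<comment> \<open>Any target would do: the argument looks at the start matrix, which is the same
      for all targets and makes every vertex heavy.\<close>
    obtain Xs where Xs0: "\<forall>i<n. \<forall>j<n. Xs 0 i j = N" and Xs: "\<forall>l<n * n * N * N + 1.
        improves n k N (n ^ 10) (2 * n ^ 10) (\<Sum>i<n. \<Sum>j<n. W i j) (2 * (n * N)) W 0 (Xs l) (Xs (Suc l)) \<and>
         weight_of n W (topk n k (score n N W (Xs l))) \<le> v \<and> (\<forall>i<n. \<forall>j<n. Xs l i j \<le> N)"
      using tj[rule_format, of 0, OF le0] by (elim exE conjE) (rule that; assumption)
    define Y where "Y = Xs 0"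
    have wY: "weight_of n W (topk n k (score n N W Y)) \<le> v" unfolding Y_def
      by (rule conjunct1[OF conjunct2[OF Xs[rule_format, of 0]]]) simp
    define Q where "Q = top_set n k (score n N W Y)"
    have T: "{..<n} = {i. i < n \<and> heavy N Y i}" using Xs0 by (auto simp: heavy_def Y_def)
    note th = top_heavy[OF kn T Q_def]
    have "real k * d - 7 * (real n)\<^sup>2 * pg.\<sigma> \<le> pg.wt (Q' \<inter> S) (Q' \<inter> S)"
    proof (rule pg.greedy_dense[where Q = Q])
      show Q: "Q \<subseteq> {..<n}" "card Q = k" unfolding Q_def by (rule ts)+
      show "(\<Sum>l<n. real_of_rat (w j l)) \<le> (\<Sum>l<n. real_of_rat (w i l))" if "i \<in> Q" "j \<in> {..<n} - Q" for i j
      proof (rule degr)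
        show "i < n" using Q that(1) by auto
        show "j < n" using that(2) by auto
        show "(\<Sum>l<n. W j l) \<le> (\<Sum>l<n. W i l)" using pg.k by (intro th(3)[OF _ that]) simp
      qed simp
      show "Q' \<subseteq> {..<n}" "card Q' = k" by (rule Q')+
      show "pg.wt Q Q \<le> pg.wt Q' Q'" unfolding Q_def by (rule better[OF wY])
    qed
    moreover have "7 * (real n)\<^sup>2 * \<sigma> \<le> real k * sqrt (3 * \<sigma> * d)"
    proof -
      define m where "m = (real n)\<^sup>2"
      have m: "1000000 \<le> m" using power_mono[of 1000 "real n" 2] pg.n by (simp add: m_def)
      have n6: "real n ^ 6 = m * m * m" by (simp add: m_def power2_eq_square eval_nat_numeral)
      \<comment> \<open>By \<open>total_weight\<close>, \<open>real k * d\<close> is nearly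
        \<open>n ^ 6 * \<sigma>\<close> or more. Hence the loss
        \<open>7 * n\<^sup>2 * \<sigma>\<close> of the choice by degree stays below \<open>k\<close>
        times the geometric mean of \<open>3 * \<sigma>\<close> and \<open>d\<close>.\<close>
      have kdm: "m * m * m * \<sigma> \<le> real k * d + 4 * m * \<sigma>"
        using False pg.total_weight unfolding Sw_def \<sigma>pg m_def[symmetric] n6 by linarith
      have mm: "1 * m \<le> m * m" "1000000 * (m * m) \<le> m * (m * m)" using m by (intro mult_right_mono; simp)+
      then have "49 * (m * m) + 12 * m \<le> 3 * (m * (m * m))" using m by linarith
      then have "(49 * (m * m) + 12 * m) * \<sigma> \<le> 3 * (m * (m * m)) * \<sigma>" using \<sigma> by (intro mult_right_mono) auto
      then have "49 * (m * m * \<sigma>) + 12 * (m * \<sigma>) \<le> 3 * (m * m * m * \<sigma>)" by (simp add: algebra_simps)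
      moreover have "m * m * m * \<sigma> \<le> real k * d + 4 * (m * \<sigma>)" using kdm by simp
      ultimately have "49 * (m * m * \<sigma>) \<le> 3 * (real k * d)" by linarith
      also have "real k * d \<le> real k * real k * d" using pg.k d by simp
      finally have "49 * (m * m * \<sigma>) * \<sigma> \<le> 3 * (real k * real k * d) * \<sigma>" using \<sigma> by (intro mult_right_mono) auto
      then have "(7 * m * \<sigma>)\<^sup>2 \<le> (real k)\<^sup>2 * (3 * \<sigma> * d)" by (simp add: power2_eq_square mult_ac)
      then have "7 * m * \<sigma> \<le> sqrt ((real k)\<^sup>2 * (3 * \<sigma> * d))" by (rule real_le_rsqrt)
      then show ?thesis unfolding m_def by (simp add: real_sqrt_mult)
    qed
    ultimately show ?thesis unfolding \<sigma>pg by linarith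
  qed
  then show "real k * d - real k * sqrt (3 * \<sigma> * d) \<le> (\<Sum>i\<in>Q' \<inter> S. \<Sum>j\<in>Q' \<inter> S. real_of_rat (w i j))" by (simp only: pg.wt_def)
qed

theorem theorem2p1:
  shows "\<exists>\<kappa> > 0. \<exists>\<xi> > 0. \<exists>c > 0. \<exists>alg. polynomial_time alg \<and>
    (\<forall>(n::nat) (k::nat) (d::real) (\<delta>::real) (d'::real) (lam::real) (S::nat set)
       (adv :: (nat \<times> nat \<Rightarrow> bool) \<Rightarrow> nat \<Rightarrow> nat \<Rightarrow> rat).
      0 < k \<and> k < n \<and> 0 < d \<and> 0 < \<delta> \<and> \<delta> < 1 \<and> 0 \<le> lam \<and>
      S \<subseteq> {..<n} \<and> card S = k \<and>
      0 < \<nu> \<xi> n k d \<delta> d' lam \<and> \<nu> \<xi> n k d \<delta> d' lam < 1 \<and>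
      \<kappa> * ln (real n) / real n \<le> \<delta> * d / real k \<and> \<delta> * d / real k < 1 \<and>
      (\<forall>R \<in> set_pmf (cross_pmf n S (\<delta> * d / real k)).
         DkSExp_output n S d d' lam R (real_weights (adv R)))
      \<longrightarrow>
      measure_pmf.prob (cross_pmf n S (\<delta> * d / real k))
        {R. case alg n k (adv R) of (Q, T) \<Rightarrow>
              card Q = k \<and>
              \<rho> (real_weights (adv R)) Q
                \<ge> (1 - \<nu> \<xi> n k d \<delta> d' lam) * (real k * d / 2) \<and>
              real (card T) \<le> real k * (1 + \<nu> \<xi> n k d \<delta> d' lam / 5) \<and>
              \<rho> (real_weights (adv R)) (T \<inter> S)
                \<ge> (1 - \<nu> \<xi> n k d \<delta> d' lam / 2) * (real k * d / 2)}
      \<ge> 1 - real n powr (- c))"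
proof -
  have "\<exists>alg. polynomial_time alg \<and> (\<forall>n k w. 1000 < n \<longrightarrow> wgraph {..<n} (real_weights w) \<longrightarrow>
     alg n k w = ({i. i < n \<and> ar (sem program (initial n k w)) 5 0 i \<noteq> 0}, {i. i < n \<and> ar (sem program (initial n k w)) 5 0 i \<noteq> 0}))"
  proof (rule polynomial_time_wrap[OF wfc_program])
    fix n k :: nat and w :: "nat \<Rightarrow> nat \<Rightarrow> rat"
    assume "1000 < n" "wgraph {..<n} (real_weights w)"
    then have ii: "instance_input n w" by (simp add: instance_input_def)
    note ok = instance_input.program_ok[OF ii, of k]
    show "ok (2 ^ (input_size n k w ^ 21)) (input_size n k w ^ 38) program (initial n k w)"
      using conjunct1[OF ok] unfolding instance_input.Q_def[OF ii] instance_input.z_def[OF ii] .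
    show "\<forall>i<n. (60 \<le> i \<longrightarrow> io (sem program (initial n k w)) i = ar (sem program (initial n k w)) 5 0 i) \<and>
        io (sem program (initial n k w)) (n + i) = ar (sem program (initial n k w)) 5 0 i"
      by (rule conjunct2[OF conjunct2[OF ok]])
  qed
  then obtain alg where poly: "polynomial_time alg" and alg: "\<forall>n k w. 1000 < n \<longrightarrow> wgraph {..<n} (real_weights w) \<longrightarrow>
     alg n k w = ({i. i < n \<and> ar (sem program (initial n k w)) 5 0 i \<noteq> 0}, {i. i < n \<and> ar (sem program (initial n k w)) 5 0 i \<noteq> 0})"
    by (elim exE conjE) (rule that; assumption)
  \<comment> \<open>100 is the coefficient of \<open>q\<close> in \<sigma>, the exponent - 1 is that
    of \<open>low_discrepancy_prob\<close>, and 3000 is large enough for the density condition to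
    force \<open>n > 1000\<close>.\<close>
  have main: "1 - real n powr (- 1) \<le> measure_pmf.prob (cross_pmf n S (\<delta> * d / real k))
        {R. case alg n k (adv R) of (Q, T) \<Rightarrow>
              card Q = k \<and>
              \<rho> (real_weights (adv R)) Q
                \<ge> (1 - \<nu> 100 n k d \<delta> d' lam) * (real k * d / 2) \<and>
              real (card T) \<le> real k * (1 + \<nu> 100 n k d \<delta> d' lam / 5) \<and>
              \<rho> (real_weights (adv R)) (T \<inter> S)
                \<ge> (1 - \<nu> 100 n k d \<delta> d' lam / 2) * (real k * d / 2)}" (is "_ \<le> measure_pmf.prob _ ?good")
    if k: "0 < k" "k < n" and d: "0 < d" and \<delta>: "0 < \<delta>" and lam: "0 \<le> lam" and S: "S \<subseteq> {..<n}" "card S = k"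
      and \<nu>: "0 < \<nu> 100 n k d \<delta> d' lam" "\<nu> 100 n k d \<delta> d' lam < 1"
      and p: "3000 * ln (real n) / real n \<le> \<delta> * d / real k" "\<delta> * d / real k < 1"
      and adv: "\<forall>R \<in> set_pmf (cross_pmf n S (\<delta> * d / real k)). DkSExp_output n S d d' lam R (real_weights (adv R))"
    for n k :: nat and d \<delta> d' lam :: real and S :: "nat set" and adv :: "(nat \<times> nat \<Rightarrow> bool) \<Rightarrow> nat \<Rightarrow> nat \<Rightarrow> rat"
  proof -
    define p0 where "p0 = \<delta> * d / real k"
    define q where "q = sqrt (p0 * real n)"
    define \<sigma> where "\<sigma> = 6 * p0 * real k + 100 * q + lam + d' / (real n - real k) * real k"
    define nu where "nu = \<nu> 100 n k d \<delta> d' lam"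
    have p0: "0 < p0" "p0 < 1" using k d \<delta> p by (simp_all add: p0_def)
    have "ln 2 \<le> ln (real n)" using k by (subst ln_le_cancel_iff) auto
    then have ln: "2 / 3 \<le> ln (real n)" using ln2_ge_two_thirds by linarith
    have n0: "0 < real n" using k by simp
    have pn: "3000 * ln (real n) \<le> p0 * real n" using p(1) n0 by (simp add: p0_def field_simps)
    have "p0 * real n < 1 * real n" using p0 n0 by (intro mult_strict_right_mono)
    \<comment> \<open>Since the edge probability is below 1, the density condition excludes every
      \<open>n\<close> for which the program stops at once.\<close>
    then have n: "1000 < n" using pn ln by linarith
    have pn4: "4 \<le> p0 * real n" using pn ln by linarith
    have \<nu>_eq: "nu = 2 * sqrt (3 * (\<sigma> / d))"
    proof -
      have "sqrt (\<delta> * real n / (d * real k)) = sqrt (p0 * real n / d\<^sup>2)"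
        using k d by (simp add: p0_def power2_eq_square field_simps)
      also have "\<dots> = q / d" using d by (simp add: q_def real_sqrt_divide)
      finally have "6 * \<delta> + 100 * sqrt (\<delta> * real n / (d * real k)) + lam / d + d' * real k / ((real n - real k) * d) = \<sigma> / d"
        using k d by (simp add: \<sigma>_def p0_def add_divide_distrib)
      then show ?thesis unfolding nu_def \<nu>_def by simp
    qed
    have nu: "0 < nu" "nu < 1" using \<nu> by (simp_all add: nu_def)
    \<comment> \<open>\<nu> < 1 means \<open>y < 1 / 4\<close>, that is,
      \<open>12 * \<sigma> < d\<close>.\<close>
    define y where "y = 3 * (\<sigma> / d)"
    have sy: "0 < sqrt y" "sqrt y < 1 / 2" using nu unfolding \<nu>_eq y_def by linarith+
    then have "0 < y" by (simp only: real_sqrt_gt_0_iff)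
    moreover have "(sqrt y)\<^sup>2 < (1 / 2)\<^sup>2" using sy by (intro power_strict_mono) auto
    ultimately have "0 < y" "y < 1 / 4" by (simp_all add: power2_eq_square)
    then have \<sigma>: "0 < \<sigma>" "12 * \<sigma> \<le> d" using d by (simp_all add: y_def field_simps)
    have good: "R \<in> ?good" if R: "R \<in> set_pmf (cross_pmf n S (\<delta> * d / real k))" and low: "low_discrepancy n S p0 R" for R
    proof -
      have out: "DkSExp_output n S d d' lam R (real_weights (adv R))" using adv R by blast
      have fin: "finite (S \<times> ({..<n} - S))" using S finite_subset by blast
      have supp: "x \<in> S \<times> ({..<n} - S)" if "R x" for x
        using R that set_Pi_pmf_subset[OF fin, of False "\<lambda>_. bernoulli_pmf p0"] unfolding cross_pmf_def p0_def by blast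
      have pg: "planted_graph n k S (real_weights (adv R)) p0 q lam d' d" "wgraph {..<n} (real_weights (adv R))"
        unfolding q_def by (rule planted_graph_output[OF out low supp S k n lam less_imp_le[OF p0(1)]]; assumption)+
      define Q where "Q = {i. i < n \<and> ar (sem program (initial n k (adv R))) 5 0 i \<noteq> 0}"
      \<comment> \<open>Both outputs are the same set of size \<open>k\<close>, so the bound on the
        size of \<open>T\<close> is immediate, and the bound for \<open>Q \<inter> S\<close> implies
        the one for \<open>Q\<close>.\<close>
      have aQ: "alg n k (adv R) = (Q, Q)" using alg n pg(2) unfolding Q_def by blast
      have Q: "card Q = k" "Q \<subseteq> {..<n}"
        "real k * d - real k * sqrt (3 * \<sigma> * d) \<le> (\<Sum>i\<in>Q \<inter> S. \<Sum>j\<in>Q \<inter> S. real_of_rat (adv R i j))"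
        by (rule planted_recovery[OF pg d \<sigma>_def \<sigma> Q_def])+
      have "sqrt (3 * \<sigma> * d) = sqrt (3 * (\<sigma> / d) * d\<^sup>2)" using d by (simp add: power2_eq_square)
      also have "\<dots> = nu / 2 * d" unfolding \<nu>_eq real_sqrt_mult using d by simp
      finally have sq: "sqrt (3 * \<sigma> * d) = nu / 2 * d" .
      have "(1 - nu / 2) * (real k * d / 2) = (real k * d - real k * (nu / 2 * d)) / 2" by (simp add: field_simps)
      then have inner: "(1 - nu / 2) * (real k * d / 2) \<le> \<rho> (real_weights (adv R)) (Q \<inter> S)"
        using Q(3) unfolding \<rho>_def sq by simp
      have w0: "0 \<le> real_of_rat (adv R i j)" for i j using pg(2) unfolding wgraph_def by blast
      have fQ: "finite Q" using Q(2) finite_subset by blast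
      have "(\<Sum>i\<in>Q \<inter> S. \<Sum>j\<in>Q \<inter> S. real_of_rat (adv R i j)) \<le> (\<Sum>i\<in>Q \<inter> S. \<Sum>j\<in>Q. real_of_rat (adv R i j))"
        using fQ w0 by (intro sum_mono sum_mono2) auto
      also have "\<dots> \<le> (\<Sum>i\<in>Q. \<Sum>j\<in>Q. real_of_rat (adv R i j))" using fQ w0 by (intro sum_mono2 sum_nonneg) auto
      finally have "\<rho> (real_weights (adv R)) (Q \<inter> S) \<le> \<rho> (real_weights (adv R)) Q" by (simp add: \<rho>_def)
      moreover have "(1 - nu) * (real k * d / 2) \<le> (1 - nu / 2) * (real k * d / 2)" using nu d by (intro mult_right_mono) auto
      moreover have "real k * 1 \<le> real k * (1 + nu / 5)" using nu by (intro mult_left_mono) auto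
      ultimately show ?thesis using inner Q(1) unfolding nu_def[symmetric] by (simp add: aQ)
    qed
    have "1 - real n powr (- 1) \<le> measure_pmf.prob (cross_pmf n S p0) {R. low_discrepancy n S p0 R}"
      by (rule low_discrepancy_prob) (use S p0 pn4 in auto)
    \<comment> \<open>Off the support nothing is known of the adversary, and \<open>R\<close> may
      contain pairs outside \<open>S \<times> ({..<n} - S)\<close>; hence the restriction to the
      support.\<close>
    also have "\<dots> = measure_pmf.prob (cross_pmf n S p0) ({R. low_discrepancy n S p0 R} \<inter> set_pmf (cross_pmf n S p0))"
      by (simp add: measure_Int_set_pmf)
    also have "\<dots> \<le> measure_pmf.prob (cross_pmf n S p0) ?good"
    proof (rule measure_pmf.finite_measure_mono)
      show "{R. low_discrepancy n S p0 R} \<inter> set_pmf (cross_pmf n S p0) \<subseteq> ?good"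
        by (rule subsetI, rule good) (simp_all only: p0_def Int_iff mem_Collect_eq)
    qed simp
    finally show ?thesis unfolding p0_def .
  qed
  show ?thesis
  proof (rule exI[of _ 3000], intro conjI, simp, rule exI[of _ 100], intro conjI, simp, rule exI[of _ 1], intro conjI, simp,
      rule exI[of _ alg], intro conjI allI impI)
    show "polynomial_time alg" by (rule poly)
  next
    fix n k :: nat and d \<delta> d' lam :: real and S :: "nat set" and adv :: "(nat \<times> nat \<Rightarrow> bool) \<Rightarrow> nat \<Rightarrow> nat \<Rightarrow> rat"
    assume a: "0 < k \<and> k < n \<and> 0 < d \<and> 0 < \<delta> \<and> \<delta> < 1 \<and> 0 \<le> lam \<and>
      S \<subseteq> {..<n} \<and> card S = k \<and>
      0 < \<nu> 100 n k d \<delta> d' lam \<and> \<nu> 100 n k d \<delta> d' lam < 1 \<and>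
      3000 * ln (real n) / real n \<le> \<delta> * d / real k \<and> \<delta> * d / real k < 1 \<and>
      (\<forall>R \<in> set_pmf (cross_pmf n S (\<delta> * d / real k)).
         DkSExp_output n S d d' lam R (real_weights (adv R)))"
    show "measure_pmf.prob (cross_pmf n S (\<delta> * d / real k))
        {R. case alg n k (adv R) of (Q, T) \<Rightarrow>
              card Q = k \<and>
              \<rho> (real_weights (adv R)) Q
                \<ge> (1 - \<nu> 100 n k d \<delta> d' lam) * (real k * d / 2) \<and>
              real (card T) \<le> real k * (1 + \<nu> 100 n k d \<delta> d' lam / 5) \<and>
              \<rho> (real_weights (adv R)) (T \<inter> S)
                \<ge> (1 - \<nu> 100 n k d \<delta> d' lam / 2) * (real k * d / 2)}
      \<ge> 1 - real n powr (- 1)"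
      by (rule main; use a in simp)
  qed
qed

end
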